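(* Let $k$ be a field and let $R$ be a graded $k$-algebra which is bimodule $(d+1)$-Calabi-Yau of $a$-invariant $a$. Let $R^{\mathrm{dg}}$ be the DG algebra with underlying graded algebra $R$ and zero differential. Then $R^{\mathrm{dg}}$ is sign twisted bimodule $(d+a+1)$-Calabi-Yau. Precisely: (1) if $a$ is odd, then $R^{\mathrm{dg}}$ is homologically smooth and $\mathbf{R}\mathrm{Hom}_{(R^{\mathrm{dg}})^e}(R^{\mathrm{dg}},(R^{\mathrm{dg}})^e)[d+a+1]\simeq R^{\mathrm{dg}}$ in $\mathcal{D}((R^{\mathrm{dg}})^e)$, that is, $R^{\mathrm{dg}}$ is bimodule $(d+a+1)$-Calabi-Yau; (2) if $a$ is even, then $R^{\mathrm{dg}}$ is homologically smooth and $\mathbf{R}\mathrm{Hom}_{(R^{\mathrm{dg}})^e}(R^{\mathrm{dg}},(R^{\mathrm{dg}})^e)[d+a+1]\simeq {}_1R^{\mathrm{dg}}_\sigma$ in $\mathcal{D}((R^{\mathrm{dg}})^e)$, where $\sigma$ is the automorphism $x\mapsto(-1)^{|x|}x$ of $R$ ($x$ homogeneous of degree $|x|$).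
   Context: Graded means $\mathbb{Z}$-graded; no sign, finiteness or boundedness condition is imposed on the grading of $R$. For a graded algebra $R$ put $R^e=R^{\mathrm{op}}\otimes_kR$ (usual, unsigned), let $\mathrm{Mod}^{\mathbb Z}R^e$ be the category of graded bimodules, $(1)$ the degree shift ($M(1)_i=M_{i+1}$), and $[1]$ the suspension of the derived category. $R$ is \emph{bimodule $n$-Calabi-Yau of $a$-invariant $a$} if it is homologically smooth, i.e. $R$ lies in the thick subcategory of $\mathcal{D}(\mathrm{Mod}^{\mathbb Z}R^e)$ generated by finitely generated graded projectives, and $\mathbf{R}\mathrm{Hom}_{R^e}(R,R^e)(a)[n]\simeq R$ in $\mathcal{D}(\mathrm{Mod}^{\mathbb Z}R^e)$. In $R^{\mathrm{dg}}$ the grading of $R$ is regarded as the cohomological grading. For a DG algebra $\Lambda$, $\Lambda^e=\Lambda^{\mathrm{op}}\otimes_k\Lambda$ is the DG enveloping algebra (with Koszul signs); DG $(\Lambda,\Lambda)$-bimodules $X$ are identified with right DG $\Lambda^e$-modules via $\lambda\cdot x\cdot\gamma=(-1)^{|\lambda||x|}x\cdot(\lambda\otimes\gamma)$; $(\Lambda^e)^{\mathrm{op}}$ is identified with $\Lambda^e$ via $x\otimes y\leftrightarrow(-1)^{|x||y|}y\otimes x$, so that $\mathbf{R}\mathrm{Hom}_{\Lambda^e}(\Lambda,\Lambda^e)$ is again an object of $\mathcal{D}(\Lambda^e)$. For a DG left module $X$, the shift $X[1]$ has the action $a\cdot x=(-1)^{|a|}ax$; for a DG right module the shift has unchanged action.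 $\Lambda$ is homologically smooth if $\Lambda\in\mathrm{per}\,\Lambda^e$. For a DG automorphism $\sigma$ of $\Lambda$, ${}_1\Lambda_\sigma$ is the bimodule $\Lambda$ with right action twisted by $\sigma$. "Sign twisted bimodule $(d+a+1)$-Calabi-Yau" is an abbreviation for the alternative (1)/(2) in the claim. *)

theory Defs
  imports "HOL-Algebra.Free_Abelian_Groups" "HOL-Algebra.QuotRing" "HOL-Algebra.Module"
    "HOL-Algebra.Generated_Groups" "HOL-Library.Product_Plus" "HOL-Library.FuncSet"
begin

section \<open>Grading groups\<close>

text \<open>
  The derived category of a DG algebra and the derived category of graded modules over a graded
  algebra are instances of one construction.  All objects are graded by an abelian group \<open>'g\<close>
  carrying a homomorphism \<open>cdeg\<close> to the integers (the cohomological degree, which alone enters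
  the Koszul signs); differentials have degree \<open>ddeg\<close>.

  \<^item> \<open>'g = int\<close>, with \<open>cdeg\<close> the identity and \<open>ddeg = 1\<close>: DG algebras and DG modules.
  \<^item> \<open>'g = int \<times> int\<close>, with degrees \<open>(p, i)\<close>, \<open>cdeg (p, i) = p\<close> and \<open>ddeg = (1, 0)\<close>: if \<open>E\<close> is a
    graded algebra placed in the degrees \<open>(0, i)\<close>, then a module with differential is exactly a
    cochain complex of graded \<open>E\<close>-modules (\<open>p\<close> the position in the complex, \<open>i\<close> the internal
    degree), and no Koszul sign involves the internal degree.
\<close>

class dg_grading = ab_group_add +
  fixes cdeg :: "'a \<Rightarrow> int" and ddeg :: 'a
  assumes cdeg_add: "cdeg (x + y) = cdeg x + cdeg y"
    and cdeg_ddeg: "cdeg ddeg = 1"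

instantiation int :: dg_grading
begin
definition cdeg_int :: "int \<Rightarrow> int" where "cdeg_int n = n"
definition ddeg_int :: int where "ddeg_int = 1"
instance by standard (simp_all add: cdeg_int_def ddeg_int_def)
end

instantiation prod :: (dg_grading, ab_group_add) dg_grading
begin
definition cdeg_prod :: "'a \<times> 'b \<Rightarrow> int" where "cdeg_prod x = cdeg (fst x)"
definition ddeg_prod :: "'a \<times> 'b" where "ddeg_prod = (ddeg, 0)"
instance by standard (simp_all add: cdeg_prod_def ddeg_prod_def cdeg_add cdeg_ddeg)
end

definition ksign :: "int \<Rightarrow> int" where
  "ksign n = (if even n then 1 else - 1)"

definition koszul :: "('a, 'z) ring_scheme \<Rightarrow> int \<Rightarrow> 'a \<Rightarrow> 'a" where
  "koszul M n x = (if even n then x else \<ominus>\<^bsub>M\<^esub> x)"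


section \<open>Graded groups, graded algebras, DG modules\<close>

text \<open>
  The scalars \<open>'s\<close> of these records are the elements of the ground field when the record is an
  algebra, and the elements of the DG algebra \<open>E\<close> when it is a right DG \<open>E\<close>-module.  In the latter
  case \<open>smult M e x\<close> is the right action, written \<open>ract M x e\<close> for \<open>x \<cdot> e\<close>, and the fields
  \<open>mult\<close> and \<open>one\<close> carry no meaning (as for the modules of HOL-Algebra).
\<close>

record ('s, 'g, 'a) graded = "('s, 'a) module" +
  gr :: "'g \<Rightarrow> 'a set"

record ('s, 'g, 'a) dg = "('s, 'g, 'a) graded" +
  dd :: "'a \<Rightarrow> 'a"

abbreviation ract :: "('s, 'a, 'z) module_scheme \<Rightarrow> 'a \<Rightarrow> 's \<Rightarrow> 'a" where
  "ract M x e \<equiv> smult M e x"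

definition is_decomp :: "('s, 'g, 'a, 'z) graded_scheme \<Rightarrow> 'a \<Rightarrow> ('g \<Rightarrow> 'a) \<Rightarrow> bool" where
  "is_decomp M x c \<longleftrightarrow> (\<forall>g. c g \<in> gr M g) \<and> finite {g. c g \<noteq> \<zero>\<^bsub>M\<^esub>} \<and>
     x = (\<Oplus>\<^bsub>M\<^esub>g\<in>{g. c g \<noteq> \<zero>\<^bsub>M\<^esub>}. c g)"

definition graded_group :: "('s, 'g, 'a, 'z) graded_scheme \<Rightarrow> bool" where
  "graded_group M \<longleftrightarrow> abelian_group M \<and> (\<forall>g. additive_subgroup (gr M g) M) \<and>
     (\<forall>x\<in>carrier M. \<exists>!c. is_decomp M x c)"

definition hcomp :: "('s, 'g, 'a, 'z) graded_scheme \<Rightarrow> 'a \<Rightarrow> 'g \<Rightarrow> 'a" where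
  "hcomp M x = (THE c. is_decomp M x c)"

definition hsupp :: "('s, 'g, 'a, 'z) graded_scheme \<Rightarrow> 'a \<Rightarrow> 'g set" where
  "hsupp M x = {g. hcomp M x g \<noteq> \<zero>\<^bsub>M\<^esub>}"

definition graded_algebra ::
  "('k, 'y) ring_scheme \<Rightarrow> ('k, 'g::ab_group_add, 'a, 'z) graded_scheme \<Rightarrow> bool" where
  "graded_algebra K R \<longleftrightarrow> field K \<and> ring R \<and> module K R \<and>
     (\<forall>c\<in>carrier K. \<forall>x\<in>carrier R. \<forall>y\<in>carrier R.
        (c \<odot>\<^bsub>R\<^esub> x) \<otimes>\<^bsub>R\<^esub> y = c \<odot>\<^bsub>R\<^esub> (x \<otimes>\<^bsub>R\<^esub> y) \<and> x \<otimes>\<^bsub>R\<^esub> (c \<odot>\<^bsub>R\<^esub> y) = c \<odot>\<^bsub>R\<^esub> (x \<otimes>\<^bsub>R\<^esub> y)) \<and>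
     graded_group R \<and> (\<forall>g. submodule (gr R g) K R) \<and>
     \<one>\<^bsub>R\<^esub> \<in> gr R 0 \<and>
     (\<forall>g h. \<forall>x\<in>gr R g. \<forall>y\<in>gr R h. x \<otimes>\<^bsub>R\<^esub> y \<in> gr R (g + h))"

definition dg_module ::
  "('k, 'g::dg_grading, 'e) dg \<Rightarrow> ('e, 'g, 'm) dg \<Rightarrow> bool" where
  "dg_module E M \<longleftrightarrow> graded_group M \<and>
     (\<forall>x\<in>carrier M. \<forall>e\<in>carrier E. ract M x e \<in> carrier M) \<and>
     (\<forall>x\<in>carrier M. \<forall>y\<in>carrier M. \<forall>e\<in>carrier E.
        ract M (x \<oplus>\<^bsub>M\<^esub> y) e = ract M x e \<oplus>\<^bsub>M\<^esub> ract M y e) \<and>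
     (\<forall>x\<in>carrier M. \<forall>e\<in>carrier E. \<forall>e'\<in>carrier E.
        ract M x (e \<oplus>\<^bsub>E\<^esub> e') = ract M x e \<oplus>\<^bsub>M\<^esub> ract M x e' \<and>
        ract M (ract M x e) e' = ract M x (e \<otimes>\<^bsub>E\<^esub> e')) \<and>
     (\<forall>x\<in>carrier M. ract M x \<one>\<^bsub>E\<^esub> = x) \<and>
     (\<forall>g h. \<forall>x\<in>gr M g. \<forall>e\<in>gr E h. ract M x e \<in> gr M (g + h)) \<and>
     dd M \<in> hom (add_monoid M) (add_monoid M) \<and>
     (\<forall>g. \<forall>x\<in>gr M g. dd M x \<in> gr M (g + ddeg)) \<and>
     (\<forall>x\<in>carrier M. dd M (dd M x) = \<zero>\<^bsub>M\<^esub>) \<and>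
     (\<forall>g. \<forall>x\<in>gr M g. \<forall>e\<in>carrier E.
        dd M (ract M x e) = ract M (dd M x) e \<oplus>\<^bsub>M\<^esub> koszul M (cdeg g) (ract M x (dd E e)))"

definition mk_dg ::
  "'m set \<Rightarrow> ('m \<Rightarrow> 'm \<Rightarrow> 'm) \<Rightarrow> 'm \<Rightarrow> ('s \<Rightarrow> 'm \<Rightarrow> 'm) \<Rightarrow> ('g \<Rightarrow> 'm set) \<Rightarrow> ('m \<Rightarrow> 'm) \<Rightarrow>
   ('s, 'g, 'm) dg" where
  "mk_dg C pl z act G D =
     \<lparr>carrier = C, mult = undefined, one = undefined, zero = z, add = pl,
      smult = act, gr = G, dd = D\<rparr>"

definition regular :: "('k, 'g, 'e) dg \<Rightarrow> ('e, 'g, 'e) dg" where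
  "regular E = mk_dg (carrier E) (add E) \<zero>\<^bsub>E\<^esub> (\<lambda>e x. x \<otimes>\<^bsub>E\<^esub> e) (gr E) (dd E)"

text \<open>
  For \<open>s = n\<close> in the DG case this is \<open>M[n]\<close>; for \<open>s = (n, a)\<close> in the bigraded case it is
  \<open>M(a)[n]\<close>.  The modules are right modules, so the action does not change.
\<close>

definition shift :: "'g::dg_grading \<Rightarrow> ('s, 'g, 'm) dg \<Rightarrow> ('s, 'g, 'm) dg" where
  "shift s M = M\<lparr>gr := (\<lambda>g. gr M (g + s)), dd := (\<lambda>x. koszul M (cdeg s) (dd M x))\<rparr>"

definition dsum :: "('s, 'g, 'm) dg \<Rightarrow> ('s, 'g, 'n) dg \<Rightarrow> ('s, 'g, 'm \<times> 'n) dg" where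
  "dsum M N = mk_dg (carrier M \<times> carrier N)
     (\<lambda>(x, y) (x', y'). (x \<oplus>\<^bsub>M\<^esub> x', y \<oplus>\<^bsub>N\<^esub> y')) (\<zero>\<^bsub>M\<^esub>, \<zero>\<^bsub>N\<^esub>)
     (\<lambda>e (x, y). (ract M x e, ract N y e))
     (\<lambda>g. gr M g \<times> gr N g)
     (\<lambda>(x, y). (dd M x, dd N y))"

definition cone ::
  "('s, 'g::dg_grading, 'm) dg \<Rightarrow> ('s, 'g, 'n) dg \<Rightarrow> ('m \<Rightarrow> 'n) \<Rightarrow> ('s, 'g, 'n \<times> 'm) dg" where
  "cone M N f = (dsum N (shift ddeg M))
     \<lparr>dd := (\<lambda>(y, x). (dd N y \<oplus>\<^bsub>N\<^esub> f x, \<ominus>\<^bsub>M\<^esub> dd M x))\<rparr>"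


section \<open>Morphisms, homotopies, quasi-isomorphisms\<close>

definition hom_deg ::
  "('k, 'g::dg_grading, 'e) dg \<Rightarrow> ('e, 'g, 'm) dg \<Rightarrow> ('e, 'g, 'n) dg \<Rightarrow> 'g \<Rightarrow> ('m \<Rightarrow> 'n) set" where
  "hom_deg E M N s = {f \<in> hom (add_monoid M) (add_monoid N).
     (\<forall>x\<in>carrier M. \<forall>e\<in>carrier E. f (ract M x e) = ract N (f x) e) \<and>
     (\<forall>g. \<forall>x\<in>gr M g. f x \<in> gr N (g + s))}"

definition dg_hom ::
  "('k, 'g::dg_grading, 'e) dg \<Rightarrow> ('e, 'g, 'm) dg \<Rightarrow> ('e, 'g, 'n) dg \<Rightarrow> ('m \<Rightarrow> 'n) set" where
  "dg_hom E M N = {f \<in> hom_deg E M N 0. \<forall>x\<in>carrier M. f (dd M x) = dd N (f x)}"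

definition homotopic ::
  "('k, 'g::dg_grading, 'e) dg \<Rightarrow> ('e, 'g, 'm) dg \<Rightarrow> ('e, 'g, 'n) dg \<Rightarrow>
   ('m \<Rightarrow> 'n) \<Rightarrow> ('m \<Rightarrow> 'n) \<Rightarrow> bool" where
  "homotopic E M N f f' \<longleftrightarrow> (\<exists>h\<in>hom_deg E M N (- ddeg). \<forall>x\<in>carrier M.
     f x \<ominus>\<^bsub>N\<^esub> f' x = dd N (h x) \<oplus>\<^bsub>N\<^esub> h (dd M x))"

definition cocycles :: "('s, 'g, 'm) dg \<Rightarrow> 'm set" where
  "cocycles M = {x \<in> carrier M. dd M x = \<zero>\<^bsub>M\<^esub>}"

definition coboundaries :: "('s, 'g, 'm) dg \<Rightarrow> 'm set" where
  "coboundaries M = dd M ` carrier M"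

definition cohomology :: "('s, 'g, 'm) dg \<Rightarrow> 'm set set" where
  "cohomology M = (\<lambda>x. coboundaries M +>\<^bsub>M\<^esub> x) ` cocycles M"

definition acyclic_dg :: "('s, 'g, 'm) dg \<Rightarrow> bool" where
  "acyclic_dg M \<longleftrightarrow> cocycles M = coboundaries M"

text \<open>
  The map on cohomology induced by \<open>f\<close> sends a class \<open>x + B(M)\<close>, a set, to
  \<open>B(N) + f(x + B(M)) = f x + B(N)\<close>.
\<close>

definition quasi_iso ::
  "('k, 'g::dg_grading, 'e) dg \<Rightarrow> ('e, 'g, 'm) dg \<Rightarrow> ('e, 'g, 'n) dg \<Rightarrow> ('m \<Rightarrow> 'n) \<Rightarrow> bool" where
  "quasi_iso E M N f \<longleftrightarrow> f \<in> dg_hom E M N \<and>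
     bij_betw (\<lambda>C. set_add N (coboundaries N) (f ` C)) (cohomology M) (cohomology N)"


section \<open>The derived category\<close>

text \<open>
  Size convention: a type \<open>'u\<close>, named by a value of type \<open>'u itself\<close>, serves as universe: the
  modules over which definitions quantify have their carriers inside \<open>'u\<close>.  An infinite \<open>'u\<close> at
  least as large as the algebra contains the resolutions and mapping cones that are needed;
  modules with carriers in other types are compared with those in \<open>'u\<close> inside the derived category.

  The derived category is the localization of the homotopy category at the quasi-isomorphisms,
  described by the calculus of fractions: a morphism from \<open>X\<close> to \<open>Y\<close> is a class of roofs
  \<open>(Z, s, f)\<close>, where \<open>s\<close> is a quasi-isomorphism from \<open>Z\<close> to \<open>X\<close> and \<open>f\<close> a morphism from \<open>Z\<close> to \<open>Y\<close>.
\<close>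

type_synonym ('e, 'g, 'm, 'x, 'y) roof = "('e, 'g, 'm) dg \<times> ('m \<Rightarrow> 'x) \<times> ('m \<Rightarrow> 'y)"

definition is_roof ::
  "('k, 'g::dg_grading, 'e) dg \<Rightarrow> ('e, 'g, 'x) dg \<Rightarrow> ('e, 'g, 'y) dg \<Rightarrow>
   ('e, 'g, 'm, 'x, 'y) roof \<Rightarrow> bool" where
  "is_roof E X Y = (\<lambda>(Z, s, f). dg_module E Z \<and> quasi_iso E Z X s \<and> f \<in> dg_hom E Z Y)"

definition roof_equiv ::
  "'u itself \<Rightarrow> ('k, 'g::dg_grading, 'e) dg \<Rightarrow> ('e, 'g, 'x) dg \<Rightarrow> ('e, 'g, 'y) dg \<Rightarrow>
   ('e, 'g, 'm, 'x, 'y) roof \<Rightarrow> ('e, 'g, 'n, 'x, 'y) roof \<Rightarrow> bool" where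
  "roof_equiv U E X Y = (\<lambda>(Z, s, f) (Z', s', f').
     \<exists>(W :: ('e, 'g, 'u) dg) u v. dg_module E W \<and> u \<in> dg_hom E W Z \<and> v \<in> dg_hom E W Z' \<and>
       quasi_iso E W X (s \<circ> u) \<and> homotopic E W X (s \<circ> u) (s' \<circ> v) \<and>
       homotopic E W Y (f \<circ> u) (f' \<circ> v))"

text \<open>
  \<open>roof_comp E Y r r' r''\<close>: the roof \<open>r''\<close> represents the composite of \<open>r\<close> (into \<open>Y\<close>), followed by
  \<open>r'\<close> (out of \<open>Y\<close>).
\<close>

definition roof_comp ::
  "('k, 'g::dg_grading, 'e) dg \<Rightarrow> ('e, 'g, 'y) dg \<Rightarrow> ('e, 'g, 'u, 'x, 'y) roof \<Rightarrow>
   ('e, 'g, 'u, 'y, 'z) roof \<Rightarrow> ('e, 'g, 'u, 'x, 'z) roof \<Rightarrow> bool" where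
  "roof_comp E Y = (\<lambda>(Z, s, f) (Z', s', f') r''.
     \<exists>(V :: ('e, 'g, 'u) dg) p q. dg_module E V \<and> quasi_iso E V Z p \<and> q \<in> dg_hom E V Z' \<and>
       homotopic E V Y (f \<circ> p) (s' \<circ> q) \<and> r'' = (V, s \<circ> p, f' \<circ> q))"

definition derived_iso ::
  "'u itself \<Rightarrow> ('k, 'g::dg_grading, 'e) dg \<Rightarrow> ('e, 'g, 'x) dg \<Rightarrow> ('e, 'g, 'y) dg \<Rightarrow> bool" where
  "derived_iso U E X Y \<longleftrightarrow>
     (\<exists>(\<alpha> :: ('e, 'g, 'u, 'x, 'y) roof) (\<beta> :: ('e, 'g, 'u, 'y, 'x) roof) \<gamma> \<delta>.
        is_roof E X Y \<alpha> \<and> is_roof E Y X \<beta> \<and>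
        roof_comp E Y \<alpha> \<beta> \<gamma> \<and> roof_equiv U E X X \<gamma> (X, id, id) \<and>
        roof_comp E X \<beta> \<alpha> \<delta> \<and> roof_equiv U E Y Y \<delta> (Y, id, id))"

text \<open>
  The thick subcategory generated by the modules satisfying \<open>G\<close>.  Every distinguished triangle of
  the derived category is isomorphic to the one of the mapping cone of a morphism of modules, so
  closure under isomorphism and under such cones is closure under triangles.
\<close>

inductive thick ::
  "'u itself \<Rightarrow> ('k, 'g::dg_grading, 'e) dg \<Rightarrow> (('e, 'g, 'u) dg \<Rightarrow> bool) \<Rightarrow> ('e, 'g, 'u) dg \<Rightarrow> bool"
  for U :: "'u itself" and E :: "('k, 'g::dg_grading, 'e) dg" and G :: "('e, 'g, 'u) dg \<Rightarrow> bool"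
where
  thick_gen: "dg_module E X \<Longrightarrow> G X \<Longrightarrow> thick U E G X"
| thick_iso: "thick U E G X \<Longrightarrow> dg_module E Y \<Longrightarrow> derived_iso U E X Y \<Longrightarrow> thick U E G Y"
| thick_shift: "thick U E G X \<Longrightarrow> thick U E G (shift ddeg X)"
| thick_unshift: "thick U E G X \<Longrightarrow> thick U E G (shift (- ddeg) X)"
| thick_cone: "thick U E G X \<Longrightarrow> thick U E G Y \<Longrightarrow> f \<in> dg_hom E X Y \<Longrightarrow>
    dg_module E Z \<Longrightarrow> derived_iso U E (cone X Y f) Z \<Longrightarrow> thick U E G Z"
| thick_summand: "thick U E G X \<Longrightarrow> dg_module E Y \<Longrightarrow> dg_module E (Y' :: ('e, 'g, 'u) dg) \<Longrightarrow>
    derived_iso U E X (dsum Y Y') \<Longrightarrow> thick U E G Y"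

definition in_thick ::
  "'u itself \<Rightarrow> ('k, 'g::dg_grading, 'e) dg \<Rightarrow> (('e, 'g, 'u) dg \<Rightarrow> bool) \<Rightarrow>
   ('e, 'g, 'x) dg \<Rightarrow> bool" where
  "in_thick U E G X \<longleftrightarrow> (\<exists>P. thick U E G P \<and> derived_iso U E P X)"

definition perfect ::
  "'u itself \<Rightarrow> ('k, 'g::dg_grading, 'e) dg \<Rightarrow> ('e, 'g, 'x) dg \<Rightarrow> bool" where
  "perfect U E X \<longleftrightarrow> in_thick U E (\<lambda>P. derived_iso U E P (regular E)) X"

definition K_projective ::
  "'u itself \<Rightarrow> ('k, 'g::dg_grading, 'e) dg \<Rightarrow> ('e, 'g, 'm) dg \<Rightarrow> bool" where
  "K_projective U E P \<longleftrightarrow> dg_module E P \<and>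
     (\<forall>(N :: ('e, 'g, 'u) dg) f. dg_module E N \<longrightarrow> acyclic_dg N \<longrightarrow> f \<in> dg_hom E P N \<longrightarrow>
        homotopic E P N f (\<lambda>_. \<zero>\<^bsub>N\<^esub>))"


section \<open>The enveloping algebra\<close>

text \<open>
  \<open>A\<^sup>o\<^sup>p \<otimes>\<^sub>k A\<close> is the direct sum of the \<open>A\<^sub>g \<otimes>\<^sub>k A\<^sub>h\<close>: the free abelian group on the symbols
  \<open>(g, x, h, y)\<close> with \<open>x \<in> A\<^sub>g\<close>, \<open>y \<in> A\<^sub>h\<close>, standing for \<open>x \<otimes> y\<close>, modulo the usual
  relations.  With homogeneous symbols the Koszul signs can be written down on the free group.
\<close>

type_synonym ('g, 'a) sym = "'g \<times> 'a \<times> 'g \<times> 'a"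

definition tsyms :: "('k, 'g, 'a) dg \<Rightarrow> ('g, 'a) sym set" where
  "tsyms A = {(g, x, h, y). x \<in> gr A g \<and> y \<in> gr A h}"

text \<open>
  The multiplication is
  \<open>(x \<otimes> y) (x' \<otimes> y') = (-1)^(|y||x'|) (x \<cdot>\<^sub>o\<^sub>p x') \<otimes> y y'\<close> with \<open>x \<cdot>\<^sub>o\<^sub>p x' = (-1)^(|x||x'|) x' x\<close>.
\<close>

definition sym_mult ::
  "('k, 'g::dg_grading, 'a) dg \<Rightarrow> ('g, 'a) sym \<Rightarrow> ('g, 'a) sym \<Rightarrow> ('g, 'a) sym \<Rightarrow>\<^sub>0 int" where
  "sym_mult A = (\<lambda>(g, x, h, y) (g', x', h', y').
     frag_cmul (ksign (cdeg h * cdeg g' + cdeg g * cdeg g'))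
       (frag_of (g + g', x' \<otimes>\<^bsub>A\<^esub> x, h + h', y \<otimes>\<^bsub>A\<^esub> y')))"

definition tring :: "('k, 'g::dg_grading, 'a) dg \<Rightarrow> (('g, 'a) sym \<Rightarrow>\<^sub>0 int) ring" where
  "tring A =
     \<lparr>carrier = carrier (free_Abelian_group (tsyms A)),
      mult = (\<lambda>u v. frag_extend (\<lambda>p. frag_extend (sym_mult A p) v) u),
      one = frag_of (0, \<one>\<^bsub>A\<^esub>, 0, \<one>\<^bsub>A\<^esub>),
      zero = 0,
      add = (+)\<rparr>"

definition trel ::
  "('k, 'z) ring_scheme \<Rightarrow> ('k, 'g, 'a) dg \<Rightarrow> (('g, 'a) sym \<Rightarrow>\<^sub>0 int) set" where
  "trel K A =
     {frag_of (g, x \<oplus>\<^bsub>A\<^esub> x', h, y) - frag_of (g, x, h, y) - frag_of (g, x', h, y) | g h x x' y.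
        x \<in> gr A g \<and> x' \<in> gr A g \<and> y \<in> gr A h} \<union>
     {frag_of (g, x, h, y \<oplus>\<^bsub>A\<^esub> y') - frag_of (g, x, h, y) - frag_of (g, x, h, y') | g h x y y'.
        x \<in> gr A g \<and> y \<in> gr A h \<and> y' \<in> gr A h} \<union>
     {frag_of (g, c \<odot>\<^bsub>A\<^esub> x, h, y) - frag_of (g, x, h, c \<odot>\<^bsub>A\<^esub> y) | c g h x y.
        c \<in> carrier K \<and> x \<in> gr A g \<and> y \<in> gr A h}"

definition tnull ::
  "('k, 'z) ring_scheme \<Rightarrow> ('k, 'g, 'a) dg \<Rightarrow> (('g, 'a) sym \<Rightarrow>\<^sub>0 int) set" where
  "tnull K A = generate (free_Abelian_group (tsyms A)) (trel K A)"

type_synonym ('g, 'a) tensor = "(('g, 'a) sym \<Rightarrow>\<^sub>0 int) set"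

definition tclass ::
  "('k, 'z) ring_scheme \<Rightarrow> ('k, 'g::dg_grading, 'a) dg \<Rightarrow> (('g, 'a) sym \<Rightarrow>\<^sub>0 int) \<Rightarrow>
   ('g, 'a) tensor" where
  "tclass K A u = tnull K A +>\<^bsub>tring A\<^esub> u"

definition trep :: "('g, 'a) tensor \<Rightarrow> (('g, 'a) sym \<Rightarrow>\<^sub>0 int)" where
  "trep U = (SOME u. u \<in> U)"

text \<open>
  The maps below are defined on symbols, extended additively and evaluated on a representative;
  they respect the relations, hence the choice in \<open>trep\<close> does not matter.
\<close>

definition env ::
  "('k, 'z) ring_scheme \<Rightarrow> ('k, 'g::dg_grading, 'a) dg \<Rightarrow> ('k, 'g, ('g, 'a) tensor) dg" where
  "env K A = (let Q = tring A Quot tnull K A in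
     \<lparr>carrier = carrier Q, mult = mult Q, one = one Q, zero = zero Q, add = add Q,
      smult = (\<lambda>c U. tclass K A
        (frag_extend (\<lambda>(g, x, h, y). frag_of (g, c \<odot>\<^bsub>A\<^esub> x, h, y)) (trep U))),
      gr = (\<lambda>n. tclass K A `
        {u \<in> carrier (tring A). \<forall>(g, x, h, y)\<in>Poly_Mapping.keys u. g + h = n}),
      dd = (\<lambda>U. tclass K A (frag_extend (\<lambda>(g, x, h, y).
          frag_of (g + ddeg, dd A x, h, y) +
          frag_cmul (ksign (cdeg g)) (frag_of (g, x, h + ddeg, dd A y))) (trep U)))\<rparr>)"

text \<open>
  The isomorphism \<open>x \<otimes> y \<mapsto> (-1)^(|x||y|) y \<otimes> x\<close> between the enveloping algebra and its opposite.
\<close>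

definition env_flip ::
  "('k, 'z) ring_scheme \<Rightarrow> ('k, 'g::dg_grading, 'a) dg \<Rightarrow> ('g, 'a) tensor \<Rightarrow> ('g, 'a) tensor" where
  "env_flip K A U = tclass K A (frag_extend (\<lambda>(g, x, h, y).
     frag_cmul (ksign (cdeg g * cdeg h)) (frag_of (h, y, g, x))) (trep U))"

text \<open>
  The bimodule \<open>A\<close> with right action twisted by \<open>\<sigma>\<close>, as right module over the enveloping algebra:
  \<open>x \<cdot> (l \<otimes> y) = (-1)^(|l||x|) l x \<sigma>(y)\<close> for homogeneous \<open>x\<close>.
\<close>

definition twisted_diag ::
  "('k, 'g::dg_grading, 'a) dg \<Rightarrow> ('a \<Rightarrow> 'a) \<Rightarrow> (('g, 'a) tensor, 'g, 'a) dg" where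
  "twisted_diag A \<sigma> = mk_dg (carrier A) (add A) \<zero>\<^bsub>A\<^esub>
     (\<lambda>U x. \<Oplus>\<^bsub>A\<^esub>n\<in>hsupp A x. \<Oplus>\<^bsub>A\<^esub>p\<in>Poly_Mapping.keys (trep U).
        [Poly_Mapping.lookup (trep U) p] \<cdot>\<^bsub>A\<^esub>
          (case p of (g, l, h, y) \<Rightarrow>
             koszul A (cdeg g * cdeg n) ((l \<otimes>\<^bsub>A\<^esub> hcomp A x n) \<otimes>\<^bsub>A\<^esub> \<sigma> y)))
     (gr A) (dd A)"

definition diag :: "('k, 'g::dg_grading, 'a) dg \<Rightarrow> (('g, 'a) tensor, 'g, 'a) dg" where
  "diag A = twisted_diag A id"

definition sign_aut :: "('k, 'g::dg_grading, 'a) dg \<Rightarrow> 'a \<Rightarrow> 'a" where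
  "sign_aut A x = (\<Oplus>\<^bsub>A\<^esub>n\<in>hsupp A x. koszul A (cdeg n) (hcomp A x n))"


section \<open>The inverse dualizing complex\<close>

text \<open>
  \<open>Hom_E(P, E)\<close> for \<open>E\<close> the enveloping algebra of \<open>A\<close>: finite sums of homogeneous \<open>E\<close>-linear maps,
  with differential \<open>d f = d \<circ> f - (-1)^|f| f \<circ> d\<close>.  The left \<open>E\<close>-action \<open>(e f)(x) = e f(x)\<close> is a right
  action of the opposite algebra by \<open>f \<cdot> e = (-1)^(|e||f|) e f\<close>, hence a right \<open>E\<close>-action via
  \<open>env_flip\<close>.
\<close>

definition hom_graded ::
  "('k, 'g::dg_grading, 'e) dg \<Rightarrow> ('e, 'g, 'm) dg \<Rightarrow> ('e, 'g, 'm \<Rightarrow> 'e) dg" where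
  "hom_graded E P = mk_dg
     {f \<in> extensional (carrier P). \<exists>S c. finite S \<and> (\<forall>g\<in>S. c g \<in> hom_deg E P (regular E) g) \<and>
        (\<forall>x\<in>carrier P. f x = (\<Oplus>\<^bsub>E\<^esub>g\<in>S. c g x))}
     (\<lambda>f f'. \<lambda>x\<in>carrier P. f x \<oplus>\<^bsub>E\<^esub> f' x)
     (\<lambda>x\<in>carrier P. \<zero>\<^bsub>E\<^esub>)
     undefined
     (\<lambda>g. hom_deg E P (regular E) g \<inter> extensional (carrier P))
     undefined"

definition env_dual ::
  "('k, 'z) ring_scheme \<Rightarrow> ('k, 'g::dg_grading, 'a) dg \<Rightarrow> (('g, 'a) tensor, 'g, 'm) dg \<Rightarrow>
   (('g, 'a) tensor, 'g, 'm \<Rightarrow> ('g, 'a) tensor) dg" where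
  "env_dual K A P = (let E = env K A; H = hom_graded E P in
     H\<lparr>smult := (\<lambda>e f. \<lambda>x\<in>carrier P.
          \<Oplus>\<^bsub>E\<^esub>g\<in>hsupp H f. \<Oplus>\<^bsub>E\<^esub>h\<in>hsupp E e.
            koszul E (cdeg h * cdeg g) (env_flip K A (hcomp E e h) \<otimes>\<^bsub>E\<^esub> hcomp H f g x)),
       dd := (\<lambda>f. \<lambda>x\<in>carrier P. \<Oplus>\<^bsub>E\<^esub>g\<in>hsupp H f.
            dd E (hcomp H f g x) \<ominus>\<^bsub>E\<^esub> koszul E (cdeg g) (hcomp H f g (dd P x)))\<rparr>)"

text \<open>
  \<open>RHom_E(A, E)\<close>, shifted by \<open>s\<close>, is isomorphic to \<open>M\<close> in the derived category of \<open>E\<close>.  The derived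
  functor is computed by a K-projective resolution \<open>P\<close> of \<open>A\<close>, on which it does not depend.
\<close>

definition RHom_shift_iso ::
  "'u itself \<Rightarrow> ('k, 'z) ring_scheme \<Rightarrow> ('k, 'g::dg_grading, 'a) dg \<Rightarrow> 'g \<Rightarrow>
   (('g, 'a) tensor, 'g, 'x) dg \<Rightarrow> bool" where
  "RHom_shift_iso U K A s M \<longleftrightarrow>
     (\<exists>(P :: (('g, 'a) tensor, 'g, 'u) dg) p.
        K_projective U (env K A) P \<and> quasi_iso (env K A) P (diag A) p \<and>
        derived_iso U (env K A) (shift s (env_dual K A P)) M)"


section \<open>Calabi-Yau algebras\<close>

definition homologically_smooth ::
  "'u itself \<Rightarrow> ('k, 'z) ring_scheme \<Rightarrow> ('k, int, 'a) dg \<Rightarrow> bool" where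
  "homologically_smooth U K A \<longleftrightarrow> perfect U (env K A) (diag A)"

definition bimodule_CY ::
  "'u itself \<Rightarrow> ('k, 'z) ring_scheme \<Rightarrow> ('k, int, 'a) dg \<Rightarrow> int \<Rightarrow> bool" where
  "bimodule_CY U K A n \<longleftrightarrow> homologically_smooth U K A \<and> RHom_shift_iso U K A n (diag A)"

definition dg_of_graded :: "('k, int, 'a) graded \<Rightarrow> ('k, int, 'a) dg" where
  "dg_of_graded R =
     \<lparr>carrier = carrier R, mult = mult R, one = \<one>\<^bsub>R\<^esub>, zero = \<zero>\<^bsub>R\<^esub>, add = add R,
      smult = smult R, gr = gr R, dd = (\<lambda>_. \<zero>\<^bsub>R\<^esub>)\<rparr>"

text \<open>
  The graded algebra \<open>R\<close> in cohomological degree \<open>0\<close>.  The modules over its (unsigned) enveloping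
  algebra are the complexes of graded \<open>R\<close>-bimodules, and \<open>derived_iso\<close> is isomorphism in the derived
  category of graded bimodules.
\<close>

definition internal_graded :: "('k, int, 'a) graded \<Rightarrow> ('k, int \<times> int, 'a) dg" where
  "internal_graded R =
     \<lparr>carrier = carrier R, mult = mult R, one = \<one>\<^bsub>R\<^esub>, zero = \<zero>\<^bsub>R\<^esub>, add = add R,
      smult = smult R, gr = (\<lambda>(p, i). if p = 0 then gr R i else {\<zero>\<^bsub>R\<^esub>}), dd = (\<lambda>_. \<zero>\<^bsub>R\<^esub>)\<rparr>"

definition graded_mod ::
  "('k, int \<times> int, 'e) dg \<Rightarrow> ('e, int \<times> int, 'm) dg \<Rightarrow> bool" where
  "graded_mod E M \<longleftrightarrow> dg_module E M \<and> (\<forall>p i. p \<noteq> 0 \<longrightarrow> gr M (p, i) = {\<zero>\<^bsub>M\<^esub>})"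

definition fg_graded_projective ::
  "'u itself \<Rightarrow> ('k, int \<times> int, 'e) dg \<Rightarrow> ('e, int \<times> int, 'm) dg \<Rightarrow> bool" where
  "fg_graded_projective U E P \<longleftrightarrow> graded_mod E P \<and>
     (\<exists>S. finite S \<and> S \<subseteq> carrier P \<and>
        (\<forall>x\<in>carrier P. \<exists>c\<in>S \<rightarrow> carrier E. x = (\<Oplus>\<^bsub>P\<^esub>s\<in>S. ract P s (c s)))) \<and>
     (\<forall>(M :: ('e, int \<times> int, 'u) dg) (N :: ('e, int \<times> int, 'u) dg) q f.
        graded_mod E M \<longrightarrow> graded_mod E N \<longrightarrow> q \<in> dg_hom E M N \<longrightarrow> q ` carrier M = carrier N \<longrightarrow>
        f \<in> dg_hom E P N \<longrightarrow> (\<exists>f'\<in>dg_hom E P M. \<forall>x\<in>carrier P. q (f' x) = f x))"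

definition graded_homologically_smooth ::
  "'u itself \<Rightarrow> ('k, 'z) ring_scheme \<Rightarrow> ('k, int, 'a) graded \<Rightarrow> bool" where
  "graded_homologically_smooth U K R \<longleftrightarrow>
     in_thick U (env K (internal_graded R))
       (fg_graded_projective U (env K (internal_graded R))) (diag (internal_graded R))"

definition graded_bimodule_CY ::
  "'u itself \<Rightarrow> ('k, 'z) ring_scheme \<Rightarrow> ('k, int, 'a) graded \<Rightarrow> int \<Rightarrow> int \<Rightarrow> bool" where
  "graded_bimodule_CY U K R n a \<longleftrightarrow> graded_homologically_smooth U K R \<and>
     RHom_shift_iso U K (internal_graded R) (n, a) (diag (internal_graded R))"

end

theory Submission
 imports Defs
begin

text \<open>
Write \<open>A0\<close> for \<open>R\<close> in cohomological degree zero, \<open>A1\<close> for the DG algebra of \<open>R\<close>, and \<open>E0\<close>, \<open>E1\<close> for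
their enveloping algebras, unsigned and signed. Modules over \<open>E0\<close> are complexes of graded bimodules and
carry a bidegree \<open>(p, i)\<close>; the proof transports everything to \<open>E1\<close> by totalization. In \<open>tot \<Psi> M\<close> an element
of bidegree \<open>(p, i)\<close> gets degree \<open>p + i\<close>, and \<open>e\<close> acts on it as \<open>\<Psi> i e\<close>, where \<open>\<Psi> i\<close> multiplies
\<open>l \<otimes> y\<close> by the sign with exponent \<open>i|l| + \<epsilon>|y|\<close>. In general no \<open>\<Psi> i\<close> is a ring homomorphism, but
\<open>\<Psi> i (e e') = \<Psi> i e \<Psi> (i + n) e'\<close> for \<open>e\<close> of degree \<open>n\<close>, which is what the associativity of the
new action asks for: \<open>E1\<close> is a Zhang twist of \<open>E0\<close> (lemma \<open>zhang\<close>). Totalization keeps the underlying group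
and the differential, so it respects quasi-isomorphisms, homotopies, sums and cones. It sends shifts of the
free module to shifts of the free module, and the diagonal bimodule to the one whose right action is twisted
by the sign with exponent \<open>\<epsilon>|y|\<close> (\<open>tot_diag_inv\<close>).

Smoothness. By induction over the thick closure, the diagonal bimodule of \<open>A0\<close> is, up to
quasi-isomorphism, a summand of a finite cell module \<open>T\<close>, that is, of a module built from the free one by finitely
many shifts and cones (\<open>thick_cell_summand\<close>). Then \<open>tot \<Psi> T\<close> is a finite cell module over \<open>E1\<close>
(\<open>fcell_tot\<close>), and its summand \<open>A1\<close> is perfect.

Duality. Let \<open>P\<close> be the given K-projective resolution of \<open>A0\<close>. It is a homotopy retract of \<open>T\<close>, so
its totalization with \<open>\<epsilon> = 0\<close> is a K-projective resolution of \<open>A1\<close>. The dual of \<open>P\<close>, shifted by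
\<open>(d + 1, a)\<close> and totalized with a second choice of \<open>\<epsilon>\<close>, is compared with the dual of the totalization, shifted
by \<open>d + a + 1\<close>: send \<open>\<psi>\<close> of bidegree \<open>(p, j)\<close> to \<open>\<Omega> (- j) o \<psi>\<close>, where \<open>\<Omega>\<close> inverts \<open>\<Psi>\<close>, with the sign
of exponent \<open>(p + a)(j + a)\<close>. The sign makes the map commute with the shifted differentials, and
the map is linear when \<open>\<epsilon> + a + 1\<close> is even (\<open>eta_act\<close>): this is where the parity of \<open>a\<close> enters.
It is bijective for \<open>T\<close>, which lives in finitely many cohomological degrees, hence a quasi-isomorphism for the
retract \<open>P\<close> (\<open>eta_quasi_iso\<close>). The hypothesis identifies the shifted dual of \<open>P\<close> with the diagonal of \<open>A0\<close>, whose
totalization is \<open>A1\<close> for odd \<open>a\<close> (take \<open>\<epsilon> = 0\<close>) and \<open>A1\<close> twisted by the sign automorphism for even \<open>a\<close>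
(take \<open>\<epsilon> = 1\<close>).
\<close>

section \<open>Additive maps and signs\<close>

text \<open>Operations of an explicitly named structure, with the structure as a short subscript.\<close>

abbreviation add_in ("_ +'__ _" [65, 1000, 66] 65) where "x +_M y \<equiv> x \<oplus>\<^bsub>M\<^esub> y"
abbreviation minus_in ("_ -'__ _" [65, 1000, 66] 65) where "x -_M y \<equiv> x \<ominus>\<^bsub>M\<^esub> y"
abbreviation uminus_in ("-'__ _" [1000, 81] 80) where "-_M x \<equiv> \<ominus>\<^bsub>M\<^esub> x"
abbreviation mult_in ("_ *'__ _" [70, 1000, 71] 70) where "x *_M y \<equiv> x \<otimes>\<^bsub>M\<^esub> y"
abbreviation zero_in ("0'__" [1000] 1000) where "0_M \<equiv> \<zero>\<^bsub>M\<^esub>"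
abbreviation one_in ("1'__" [1000] 1000) where "1_M \<equiv> \<one>\<^bsub>M\<^esub>"

abbreviation keys where "keys \<equiv> Poly_Mapping.keys"
abbreviation lookup where "lookup \<equiv> Poly_Mapping.lookup"

lemmas (in abelian_group) abgrp = abelian_group_axioms

abbreviation ahom :: "('a, 'y) ring_scheme => ('b, 'z) ring_scheme => ('a => 'b) set" where
 "ahom M N \<equiv> hom (add_monoid M) (add_monoid N)"

lemma ahomI:
 assumes "\<And>x. x \<in> carrier M ==> f x \<in> carrier N"
  and "\<And>x y. x \<in> carrier M ==> y \<in> carrier M ==> f (x +_M y) = f x +_N f y"
 shows "f \<in> ahom M N"
 using assms by (auto simp: hom_def)

lemma ahom_closed: "f \<in> ahom M N ==> x \<in> carrier M ==> f x \<in> carrier N"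
 by (auto simp: hom_def)

lemma ahom_add:
 "f \<in> ahom M N ==> x \<in> carrier M ==> y \<in> carrier M ==> f (x +_M y) = f x +_N f y"
 by (auto simp: hom_def)

lemma ahom_zero:
 assumes "abelian_group M" "abelian_group N" "f \<in> ahom M N"
 shows "f 0_M = 0_N"
proof -
 interpret M: abelian_group M by fact
 interpret N: abelian_group N by fact
 interpret h: group_hom "add_monoid M" "add_monoid N" f
  using assms M.a_group N.a_group by (simp add: group_hom_def group_hom_axioms_def)
 show ?thesis using h.hom_one by simp
qed

lemma ahom_minus:
 assumes "abelian_group M" "abelian_group N" "f \<in> ahom M N" "x \<in> carrier M"
 shows "f (-_M x) = -_N f x"
proof -
 interpret M: abelian_group M by fact
 interpret N: abelian_group N by fact
 interpret h: group_hom "add_monoid M" "add_monoid N" f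
  using assms M.a_group N.a_group by (simp add: group_hom_def group_hom_axioms_def)
 show ?thesis using h.hom_inv[of x] assms(4) by (simp add: a_inv_def)
qed

lemma ahom_finsum:
 assumes "abelian_group M" "abelian_group N" "f \<in> ahom M N" "finite S"
  and "\<And>i. i \<in> S ==> c i \<in> carrier M"
 shows "f (\<Oplus>\<^bsub>M\<^esub>i\<in>S. c i) = (\<Oplus>\<^bsub>N\<^esub>i\<in>S. f (c i))"
proof -
 interpret M: abelian_group M by fact
 interpret N: abelian_group N by fact
 show ?thesis using assms(4,5)
 proof (induction S rule: finite_induct)
  case empty
  then show ?case using ahom_zero[OF assms(1-3)] by simp
 next
  case (insert i S)
  have "f \<in> carrier M \<rightarrow> carrier N" using ahom_closed[OF assms(3)] by auto
  then have c: "c \<in> S \<rightarrow> carrier M" "(\<lambda>i. f (c i)) \<in> S \<rightarrow> carrier N" "c i \<in> carrier M" "f (c i) \<in> carrier N"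
   using insert by auto
  show ?case using insert c by (simp add: ahom_add[OF assms(3)] M.finsum_closed)
 qed
qed

lemma ahom_comp: "f \<in> ahom M N ==> g \<in> ahom N P ==> g o f \<in> ahom M P"
 by (rule ahomI) (simp_all add: ahom_closed ahom_add)

lemma (in abelian_group) add_4_swap:
 "a \<in> carrier G ==> b \<in> carrier G ==> c \<in> carrier G ==> e \<in> carrier G ==>
  (a \<oplus> b) \<oplus> (c \<oplus> e) = (a \<oplus> c) \<oplus> (b \<oplus> e)"
 by (simp add: a_ac)

lemma (in abelian_group) minus_eq_zero_iff:
 assumes "x \<in> carrier G" "y \<in> carrier G"
 shows "x \<ominus> y = \<zero> \<longleftrightarrow> x = y"
proof
 assume "x \<ominus> y = \<zero>"
 then have "(x \<oplus> \<ominus> y) \<oplus> y = y" using assms by (simp add: a_minus_def)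
 then show "x = y" using assms by (simp add: a_assoc l_neg)
qed (use assms in "simp add: a_minus_def r_neg")

lemma (in abelian_group) minus_eq_iff:
 assumes "x \<in> carrier G" "y \<in> carrier G" "z \<in> carrier G"
 shows "x \<ominus> y = z \<longleftrightarrow> x = y \<oplus> z"
proof
 assume "x \<ominus> y = z"
 then have "y \<oplus> (x \<oplus> \<ominus> y) = y \<oplus> z" by (simp add: a_minus_def)
 then have "x \<oplus> (y \<oplus> \<ominus> y) = y \<oplus> z" using assms by (simp add: a_lcomm)
 then show "x = y \<oplus> z" using assms by (simp add: r_neg)
next
 assume "x = y \<oplus> z"
 then have "x \<ominus> y = (y \<oplus> \<ominus> y) \<oplus> z" using assms by (simp add: a_minus_def a_ac)
 then show "x \<ominus> y = z" using assms by (simp add: r_neg)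
qed

lemma (in abelian_group) ahom_plus:
 assumes "f \<in> ahom M G" "g \<in> ahom M G" "abelian_group M"
 shows "(\<lambda>x. f x \<oplus> g x) \<in> ahom M G"
 using assms by (intro ahomI) (auto simp: ahom_closed ahom_add add_4_swap)

lemma (in abelian_group) ahom_uminus:
 assumes "f \<in> ahom M G"
 shows "(\<lambda>x. \<ominus> f x) \<in> ahom M G"
 using assms by (intro ahomI) (auto simp: ahom_closed ahom_add minus_add)

lemma minus_zero_ag: "abelian_group M ==> -_M 0_M = 0_M"
 by (metis abelian_group.r_neg abelian_groupE(2) abelian_groupE(5) abelian_group.a_inv_closed)

lemma koszul_closed [simp]:
 "abelian_group M ==> x \<in> carrier M ==> koszul M n x \<in> carrier M"
 by (simp add: koszul_def abelian_group.a_inv_closed)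

lemma koszul_zero [simp]: "abelian_group M ==> koszul M n 0_M = 0_M"
 by (simp add: koszul_def minus_zero_ag)

lemma koszul_add:
 "abelian_group M ==> x \<in> carrier M ==> y \<in> carrier M ==>
  koszul M n (x +_M y) = koszul M n x +_M koszul M n y"
 by (simp add: koszul_def abelian_group.minus_add)

lemma koszul_koszul:
 "abelian_group M ==> x \<in> carrier M ==> koszul M n (koszul M m x) = koszul M (n + m) x"
 by (auto simp: koszul_def abelian_group.minus_minus)

lemma koszul_even: "even n ==> koszul M n x = x"
 by (simp add: koszul_def)

lemma koszul_cong: "even (n - m) ==> koszul M n x = koszul M m x"
 by (auto simp: koszul_def)

lemma koszul_eq_zero:
 "abelian_group M ==> x \<in> carrier M ==> koszul M n x = 0_M \<longleftrightarrow> x = 0_M"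
 by (metis even_add koszul_even koszul_koszul koszul_zero)

lemma koszul_ahom: "abelian_group M ==> koszul M n \<in> ahom M M"
 by (intro ahomI) (auto simp: koszul_add)

lemma ahom_koszul:
 "abelian_group M ==> abelian_group N ==> f \<in> ahom M N ==> x \<in> carrier M ==>
  f (koszul M n x) = koszul N n (f x)"
 by (simp add: koszul_def ahom_minus)

lemma finsum_mono_zero:
 assumes "abelian_group M" "finite S" "T \<subseteq> S" "\<And>i. i \<in> S ==> c i \<in> carrier M"
  "\<And>i. i \<in> S - T ==> c i = 0_M"
 shows "(\<Oplus>\<^bsub>M\<^esub>i\<in>S. c i) = (\<Oplus>\<^bsub>M\<^esub>i\<in>T. c i)"
proof -
 interpret abelian_group M by fact
 show ?thesis
  by (rule sym, rule add.finprod_mono_neutral_cong_left) (use assms in auto)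
qed

subsection \<open>Linear identities in abelian groups\<close>

text \<open>
Additive identities are decided by reflection: two expressions in the same atoms agree as soon as the
integer coefficients of all atoms do. The rules \<open>lin_intros\<close> read off the expression, \<open>lin_solve\<close>
compares coefficients. This works in the additive group of any record, relative to its carrier.
\<close>

datatype lin = LV nat | LZ | LA lin lin | LN lin
primrec lev :: "('a,'z) ring_scheme => lin => 'a list => 'a" where
 "lev G (LV n) xs = xs ! n"
| "lev G LZ xs = 0_G"
| "lev G (LA s t) xs = lev G s xs +_G lev G t xs"
| "lev G (LN s) xs = -_G lev G s xs"

primrec lco :: "lin => nat => int" where
 "lco (LV n) i = (if n = i then 1 else 0)"
| "lco LZ i = 0"
| "lco (LA s t) i = lco s i + lco t i"
| "lco (LN s) i = - lco s i"

primrec lvars :: "lin => nat set" where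
 "lvars (LV n) = {n}"
| "lvars LZ = {}"
| "lvars (LA s t) = lvars s \<union> lvars t"
| "lvars (LN s) = lvars s"

lemma lev_normal:
 assumes "abelian_group G" "set xs \<subseteq> carrier G" "lvars t \<subseteq> {..<length xs}"
 shows "lev G t xs = (\<Oplus>\<^bsub>G\<^esub>i\<in>{..<length xs}. [lco t i] \<cdot>\<^bsub>G\<^esub> (xs ! i))"
proof -
 interpret abelian_group G by fact
 have xs: "xs ! i \<in> carrier G" if "i < length xs" for i using assms(2) that by auto
 have z: "[(0::int)] \<cdot>\<^bsub>G\<^esub> x = 0_G" for x by (simp add: add_pow_def)
 have c: "(\<lambda>i. [lco t i] \<cdot>\<^bsub>G\<^esub> (xs ! i)) \<in> {..<length xs} \<rightarrow> carrier G" for t using xs by auto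
 show ?thesis using assms(3)
 proof (induction t)
  case (LV n)
  have "(\<Oplus>\<^bsub>G\<^esub>i\<in>{..<length xs}. [lco (LV n) i] \<cdot>\<^bsub>G\<^esub> (xs ! i)) = (\<Oplus>\<^bsub>G\<^esub>i\<in>{n}. [lco (LV n) i] \<cdot>\<^bsub>G\<^esub> (xs ! i))"
   by (rule finsum_mono_zero) (use LV abgrp xs in "auto simp: z")
  then show ?case using LV xs[of n] by simp
 next
  case LZ
  then show ?case by (simp add: z)
 next
  case (LA s t)
  then show ?case
   by (simp add: add.int_pow_mult[symmetric] xs finsum_addf[symmetric, OF c c] cong: finsum_cong)
 next
  case (LN s)
  have "(\<lambda>x. -_G x) \<in> ahom G G" by (rule ahomI) (auto simp: minus_add)
  from ahom_finsum[OF abgrp abgrp this, of "{..<length xs}" "\<lambda>i. [lco s i] \<cdot>\<^bsub>G\<^esub> (xs ! i)"] LN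
  have "lev G (LN s) xs = (\<Oplus>\<^bsub>G\<^esub>i\<in>{..<length xs}. -_G ([lco s i] \<cdot>\<^bsub>G\<^esub> (xs ! i)))" using xs by simp
  also have "\<dots> = (\<Oplus>\<^bsub>G\<^esub>i\<in>{..<length xs}. [lco (LN s) i] \<cdot>\<^bsub>G\<^esub> (xs ! i))"
   by (rule finsum_cong') (auto simp: xs add.int_pow_neg)
  finally show ?case .
 qed
qed

lemma lev_eqI:
 assumes "abelian_group G" "\<forall>x\<in>set xs. x \<in> carrier G" "lvars s \<subseteq> {..<length xs}" "lvars t \<subseteq> {..<length xs}"
  "\<forall>i\<in>set [0..<length xs]. lco s i = lco t i"
 shows "lev G s xs = lev G t xs"
proof -
 interpret abelian_group G by fact
 have xs: "xs ! i \<in> carrier G" if "i < length xs" for i using assms(2) that by auto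
 show ?thesis
  using assms by (subst (1 2) lev_normal) (auto intro!: finsum_cong' simp: xs)
qed

lemma lin_solve:
 assumes "abelian_group G" "a = lev G s xs" "b = lev G t xs" "\<forall>x\<in>set xs. x \<in> carrier G"
  "lvars s \<subseteq> {..<length xs} \<and> lvars t \<subseteq> {..<length xs} \<and> (\<forall>i\<in>set [0..<length xs]. lco s i = lco t i)"
 shows "a = b"
 using lev_eqI[OF assms(1,4)] assms by simp

lemma lin_intros:
 "x = lev G s xs ==> y = lev G t xs ==> x +_G y = lev G (LA s t) xs"
 "x = lev G s xs ==> y = lev G t xs ==> x -_G y = lev G (LA s (LN t)) xs"
 "x = lev G s xs ==> -_G x = lev G (LN s) xs"
 "0_G = lev G LZ xs"
 "x = lev G (LV 0) (x # xs)"
 "x = lev G (LV n) xs ==> x = lev G (LV (Suc n)) (y # xs)"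
 by (simp_all add: a_minus_def)

section \<open>Graded groups\<close>

lemma gr_subgroup: "graded_group M ==> subgroup (gr M g) (add_monoid M)"
 by (simp add: graded_group_def additive_subgroup_def)

lemma gr_carrier: "graded_group M ==> x \<in> gr M g ==> x \<in> carrier M"
 using subgroup.subset[OF gr_subgroup] by fastforce

lemma gr_zero [simp]: "graded_group M ==> 0_M \<in> gr M g"
 using subgroup.one_closed[OF gr_subgroup] by fastforce

lemma gr_add: "graded_group M ==> x \<in> gr M g ==> y \<in> gr M g ==> x +_M y \<in> gr M g"
 using subgroup.m_closed[OF gr_subgroup] by fastforce

lemma gr_minus: "graded_group M ==> x \<in> gr M g ==> -_M x \<in> gr M g"
 using subgroup.m_inv_closed[OF gr_subgroup] unfolding a_inv_def by fastforce

lemma gr_koszul: "graded_group M ==> x \<in> gr M g ==> koszul M n x \<in> gr M g"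
 by (simp add: koszul_def gr_minus)

lemma graded_ag: "graded_group M ==> abelian_group M"
 by (simp add: graded_group_def)

lemma graded_group_ex1: "graded_group M ==> x \<in> carrier M ==> \<exists>!c. is_decomp M x c"
 by (simp add: graded_group_def)

lemma hcomp_decomp:
 assumes "graded_group M" "x \<in> carrier M" shows "is_decomp M x (hcomp M x)"
 unfolding hcomp_def by (rule theI'[of "is_decomp M x", OF graded_group_ex1[OF assms]])

lemma hcomp_eqI:
 assumes "graded_group M" "x \<in> carrier M" "is_decomp M x c" shows "hcomp M x = c"
 using hcomp_decomp[OF assms(1,2)] assms(3) graded_group_ex1[OF assms(1,2)] by metis

lemma hcomp_gr:
 assumes "graded_group M" "x \<in> carrier M" shows "hcomp M x g \<in> gr M g"
 using hcomp_decomp[OF assms] by (simp add: is_decomp_def)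

lemma hcomp_closed: "graded_group M ==> x \<in> carrier M ==> hcomp M x g \<in> carrier M"
 by (rule gr_carrier, assumption, rule hcomp_gr)

lemma hsupp_finite:
 assumes "graded_group M" "x \<in> carrier M" shows "finite (hsupp M x)"
 using hcomp_decomp[OF assms] by (simp add: is_decomp_def hsupp_def)

lemma hcomp_sum:
 assumes "graded_group M" "x \<in> carrier M" "finite S" "hsupp M x \<subseteq> S"
 shows "x = (\<Oplus>\<^bsub>M\<^esub>g\<in>S. hcomp M x g)"
proof -
 have "x = (\<Oplus>\<^bsub>M\<^esub>g\<in>hsupp M x. hcomp M x g)"
  using hcomp_decomp[OF assms(1,2)] by (auto simp: is_decomp_def hsupp_def)
 also have "\<dots> = (\<Oplus>\<^bsub>M\<^esub>g\<in>S. hcomp M x g)"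
  by (rule finsum_mono_zero[symmetric])
   (use assms in "auto simp: graded_ag hcomp_closed hsupp_def")
 finally show ?thesis .
qed

lemma hcomp_finsum:
 assumes "graded_group M" "finite S" "\<And>g. g \<in> S ==> c g \<in> gr M g"
 shows "hcomp M (\<Oplus>\<^bsub>M\<^esub>g\<in>S. c g) = (\<lambda>g. if g \<in> S then c g else 0_M)"
proof -
 interpret abelian_group M using assms(1) by (rule graded_ag)
 let ?c = "\<lambda>g. if g \<in> S then c g else 0_M"
 have c: "c g \<in> carrier M" if "g \<in> S" for g by (rule gr_carrier[OF assms(1) assms(3)[OF that]])
 have "(\<Oplus>\<^bsub>M\<^esub>g\<in>S. c g) = (\<Oplus>\<^bsub>M\<^esub>g\<in>S. ?c g)"
  by (rule finsum_cong') (use c in auto)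
 also have "\<dots> = (\<Oplus>\<^bsub>M\<^esub>g\<in>{g. ?c g \<noteq> 0_M}. ?c g)"
  by (rule finsum_mono_zero) (use c assms abgrp in "auto split: if_splits")
 finally have "(\<Oplus>\<^bsub>M\<^esub>g\<in>S. c g) = (\<Oplus>\<^bsub>M\<^esub>g\<in>{g. ?c g \<noteq> 0_M}. ?c g)" .
 moreover have "finite {g. ?c g \<noteq> 0_M}" by (rule finite_subset[OF _ assms(2)]) auto
 ultimately have "is_decomp M (\<Oplus>\<^bsub>M\<^esub>g\<in>S. c g) ?c"
  using assms by (auto simp: is_decomp_def)
 then show ?thesis
  by (rule hcomp_eqI[OF assms(1), rotated]) (use c in "auto intro: finsum_closed")
qed

lemma hcomp_hom:
 assumes "graded_group M" "x \<in> gr M g"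
 shows "hcomp M x = (\<lambda>h. if h = g then x else 0_M)"
proof -
 interpret abelian_group M using assms(1) by (rule graded_ag)
 have "x = (\<Oplus>\<^bsub>M\<^esub>h\<in>{g}. x)" using gr_carrier[OF assms] by simp
 then show ?thesis using hcomp_finsum[OF assms(1), of "{g}" "\<lambda>_. x"] assms(2) by auto
qed

lemma hsupp_homogeneous:
 assumes "graded_group M" "x \<in> gr M g"
 shows "hsupp M x = (if x = 0_M then {} else {g})"
 using hcomp_hom[OF assms] by (auto simp: hsupp_def)

lemma hcomp_add:
 assumes "graded_group M" "x \<in> carrier M" "y \<in> carrier M"
 shows "hcomp M (x +_M y) g = hcomp M x g +_M hcomp M y g"
proof -
 interpret abelian_group M using assms(1) by (rule graded_ag)
 let ?S = "hsupp M x \<union> hsupp M y"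
 have fin: "finite ?S" using assms by (simp add: hsupp_finite)
 have "x +_M y = (\<Oplus>\<^bsub>M\<^esub>g\<in>?S. hcomp M x g) +_M (\<Oplus>\<^bsub>M\<^esub>g\<in>?S. hcomp M y g)"
  using hcomp_sum[OF assms(1,2) fin] hcomp_sum[OF assms(1,3) fin] by simp
 also have "\<dots> = (\<Oplus>\<^bsub>M\<^esub>g\<in>?S. hcomp M x g +_M hcomp M y g)"
  by (rule finsum_addf[symmetric]) (simp_all add: assms hcomp_closed)
 finally have e: "x +_M y = (\<Oplus>\<^bsub>M\<^esub>g\<in>?S. hcomp M x g +_M hcomp M y g)" .
 have "hcomp M (x +_M y) = (\<lambda>g. if g \<in> ?S then hcomp M x g +_M hcomp M y g else 0_M)"
  unfolding e by (rule hcomp_finsum[OF assms(1) fin]) (simp add: assms gr_add hcomp_gr)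
 then show ?thesis by (auto simp: hsupp_def)
qed

lemma hcomp_ahom: "graded_group M ==> (\<lambda>x. hcomp M x g) \<in> ahom M M"
 by (intro ahomI) (auto simp: hcomp_add hcomp_closed)

lemma hcomp_zero: "graded_group M ==> hcomp M 0_M g = 0_M"
 by (simp add: hcomp_hom[where g=g])

text \<open>
Finite sums of homogeneous elements. The inductive form makes no reference to components, whose
uniqueness is not available while a grading is being established.
\<close>

inductive_set hspan :: "('s, 'g, 'a, 'z) graded_scheme => 'a set" for M where
 hspan_zero: "0_M \<in> hspan M"
| hspan_add: "x \<in> gr M g ==> y \<in> hspan M ==> x +_M y \<in> hspan M"

lemma graded_group_hspan:
 assumes "graded_group M" "x \<in> carrier M"
 shows "x \<in> hspan M"
proof -
 interpret abelian_group M using assms(1) by (rule graded_ag)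
 have "(\<Oplus>\<^bsub>M\<^esub>g\<in>S. hcomp M x g) \<in> hspan M" if "finite S" for S
  using that
 proof (induction S rule: finite_induct)
  case empty
  then show ?case by (simp add: hspan_zero)
 next
  case (insert g S)
  have "(\<Oplus>\<^bsub>M\<^esub>g\<in>insert g S. hcomp M x g) = hcomp M x g +_M (\<Oplus>\<^bsub>M\<^esub>g\<in>S. hcomp M x g)"
   by (rule finsum_insert) (use insert in "simp_all add: assms hcomp_closed")
  then show ?case using insert hspan_add[OF hcomp_gr[OF assms]] by simp
 qed
 then show ?thesis using hcomp_sum[OF assms hsupp_finite[OF assms] subset_refl] hsupp_finite[OF assms] by metis
qed

lemma graded_induct [consumes 2, case_names zero add]:
 assumes "graded_group M" "x \<in> carrier M"
  and "P 0_M"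
  and "\<And>x g y. x \<in> gr M g ==> y \<in> carrier M ==> P y ==> P (x +_M y)"
 shows "P x"
proof -
 interpret abelian_group M using assms(1) by (rule graded_ag)
 have "x \<in> hspan M" by (rule graded_group_hspan[OF assms(1,2)])
 then have "x \<in> carrier M \<and> P x"
  by induction (use assms(3,4) gr_carrier[OF assms(1)] in simp_all)
 then show ?thesis by simp
qed

lemma ahom_eqI:
 assumes "graded_group M" "abelian_group N" "f \<in> ahom M N" "f' \<in> ahom M N"
  and "\<And>g x. x \<in> gr M g ==> f x = f' x" "x \<in> carrier M"
 shows "f x = f' x"
 using assms(1,6)
proof (induction rule: graded_induct)
 case zero
 then show ?case using assms ahom_zero graded_ag by metis
next
 case (add x g y)
 then show ?case using assms gr_carrier[OF assms(1)] by (metis ahom_add)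
qed

text \<open>
 A grading is recognised by its projections: if homogeneous elements span and each degree has an
 additive map that is the identity in this degree and zero in the others, then decompositions
 exist and are unique.
\<close>

lemma graded_groupI:
 assumes "abelian_group M"
  and zero: "\<And>g. 0_M \<in> gr M g"
  and gadd: "\<And>g x y. x \<in> gr M g ==> y \<in> gr M g ==> x +_M y \<in> gr M g"
  and gmin: "\<And>g x. x \<in> gr M g ==> -_M x \<in> gr M g"
  and sub: "\<And>g x. x \<in> gr M g ==> x \<in> carrier M"
  and span: "\<And>x. x \<in> carrier M ==> x \<in> hspan M"
  and pr: "\<And>g. \<exists>pr \<in> ahom M N. (\<forall>x\<in>gr M g. pr x = 0_N --> x = 0_M) \<and>
    (\<forall>h. \<forall>x\<in>gr M h. h \<noteq> g --> pr x = 0_N)"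
  and "abelian_group N"
 shows "graded_group M"
proof -
 interpret abelian_group M by fact
 have ex: "\<exists>c. is_decomp M x c" if x: "x \<in> carrier M" for x
 proof -
  have "x \<in> hspan M" using span x by blast
  then have "x \<in> carrier M \<and> (\<exists>S c. finite S \<and> (\<forall>g\<in>S. c g \<in> gr M g) \<and> x = (\<Oplus>\<^bsub>M\<^esub>g\<in>S. c g))"
  proof induction
   case hspan_zero
   have "0_M = (\<Oplus>\<^bsub>M\<^esub>g\<in>{}. 0_M)" by simp
   then show ?case by (metis empty_iff finite.emptyI zero_closed)
  next
   case (hspan_add x g y)
   then obtain S c where S: "finite S" "\<forall>g\<in>S. c g \<in> gr M g" "y = (\<Oplus>\<^bsub>M\<^esub>g\<in>S. c g)" by blast
   define c' where "c' = (\<lambda>h. if h \<in> S then c h else 0_M)"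
   have c': "c' h \<in> gr M h" for h using S zero by (auto simp: c'_def)
   have cc: "c' \<in> A \<rightarrow> carrier M" for A by (intro Pi_I sub[OF c'])
   have y: "y = (\<Oplus>\<^bsub>M\<^esub>g\<in>S. c' g)"
    unfolding S(3) by (rule finsum_cong') (use cc in "auto simp: c'_def")
   also have "\<dots> = (\<Oplus>\<^bsub>M\<^esub>g\<in>insert g S. c' g)"
    by (rule finsum_mono_zero[symmetric])
     (use abgrp S(1) sub[OF c'] in "auto simp: c'_def")
   also have "\<dots> = (\<Oplus>\<^bsub>M\<^esub>g\<in>insert g (S - {g}). c' g)" by simp
   also have "\<dots> = c' g +_M (\<Oplus>\<^bsub>M\<^esub>g\<in>S - {g}. c' g)"
    by (rule finsum_insert) (use S cc in auto)
   finally have y: "y = c' g +_M (\<Oplus>\<^bsub>M\<^esub>g\<in>S - {g}. c' g)" .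
   have x: "x \<in> carrier M" using sub hspan_add by blast
   have s: "(\<Oplus>\<^bsub>M\<^esub>g\<in>S - {g}. c' g) \<in> carrier M" by (rule finsum_closed) (use cc in auto)
   have "x +_M y = (x +_M c' g) +_M (\<Oplus>\<^bsub>M\<^esub>g\<in>S - {g}. c' g)"
    unfolding y using x s c' sub by (metis a_assoc)
   also have "(\<Oplus>\<^bsub>M\<^esub>g\<in>S - {g}. c' g) = (\<Oplus>\<^bsub>M\<^esub>h\<in>S - {g}. (c'(g := x +_M c' g)) h)"
    by (rule finsum_cong') (use sub[OF c'] in auto)
   also have "(x +_M c' g) +_M \<dots> = (\<Oplus>\<^bsub>M\<^esub>h\<in>insert g (S - {g}). (c'(g := x +_M c' g)) h)"
    by (subst finsum_insert) (use S sub[OF c'] x in auto)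
   finally have "x +_M y = (\<Oplus>\<^bsub>M\<^esub>h\<in>insert g (S - {g}). (c'(g := x +_M c' g)) h)" .
   moreover have "\<forall>h\<in>insert g (S - {g}). (c'(g := x +_M c' g)) h \<in> gr M h"
    using c' gadd hspan_add by auto
   moreover have "finite (insert g (S - {g}))" using S by simp
   ultimately show ?case using x hspan_add by blast
  qed
  then obtain S c where S: "finite S" "\<forall>g\<in>S. c g \<in> gr M g" "x = (\<Oplus>\<^bsub>M\<^esub>g\<in>S. c g)" by blast
  define c' where "c' = (\<lambda>h. if h \<in> S then c h else 0_M)"
  have c': "c' h \<in> gr M h" for h using S zero by (auto simp: c'_def)
  have "x = (\<Oplus>\<^bsub>M\<^esub>g\<in>S. c' g)"
   unfolding S(3) by (rule finsum_cong') (use c' sub in "auto simp: c'_def")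
  also have "\<dots> = (\<Oplus>\<^bsub>M\<^esub>g\<in>{g. c' g \<noteq> 0_M}. c' g)"
   by (rule finsum_mono_zero[OF abgrp S(1)]) (use sub S(2) in "auto simp: c'_def")
  moreover have "finite {g. c' g \<noteq> 0_M}"
   by (rule finite_subset[OF _ S(1)]) (auto simp: c'_def)
  ultimately show ?thesis using c' by (auto simp: is_decomp_def)
 qed
 have pr_dec: "p x = p (c g)"
  if dec: "is_decomp M x c" and p: "p \<in> ahom M N" "\<forall>h. \<forall>x\<in>gr M h. h \<noteq> g --> p x = 0_N" for x c p g
 proof -
  interpret N: abelian_group N by fact
  let ?T = "{g. c g \<noteq> 0_M}"
  have T: "finite ?T" "x = (\<Oplus>\<^bsub>M\<^esub>g\<in>?T. c g)" "\<And>g. c g \<in> carrier M" "\<And>g. c g \<in> gr M g"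
   using dec sub by (auto simp: is_decomp_def)
  have pc: "p (c h) \<in> carrier N" for h by (rule ahom_closed[OF p(1) T(3)])
  have "p x = (\<Oplus>\<^bsub>N\<^esub>h\<in>?T. p (c h))"
   unfolding T(2) by (rule ahom_finsum[OF abgrp N.abgrp p(1) T(1) T(3)])
  also have "\<dots> = (\<Oplus>\<^bsub>N\<^esub>h\<in>insert g ?T. p (c h))"
   by (rule finsum_mono_zero[symmetric])
    (use T pc N.abgrp ahom_zero[OF abgrp N.abgrp p(1)] in auto)
  also have "\<dots> = (\<Oplus>\<^bsub>N\<^esub>h\<in>{g}. p (c h))"
   by (rule finsum_mono_zero) (use T p pc N.abgrp in auto)
  also have "\<dots> = p (c g)" using pc by simp
  finally show ?thesis .
 qed
 have uniq: "c = c'" if c: "is_decomp M x c" and c': "is_decomp M x c'" for x c c'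
 proof
  fix g
  obtain p where p: "p \<in> ahom M N" "\<forall>x\<in>gr M g. p x = 0_N --> x = 0_M"
    "\<forall>h. \<forall>x\<in>gr M h. h \<noteq> g --> p x = 0_N" using pr by blast
  interpret N: abelian_group N by fact
  have e: "p (c g) = p (c' g)" using pr_dec[OF c p(1,3)] pr_dec[OF c' p(1,3)] by simp
  have g: "c g \<in> gr M g" "c' g \<in> gr M g" using c c' by (auto simp: is_decomp_def)
  then have cc: "c g \<in> carrier M" "c' g \<in> carrier M" using sub by auto
  then have "p (c g -_M c' g) = 0_N"
   unfolding a_minus_def using e p(1)
   by (simp add: ahom_add[OF p(1)] ahom_minus[OF abgrp N.abgrp p(1)]
    ahom_closed[OF p(1)] N.r_neg)
  moreover have "c g -_M c' g \<in> gr M g" using g gadd gmin by (simp add: a_minus_def)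
  ultimately show "c g = c' g" using p(2) cc minus_eq_zero_iff by metis
 qed
 have "additive_subgroup (gr M g) M" for g
  unfolding additive_subgroup_def
  by (rule add.subgroupI) (use sub zero[of g] gadd gmin in "auto simp: a_inv_def")
 then show ?thesis unfolding graded_group_def using ex uniq abgrp by blast
qed

lemma hspan_sum:
 assumes "abelian_group M" "\<And>g x. x \<in> gr M g ==> x \<in> carrier M" "x \<in> hspan M" "y \<in> hspan M"
 shows "x +_M y \<in> hspan M"
proof -
 interpret abelian_group M by fact
 have c: "x \<in> carrier M" if "x \<in> hspan M" for x using that by induction (use assms in auto)
 show ?thesis using assms(3)
 proof induction
  case hspan_zero
  then show ?case using assms(4) c by simp
 next
  case (hspan_add x g z)
  then show ?case using assms c by (metis a_assoc hspan.hspan_add)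
 qed
qed

lemma hspan_gr:
 assumes "abelian_group M" "x \<in> gr M g" "x \<in> carrier M"
 shows "x \<in> hspan M"
 using hspan_add[OF assms(2) hspan_zero] assms by (simp add: abelian_group.axioms(1) abelian_monoid.r_zero)

section \<open>Complexes and maps inducing isomorphisms in cohomology\<close>

locale cx = abelian_group M for M :: "('s, 'g, 'm) dg" (structure) +
 assumes d_hom: "dd M \<in> ahom M M"
  and d_d: "x \<in> carrier M ==> dd M (dd M x) = \<zero>"
begin

lemma d_closed [simp]: "x \<in> carrier M ==> dd M x \<in> carrier M"
 by (rule ahom_closed[OF d_hom])
lemma d_add: "x \<in> carrier M ==> y \<in> carrier M ==> dd M (x \<oplus> y) = dd M x \<oplus> dd M y"
 by (rule ahom_add[OF d_hom])
lemma d_zero [simp]: "dd M \<zero> = \<zero>"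
 by (rule ahom_zero[OF abgrp abgrp d_hom])
lemma d_minus: "x \<in> carrier M ==> dd M (\<ominus> x) = \<ominus> dd M x"
 by (rule ahom_minus[OF abgrp abgrp d_hom])
lemma ag: "abelian_group M" by (rule abgrp)
lemma zero_minus [simp]: "\<ominus> \<zero> = \<zero>" by (rule minus_zero_ag[OF ag])

end

definition chain_map :: "('s, 'g, 'm) dg => ('t, 'h, 'n) dg => ('m => 'n) => bool" where
 "chain_map M N f \<longleftrightarrow> f \<in> ahom M N \<and> (\<forall>x\<in>carrier M. f (dd M x) = dd N (f x))"

text \<open>
Injectivity and surjectivity on cohomology in terms of elements. They are kept apart because arguments with
retracts and with invertible roofs establish them separately; together they say that a morphism is a
quasi-isomorphism (\<open>quasi_iso_iff\<close>).
\<close>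

definition hinj :: "('s, 'g, 'm) dg => ('t, 'h, 'n) dg => ('m => 'n) => bool" where
 "hinj M N f \<longleftrightarrow> (\<forall>x\<in>carrier M. \<forall>z\<in>carrier N. dd M x = 0_M --> f x = dd N z -->
   (\<exists>w\<in>carrier M. x = dd M w))"

definition hsurj :: "('s, 'g, 'm) dg => ('t, 'h, 'n) dg => ('m => 'n) => bool" where
 "hsurj M N f \<longleftrightarrow> (\<forall>y\<in>carrier N. dd N y = 0_N -->
   (\<exists>x\<in>carrier M. dd M x = 0_M \<and> (\<exists>z\<in>carrier N. y = f x +_N dd N z)))"

lemma chain_mapD:
 assumes "chain_map M N f"
 shows "f \<in> ahom M N" "x \<in> carrier M ==> f (dd M x) = dd N (f x)"
  "x \<in> carrier M ==> f x \<in> carrier N"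
  "x \<in> carrier M ==> y \<in> carrier M ==> f (x +_M y) = f x +_N f y"
 using assms by (auto simp: chain_map_def hom_def)

lemma chain_map_zero:
 assumes "cx M" "cx N" "chain_map M N f"
 shows "f 0_M = 0_N"
 by (rule ahom_zero[OF cx.ag[OF assms(1)] cx.ag[OF assms(2)] chain_mapD(1)[OF assms(3)]])

lemma chain_map_minus:
 assumes "cx M" "cx N" "chain_map M N f" "x \<in> carrier M"
 shows "f (-_M x) = -_N f x"
 by (rule ahom_minus[OF cx.ag[OF assms(1)] cx.ag[OF assms(2)] chain_mapD(1)[OF assms(3)] assms(4)])

lemma coset_eq_iff:
 assumes "cx M" "x \<in> carrier M" "y \<in> carrier M"
 shows "coboundaries M +>\<^bsub>M\<^esub> x = coboundaries M +>\<^bsub>M\<^esub> y \<longleftrightarrow> (\<exists>w\<in>carrier M. x = dd M w +_M y)"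
proof -
 interpret cx M by fact
 let ?c = "\<lambda>u. coboundaries M +>\<^bsub>M\<^esub> u"
 have c: "?c u = {dd M w +_M u | w. w \<in> carrier M}" for u
  by (auto simp: a_r_coset_def r_coset_def coboundaries_def)
 show ?thesis
 proof
  assume eq: "?c x = ?c y"
  have "x = dd M 0_M +_M x" using assms by simp
  then have "x \<in> ?c x" unfolding c by blast
  then have "x \<in> ?c y" using eq by simp
  then show "\<exists>w\<in>carrier M. x = dd M w +_M y" unfolding c by blast
 next
  assume "\<exists>w\<in>carrier M. x = dd M w +_M y"
  then obtain w where w: "w \<in> carrier M" "x = dd M w +_M y" by blast
  have 1: "dd M v +_M x = dd M (v +_M w) +_M y" if "v \<in> carrier M" for v
   using w that assms by (simp add: d_add a_assoc)
  have 2: "dd M v +_M y = dd M (v +_M -_M w) +_M x" if v: "v \<in> carrier M" for v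
  proof -
   have "dd M (v +_M -_M w) +_M x = dd M v +_M ((-_M dd M w +_M dd M w) +_M y)"
    using w v assms by (simp add: d_add d_minus a_assoc)
   then show ?thesis using w v assms by (simp add: l_neg)
  qed
  show "?c x = ?c y"
   unfolding c
  proof (rule subset_antisym; rule subsetI; elim CollectE exE conjE; hypsubst; rule CollectI)
   fix v assume v: "v \<in> carrier M"
   show "\<exists>w. dd M v +_M x = dd M w +_M y \<and> w \<in> carrier M"
    using 1[OF v] v w(1) a_closed by blast
   show "\<exists>w. dd M v +_M y = dd M w +_M x \<and> w \<in> carrier M"
    using 2[OF v] v w(1) a_closed a_inv_closed by blast
  qed
 qed
qed

lemma quasi_iso_iff:
 assumes "cx M" "cx N"
 shows "quasi_iso E M N f \<longleftrightarrow> f \<in> dg_hom E M N \<and> hinj M N f \<and> hsurj M N f"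
proof (cases "f \<in> dg_hom E M N")
 case False
 then show ?thesis by (simp add: quasi_iso_def)
next
 case True
 interpret M: cx M by fact
 interpret N: cx N by fact
 have f: "chain_map M N f" using True by (auto simp: dg_hom_def hom_deg_def chain_map_def)
 note fc = chain_mapD[OF f]
 let ?m = "\<lambda>x. coboundaries M +>\<^bsub>M\<^esub> x" and ?n = "\<lambda>x. coboundaries N +>\<^bsub>N\<^esub> x"
 let ?F = "\<lambda>C. set_add N (coboundaries N) (f ` C)"
 have F: "?F (?m x) = ?n (f x)" if x: "x \<in> carrier M" for x
 proof -
  have "?F (?m x) = {dd N u +_N f (dd M w +_M x) | u w. u \<in> carrier N \<and> w \<in> carrier M}"
   by (auto simp: set_add_def set_mult_def a_r_coset_def r_coset_def coboundaries_def)
  also have "\<dots> = {dd N u +_N f x | u. u \<in> carrier N}"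
  proof (rule subset_antisym; rule subsetI; elim CollectE exE conjE; hypsubst; rule CollectI)
   fix u w assume u: "u \<in> carrier N" and w: "w \<in> carrier M"
   have "dd N u +_N f (dd M w +_M x) = dd N (u +_N f w) +_N f x"
    using u w x fc by (simp add: N.d_add N.a_assoc)
   then show "\<exists>v. dd N u +_N f (dd M w +_M x) = dd N v +_N f x \<and> v \<in> carrier N"
    using u w fc N.a_closed by blast
  next
   fix u assume u: "u \<in> carrier N"
   have "dd N u +_N f x = dd N u +_N f (dd M 0_M +_M x)" using x by simp
   then show "\<exists>v w. dd N u +_N f x = dd N v +_N f (dd M w +_M x) \<and> v \<in> carrier N \<and> w \<in> carrier M"
    using u M.zero_closed by blast
  qed
  also have "\<dots> = ?n (f x)"
   by (auto simp: a_r_coset_def r_coset_def coboundaries_def)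
  finally show ?thesis .
 qed
 have zM: "cohomology M = (\<lambda>x. ?m x) ` {x \<in> carrier M. dd M x = 0_M}"
  and zN: "cohomology N = (\<lambda>x. ?n x) ` {x \<in> carrier N. dd N x = 0_N}"
  by (simp_all add: cohomology_def cocycles_def)
 have inj: "inj_on ?F (cohomology M) \<longleftrightarrow> hinj M N f"
 proof
  assume i: "inj_on ?F (cohomology M)"
  show "hinj M N f" unfolding hinj_def
  proof (intro ballI impI)
   fix x z assume x: "x \<in> carrier M" and z: "z \<in> carrier N" and d: "dd M x = 0_M" "f x = dd N z"
   have "f 0_M = 0_N" by (rule chain_map_zero[OF assms f])
   then have "f x = dd N z +_N f 0_M" using d z by simp
   then have "?n (f x) = ?n (f 0_M)"
    using coset_eq_iff[OF assms(2)] fc x z by blast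
   then have "?F (?m x) = ?F (?m 0_M)" using F x by simp
   then have "?m x = ?m 0_M"
    by (rule inj_onD[OF i]) (use x d in "auto simp: zM")
   then obtain w where "w \<in> carrier M" "x = dd M w +_M 0_M"
    using coset_eq_iff[OF assms(1) x] by auto
   then show "\<exists>w\<in>carrier M. x = dd M w" by auto
  qed
 next
  assume h: "hinj M N f"
  show "inj_on ?F (cohomology M)"
  proof (rule inj_onI)
   fix C C' assume "C \<in> cohomology M" "C' \<in> cohomology M" and e: "?F C = ?F C'"
   then obtain x x' where x: "x \<in> carrier M" "x' \<in> carrier M" "dd M x = 0_M" "dd M x' = 0_M"
    "C = ?m x" "C' = ?m x'" by (auto simp: zM)
   then have "?n (f x) = ?n (f x')" using e F by simp
   then obtain z where z: "z \<in> carrier N" "f x = dd N z +_N f x'"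
    using coset_eq_iff[OF assms(2) fc(3)[OF x(1)] fc(3)[OF x(2)]] by blast
   have "f (x +_M -_M x') = (dd N z +_N f x') +_N -_N f x'"
    using x z fc chain_map_minus[OF assms f] by simp
   then have "f (x +_M -_M x') = dd N z"
    using x z fc by (simp add: N.a_assoc N.r_neg)
   moreover have "dd M (x +_M -_M x') = 0_M" using x by (simp add: M.d_add M.d_minus)
   ultimately obtain w where w: "w \<in> carrier M" "x +_M -_M x' = dd M w"
    using h[unfolded hinj_def, rule_format, of "x +_M -_M x'" z] x z by auto
   have "x = (x +_M -_M x') +_M x'" using x by (simp add: M.a_assoc M.l_neg)
   then have "x = dd M w +_M x'" using w by simp
   then show "C = C'" using coset_eq_iff[OF assms(1)] x w by blast
  qed
 qed
 have surj: "?F ` cohomology M = cohomology N \<longleftrightarrow> hsurj M N f"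
 proof -
  have im: "?F ` cohomology M = (\<lambda>x. ?n (f x)) ` {x \<in> carrier M. dd M x = 0_M}"
   unfolding zM image_image by (rule image_cong) (use F in auto)
  have sub: "?F ` cohomology M \<subseteq> cohomology N"
   unfolding im zN
  proof (intro image_subsetI)
   fix x assume "x \<in> {x \<in> carrier M. dd M x = 0_M}"
   then have x: "x \<in> carrier M" "dd M x = 0_M" by auto
   have "dd N (f x) = 0_N"
    using fc(2)[OF x(1)] x(2) chain_map_zero[OF assms f] by simp
   then show "?n (f x) \<in> (+>\<^bsub>N\<^esub>) (coboundaries N) ` {x \<in> carrier N. dd N x = 0_N}"
    using fc(3) x by blast
  qed
  have "hsurj M N f \<longleftrightarrow> cohomology N \<subseteq> ?F ` cohomology M"
  proof
   assume h: "hsurj M N f"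
   show "cohomology N \<subseteq> ?F ` cohomology M"
   proof
    fix C assume "C \<in> cohomology N"
    then obtain y where y: "y \<in> carrier N" "dd N y = 0_N" "C = ?n y" by (auto simp: zN)
    then obtain x z where x: "x \<in> carrier M" "dd M x = 0_M" "z \<in> carrier N" "y = f x +_N dd N z"
     using h unfolding hsurj_def by blast
    then have "y = dd N z +_N f x" using fc by (simp add: N.a_comm)
    then have "?n y = ?n (f x)"
     using coset_eq_iff[OF assms(2) y(1)] fc x by blast
    then show "C \<in> ?F ` cohomology M" unfolding im using x y by blast
   qed
  next
   assume h: "cohomology N \<subseteq> ?F ` cohomology M"
   show "hsurj M N f" unfolding hsurj_def
   proof (intro ballI impI)
    fix y assume y: "y \<in> carrier N" "dd N y = 0_N"
    then have "?n y \<in> cohomology N" by (auto simp: zN)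
    then have "?n y \<in> (\<lambda>x. ?n (f x)) ` {x \<in> carrier M. dd M x = 0_M}"
     using h im by blast
    then obtain x where x: "x \<in> carrier M" "dd M x = 0_M" "?n y = ?n (f x)"
     by auto
    then obtain z where z: "z \<in> carrier N" "y = dd N z +_N f x"
     using coset_eq_iff[OF assms(2) y(1)] fc by blast
    then have "y = f x +_N dd N z" using fc x by (simp add: N.a_comm)
    then show "\<exists>x\<in>carrier M. dd M x = 0_M \<and> (\<exists>z\<in>carrier N. y = f x +_N dd N z)"
     using x z by blast
   qed
  qed
  then show ?thesis using sub by blast
 qed
 show ?thesis using True inj surj by (simp add: quasi_iso_def bij_betw_def)
qed

lemma hinj_comp:
 assumes "chain_map M N f" "cx M" "cx N" "hinj M N f" "hinj N P g"
 shows "hinj M P (g o f)"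
 unfolding hinj_def
proof (intro ballI impI)
 fix x z assume x: "x \<in> carrier M" "z \<in> carrier P" "dd M x = 0_M" "(g o f) x = dd P z"
 have "dd N (f x) = 0_N" using x chain_mapD(2)[OF assms(1) x(1)] chain_map_zero[OF assms(2,3,1)] by simp
 then obtain w where "w \<in> carrier N" "f x = dd N w"
  using assms(5) x chain_mapD(3)[OF assms(1) x(1)] unfolding hinj_def by auto
 then show "\<exists>w\<in>carrier M. x = dd M w" using assms(4) x unfolding hinj_def by blast
qed

lemma hinj_cancel:
 assumes "chain_map N P g" "hinj M P (g o f)"
 shows "hinj M N f"
 unfolding hinj_def
proof (intro ballI impI)
 fix x z assume x: "x \<in> carrier M" "z \<in> carrier N" "dd M x = 0_M" "f x = dd N z"
 then have "(g o f) x = dd P (g z)" "g z \<in> carrier P" using chain_mapD[OF assms(1)] by simp_all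
 then show "\<exists>w\<in>carrier M. x = dd M w" using assms(2) x unfolding hinj_def by blast
qed

lemma hsurj_comp:
 assumes "chain_map M N f" "chain_map N P g" "cx N" "cx P" "hsurj M N f" "hsurj N P g"
 shows "hsurj M P (g o f)"
 unfolding hsurj_def
proof (intro ballI impI)
 interpret N: cx N by fact
 interpret P: cx P by fact
 fix y assume y: "y \<in> carrier P" "dd P y = 0_P"
 then obtain x z where x: "x \<in> carrier N" "dd N x = 0_N" "z \<in> carrier P" "y = g x +_P dd P z"
  using assms(6) unfolding hsurj_def by blast
 then obtain w v where w: "w \<in> carrier M" "dd M w = 0_M" "v \<in> carrier N" "x = f w +_N dd N v"
  using assms(5) unfolding hsurj_def by blast
 note f = chain_mapD[OF assms(1)] and g = chain_mapD[OF assms(2)]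
 have "y = (g o f) w +_P dd P (g v +_P z)"
  using x w f g by (simp add: P.d_add P.a_assoc)
 then show "\<exists>x\<in>carrier M. dd M x = 0_M \<and> (\<exists>z\<in>carrier P. y = (g o f) x +_P dd P z)"
  using w g x P.a_closed by blast
qed

lemma hsurj_cancel:
 assumes "chain_map M N f" "chain_map N P g" "cx M" "cx N" "hsurj M P (g o f)"
 shows "hsurj N P g"
 unfolding hsurj_def
proof (intro ballI impI)
 note f = chain_mapD[OF assms(1)]
 fix y assume y: "y \<in> carrier P" "dd P y = 0_P"
 then obtain x z where x: "x \<in> carrier M" "dd M x = 0_M" "z \<in> carrier P" "y = g (f x) +_P dd P z"
  using assms(5) unfolding hsurj_def by auto
 have "dd N (f x) = 0_N" using f(2)[OF x(1)] x(2) chain_map_zero[OF assms(3,4,1)] by simp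
 then show "\<exists>x\<in>carrier N. dd N x = 0_N \<and> (\<exists>z\<in>carrier P. y = g x +_P dd P z)"
  using x f(3)[OF x(1)] by blast
qed

lemma hinj_cancel_right:
 assumes "chain_map M N f" "chain_map N P g" "cx M" "cx N" "cx P" "hsurj M N f" "hinj M P (g o f)"
 shows "hinj N P g"
 unfolding hinj_def
proof (intro ballI impI)
 interpret N: cx N by fact
 interpret P: cx P by fact
 note f = chain_mapD[OF assms(1)] and g = chain_mapD[OF assms(2)]
 fix x z assume x: "x \<in> carrier N" "z \<in> carrier P" "dd N x = 0_N" "g x = dd P z"
 then obtain w v where w: "w \<in> carrier M" "dd M w = 0_M" "v \<in> carrier N" "x = f w +_N dd N v"
  using assms(6) unfolding hsurj_def by blast
 have "dd P z = g (f w) +_P dd P (g v)" using x w f g by simp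
 then have "g (f w) = dd P z +_P -_P dd P (g v)"
  using w f g by (simp add: P.a_assoc P.r_neg)
 also have "\<dots> = dd P (z +_P -_P g v)" using x w g by (simp add: P.d_add P.d_minus)
 finally have "(g o f) w = dd P (z +_P -_P g v)" by simp
 moreover have "z +_P -_P g v \<in> carrier P" using x w g by simp
 ultimately obtain u where u: "u \<in> carrier M" "w = dd M u"
  using assms(7) w unfolding hinj_def by blast
 have "x = dd N (f u +_N v)" using w u f by (simp add: N.d_add)
 then show "\<exists>w\<in>carrier N. x = dd N w" using u w f N.a_closed by blast
qed

lemma hsurj_cancel_left:
 assumes "chain_map M N f" "chain_map N P g" "cx M" "cx N" "cx P" "hinj N P g" "hsurj M P (g o f)"
 shows "hsurj M N f"
 unfolding hsurj_def
proof (intro ballI impI)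
 interpret N: cx N by fact
 interpret P: cx P by fact
 note f = chain_mapD[OF assms(1)] and g = chain_mapD[OF assms(2)]
 fix y assume y: "y \<in> carrier N" "dd N y = 0_N"
 have "dd P (g y) = 0_P" using g(2)[OF y(1)] y(2) chain_map_zero[OF assms(4,5,2)] by simp
 then obtain x z where x: "x \<in> carrier M" "dd M x = 0_M" "z \<in> carrier P" "g y = g (f x) +_P dd P z"
  using assms(7) y g unfolding hsurj_def by auto
 have "g (y +_N -_N f x) = dd P z +_P (g (f x) +_P -_P g (f x))"
  using x y f g chain_map_minus[OF assms(4,5,2)] by (simp add: P.a_ac)
 then have e: "g (y +_N -_N f x) = dd P z" using x f g by (simp add: P.r_neg)
 have "dd N (f x) = 0_N" using f(2)[OF x(1)] x(2) chain_map_zero[OF assms(3,4,1)] by simp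
 then have "dd N (y +_N -_N f x) = 0_N" using x y f by (simp add: N.d_add N.d_minus)
 moreover have "y +_N -_N f x \<in> carrier N" using x y f by simp
 ultimately obtain w where w: "w \<in> carrier N" "y +_N -_N f x = dd N w"
  using e x assms(6) unfolding hinj_def by blast
 have "y = f x +_N (y +_N -_N f x)" using x y f by (simp add: N.a_lcomm[of "f x" y] N.r_neg)
 then have "y = f x +_N dd N w" using w by simp
 then show "\<exists>x\<in>carrier M. dd M x = 0_M \<and> (\<exists>z\<in>carrier N. y = f x +_N dd N z)"
  using x w by blast
qed

section \<open>DG modules over an algebra with zero differential\<close>

locale dgmod = cx M for E :: "('k, 'g::dg_grading, 'e) dg" and M :: "('e, 'g, 'm) dg" (structure) +
 assumes dgm: "dg_module E M"
begin

lemma gg: "graded_group M" using dgm by (simp add: dg_module_def)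
lemma act_closed [simp]: "x \<in> carrier M ==> e \<in> carrier E ==> ract M x e \<in> carrier M"
 using dgm by (simp add: dg_module_def)
lemma act_add: "x \<in> carrier M ==> y \<in> carrier M ==> e \<in> carrier E ==>
  ract M (x \<oplus> y) e = ract M x e \<oplus> ract M y e"
 using dgm by (simp add: dg_module_def)
lemma act_add_right: "x \<in> carrier M ==> e \<in> carrier E ==> e' \<in> carrier E ==>
  ract M x (e +_E e') = ract M x e \<oplus> ract M x e'"
 using dgm by (simp add: dg_module_def)
lemma act_act: "x \<in> carrier M ==> e \<in> carrier E ==> e' \<in> carrier E ==>
  ract M (ract M x e) e' = ract M x (e *_E e')"
 using dgm by (simp add: dg_module_def)
lemma act_one [simp]: "x \<in> carrier M ==> ract M x 1_E = x"
 using dgm by (simp add: dg_module_def)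
lemma act_gr: "x \<in> gr M g ==> e \<in> gr E h ==> ract M x e \<in> gr M (g + h)"
 using dgm by (simp add: dg_module_def)
lemma d_gr: "x \<in> gr M g ==> dd M x \<in> gr M (g + ddeg)"
 using dgm by (simp add: dg_module_def)
lemma act_hom: "e \<in> carrier E ==> (\<lambda>x. ract M x e) \<in> ahom M M"
 by (rule ahomI) (simp_all add: act_add)
lemma act_zero [simp]: "e \<in> carrier E ==> ract M \<zero> e = \<zero>"
 using ahom_zero[OF ag ag act_hom] by simp
lemma act_minus: "e \<in> carrier E ==> x \<in> carrier M ==> ract M (\<ominus> x) e = \<ominus> ract M x e"
 using ahom_minus[OF ag ag act_hom] by simp
lemma gr_closed: "x \<in> gr M g ==> x \<in> carrier M" by (rule gr_carrier[OF gg])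

end

lemma dgmodI [intro]: "dg_module E M ==> dgmod E M"
 unfolding dgmod_def cx_def cx_axioms_def dgmod_axioms_def
 by (simp add: dg_module_def graded_group_def)

lemma dgm_cx: "dg_module E M ==> cx M"
 using dgmodI[of E M] by (simp add: dgmod_def)

lemma dgm_ag: "dg_module E M ==> abelian_group M"
 using dgm_cx cx.ag by blast

lemma dgm_gg: "dg_module E M ==> graded_group M"
 by (simp add: dg_module_def)

text \<open>
Both enveloping algebras have zero differential. The Leibniz rule then says that the differential of a
module commutes with the action, so a module is a complex with linear differential.
\<close>

locale zalg = ring E for E :: "('k, 'g::dg_grading, 'e) dg" (structure) +
 assumes gg: "graded_group E"
  and one_gr: "\<one> \<in> gr E 0"
  and mult_gr: "x \<in> gr E g ==> y \<in> gr E h ==> x \<otimes> y \<in> gr E (g + h)"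
  and d0: "x \<in> carrier E ==> dd E x = \<zero>"
begin

lemma dg_moduleI:
 assumes "graded_group M"
  and "\<And>x e. x \<in> carrier M ==> e \<in> carrier E ==> ract M x e \<in> carrier M"
  and "\<And>x y e. x \<in> carrier M ==> y \<in> carrier M ==> e \<in> carrier E ==>
    ract M (x +_M y) e = ract M x e +_M ract M y e"
  and ar: "\<And>x e e'. x \<in> carrier M ==> e \<in> carrier E ==> e' \<in> carrier E ==>
    ract M x (e +_E e') = ract M x e +_M ract M x e'"
  and "\<And>x e e'. x \<in> carrier M ==> e \<in> carrier E ==> e' \<in> carrier E ==>
    ract M (ract M x e) e' = ract M x (e *_E e')"
  and "\<And>x. x \<in> carrier M ==> ract M x 1_E = x"
  and "\<And>g h x e. x \<in> gr M g ==> e \<in> gr E h ==> ract M x e \<in> gr M (g + h)"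
  and "dd M \<in> ahom M M"
  and "\<And>g x. x \<in> gr M g ==> dd M x \<in> gr M (g + ddeg)"
  and "\<And>x. x \<in> carrier M ==> dd M (dd M x) = 0_M"
  and da: "\<And>x e. x \<in> carrier M ==> e \<in> carrier E ==> dd M (ract M x e) = ract M (dd M x) e"
 shows "dg_module E M"
proof -
 interpret M: abelian_group M using assms(1) by (rule graded_ag)
 have z: "ract M x \<zero> = 0_M" if "x \<in> carrier M" for x
 proof -
  have "(\<lambda>e. ract M x e) \<in> ahom E M" using assms(2) ar that by (intro ahomI) auto
  from ahom_zero[OF abgrp M.abgrp this] show ?thesis .
 qed
 have "dd M (ract M x e) = ract M (dd M x) e +_M koszul M (cdeg g) (ract M x (dd E e))"
  if "x \<in> gr M g" "e \<in> carrier E" for g x e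
 proof -
  have x: "x \<in> carrier M" by (rule gr_carrier[OF assms(1) that(1)])
  have "ract M (dd M x) e \<in> carrier M" using ahom_closed[OF assms(8) x] assms(2) that by simp
  then show ?thesis using da[OF x that(2)] z[OF x] d0[OF that(2)]
   by (simp add: M.abgrp)
 qed
 then show ?thesis using assms(1-10) by (simp add: dg_module_def)
qed

lemma act_ring_zero:
 assumes "dg_module E M" "x \<in> carrier M" shows "ract M x \<zero> = 0_M"
proof -
 interpret M: dgmod E M using assms by blast
 have "(\<lambda>e. ract M x e) \<in> ahom E M" using assms by (intro ahomI) (auto simp: M.act_add_right)
 from ahom_zero[OF abgrp M.ag this] show ?thesis .
qed

lemma act_d:
 assumes "dg_module E M" "x \<in> carrier M" "e \<in> carrier E"
 shows "dd M (ract M x e) = ract M (dd M x) e"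
proof -
 interpret M: dgmod E M using assms by blast
 have 1: "dd M (ract M x e) = ract M (dd M x) e" if "x \<in> gr M g" for x g
 proof -
  have x: "x \<in> carrier M" by (rule M.gr_closed[OF that])
  have "dd M (ract M x e) = ract M (dd M x) e +_M koszul M (cdeg g) (ract M x (dd E e))"
   using assms(1,3) that by (simp add: dg_module_def)
  then show ?thesis using x assms(3) by (simp add: d0 act_ring_zero[OF assms(1)] M.ag)
 qed
 have a: "(\<lambda>x. dd M (ract M x e)) \<in> ahom M M" "(\<lambda>x. ract M (dd M x) e) \<in> ahom M M"
  using assms(3) by (auto intro!: ahomI simp: M.act_add M.d_add)
 show ?thesis
  by (rule ahom_eqI[OF M.gg M.ag a 1 assms(2)])
qed

end

subsection \<open>Morphisms and homotopies\<close>

lemma hom_degI: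
 assumes "f \<in> ahom M N"
  and "\<And>x e. x \<in> carrier M ==> e \<in> carrier E ==> f (ract M x e) = ract N (f x) e"
  and "\<And>g x. x \<in> gr M g ==> f x \<in> gr N (g + s)"
 shows "f \<in> hom_deg E M N s"
 using assms by (simp add: hom_deg_def)

lemma hom_degD:
 assumes "f \<in> hom_deg E M N s"
 shows "f \<in> ahom M N" "x \<in> carrier M ==> f x \<in> carrier N"
  "x \<in> carrier M ==> y \<in> carrier M ==> f (x +_M y) = f x +_N f y"
  "x \<in> carrier M ==> e \<in> carrier E ==> f (ract M x e) = ract N (f x) e"
  "x \<in> gr M g ==> f x \<in> gr N (g + s)"
proof -
 show *: "f \<in> ahom M N" using assms by (simp add: hom_deg_def)
 show "x \<in> carrier M ==> f x \<in> carrier N" by (rule ahom_closed[OF *])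
 show "x \<in> carrier M ==> y \<in> carrier M ==> f (x +_M y) = f x +_N f y" by (rule ahom_add[OF *])
qed (use assms in "simp_all add: hom_deg_def")

lemma dg_homI:
 assumes "\<And>x. x \<in> carrier M ==> f x \<in> carrier N"
  and "\<And>x y. x \<in> carrier M ==> y \<in> carrier M ==> f (x +_M y) = f x +_N f y"
  and "\<And>x e. x \<in> carrier M ==> e \<in> carrier E ==> f (ract M x e) = ract N (f x) e"
  and "\<And>g x. x \<in> gr M g ==> f x \<in> gr N g"
  and "\<And>x. x \<in> carrier M ==> f (dd M x) = dd N (f x)"
 shows "f \<in> dg_hom E M N"
 using assms unfolding dg_hom_def by (auto intro!: hom_degI ahomI)

lemma dg_homD:
 assumes "f \<in> dg_hom E M N"
 shows "f \<in> ahom M N" "x \<in> carrier M ==> f x \<in> carrier N"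
  "x \<in> carrier M ==> y \<in> carrier M ==> f (x +_M y) = f x +_N f y"
  "x \<in> carrier M ==> e \<in> carrier E ==> f (ract M x e) = ract N (f x) e"
  "x \<in> gr M g ==> f x \<in> gr N g"
  "x \<in> carrier M ==> f (dd M x) = dd N (f x)"
  "chain_map M N f"
proof -
 have *: "f \<in> hom_deg E M N 0" "\<forall>x\<in>carrier M. f (dd M x) = dd N (f x)"
  using assms by (simp_all add: dg_hom_def)
 note h = hom_degD[OF *(1)]
 show "f \<in> ahom M N" by (rule h(1))
 show "x \<in> carrier M ==> f x \<in> carrier N" by (rule h(2))
 show "x \<in> carrier M ==> y \<in> carrier M ==> f (x +_M y) = f x +_N f y" by (rule h(3))
 show "x \<in> carrier M ==> e \<in> carrier E ==> f (ract M x e) = ract N (f x) e" by (rule h(4))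
 show "x \<in> gr M g ==> f x \<in> gr N g" using h(5)[of x g] by simp
 show "x \<in> carrier M ==> f (dd M x) = dd N (f x)" using * by simp
 show "chain_map M N f" using h * by (simp add: chain_map_def)
qed

lemma dg_hom_id: "id \<in> dg_hom E M M"
 by (rule dg_homI) simp_all

lemma dg_hom_comp:
 assumes "f \<in> dg_hom E M N" "g \<in> dg_hom E N P" shows "g o f \<in> dg_hom E M P"
 using dg_homD[OF assms(1)] dg_homD[OF assms(2)] by (intro dg_homI) simp_all

lemma dg_hom_zero_map:
 assumes "dg_module E M" "dg_module E N" shows "(\<lambda>_. 0_N) \<in> dg_hom E M N"
proof -
 interpret N: dgmod E N using assms by blast
 show ?thesis by (rule dg_homI) (simp_all add: N.gg)
qed

lemma dg_hom_zero:
 assumes "dg_module E M" "dg_module E N" "f \<in> dg_hom E M N" shows "f 0_M = 0_N"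
 by (rule ahom_zero[OF dgm_ag[OF assms(1)] dgm_ag[OF assms(2)] dg_homD(1)[OF assms(3)]])

lemma dg_hom_minus:
 assumes "dg_module E M" "dg_module E N" "f \<in> dg_hom E M N" "x \<in> carrier M"
 shows "f (-_M x) = -_N f x"
 by (rule ahom_minus[OF dgm_ag[OF assms(1)] dgm_ag[OF assms(2)] dg_homD(1)[OF assms(3)] assms(4)])

lemma hom_deg_zero:
 assumes "dg_module E M" "dg_module E N" "f \<in> hom_deg E M N s" shows "f 0_M = 0_N"
 by (rule ahom_zero[OF dgm_ag[OF assms(1)] dgm_ag[OF assms(2)] hom_degD(1)[OF assms(3)]])

lemma hom_deg_minus:
 assumes "dg_module E M" "dg_module E N" "f \<in> hom_deg E M N s" "x \<in> carrier M"
 shows "f (-_M x) = -_N f x"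
 by (rule ahom_minus[OF dgm_ag[OF assms(1)] dgm_ag[OF assms(2)] hom_degD(1)[OF assms(3)] assms(4)])

lemma hom_deg_add:
 assumes "dg_module E N" "f \<in> hom_deg E M N s" "f' \<in> hom_deg E M N s"
  and "dg_module E M"
 shows "(\<lambda>x. f x +_N f' x) \<in> hom_deg E M N s"
proof -
 interpret N: dgmod E N using assms by blast
 note f = hom_degD[OF assms(2)] and f' = hom_degD[OF assms(3)]
 show ?thesis using f f' N.gg
  by (intro hom_degI N.ahom_plus dgm_ag[OF assms(4)]) (simp_all add: N.act_add gr_add)
qed

lemma hom_deg_uminus:
 assumes "dg_module E N" "f \<in> hom_deg E M N s"
 shows "(\<lambda>x. -_N f x) \<in> hom_deg E M N s"
proof -
 interpret N: dgmod E N using assms by blast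
 note f = hom_degD[OF assms(2)]
 show ?thesis using f N.gg
  by (intro hom_degI N.ahom_uminus) (simp_all add: N.act_minus gr_minus)
qed

lemma hom_deg_comp:
 assumes "f \<in> hom_deg E M N s" "g \<in> hom_deg E N P t" shows "g o f \<in> hom_deg E M P (s + t)"
proof -
 note f = hom_degD[OF assms(1)] and g = hom_degD[OF assms(2)]
 have "f x \<in> gr N (a + s) ==> g (f x) \<in> gr P (a + (s + t))" for x a
  using g(5)[of "f x" "a + s"] by (simp add: add.assoc)
 then show ?thesis using f g by (intro hom_degI ahom_comp[OF f(1) g(1)]) simp_all
qed

lemma dg_hom_hom_deg: "f \<in> dg_hom E M N ==> f \<in> hom_deg E M N 0"
 by (simp add: dg_hom_def)

text \<open>Homotopies with the subtraction resolved.\<close>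

lemma homotopicI:
 assumes "dg_module E N" "h \<in> hom_deg E M N (- ddeg)"
  and "\<And>x. x \<in> carrier M ==> f x \<in> carrier N" "\<And>x. x \<in> carrier M ==> f' x \<in> carrier N"
  and "\<And>x. x \<in> carrier M ==> dd M x \<in> carrier M"
  and "\<And>x. x \<in> carrier M ==> f x = f' x +_N (dd N (h x) +_N h (dd M x))"
 shows "homotopic E M N f f'"
proof -
 interpret N: dgmod E N using assms by blast
 show ?thesis unfolding homotopic_def
  using assms hom_degD(2)[OF assms(2)] by (intro bexI[of _ h]) (simp_all add: N.minus_eq_iff)
qed

lemma homotopicE:
 assumes "homotopic E M N f f'" "dg_module E M" "dg_module E N"
  and "\<And>x. x \<in> carrier M ==> f x \<in> carrier N" "\<And>x. x \<in> carrier M ==> f' x \<in> carrier N"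
 obtains h where "h \<in> hom_deg E M N (- ddeg)"
  "\<And>x. x \<in> carrier M ==> f x = f' x +_N (dd N (h x) +_N h (dd M x))"
proof -
 interpret M: dgmod E M using assms by blast
 interpret N: dgmod E N using assms by blast
 obtain h where h: "h \<in> hom_deg E M N (- ddeg)"
  "\<forall>x\<in>carrier M. f x -_N f' x = dd N (h x) +_N h (dd M x)"
  using assms(1) unfolding homotopic_def by blast
 then have "f x = f' x +_N (dd N (h x) +_N h (dd M x))" if "x \<in> carrier M" for x
  using assms(4,5) hom_degD(2)[OF h(1)] that by (simp add: N.minus_eq_iff)
 then show ?thesis using h(1) that by blast
qed

lemma homotopic_refl:
 assumes "dg_module E M" "dg_module E N" "f \<in> dg_hom E M N"
  and "\<And>x. x \<in> carrier M ==> f' x = f x"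
 shows "homotopic E M N f f'"
proof -
 interpret M: dgmod E M using assms by blast
 interpret N: dgmod E N using assms by blast
 note f = dg_homD(2)[OF assms(3)]
 have h: "(\<lambda>_. 0_N) \<in> hom_deg E M N (- ddeg)"
  by (rule hom_degI) (auto intro!: ahomI simp: N.gg)
 have f': "f' x \<in> carrier N" "f x = f' x +_N (dd N 0_N +_N 0_N)" if "x \<in> carrier M" for x
  using f[OF that] assms(4)[OF that] by simp_all
 show ?thesis
  by (rule homotopicI[OF assms(2) h f f'(1) M.d_closed f'(2)])
qed

lemma homotopic_sym:
 assumes "homotopic E M N f f'" "dg_module E M" "dg_module E N" "f \<in> dg_hom E M N" "f' \<in> dg_hom E M N"
 shows "homotopic E M N f' f"
proof -
 interpret M: dgmod E M using assms by blast
 interpret N: dgmod E N using assms by blast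
 note f = dg_homD(2)[OF assms(4)] and f' = dg_homD(2)[OF assms(5)]
 obtain h where h: "h \<in> hom_deg E M N (- ddeg)"
  "\<And>x. x \<in> carrier M ==> f x = f' x +_N (dd N (h x) +_N h (dd M x))"
  by (rule homotopicE[OF assms(1-3) f f']) blast+
 show ?thesis
 proof (rule homotopicI[OF assms(3) hom_deg_uminus[OF assms(3) h(1)] f' f M.d_closed])
  fix x assume x: "x \<in> carrier M"
  let ?w = "dd N (h x) +_N h (dd M x)"
  have c: "?w \<in> carrier N" "f' x \<in> carrier N" using x f' hom_degD(2)[OF h(1)] by simp_all
  have "f x +_N (dd N (-_N h x) +_N -_N h (dd M x)) = (f' x +_N ?w) +_N -_N ?w"
   using x hom_degD(2)[OF h(1)] by (simp add: h(2) N.d_minus N.minus_add)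
  also have "\<dots> = f' x" using c by (simp add: N.a_assoc N.r_neg del: N.a_closed)
  finally show "f' x = f x +_N (dd N (-_N h x) +_N -_N h (dd M x))" by simp
 qed
qed

lemma homotopic_trans:
 assumes "homotopic E M N f f'" "homotopic E M N f' f''" "dg_module E M" "dg_module E N"
  "f \<in> dg_hom E M N" "f' \<in> dg_hom E M N" "f'' \<in> dg_hom E M N"
 shows "homotopic E M N f f''"
proof -
 interpret M: dgmod E M using assms by blast
 interpret N: dgmod E N using assms by blast
 note f = dg_homD(2)[OF assms(5)] and f' = dg_homD(2)[OF assms(6)] and f'' = dg_homD(2)[OF assms(7)]
 obtain h where h: "h \<in> hom_deg E M N (- ddeg)"
  "\<And>x. x \<in> carrier M ==> f x = f' x +_N (dd N (h x) +_N h (dd M x))"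
  by (rule homotopicE[OF assms(1,3,4) f f']) blast+
 obtain k where k: "k \<in> hom_deg E M N (- ddeg)"
  "\<And>x. x \<in> carrier M ==> f' x = f'' x +_N (dd N (k x) +_N k (dd M x))"
  by (rule homotopicE[OF assms(2,3,4) f' f'']) blast+
 note hk = hom_degD(2)[OF h(1)] hom_degD(2)[OF k(1)]
 show ?thesis
  by (rule homotopicI[OF assms(4) hom_deg_add[OF assms(4) h(1) k(1) assms(3)] f f'' M.d_closed])
   (simp_all add: h(2) k(2) hk f'' N.d_add N.a_ac)
qed

lemma homotopic_comp_left:
 assumes "homotopic E M N f f'" "dg_module E M" "dg_module E N" "dg_module E P"
  "f \<in> dg_hom E M N" "f' \<in> dg_hom E M N" "g \<in> dg_hom E N P"
 shows "homotopic E M P (g o f) (g o f')"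
proof -
 interpret M: dgmod E M using assms by blast
 note f = dg_homD(2)[OF assms(5)] and f' = dg_homD(2)[OF assms(6)] and g = dg_homD[OF assms(7)]
 interpret N: dgmod E N using assms by blast
 interpret P: dgmod E P using assms by blast
 obtain h where h: "h \<in> hom_deg E M N (- ddeg)"
  "\<And>x. x \<in> carrier M ==> f x = f' x +_N (dd N (h x) +_N h (dd M x))"
  by (rule homotopicE[OF assms(1,2,3) f f']) blast+
 have gh: "g o h \<in> hom_deg E M P (- ddeg)"
  using hom_deg_comp[OF h(1) dg_hom_hom_deg[OF assms(7)]] by simp
 show ?thesis
  by (rule homotopicI[OF assms(4) gh]) (simp_all add: f f' g h(2) hom_degD(2)[OF h(1)])
qed

lemma homotopic_comp_right:
 assumes "homotopic E N P g g'" "dg_module E M" "dg_module E N" "dg_module E P"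
  "g \<in> dg_hom E N P" "g' \<in> dg_hom E N P" "f \<in> dg_hom E M N"
 shows "homotopic E M P (g o f) (g' o f)"
proof -
 interpret M: dgmod E M using assms by blast
 note f = dg_homD[OF assms(7)] and g = dg_homD(2)[OF assms(5)] and g' = dg_homD(2)[OF assms(6)]
 interpret N: dgmod E N using assms by blast
 interpret P: dgmod E P using assms by blast
 obtain h where h: "h \<in> hom_deg E N P (- ddeg)"
  "\<And>x. x \<in> carrier N ==> g x = g' x +_P (dd P (h x) +_P h (dd N x))"
  by (rule homotopicE[OF assms(1,3,4) g g']) blast+
 have gh: "h o f \<in> hom_deg E M P (- ddeg)"
  using hom_deg_comp[OF dg_hom_hom_deg[OF assms(7)] h(1)] by simp
 show ?thesis
  by (rule homotopicI[OF assms(4) gh]) (simp_all add: f g g' h(2) hom_degD(2)[OF h(1)])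
qed

lemma homotopic_on_cocycle:
 assumes "homotopic E M N f f'" "dg_module E M" "dg_module E N" "f \<in> dg_hom E M N" "f' \<in> dg_hom E M N"
  "x \<in> carrier M" "dd M x = 0_M"
 shows "\<exists>z\<in>carrier N. f x = f' x +_N dd N z"
proof -
 interpret M: dgmod E M using assms by blast
 interpret N: dgmod E N using assms by blast
 note f = dg_homD(2)[OF assms(4)] and f' = dg_homD(2)[OF assms(5)]
 obtain h where h: "h \<in> hom_deg E M N (- ddeg)"
  "\<And>x. x \<in> carrier M ==> f x = f' x +_N (dd N (h x) +_N h (dd M x))"
  by (rule homotopicE[OF assms(1-3) f f']) blast+
 have "f x = f' x +_N dd N (h x)"
  using h(2)[OF assms(6)] assms(6,7) hom_deg_zero[OF assms(2,3) h(1)] hom_degD(2)[OF h(1)] by simp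
 then show ?thesis using hom_degD(2)[OF h(1)] assms(6) by blast
qed

lemma hinj_homotopic:
 assumes "homotopic E M N f f'" "dg_module E M" "dg_module E N" "f \<in> dg_hom E M N" "f' \<in> dg_hom E M N"
  "hinj M N f"
 shows "hinj M N f'"
 unfolding hinj_def
proof (intro ballI impI)
 interpret N: dgmod E N using assms by blast
 fix x z assume x: "x \<in> carrier M" "z \<in> carrier N" "dd M x = 0_M" "f' x = dd N z"
 obtain v where v: "v \<in> carrier N" "f x = f' x +_N dd N v"
  using homotopic_on_cocycle[OF assms(1-5) x(1,3)] by blast
 have "f x = dd N (z +_N v)" using v x by (simp add: N.d_add)
 then show "\<exists>w\<in>carrier M. x = dd M w" using assms(6) x v N.a_closed unfolding hinj_def by blast
qed

lemma hsurj_homotopic: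
 assumes "homotopic E M N f f'" "dg_module E M" "dg_module E N" "f \<in> dg_hom E M N" "f' \<in> dg_hom E M N"
  "hsurj M N f"
 shows "hsurj M N f'"
 unfolding hsurj_def
proof (intro ballI impI)
 interpret N: dgmod E N using assms by blast
 fix y assume y: "y \<in> carrier N" "dd N y = 0_N"
 then obtain x z where x: "x \<in> carrier M" "dd M x = 0_M" "z \<in> carrier N" "y = f x +_N dd N z"
  using assms(6) unfolding hsurj_def by blast
 obtain v where v: "v \<in> carrier N" "f x = f' x +_N dd N v"
  using homotopic_on_cocycle[OF assms(1-5) x(1,2)] by blast
 have "y = f' x +_N dd N (v +_N z)"
  using v x dg_homD(2)[OF assms(5) x(1)] by (simp add: N.d_add N.a_assoc)
 then show "\<exists>x\<in>carrier M. dd M x = 0_M \<and> (\<exists>z\<in>carrier N. y = f' x +_N dd N z)"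
  using x v N.a_closed by blast
qed

subsection \<open>Quasi-isomorphisms\<close>

lemma quasi_isoD:
 assumes "quasi_iso E M N f" "dg_module E M" "cx N"
 shows "f \<in> dg_hom E M N" "hinj M N f" "hsurj M N f"
 using assms quasi_iso_iff[OF dgm_cx[OF assms(2)] assms(3), of E f] by simp_all

lemma quasi_isoI:
 assumes "f \<in> dg_hom E M N" "hinj M N f" "hsurj M N f" "cx M" "cx N"
 shows "quasi_iso E M N f"
 using assms quasi_iso_iff[OF assms(4,5), of E f] by simp

lemma quasi_iso_comp:
 assumes "quasi_iso E M N f" "quasi_iso E N P g" "dg_module E M" "dg_module E N" "cx P"
 shows "quasi_iso E M P (g o f)"
proof -
 note f = quasi_isoD[OF assms(1,3) dgm_cx[OF assms(4)]] and g = quasi_isoD[OF assms(2,4,5)]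
 note c = dg_homD(7)[OF f(1)] dg_homD(7)[OF g(1)] dgm_cx[OF assms(3)] dgm_cx[OF assms(4)]
 show ?thesis
  by (rule quasi_isoI[OF dg_hom_comp[OF f(1) g(1)] hinj_comp[OF c(1,3,4) f(2) g(2)]
   hsurj_comp[OF c(1,2,4) assms(5) f(3) g(3)] c(3) assms(5)])
qed

lemma quasi_iso_homotopic:
 assumes "homotopic E M N f f'" "dg_module E M" "dg_module E N" "f' \<in> dg_hom E M N" "quasi_iso E M N f"
 shows "quasi_iso E M N f'"
proof -
 note f = quasi_isoD[OF assms(5,2) dgm_cx[OF assms(3)]]
 show ?thesis
  by (rule quasi_isoI[OF assms(4) hinj_homotopic[OF assms(1-3) f(1) assms(4) f(2)]
   hsurj_homotopic[OF assms(1-3) f(1) assms(4) f(3)] dgm_cx[OF assms(2)] dgm_cx[OF assms(3)]])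
qed

lemma quasi_iso_cancel_left:
 assumes "quasi_iso E M P (g o f)" "quasi_iso E N P g" "dg_module E M" "dg_module E N" "dg_module E P"
  "f \<in> dg_hom E M N"
 shows "quasi_iso E M N f"
proof -
 note c = dgm_cx[OF assms(3)] dgm_cx[OF assms(4)] dgm_cx[OF assms(5)]
 note g = quasi_isoD[OF assms(2,4) c(3)] and gf = quasi_isoD[OF assms(1,3) c(3)]
 note fc = dg_homD(7)[OF assms(6)] and gc = dg_homD(7)[OF g(1)]
 show ?thesis
  by (rule quasi_isoI[OF assms(6) hinj_cancel[OF gc gf(2)] hsurj_cancel_left[OF fc gc c g(2) gf(3)] c(1,2)])
qed

lemma quasi_iso_acyclic:
 assumes "cx M"
 shows "acyclic_dg M \<longleftrightarrow> (\<forall>x\<in>carrier M. dd M x = 0_M --> (\<exists>w\<in>carrier M. x = dd M w))"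
proof -
 interpret cx M by fact
 show ?thesis
  unfolding acyclic_dg_def cocycles_def coboundaries_def using d_d d_closed by auto
qed

definition dg_inv where
 "dg_inv E M N f g \<longleftrightarrow> f \<in> dg_hom E M N \<and> g \<in> dg_hom E N M \<and>
   (\<forall>x\<in>carrier M. g (f x) = x) \<and> (\<forall>y\<in>carrier N. f (g y) = y)"

definition dg_isom where "dg_isom E M N \<longleftrightarrow> (\<exists>f g. dg_inv E M N f g)"

lemma dg_invD:
 assumes "dg_inv E M N f g"
 shows "f \<in> dg_hom E M N" "g \<in> dg_hom E N M" "x \<in> carrier M ==> g (f x) = x" "y \<in> carrier N ==> f (g y) = y"
  "dg_inv E N M g f"
 using assms by (simp_all add: dg_inv_def)

lemma dg_inv_comp:
 assumes "dg_inv E M N f g" "dg_inv E N P f' g'"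
 shows "dg_inv E M P (f' o f) (g o g')"
 using assms dg_hom_comp[of f E M N f' P] dg_hom_comp[of g' E P N g M]
  dg_homD(2)[OF dg_invD(1)[OF assms(1)]] dg_homD(2)[OF dg_invD(2)[OF assms(2)]]
 by (simp add: dg_inv_def)

lemma dg_isom_sym: "dg_isom E M N ==> dg_isom E N M"
 unfolding dg_isom_def using dg_invD(5) by blast

lemma dg_isom_trans: "dg_isom E M N ==> dg_isom E N P ==> dg_isom E M P"
 unfolding dg_isom_def using dg_inv_comp by blast

lemma dg_isom_refl: "dg_isom E M M"
 unfolding dg_isom_def dg_inv_def using dg_hom_id by fastforce

lemma dg_inv_quasi_iso:
 assumes "dg_inv E M N f g" "cx M" "cx N"
 shows "quasi_iso E M N f"
proof -
 note i = dg_invD[OF assms(1)]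
 note f = dg_homD[OF i(1)] and g = dg_homD[OF i(2)]
 interpret M: cx M by fact
 interpret N: cx N by fact
 show ?thesis
 proof (rule quasi_isoI[OF i(1) _ _ assms(2,3)])
  show "hinj M N f" unfolding hinj_def
  proof (intro ballI impI)
   fix x z assume x: "x \<in> carrier M" "z \<in> carrier N" "f x = dd N z"
   have "x = dd M (g z)" using x i g by metis
   then show "\<exists>w\<in>carrier M. x = dd M w" using g x by blast
  qed
  show "hsurj M N f" unfolding hsurj_def
  proof (intro ballI impI)
   fix y assume y: "y \<in> carrier N" "dd N y = 0_N"
   have "dd M (g y) = 0_M" using y g(6)[OF y(1)] chain_map_zero[OF assms(3,2) g(7)] by simp
   moreover have "y = f (g y) +_N dd N 0_N" using y i by simp
   ultimately show "\<exists>x\<in>carrier M. dd M x = 0_M \<and> (\<exists>z\<in>carrier N. y = f x +_N dd N z)"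
    using g y by blast
  qed
 qed
qed

section \<open>Shifts, sums, cones and transport of structure\<close>

lemma shift_simps [simp]:
 "carrier (shift s M) = carrier M" "add (shift s M) = add M" "zero (shift s M) = zero M"
 "smult (shift s M) = smult M" "gr (shift s M) g = gr M (g + s)"
 "dd (shift s M) x = koszul M (cdeg s) (dd M x)"
 by (simp_all add: shift_def)

lemma shift_a_inv [simp]: "a_inv (shift s M) = a_inv M"
 by (simp add: a_inv_def fun_eq_iff m_inv_def)

lemma shift_koszul [simp]: "koszul (shift s M) = koszul M"
 by (simp add: koszul_def fun_eq_iff)

lemma cdeg_minus: "cdeg (- s) = - cdeg (s :: 'g :: dg_grading)"
 and cdeg_zero [simp]: "cdeg (0 :: 'g :: dg_grading) = 0"
 and cdeg_diff: "cdeg (s - t) = cdeg s - cdeg (t :: 'g :: dg_grading)"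
proof -
 show z: "cdeg (0 :: 'g) = 0" using cdeg_add[of "0::'g" 0] by simp
 show m: "cdeg (- s) = - cdeg (s :: 'g)" for s using cdeg_add[of s "- s"] z by simp
 show "cdeg (s - t) = cdeg s - cdeg (t :: 'g)" using cdeg_add[of s "- t"] m by simp
qed

lemma abelian_group_add_cong:
 assumes "abelian_group M" "carrier N = carrier M" "zero N = zero M"
  "\<And>x y. x \<in> carrier M ==> y \<in> carrier M ==> add N x y = add M x y"
 shows "abelian_group N"
proof -
 interpret abelian_group M by fact
 show ?thesis
 proof (rule abelian_groupI)
  fix x assume "x \<in> carrier N"
  then show "\<exists>y\<in>carrier N. y +_N x = 0_N"
   by (intro bexI[of _ "-_M x"]) (simp_all add: assms(2-4) l_neg)
 qed (simp_all add: assms(2-4) a_ac)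
qed

lemma a_inv_cong:
 assumes "abelian_group M" "carrier N = carrier M" "zero N = zero M"
  "\<And>x y. x \<in> carrier M ==> y \<in> carrier M ==> add N x y = add M x y" "x \<in> carrier M"
 shows "-_N x = -_M x"
proof -
 interpret M: abelian_group M by fact
 interpret N: abelian_group N by (rule abelian_group_add_cong[OF assms(1-4)])
 show ?thesis by (rule N.minus_equality) (use assms in "simp_all add: M.l_neg")
qed

lemma graded_group_cong:
 assumes "graded_group M" "carrier N = carrier M" "zero N = zero M"
  "\<And>x y. x \<in> carrier M ==> y \<in> carrier M ==> add N x y = add M x y" "\<And>g. gr N g = gr M g"
 shows "graded_group N"
proof -
 note ag = graded_ag[OF assms(1)]
 interpret M: abelian_group M by (rule ag)
 note grc = gr_carrier[OF assms(1)]
 have sp: "x \<in> hspan N" if "x \<in> carrier M" for x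
  using assms(1) that
 proof (induction rule: graded_induct)
  case zero
  show ?case using hspan_zero[of N] assms(3) by simp
 next
  case (add x g y)
  have "x \<in> gr N g" using add assms(5) by simp
  from hspan_add[OF this add(3)] show ?case using grc[OF add(1)] add(2) assms(4) by simp
 qed
 show ?thesis
 proof (rule graded_groupI[where N = M])
  fix g
  show "\<exists>pr\<in>ahom N M. (\<forall>x\<in>gr N g. pr x = 0_M --> x = 0_N) \<and>
     (\<forall>h. \<forall>x\<in>gr N h. h \<noteq> g --> pr x = 0_M)"
   by (intro bexI[of _ "\<lambda>x. hcomp M x g"] ahomI)
    (auto simp: hcomp_hom[OF assms(1)] assms hcomp_add hcomp_closed)
 next
  fix g x assume "x \<in> gr N g"
  then show "-_N x \<in> gr N g"
   using a_inv_cong[OF ag assms(2-4)] grc by (simp add: assms(5) gr_minus assms(1))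
 next
  fix g x y assume "x \<in> gr N g" "y \<in> gr N g"
  then show "x +_N y \<in> gr N g" using grc[of _ g] by (simp add: assms(4,5) gr_add assms(1))
 qed (use grc sp in "simp_all add: assms(1-3,5) abelian_group_add_cong[OF ag assms(2-4)] ag")
qed

lemma shift_abelian: "abelian_group M ==> abelian_group (shift s M)"
 by (rule abelian_group_add_cong) simp_all

lemma shift_cx:
 assumes "cx M" shows "cx (shift s M)"
proof -
 interpret cx M by fact
 interpret S: abelian_group "shift s M" by (rule shift_abelian[OF ag])
 show ?thesis
  by unfold_locales
   (auto intro!: ahomI simp: ag koszul_add d_add ahom_koszul[OF ag ag d_hom] koszul_koszul d_d)
qed

lemma shift_graded:
 fixes M :: "('s, 'g::dg_grading, 'm) dg"
 assumes "graded_group M" shows "graded_group (shift s M)"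
proof -
 interpret abelian_group M using assms by (rule graded_ag)
 have sp: "x \<in> hspan (shift s M)" if "x \<in> carrier M" for x
  using assms that
 proof (induction rule: graded_induct)
  case zero
  show ?case using hspan_zero[of "shift s M"] by simp
 next
  case (add x g y)
  have "x \<in> gr (shift s M) (g - s)" using add by simp
  from hspan_add[OF this add(3)] show ?case by simp
 qed
 show ?thesis
 proof (rule graded_groupI[where N = M])
  fix g
  show "\<exists>pr\<in>ahom (shift s M) M. (\<forall>x\<in>gr (shift s M) g. pr x = 0_M --> x = 0_(shift s M)) \<and>
     (\<forall>h. \<forall>x\<in>gr (shift s M) h. h \<noteq> g --> pr x = 0_M)"
   using hcomp_ahom[OF assms, of "g + s"]
   by (intro bexI[of _ "\<lambda>x. hcomp M x (g + s)"]) (auto simp: hcomp_hom[OF assms] hom_def)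
 qed (use assms sp gr_carrier[OF assms] in "simp_all add: gr_add gr_minus shift_abelian abgrp")
qed

lemma dsum_simps [simp]:
 "carrier (dsum M N) = carrier M \<times> carrier N"
 "add (dsum M N) (x, y) (x', y') = (x +_M x', y +_N y')"
 "zero (dsum M N) = (0_M, 0_N)"
 "ract (dsum M N) (x, y) e = (ract M x e, ract N y e)"
 "gr (dsum M N) g = gr M g \<times> gr N g"
 "dd (dsum M N) (x, y) = (dd M x, dd N y)"
 by (simp_all add: dsum_def mk_dg_def)

lemma cone_simps [simp]:
 "carrier (cone M N f) = carrier N \<times> carrier M"
 "add (cone M N f) (y, x) (y', x') = (y +_N y', x +_M x')"
 "zero (cone M N f) = (0_N, 0_M)"
 "ract (cone M N f) (y, x) e = (ract N y e, ract M x e)"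
 "gr (cone M N f) g = gr N g \<times> gr M (g + ddeg)"
 "dd (cone M N f) (y, x) = (dd N y +_N f x, -_M dd M x)"
 by (simp_all add: cone_def dsum_def mk_dg_def)

lemma cone_proj:
 "fst (add (cone M N f) u v) = fst u +_N fst v" "snd (add (cone M N f) u v) = snd u +_M snd v"
 "fst (ract (cone M N f) u e) = ract N (fst u) e" "snd (ract (cone M N f) u e) = ract M (snd u) e"
 by (cases u; cases v; simp)+

lemma dsum_proj:
 "fst (add (dsum M N) u v) = fst u +_M fst v" "snd (add (dsum M N) u v) = snd u +_N snd v"
 "fst (ract (dsum M N) u e) = ract M (fst u) e" "snd (ract (dsum M N) u e) = ract N (snd u) e"
 "fst (dd (dsum M N) u) = dd M (fst u)" "snd (dd (dsum M N) u) = dd N (snd u)"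
 by (cases u; cases v; simp)+

lemma dsum_abelian:
 assumes "abelian_group M" "abelian_group N" shows "abelian_group (dsum M N)"
proof -
 interpret M: abelian_group M by fact
 interpret N: abelian_group N by fact
 show ?thesis
 proof (rule abelian_groupI)
  fix x assume "x \<in> carrier (dsum M N)"
  then show "\<exists>y\<in>carrier (dsum M N). y +_(dsum M N) x = 0_(dsum M N)"
   by (cases x) (auto intro!: bexI[of _ "(-_M fst x, -_N snd x)"] simp: M.l_neg N.l_neg)
 qed (auto simp: M.a_ac N.a_ac)
qed

lemma dsum_a_inv:
 assumes "abelian_group M" "abelian_group N" "x \<in> carrier M" "y \<in> carrier N"
 shows "-_(dsum M N) (x, y) = (-_M x, -_N y)"
proof -
 interpret M: abelian_group M by fact
 interpret N: abelian_group N by fact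
 interpret D: abelian_group "dsum M N" using assms by (simp add: dsum_abelian)
 show ?thesis
  by (rule D.minus_equality) (use assms in "simp_all add: M.l_neg N.l_neg")
qed

lemma dsum_graded:
 assumes "graded_group M" "graded_group N" shows "graded_group (dsum M N)"
proof -
 interpret M: abelian_group M using assms(1) by (rule graded_ag)
 interpret N: abelian_group N using assms(2) by (rule graded_ag)
 note D = dsum_abelian[OF M.abgrp N.abgrp]
 note mg = gr_carrier[OF assms(1)] and ng = gr_carrier[OF assms(2)]
 have 1: "(x, 0_N) \<in> hspan (dsum M N)" if "x \<in> carrier M" for x
  using assms(1) that
 proof (induction rule: graded_induct)
  case zero
  show ?case using hspan_zero[of "dsum M N"] by simp
 next
  case (add x g y)
  have "(x, 0_N) \<in> gr (dsum M N) g" using add assms by simp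
  from hspan_add[OF this add(3)] show ?case by simp
 qed
 have 2: "(0_M, y) \<in> hspan (dsum M N)" if "y \<in> carrier N" for y
  using assms(2) that
 proof (induction rule: graded_induct)
  case zero
  show ?case using hspan_zero[of "dsum M N"] by simp
 next
  case (add x g y)
  have "(0_M, x) \<in> gr (dsum M N) g" using add assms by simp
  from hspan_add[OF this add(3)] show ?case by simp
 qed
 have gc: "x \<in> gr (dsum M N) g ==> x \<in> carrier (dsum M N)" for x g
  using mg[of _ g] ng[of _ g] by auto
 show ?thesis
 proof (rule graded_groupI[where N = "dsum M N"])
  fix g
  show "\<exists>pr\<in>ahom (dsum M N) (dsum M N). (\<forall>x\<in>gr (dsum M N) g. pr x = 0_(dsum M N) --> x = 0_(dsum M N)) \<and>
     (\<forall>h. \<forall>x\<in>gr (dsum M N) h. h \<noteq> g --> pr x = 0_(dsum M N))"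
   by (intro bexI[of _ "\<lambda>(x, y). (hcomp M x g, hcomp N y g)"] ahomI)
    (auto simp: hcomp_hom[OF assms(1)] hcomp_hom[OF assms(2)]
     hcomp_add assms hcomp_closed)
 next
  fix x assume "x \<in> carrier (dsum M N)"
  then have x: "fst x \<in> carrier M" "snd x \<in> carrier N" by auto
  have "(fst x, 0_N) +_(dsum M N) (0_M, snd x) \<in> hspan (dsum M N)"
   by (rule hspan_sum[OF D gc 1[OF x(1)] 2[OF x(2)]])
  then show "x \<in> hspan (dsum M N)" using x by simp
 next
  fix g x assume "x \<in> gr (dsum M N) g"
  then show "-_(dsum M N) x \<in> gr (dsum M N) g"
   using mg[of _ g] ng[of _ g] dsum_a_inv[OF M.abgrp N.abgrp]
   by (auto simp: gr_minus assms)
 qed (use D gc in "auto simp: gr_add assms")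
qed

lemma graded_group_dd_cong:
 fixes M :: "('s, 'g, 'm) dg" and D :: "'m => 'm"
 assumes "graded_group M" shows "graded_group (M\<lparr>dd := D\<rparr>)"
proof -
 let ?N = "M\<lparr>dd := D\<rparr>"
 have [simp]: "finsum ?N = finsum M"
  by (simp add: finsum_def finprod_def fun_eq_iff)
 have "is_decomp ?N = is_decomp M" by (simp add: is_decomp_def fun_eq_iff)
 moreover have "abelian_group ?N"
  by (rule abelian_group_add_cong[OF graded_ag[OF assms]]) simp_all
 ultimately show ?thesis using assms
  by (simp add: graded_group_def additive_subgroup_def)
qed

lemma cone_graded:
 assumes "graded_group M" "graded_group N" shows "graded_group (cone M N f)"
 unfolding cone_def by (rule graded_group_dd_cong, rule dsum_graded, fact, rule shift_graded, fact)

lemma cone_a_inv: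
 assumes "abelian_group M" "abelian_group N" "x \<in> carrier M" "y \<in> carrier N"
 shows "-_(cone M N f) (y, x) = (-_N y, -_M x)"
proof -
 interpret M: abelian_group M by fact
 interpret N: abelian_group N by fact
 interpret D: abelian_group "cone M N f"
  by (rule abelian_group_add_cong[OF dsum_abelian[OF assms(2,1)]]) auto
 show ?thesis
  by (rule D.minus_equality) (use assms in "simp_all add: M.l_neg N.l_neg")
qed

context zalg
begin

lemma shift_dgm:
 assumes "dg_module E M" shows "dg_module E (shift s M)"
proof -
 interpret M: dgmod E M using assms by blast
 interpret S: cx "shift s M" by (rule shift_cx[OF M.cx_axioms])
 show ?thesis
 proof (rule dg_moduleI[OF shift_graded[OF M.gg]])
  fix g h x e assume x: "x \<in> gr (shift s M) g" "e \<in> gr E h"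
  have "ract M x e \<in> gr M ((g + s) + h)" by (rule M.act_gr) (use x in simp_all)
  then show "ract (shift s M) x e \<in> gr (shift s M) (g + h)" by (simp add: ac_simps)
 next
  fix g x assume x: "x \<in> gr (shift s M) g"
  have "dd M x \<in> gr M ((g + s) + ddeg)" by (rule M.d_gr) (use x in simp)
  then show "dd (shift s M) x \<in> gr (shift s M) (g + ddeg)"
   by (simp add: ac_simps gr_koszul[OF M.gg])
 next
  fix x e assume "x \<in> carrier (shift s M)" and e: "e \<in> carrier E"
  then have x: "x \<in> carrier M" by simp
  show "dd (shift s M) (ract (shift s M) x e) = ract (shift s M) (dd (shift s M) x) e"
   using x e ahom_koszul[OF M.ag M.ag M.act_hom[OF e], of "dd M x"] by (simp add: act_d[OF assms])
 qed (use S.d_hom S.d_d in "simp_all add: M.act_add M.act_add_right M.act_act")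
qed

lemma dsum_dgm:
 assumes "dg_module E M" "dg_module E N" shows "dg_module E (dsum M N)"
proof -
 interpret M: dgmod E M using assms by blast
 interpret N: dgmod E N using assms by blast
 have d: "dd (dsum M N) \<in> ahom (dsum M N) (dsum M N)"
  by (rule ahomI) (auto simp: M.d_add N.d_add)
 show ?thesis
  by (rule dg_moduleI[OF dsum_graded[OF M.gg N.gg] _ _ _ _ _ _ d])
   (auto simp: M.act_add M.act_add_right M.act_act N.act_add N.act_add_right N.act_act
    M.act_gr N.act_gr M.d_gr N.d_gr M.d_d N.d_d act_d[OF assms(1)] act_d[OF assms(2)])
qed

lemma cone_dgm:
 assumes "dg_module E M" "dg_module E N" "f \<in> dg_hom E M N" shows "dg_module E (cone M N f)"
proof -
 interpret M: dgmod E M using assms by blast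
 interpret N: dgmod E N using assms by blast
 note f = dg_homD[OF assms(3)]
 show ?thesis
 proof (rule dg_moduleI[OF cone_graded[OF M.gg N.gg]])
  fix g h x e assume x: "x \<in> gr (cone M N f) g" and e: "e \<in> gr E h"
  obtain y z where yz: "x = (y, z)" by (cases x)
  have "ract M z e \<in> gr M ((g + ddeg) + h)" by (rule M.act_gr) (use x e yz in simp_all)
  then show "ract (cone M N f) x e \<in> gr (cone M N f) (g + h)"
   using x e yz by (simp add: ac_simps N.act_gr)
 next
  fix g x assume x: "x \<in> gr (cone M N f) g"
  then show "dd (cone M N f) x \<in> gr (cone M N f) (g + ddeg)"
   by (auto simp: gr_add gr_minus N.gg M.gg N.d_gr M.d_gr f(5))
 next
  fix x e assume "x \<in> carrier (cone M N f)" and e: "e \<in> carrier E"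
  then show "dd (cone M N f) (ract (cone M N f) x e) = ract (cone M N f) (dd (cone M N f) x) e"
   by (auto simp: act_d[OF assms(1)] act_d[OF assms(2)] N.act_add M.act_minus f)
 next
  show "dd (cone M N f) \<in> ahom (cone M N f) (cone M N f)"
   by (rule ahomI) (auto simp: f M.d_add N.d_add M.minus_add N.a_ac)
 next
  fix x assume "x \<in> carrier (cone M N f)"
  then show "dd (cone M N f) (dd (cone M N f) x) = 0_(cone M N f)"
   by (auto simp: f M.d_d N.d_d N.d_add M.d_minus dg_hom_minus[OF assms] N.r_neg
    dg_hom_zero[OF assms])
 qed (auto simp: M.act_add M.act_add_right M.act_act N.act_add N.act_add_right N.act_act)
qed

lemma transport_dgm:
 assumes "dg_module E M" and bij: "bij_betw f (carrier M) (carrier N)"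
  and add: "\<And>x y. x \<in> carrier M ==> y \<in> carrier M ==> f (x +_M y) = f x +_N f y"
  and f0: "f 0_M = 0_N"
  and gr: "\<And>g. gr N g = f ` gr M g"
  and act: "\<And>x e. x \<in> carrier M ==> e \<in> carrier E ==> f (ract M x e) = ract N (f x) e"
  and d: "\<And>x. x \<in> carrier M ==> f (dd M x) = dd N (f x)"
 shows "dg_module E N" "dg_inv E M N f (inv_into (carrier M) f)"
proof -
 interpret M: dgmod E M using assms(1) by blast
 let ?g = "inv_into (carrier M) f"
 have im: "carrier N = f ` carrier M" using bij by (simp add: bij_betw_def)
 have gf: "?g (f x) = x" if "x \<in> carrier M" for x
  using bij that by (simp add: bij_betw_def)
 have fc: "f x \<in> carrier N" if "x \<in> carrier M" for x using that im by blast
 have add': "f x +_N f y = f (x +_M y)" if "x \<in> carrier M" "y \<in> carrier M" for x y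
  using add that by simp
 have act': "ract N (f x) e = f (ract M x e)" if "x \<in> carrier M" "e \<in> carrier E" for x e
  using act that by simp
 have d': "dd N (f x) = f (dd M x)" if "x \<in> carrier M" for x using d that by simp
 interpret N: abelian_group N
 proof (rule abelian_groupI)
  fix x assume "x \<in> carrier N"
  then obtain u where u: "u \<in> carrier M" "x = f u" using im by auto
  have "f (-_M u) +_N x = 0_N" using u by (simp add: add' M.l_neg f0)
  then show "\<exists>y\<in>carrier N. y +_N x = 0_N" using fc u M.a_inv_closed by blast
 qed (auto simp: im add' M.a_ac f0[symmetric])
 have fh: "f \<in> ahom M N" by (rule ahomI) (simp_all add: fc add)
 have gh: "?g \<in> ahom N M" by (rule ahomI) (auto simp: im gf add')
 have grc: "x \<in> carrier N" if "x \<in> gr N g" for x g using that gr fc M.gr_closed by auto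
 have gN: "graded_group N"
 proof (rule graded_groupI[where N = M])
  fix g x assume "x \<in> gr N g"
  then obtain u where u: "u \<in> gr M g" "x = f u" using gr by auto
  then show "-_N x \<in> gr N g"
   using ahom_minus[OF M.ag N.abgrp fh M.gr_closed[OF u(1)]] gr_minus[OF M.gg u(1)] gr
   by (metis imageI)
 next
  fix g x y assume "x \<in> gr N g" "y \<in> gr N g"
  then show "x +_N y \<in> gr N g"
   using M.gr_closed gr_add[OF M.gg] by (auto simp: gr add')
 next
  fix x assume "x \<in> carrier N"
  then obtain u where u: "u \<in> carrier M" "x = f u" using im by auto
  have "f u \<in> hspan N" using M.gg u(1)
  proof (induction rule: graded_induct)
   case zero
   then show ?case by (simp add: f0 hspan_zero)
  next
   case (add x g y)
   have "f x \<in> gr N g" using add gr by blast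
   from hspan_add[OF this add(3)] show ?case using add M.gr_closed by (simp add: add')
  qed
  then show "x \<in> hspan N" using u by simp
 next
  fix g
  show "\<exists>pr\<in>ahom N M. (\<forall>x\<in>gr N g. pr x = 0_M --> x = 0_N) \<and>
     (\<forall>h. \<forall>x\<in>gr N h. h \<noteq> g --> pr x = 0_M)"
  proof (rule bexI[of _ "(\<lambda>x. hcomp M x g) o ?g"], intro conjI allI ballI impI)
   fix x assume "x \<in> gr N g" "((\<lambda>x. hcomp M x g) o ?g) x = 0_M"
   then show "x = 0_N" using M.gr_closed gf f0 by (auto simp: gr hcomp_hom[OF M.gg])
  next
   fix h x assume "x \<in> gr N h" "h \<noteq> g"
   then show "((\<lambda>x. hcomp M x g) o ?g) x = 0_M"
    using M.gr_closed gf by (auto simp: gr hcomp_hom[OF M.gg])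
  qed (rule ahom_comp[OF gh hcomp_ahom[OF M.gg]])
 qed (use N.abgrp M.ag grc gr f0 M.gg in \<open>auto simp: image_iff intro!: bexI[of _ "0_M"]\<close>)
 show "dg_module E N"
 proof (rule dg_moduleI[OF gN])
  show "dd N \<in> ahom N N" by (rule ahomI) (auto simp: im add' d' M.d_add)
 next
  fix g h x e assume "x \<in> gr N g" and e: "e \<in> gr E h"
  then obtain u where u: "u \<in> gr M g" "x = f u" using gr by auto
  then show "ract N x e \<in> gr N (g + h)"
   using act'[OF M.gr_closed[OF u(1)] gr_carrier[OF gg e]] M.act_gr[OF u(1) e] gr by auto
 next
  fix g x assume "x \<in> gr N g"
  then obtain u where u: "u \<in> gr M g" "x = f u" using gr by auto
  then show "dd N x \<in> gr N (g + ddeg)" using d'[OF M.gr_closed[OF u(1)]] M.d_gr[OF u(1)] gr by auto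
 qed (auto simp: im add' act' d' M.act_add M.act_add_right M.act_act M.d_d f0 act_d[OF assms(1)])
 show "dg_inv E M N f ?g"
  unfolding dg_inv_def
 proof (intro conjI ballI)
  show "f \<in> dg_hom E M N" by (rule dg_homI) (simp_all add: fc add act d gr)
  show "?g \<in> dg_hom E N M"
  proof (rule dg_homI)
   fix g x assume "x \<in> gr N g"
   then show "?g x \<in> gr M g" using gr gf M.gr_closed by auto
  qed (auto simp: im gf add' act' d')
 qed (auto simp: im gf)
qed

definition push :: "('m => 'n) => ('e, 'g, 'm) dg => ('e, 'g, 'n) dg" where
 "push \<iota> M = (let j = inv_into (carrier M) \<iota> in
   mk_dg (\<iota> ` carrier M) (\<lambda>x y. \<iota> (j x +_M j y)) (\<iota> 0_M) (\<lambda>e x. \<iota> (ract M (j x) e))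
    (\<lambda>g. \<iota> ` gr M g) (\<lambda>x. \<iota> (dd M (j x))))"

lemma push_dgm:
 assumes "dg_module E M" "inj_on \<iota> (carrier M)"
 shows "dg_module E (push \<iota> M)" "dg_inv E M (push \<iota> M) \<iota> (inv_into (carrier M) \<iota>)"
proof -
 interpret M: dgmod E M using assms(1) by blast
 have j: "inv_into (carrier M) \<iota> (\<iota> x) = x" if "x \<in> carrier M" for x using assms(2) that by simp
 note * = transport_dgm[OF assms(1), of \<iota> "push \<iota> M"]
 have b: "bij_betw \<iota> (carrier M) (carrier (push \<iota> M))"
  using assms(2) by (simp add: push_def Let_def mk_dg_def bij_betw_def)
 show "dg_module E (push \<iota> M)" "dg_inv E M (push \<iota> M) \<iota> (inv_into (carrier M) \<iota>)"
  by (rule *[OF b]; simp add: push_def Let_def mk_dg_def j)+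
qed

end

lemma dg_inv_id:
 assumes "graded_group M" "carrier N = carrier M"
  "\<And>x y. x \<in> carrier M ==> y \<in> carrier M ==> x +_N y = x +_M y"
  "\<And>g. gr N g = gr M g"
  "\<And>x e. x \<in> carrier M ==> e \<in> carrier E ==> ract N x e = ract M x e"
  "\<And>x. x \<in> carrier M ==> dd N x = dd M x"
 shows "dg_inv E M N id id"
 unfolding dg_inv_def using assms by (auto intro!: dg_homI)

text \<open>
The size condition under which a module has an isomorphic copy in the universe \<open>'u\<close> over which the derived
category is defined; the copy is made by \<open>push\<close>.
\<close>

definition emb :: "'u itself => ('s, 'g, 'm) dg => bool" where
 "emb U M \<longleftrightarrow> (\<exists>\<iota> :: 'm => 'u. inj_on \<iota> (carrier M))"

lemma emb_self [simp]: "emb TYPE('u) (M :: ('s, 'g, 'u) dg)"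
 unfolding emb_def using inj_on_id by blast

lemma emb_shift [simp]: "emb U (shift s M) \<longleftrightarrow> emb U M"
 by (simp add: emb_def)

lemma emb_prod:
 fixes P :: "('s, 'g, 'm \<times> 'n) dg"
 assumes "infinite (UNIV :: 'u set)" "carrier P = carrier M \<times> carrier N"
  "emb TYPE('u) (M :: ('s, 'g, 'm) dg)" "emb TYPE('u) (N :: ('s, 'g, 'n) dg)"
 shows "emb TYPE('u) P"
proof -
 obtain i :: "'m => 'u" and j :: "'n => 'u"
  where ij: "inj_on i (carrier M)" "inj_on j (carrier N)" using assms(3,4) unfolding emb_def by blast
 have "|UNIV \<times> UNIV :: ('u \<times> 'u) set| \<le>o |UNIV :: 'u set|"
  using card_of_Times_same_infinite[OF assms(1)] ordIso_iff_ordLeq by blast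
 then obtain p :: "'u \<times> 'u => 'u" where "inj_on p (UNIV \<times> UNIV)"
  using card_of_ordLeq[of "UNIV \<times> UNIV :: ('u \<times> 'u) set" "UNIV :: 'u set"] by auto
 then have p: "inj p" by simp
 have "inj_on (\<lambda>x. p (i (fst x), j (snd x))) (carrier P)"
  using ij by (auto simp: inj_on_def assms(2) dest!: injD[OF p])
 then show ?thesis unfolding emb_def by blast
qed

lemma emb_dsum:
 assumes "infinite (UNIV :: 'u set)" "emb TYPE('u) M" "emb TYPE('u) N" shows "emb TYPE('u) (dsum M N)"
 by (rule emb_prod[OF assms(1) _ assms(2,3)]) simp

lemma emb_cone:
 assumes "infinite (UNIV :: 'u set)" "emb TYPE('u) M" "emb TYPE('u) N" shows "emb TYPE('u) (cone M N f)"
 by (rule emb_prod[OF assms(1) _ assms(3,2)]) simp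

lemma (in zalg) emb_obtain:
 fixes M :: "('e, 'g, 'm) dg"
 assumes "dg_module E M" "emb TYPE('u) M"
 obtains M' :: "('e, 'g, 'u) dg" where "dg_module E M'" "dg_isom E M M'"
proof -
 obtain i :: "'m => 'u" where "inj_on i (carrier M)" using assms(2) unfolding emb_def by blast
 then show ?thesis using that push_dgm[OF assms(1)] unfolding dg_isom_def by blast
qed

section \<open>Isomorphism in the derived category\<close>

lemma homotopic_same:
 assumes "dg_module E M" "dg_module E N" "f \<in> dg_hom E M N"
 shows "homotopic E M N f f"
 by (rule homotopic_refl[OF assms refl])

lemma derived_iso_spanI:
 fixes Z :: "('e, 'g::dg_grading, 'u) dg"
 assumes "dg_module E Z" "dg_module E X" "dg_module E Y" "quasi_iso E Z X s" "quasi_iso E Z Y f"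
 shows "derived_iso TYPE('u) E X Y"
proof -
 note s = quasi_isoD(1)[OF assms(4,1) dgm_cx[OF assms(2)]]
 note f = quasi_isoD(1)[OF assms(5,1) dgm_cx[OF assms(3)]]
 have i: "quasi_iso E Z Z id"
  by (rule dg_inv_quasi_iso[of _ _ _ _ id]) (simp_all add: dg_inv_def dg_hom_id dgm_cx[OF assms(1)])
 have c: "roof_comp E B (Z, a, b) (Z, b, a') (Z, a o id, a' o id)"
  if "b \<in> dg_hom E Z B" "dg_module E B" for B a b a'
  unfolding roof_comp_def split_conv
  by (rule exI[of _ Z], rule exI[of _ id], rule exI[of _ id])
   (use i assms homotopic_same[OF assms(1) that(2,1)] in "simp add: dg_hom_id")
 have e: "roof_equiv TYPE('u) E B B (Z, b o id, b o id) (B, id, id)"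
  if "quasi_iso E Z B b" "dg_module E B" "b \<in> dg_hom E Z B" for B b
  unfolding roof_equiv_def split_conv
  by (rule exI[of _ Z], rule exI[of _ id], rule exI[of _ b])
   (use that assms homotopic_same[OF assms(1) that(2,3)] in "simp add: dg_hom_id")
 have "is_roof E X Y (Z, s, f)" "is_roof E Y X (Z, f, s)"
  using assms s f by (simp_all add: is_roof_def)
 then show ?thesis unfolding derived_iso_def
  using c[OF f assms(3), of s s] e[OF assms(4,2) s] c[OF s assms(2), of f f] e[OF assms(5,3) f] by blast
qed

text \<open>
The second leg of an invertible roof is a quasi-isomorphism: the composite with the inverse on one side makes it
injective on cohomology, the composite on the other side surjective.
\<close>

lemma derived_iso_spanD:
 assumes "derived_iso TYPE('u) E X Y" "dg_module E X" "dg_module E Y"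
 obtains Z :: "('e, 'g::dg_grading, 'u) dg" and s f
 where "dg_module E Z" "quasi_iso E Z X s" "quasi_iso E Z Y f"
proof -
 note cX = dgm_cx[OF assms(2)] and cY = dgm_cx[OF assms(3)]
 obtain \<alpha> \<beta> :: "('e, 'g, 'u) dg \<times> _ \<times> _" and \<gamma> \<delta>
  where ab: "is_roof E X Y \<alpha>" "is_roof E Y X \<beta>"
   "roof_comp E Y \<alpha> \<beta> \<gamma>" "roof_equiv TYPE('u) E X X \<gamma> (X, id, id)"
   "roof_comp E X \<beta> \<alpha> \<delta>" "roof_equiv TYPE('u) E Y Y \<delta> (Y, id, id)"
  using assms(1) unfolding derived_iso_def by blast
 obtain Z s f where al: "\<alpha> = (Z, s, f)" by (cases \<alpha>)
 obtain Z' s' f' where be: "\<beta> = (Z', s', f')" by (cases \<beta>)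
 have Z: "dg_module E Z" "quasi_iso E Z X s" "f \<in> dg_hom E Z Y" using ab(1) al by (auto simp: is_roof_def)
 have Z': "dg_module E Z'" "quasi_iso E Z' Y s'" "f' \<in> dg_hom E Z' X" using ab(2) be by (auto simp: is_roof_def)
 note s = quasi_isoD[OF Z(2,1) cX] and s' = quasi_isoD[OF Z'(2,1) cY]
 obtain V p q where V: "dg_module E V" "quasi_iso E V Z p" "q \<in> dg_hom E V Z'"
  "homotopic E V Y (f o p) (s' o q)" "\<gamma> = (V, s o p, f' o q)"
  using ab(3) unfolding al be roof_comp_def by auto
 obtain V2 p2 q2 where V2: "dg_module E V2" "quasi_iso E V2 Z' p2" "q2 \<in> dg_hom E V2 Z"
  "homotopic E V2 X (f' o p2) (s o q2)" "\<delta> = (V2, s' o p2, f o q2)"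
  using ab(5) unfolding al be roof_comp_def by auto
 note p = quasi_isoD[OF V(2,1) dgm_cx[OF Z(1)]] and p2 = quasi_isoD[OF V2(2,1) dgm_cx[OF Z'(1)]]
 obtain W :: "('e, 'g, 'u) dg" and u v where W: "dg_module E W" "u \<in> dg_hom E W V" "v \<in> dg_hom E W X"
  "quasi_iso E W X (s o p o u)" "homotopic E W X (s o p o u) v" "homotopic E W X (f' o q o u) v"
  using ab(4) unfolding V(5) roof_equiv_def by auto
 obtain W2 :: "('e, 'g, 'u) dg" and u2 v2 where W2: "dg_module E W2" "u2 \<in> dg_hom E W2 V2" "v2 \<in> dg_hom E W2 Y"
  "quasi_iso E W2 Y (s' o p2 o u2)" "homotopic E W2 Y (s' o p2 o u2) v2" "homotopic E W2 Y (f o q2 o u2) v2"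
  using ab(6) unfolding V2(5) roof_equiv_def by auto
 have hsf: "hsurj Z Y f"
 proof -
  have fq: "f o q2 o u2 \<in> dg_hom E W2 Y"
   by (rule dg_hom_comp[OF W2(2) dg_hom_comp[OF V2(3) Z(3)]])
  have vq: "quasi_iso E W2 Y v2"
   by (rule quasi_iso_homotopic[OF W2(5,1) assms(3) W2(3,4)])
  have "quasi_iso E W2 Y (f o q2 o u2)"
   by (rule quasi_iso_homotopic[OF homotopic_sym[OF W2(6,1) assms(3) fq W2(3)] W2(1) assms(3) fq vq])
  then have "hsurj W2 Y (f o (q2 o u2))" using quasi_isoD(3)[OF _ W2(1) cY] by (simp add: comp_assoc)
  then show ?thesis
   by (rule hsurj_cancel[OF dg_homD(7)[OF dg_hom_comp[OF W2(2) V2(3)]] dg_homD(7)[OF Z(3)]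
     dgm_cx[OF W2(1)] dgm_cx[OF Z(1)]])
 qed
 have hif: "hinj Z Y f"
 proof -
  have fq: "f' o q o u \<in> dg_hom E W X"
   by (rule dg_hom_comp[OF W(2) dg_hom_comp[OF V(3) Z'(3)]])
  have vq: "quasi_iso E W X v"
   by (rule quasi_iso_homotopic[OF W(5,1) assms(2) W(3,4)])
  have fqu: "quasi_iso E W X (f' o q o u)"
   by (rule quasi_iso_homotopic[OF homotopic_sym[OF W(6,1) assms(2) fq W(3)] W(1) assms(2) fq vq])
  have sp: "quasi_iso E V X (s o p)" by (rule quasi_iso_comp[OF V(2) Z(2) V(1) Z(1) cX])
  have u: "quasi_iso E W V u"
   by (rule quasi_iso_cancel_left[OF W(4) sp W(1) V(1) assms(2) W(2)])
  note uD = quasi_isoD[OF u W(1) dgm_cx[OF V(1)]]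
  have f'q: "f' o q \<in> dg_hom E V X" by (rule dg_hom_comp[OF V(3) Z'(3)])
  have "hinj V X (f' o q)"
   by (rule hinj_cancel_right[OF dg_homD(7)[OF uD(1)] dg_homD(7)[OF f'q] dgm_cx[OF W(1)] dgm_cx[OF V(1)] cX uD(3)
    quasi_isoD(2)[OF fqu W(1) cX]])
  then have hq: "hinj V Z' q" by (rule hinj_cancel[OF dg_homD(7)[OF Z'(3)]])
  have "hinj V Y (s' o q)"
   by (rule hinj_comp[OF dg_homD(7)[OF V(3)] dgm_cx[OF V(1)] dgm_cx[OF Z'(1)] hq s'(2)])
  then have "hinj V Y (f o p)"
   using hinj_homotopic[OF homotopic_sym[OF V(4,1) assms(3)] V(1) assms(3)]
    dg_hom_comp[OF p(1) Z(3)] dg_hom_comp[OF V(3) s'(1)] by blast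
  then show ?thesis
   by (rule hinj_cancel_right[OF dg_homD(7)[OF p(1)] dg_homD(7)[OF Z(3)] dgm_cx[OF V(1)] dgm_cx[OF Z(1)] cY p(3)])
 qed
 have "quasi_iso E Z Y f" by (rule quasi_isoI[OF Z(3) hif hsf dgm_cx[OF Z(1)] cY])
 then show ?thesis using that Z by blast
qed

lemma derived_iso_isom:
 assumes "dg_isom E X Y" "dg_module E X" "dg_module E Y"
 shows "derived_iso TYPE('u) E (X :: ('e, 'g::dg_grading, 'u) dg) (Y :: ('e, 'g, 'y) dg)"
  and "derived_iso TYPE('u) E Y X"
proof -
 obtain f g where fg: "dg_inv E X Y f g" using assms(1) unfolding dg_isom_def by blast
 have q: "quasi_iso E X Y f" by (rule dg_inv_quasi_iso[OF fg dgm_cx[OF assms(2)] dgm_cx[OF assms(3)]])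
 have i: "quasi_iso E X X id"
  by (rule dg_inv_quasi_iso[of _ _ _ _ id]) (simp_all add: dg_inv_def dg_hom_id dgm_cx[OF assms(2)])
 show "derived_iso TYPE('u) E X Y" by (rule derived_iso_spanI[OF assms(2) assms(2) assms(3) i q])
 show "derived_iso TYPE('u) E Y X" by (rule derived_iso_spanI[OF assms(2) assms(3) assms(2) q i])
qed

section \<open>K-projective modules\<close>

text \<open>
A cocycle \<open>(y, x)\<close> of the cone has \<open>x\<close> a cocycle with \<open>f x\<close> a boundary, so \<open>x\<close> is a boundary by injectivity;
surjectivity then corrects \<open>y\<close>.
\<close>

lemma cone_acyclic:
 assumes "dg_module E X" "dg_module E Y" "quasi_iso E X Y f"
 shows "acyclic_dg (cone X Y f)"
proof -
 interpret X: dgmod E X using assms by blast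
 interpret Y: dgmod E Y using assms by blast
 note q = quasi_isoD[OF assms(3,1) Y.cx_axioms]
 note f = dg_homD[OF q(1)] and fm = dg_hom_minus[OF assms(1,2) q(1)]
 have d2: "dd (cone X Y f) (dd (cone X Y f) z) = 0_(cone X Y f)" if "z \<in> carrier (cone X Y f)" for z
  using that by (auto simp: f X.d_d Y.d_d Y.d_add X.d_minus fm Y.r_neg dg_hom_zero[OF assms(1,2) q(1)])
 have ex: "\<exists>w\<in>carrier (cone X Y f). z = dd (cone X Y f) w"
  if "z \<in> carrier (cone X Y f)" "dd (cone X Y f) z = 0_(cone X Y f)" for z
 proof -
  obtain y x where z: "z = (y, x)" "y \<in> carrier Y" "x \<in> carrier X" using \<open>z \<in> _\<close> by auto
  have e: "dd Y y +_Y f x = 0_Y" and "-_X dd X x = 0_X" using that z by simp_all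
  then have dx: "dd X x = 0_X" using z X.minus_minus[of "dd X x"] by simp
  have "f x = -_Y dd Y y" using e z f Y.minus_equality[of "f x" "dd Y y"] by (simp add: Y.a_comm)
  then have "f x = dd Y (-_Y y)" using z by (simp add: Y.d_minus)
  then obtain u where u: "u \<in> carrier X" "x = dd X u"
   using q(2)[unfolded hinj_def] z dx Y.a_inv_closed[of y] by blast
  have "dd Y (y +_Y f u) = 0_Y" using e u z f by (simp add: Y.d_add)
  then obtain v w where v: "v \<in> carrier X" "dd X v = 0_X" "w \<in> carrier Y" "y +_Y f u = f v +_Y dd Y w"
   using q(3)[unfolded hsurj_def, rule_format, of "y +_Y f u"] z f(2)[OF u(1)] by auto
  have "y = (y +_Y f u) +_Y -_Y f u" using z u f by (simp add: Y.a_assoc Y.r_neg)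
  also have "\<dots> = dd Y w +_Y f (v +_X -_X u)"
   using v u f by (simp add: fm Y.a_ac)
  finally have y: "y = dd Y w +_Y f (v +_X -_X u)" .
  have "x = -_X dd X (v +_X -_X u)" using u v by (simp add: X.d_add X.d_minus X.minus_minus)
  then have "z = dd (cone X Y f) (w, v +_X -_X u)" using z y by simp
  then show ?thesis using v u by (intro bexI[of _ "(w, v +_X -_X u)"]) simp_all
 qed
 have "dd (cone X Y f) w \<in> carrier (cone X Y f)" if "w \<in> carrier (cone X Y f)" for w
  using that f by auto
 then show ?thesis
  unfolding acyclic_dg_def cocycles_def coboundaries_def using ex d2 by blast
qed

lemma acyclic_quasi_inv:
 assumes "dg_inv E M N f g" "dg_module E M" "dg_module E N" "acyclic_dg M"
 shows "acyclic_dg N"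
proof -
 note fg = dg_invD[OF assms(1)]
 note f = dg_homD[OF fg(1)] and g = dg_homD[OF fg(2)]
 have m: "\<forall>x\<in>carrier M. dd M x = 0_M --> (\<exists>w\<in>carrier M. x = dd M w)"
  using assms(4) quasi_iso_acyclic[OF dgm_cx[OF assms(2)]] by simp
 have "\<exists>w\<in>carrier N. y = dd N w" if y: "y \<in> carrier N" "dd N y = 0_N" for y
 proof -
  have "dd M (g y) = 0_M" using y g(6)[OF y(1)] dg_hom_zero[OF assms(3,2) fg(2)] by simp
  then obtain w where w: "w \<in> carrier M" "g y = dd M w" using m g(2) y by blast
  have "y = dd N (f w)" using w fg(4)[OF y(1)] f(6)[OF w(1)] by simp
  then show ?thesis using f(2) w by blast
 qed
 then show ?thesis using quasi_iso_acyclic[OF dgm_cx[OF assms(3)]] by blast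
qed

lemma acyclic_shift:
 assumes "dg_module E M" "acyclic_dg M" shows "acyclic_dg (shift s M)"
proof -
 interpret M: dgmod E M using assms by blast
 have m: "\<forall>x\<in>carrier M. dd M x = 0_M --> (\<exists>w\<in>carrier M. x = dd M w)"
  using assms(2) quasi_iso_acyclic[OF M.cx_axioms] by simp
 have "\<exists>w\<in>carrier (shift s M). x = dd (shift s M) w"
  if x: "x \<in> carrier (shift s M)" "dd (shift s M) x = 0_(shift s M)" for x
 proof -
  have "dd M x = 0_M" using x by (simp add: koszul_eq_zero M.ag)
  then obtain w where w: "w \<in> carrier M" "x = dd M w" using m x by auto
  have "x = dd (shift s M) (koszul M (cdeg s) w)"
   using w ahom_koszul[OF M.ag M.ag M.d_hom w(1)] by (simp add: koszul_koszul M.ag koszul_even)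
  then show ?thesis using w by (intro bexI[of _ "koszul M (cdeg s) w"]) (simp_all add: M.ag)
 qed
 then show ?thesis using quasi_iso_acyclic[OF shift_cx[OF M.cx_axioms]] by blast
qed

lemma K_dgm: "K_projective U E P ==> dg_module E P" by (simp add: K_projective_def)

context zalg
begin

text \<open>
K-projectivity is tested on modules in the universe only; a test module of another type is first copied there.
\<close>

lemma K_null:
 fixes N :: "('e, 'g, 'n) dg"
 assumes "K_projective TYPE('u) E P" "dg_module E N" "acyclic_dg N" "emb TYPE('u) N" "f \<in> dg_hom E P N"
 obtains h where "h \<in> hom_deg E P N (- ddeg)" "\<And>x. x \<in> carrier P ==> f x = dd N (h x) +_N h (dd P x)"
proof -
 obtain N' :: "('e, 'g, 'u) dg" where N': "dg_module E N'" "dg_isom E N N'"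
  by (rule emb_obtain[OF assms(2,4)])
 then obtain a b where ab: "dg_inv E N N' a b" unfolding dg_isom_def by blast
 note abD = dg_invD[OF ab]
 interpret N: dgmod E N using assms by blast
 interpret N': dgmod E N' using N' by blast
 interpret P: dgmod E P using K_dgm[OF assms(1)] by blast
 note a = dg_homD[OF abD(1)] and b = dg_homD[OF abD(2)] and f = dg_homD[OF assms(5)]
 have af: "a o f \<in> dg_hom E P N'" by (rule dg_hom_comp[OF assms(5) abD(1)])
 have "homotopic E P N' (a o f) (\<lambda>_. 0_N')"
  using assms(1) N'(1) acyclic_quasi_inv[OF ab assms(2) N'(1) assms(3)] af unfolding K_projective_def by blast
 then obtain h where h: "h \<in> hom_deg E P N' (- ddeg)"
  "\<And>x. x \<in> carrier P ==> (a o f) x = 0_N' +_N' (dd N' (h x) +_N' h (dd P x))"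
  by (rule homotopicE[OF _ P.dgm N'(1)]) (use dg_homD(2)[OF af] in auto)
 note hD = hom_degD[OF h(1)]
 have "f x = dd N ((b o h) x) +_N (b o h) (dd P x)" if x: "x \<in> carrier P" for x
 proof -
  have "f x = b ((a o f) x)" using x abD f by simp
  also have "\<dots> = dd N ((b o h) x) +_N (b o h) (dd P x)"
   using h(2)[OF x] x hD b by simp
  finally show ?thesis .
 qed
 moreover have "b o h \<in> hom_deg E P N (- ddeg)"
  using hom_deg_comp[OF h(1) dg_hom_hom_deg[OF abD(2)]] by simp
 ultimately show ?thesis using that by blast
qed

lemma K_projectiveI:
 assumes "dg_module E P"
  and "\<And>(N :: ('e, 'g, 'u) dg) f. dg_module E N ==> acyclic_dg N ==> f \<in> dg_hom E P N ==>
   \<exists>h\<in>hom_deg E P N (- ddeg). \<forall>x\<in>carrier P. f x = dd N (h x) +_N h (dd P x)"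
 shows "K_projective TYPE('u) E P"
 unfolding K_projective_def
proof (intro conjI allI impI assms(1))
 fix N :: "('e, 'g, 'u) dg" and f assume N: "dg_module E N" "acyclic_dg N" "f \<in> dg_hom E P N"
 interpret N: dgmod E N using N by blast
 interpret P: dgmod E P using assms by blast
 obtain h where h: "h \<in> hom_deg E P N (- ddeg)" "\<forall>x\<in>carrier P. f x = dd N (h x) +_N h (dd P x)"
  using assms(2)[OF N] by blast
 show "homotopic E P N f (\<lambda>_. 0_N)"
  by (rule homotopicI[OF N(1) h(1) dg_homD(2)[OF N(3)] _ P.d_closed])
   (use h hom_degD(2)[OF h(1)] in simp_all)
qed

text \<open>
The cone of a quasi-isomorphism \<open>s\<close> is acyclic, so the composite of \<open>g\<close> with the inclusion into the cone is
null-homotopic. The two components of the null-homotopy are the homotopy and the lift.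
\<close>

lemma K_lift:
 fixes Z :: "('e, 'g, 'z) dg" and X :: "('e, 'g, 'x) dg"
 assumes U: "infinite (UNIV :: 'u set)" "emb TYPE('u) Z" "emb TYPE('u) X"
  and P: "K_projective TYPE('u) E P" and Z: "dg_module E Z" and X: "dg_module E X"
  and s: "quasi_iso E Z X s" and g: "g \<in> dg_hom E P X"
 obtains w where "w \<in> dg_hom E P Z" "homotopic E P X (s o w) g"
proof -
 interpret Z: dgmod E Z using Z by blast
 interpret X: dgmod E X using X by blast
 interpret P: dgmod E P using K_dgm[OF P] by blast
 note sD = dg_homD[OF quasi_isoD(1)[OF s Z X.cx_axioms]] and gD = dg_homD[OF g]
 note s0 = dg_hom_zero[OF Z X quasi_isoD(1)[OF s Z X.cx_axioms]]
 let ?C = "cone Z X s"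
 have C: "dg_module E ?C" by (rule cone_dgm[OF Z X quasi_isoD(1)[OF s Z X.cx_axioms]])
 have f: "(\<lambda>x. (g x, 0_Z)) \<in> dg_hom E P ?C"
  by (rule dg_homI) (simp_all add: gD Z.gg s0)
 obtain h where h: "h \<in> hom_deg E P ?C (- ddeg)"
  "\<And>x. x \<in> carrier P ==> (g x, 0_Z) = dd ?C (h x) +_?C h (dd P x)"
  using K_null[OF P C cone_acyclic[OF Z X s] emb_cone[OF U] f] by blast
 note hD = hom_degD[OF h(1)]
 define k w where "k = fst o h" and "w = snd o h"
 have kw: "h x = (k x, w x)" for x by (simp add: k_def w_def)
 have c: "k x \<in> carrier X" "w x \<in> carrier Z" if "x \<in> carrier P" for x
  using hD(2)[OF that] by (simp_all add: kw)
 have eq: "g x = dd X (k x) +_X s (w x) +_X k (dd P x)"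
  "0_Z = -_Z dd Z (w x) +_Z w (dd P x)" if "x \<in> carrier P" for x
  using h(2)[OF that] by (simp_all add: kw)
 have k: "k \<in> hom_deg E P X (- ddeg)"
  by (rule hom_degI, rule ahomI) (use c hD(3-5) in "simp_all add: kw")
 have w: "w \<in> dg_hom E P Z"
 proof (rule dg_homI)
  fix x assume x: "x \<in> carrier P"
  have "w (dd P x) +_Z -_Z dd Z (w x) = 0_Z" using eq(2)[OF x] c x by (simp add: Z.a_comm)
  then show "w (dd P x) = dd Z (w x)"
   using Z.minus_eq_zero_iff[of "w (dd P x)" "dd Z (w x)"] c x by (simp add: a_minus_def)
 next
  fix g x assume "x \<in> gr P g"
  from hD(5)[OF this] show "w x \<in> gr Z g" by (simp add: kw)
 qed (use c hD(3,4) in "simp_all add: kw")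
 have sw: "s o w \<in> dg_hom E P X" by (rule dg_hom_comp[OF w quasi_isoD(1)[OF s Z X.cx_axioms]])
 have "homotopic E P X g (s o w)"
  by (rule homotopicI[OF X k gD(2) dg_homD(2)[OF sw] P.d_closed])
   (use eq(1) c sD in "simp_all add: X.a_ac")
 then show ?thesis using that[OF w] homotopic_sym[OF _ P.dgm X g sw] by blast
qed

text \<open>
A homotopy \<open>k\<close> between the composites and the difference of the two maps are the components of a morphism
into the desuspended cone; a null-homotopy of it contains the required homotopy.
\<close>

lemma K_unique:
 fixes Z :: "('e, 'g, 'z) dg" and X :: "('e, 'g, 'x) dg"
 assumes U: "infinite (UNIV :: 'u set)" "emb TYPE('u) Z" "emb TYPE('u) X"
  and P: "K_projective TYPE('u) E P" and Z: "dg_module E Z" and X: "dg_module E X"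
  and s: "quasi_iso E Z X s" and w: "w \<in> dg_hom E P Z" "w' \<in> dg_hom E P Z"
  and hom: "homotopic E P X (s o w) (s o w')"
 shows "homotopic E P Z w w'"
proof -
 interpret Z: dgmod E Z using Z by blast
 interpret X: dgmod E X using X by blast
 interpret P: dgmod E P using K_dgm[OF P] by blast
 note sq = quasi_isoD(1)[OF s Z X.cx_axioms]
 note sD = dg_homD[OF sq] and sm = dg_hom_minus[OF Z X sq]
 note wD = dg_homD[OF w(1)] and w'D = dg_homD[OF w(2)]
 let ?C = "shift (- ddeg) (cone Z X s)"
 note C0 = cone_dgm[OF Z X sq]
 have C: "dg_module E ?C" by (rule shift_dgm[OF C0])
 have ac: "acyclic_dg ?C" by (rule acyclic_shift[OF C0 cone_acyclic[OF Z X s]])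
 obtain k where k: "k \<in> hom_deg E P X (- ddeg)"
  "\<And>x. x \<in> carrier P ==> (s o w) x = (s o w') x +_X (dd X (k x) +_X k (dd P x))"
  by (rule homotopicE[OF hom P.dgm X]) (use sD wD w'D in auto)
 note kD = hom_degD[OF k(1)]
 define \<phi> where "\<phi> x = (-_X k x, w x -_Z w' x)" for x
 have dC: "dd ?C (y, z) = (-_X (dd X y +_X s z), dd Z z)" if "y \<in> carrier X" "z \<in> carrier Z" for y z
  using that sD by (simp add: koszul_def cdeg_minus cdeg_ddeg cone_a_inv[OF Z.ag X.ag] Z.minus_minus)
 have f: "\<phi> \<in> dg_hom E P ?C"
 proof (rule dg_homI)
  fix g x assume "x \<in> gr P g"
  then show "\<phi> x \<in> gr ?C g"
   using kD(5)[of x g] wD(5)[of x g] w'D(5)[of x g]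
   by (simp add: \<phi>_def gr_minus gr_add X.gg Z.gg a_minus_def)
 next
  fix x assume x: "x \<in> carrier P"
  let ?a = "s (w' x)" and ?b = "dd X (k x)" and ?c = "k (dd P x)"
  have c: "?a \<in> carrier X" "?b \<in> carrier X" "?c \<in> carrier X" using x sD w'D kD by simp_all
  have "s (w x -_Z w' x) = (?a +_X (?b +_X ?c)) +_X -_X ?a"
   using x k(2)[OF x] sD wD w'D by (simp add: a_minus_def sm)
  also have "\<dots> = (?b +_X ?c) +_X (?a +_X -_X ?a)" using c by (simp add: X.a_ac)
  finally have e: "s (w x -_Z w' x) = ?b +_X ?c" using c by (simp add: X.r_neg)
  have "dd X (-_X k x) +_X (?b +_X ?c) = (?b +_X -_X ?b) +_X ?c"
   using c x kD by (simp add: X.d_minus X.a_ac)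
  then have "dd X (-_X k x) +_X s (w x -_Z w' x) = ?c" using c e by (simp add: X.r_neg)
  then show "\<phi> (dd P x) = dd ?C (\<phi> x)"
   unfolding \<phi>_def using x kD wD w'D by (subst dC) (simp_all add: a_minus_def Z.d_add Z.d_minus)
 qed (use kD wD w'D in "simp_all add: \<phi>_def a_minus_def X.minus_add Z.minus_add Z.a_ac
   X.act_minus Z.act_minus Z.act_add")
 have ce: "emb TYPE('u) ?C" using emb_cone[OF U] by simp
 obtain h where h: "h \<in> hom_deg E P ?C (- ddeg)"
  "\<And>x. x \<in> carrier P ==> \<phi> x = dd ?C (h x) +_?C h (dd P x)"
  using K_null[OF P C ac ce f] by blast
 note hD = hom_degD[OF h(1)]
 have hc: "fst (h x) \<in> carrier X" "snd (h x) \<in> carrier Z" if "x \<in> carrier P" for x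
  using hD(2)[OF that] by (auto simp: mem_Times_iff)
 have h2: "snd o h \<in> hom_deg E P Z (- ddeg)"
 proof (rule hom_degI, rule ahomI)
  fix g x assume "x \<in> gr P g"
  from hD(5)[OF this] show "(snd o h) x \<in> gr Z (g + - ddeg)"
   by (simp add: mem_Times_iff)
 qed (use hc in "simp_all add: hD(3,4) cone_proj")
 show ?thesis
 proof (rule homotopicI[OF Z h2 wD(2) w'D(2) P.d_closed])
  fix x assume x: "x \<in> carrier P"
  have "snd (\<phi> x) = snd (dd ?C (h x)) +_Z snd (h (dd P x))"
   unfolding h(2)[OF x] by (simp add: cone_proj)
  moreover have "snd (dd ?C (h x)) = dd Z (snd (h x))"
   using dC[OF hc[OF x]] unfolding prod.collapse by simp
  ultimately have "w x -_Z w' x = dd Z (snd (h x)) +_Z snd (h (dd P x))"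
   by (simp add: \<phi>_def)
  then show "w x = w' x +_Z (dd Z ((snd o h) x) +_Z (snd o h) (dd P x))"
   using x hc wD w'D by (simp add: Z.minus_eq_iff)
 qed
qed

end

section \<open>Finite cell modules\<close>

context zalg
begin

lemma dg_hom_shift:
 assumes "dg_module E M" "dg_module E N" "f \<in> dg_hom E M N"
 shows "f \<in> dg_hom E (shift s M) (shift s N)"
proof -
 interpret M: dgmod E M using assms by blast
 interpret N: dgmod E N using assms by blast
 note f = dg_homD[OF assms(3)]
 show ?thesis
  by (rule dg_homI) (simp_all add: f ahom_koszul[OF M.ag N.ag f(1)])
qed

lemma shift_shift_inv:
 assumes "dg_module E M"
 shows "dg_inv E (shift s (shift t M)) (shift (s + t) M) id id"
  "s + t = 0 ==> dg_inv E (shift s (shift t M)) M id id"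
proof -
 interpret M: dgmod E M using assms by blast
 show "dg_inv E (shift s (shift t M)) (shift (s + t) M) id id"
  by (rule dg_inv_id) (simp_all add: shift_graded M.gg add.assoc koszul_koszul M.ag cdeg_add)
 assume st: "s + t = 0"
 have "even (cdeg s + cdeg t)" using st cdeg_add[of s t] by simp
 then show "dg_inv E (shift s (shift t M)) M id id"
  by (intro dg_inv_id)
   (simp_all add: shift_graded M.gg add.assoc st koszul_koszul M.ag koszul_even)
qed

lemma quasi_iso_shift:
 assumes "dg_module E M" "dg_module E N" "quasi_iso E M N f"
 shows "quasi_iso E (shift s M) (shift s N) f"
proof -
 interpret M: dgmod E M using assms by blast
 interpret N: dgmod E N using assms by blast
 note q = quasi_isoD[OF assms(3,1) N.cx_axioms]
 have kd: "dd M (koszul M n w) = koszul M n (dd M w)" if "w \<in> carrier M" for w n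
  by (rule ahom_koszul[OF M.ag M.ag M.d_hom that])
 have kd': "dd N (koszul N n w) = koszul N n (dd N w)" if "w \<in> carrier N" for w n
  by (rule ahom_koszul[OF N.ag N.ag N.d_hom that])
 show ?thesis
 proof (rule quasi_isoI[OF dg_hom_shift[OF assms(1,2) q(1)] _ _ shift_cx[OF M.cx_axioms] shift_cx[OF N.cx_axioms]])
  show "hinj (shift s M) (shift s N) f"
   unfolding hinj_def
  proof (intro ballI impI)
   fix x z assume x: "x \<in> carrier (shift s M)" "z \<in> carrier (shift s N)"
    "dd (shift s M) x = 0_(shift s M)" "f x = dd (shift s N) z"
   then have "dd M x = 0_M" "f x = dd N (koszul N (cdeg s) z)"
    by (simp_all add: koszul_eq_zero M.ag kd')
   then obtain w where w: "w \<in> carrier M" "x = dd M w"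
    using q(2) x N.ag unfolding hinj_def by (metis koszul_closed shift_simps(1))
   then have "x = dd (shift s M) (koszul M (cdeg s) w)" by (simp add: kd koszul_koszul M.ag koszul_even)
   then show "\<exists>w\<in>carrier (shift s M). x = dd (shift s M) w"
    using w by (intro bexI[of _ "koszul M (cdeg s) w"]) (simp_all add: M.ag)
  qed
  show "hsurj (shift s M) (shift s N) f"
   unfolding hsurj_def
  proof (intro ballI impI)
   fix y assume y: "y \<in> carrier (shift s N)" "dd (shift s N) y = 0_(shift s N)"
   then have "dd N y = 0_N" by (simp add: koszul_eq_zero N.ag)
   then obtain x z where x: "x \<in> carrier M" "dd M x = 0_M" "z \<in> carrier N" "y = f x +_N dd N z"
    using q(3) y unfolding hsurj_def by auto
   have "y = f x +_N dd (shift s N) (koszul N (cdeg s) z)"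
    using x by (simp add: kd' koszul_koszul N.ag koszul_even)
   then show "\<exists>x\<in>carrier (shift s M). dd (shift s M) x = 0_(shift s M) \<and>
     (\<exists>z\<in>carrier (shift s N). y = f x +_(shift s N) dd (shift s N) z)"
    using x by (intro bexI[of _ x] conjI bexI[of _ "koszul N (cdeg s) z"]) (simp_all add: M.ag N.ag)
  qed
 qed
qed

lemma K_retract:
 assumes "K_projective TYPE('u) E T" "dg_module E P" "i \<in> dg_hom E P T" "r \<in> dg_hom E T P"
  "homotopic E P P (r o i) id"
 shows "K_projective TYPE('u) E P"
proof (rule K_projectiveI[OF assms(2)])
 fix N :: "('e, 'g, 'u) dg" and f assume N: "dg_module E N" "acyclic_dg N" "f \<in> dg_hom E P N"
 interpret N: dgmod E N using N by blast
 interpret P: dgmod E P using assms by blast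
 interpret T: dgmod E T using K_dgm[OF assms(1)] by blast
 note f = dg_homD[OF N(3)] and i = dg_homD[OF assms(3)] and r = dg_homD[OF assms(4)]
 obtain k where k: "k \<in> hom_deg E T N (- ddeg)"
  "\<And>x. x \<in> carrier T ==> (f o r) x = dd N (k x) +_N k (dd T x)"
  using K_null[OF assms(1) N(1,2) emb_self dg_hom_comp[OF assms(4) N(3)]] by blast
 note kD = hom_degD[OF k(1)]
 have ri: "r o i \<in> dg_hom E P P" by (rule dg_hom_comp[OF assms(3,4)])
 obtain h where h: "h \<in> hom_deg E P P (- ddeg)"
  "\<And>x. x \<in> carrier P ==> id x = (r o i) x +_P (dd P (h x) +_P h (dd P x))"
  by (rule homotopicE[OF homotopic_sym[OF assms(5,2,2) ri dg_hom_id] assms(2,2)])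
   (use dg_homD(2)[OF ri] in auto)
 note hD = hom_degD[OF h(1)]
 have ki: "k o i \<in> hom_deg E P N (- ddeg)"
  using hom_deg_comp[OF dg_hom_hom_deg[OF assms(3)] k(1)] by simp
 have fh: "f o h \<in> hom_deg E P N (- ddeg)"
  using hom_deg_comp[OF h(1) dg_hom_hom_deg[OF N(3)]] by simp
 have "f x = dd N ((k o i) x +_N (f o h) x) +_N ((k o i) (dd P x) +_N (f o h) (dd P x))"
  if x: "x \<in> carrier P" for x
 proof -
  have "f x = f (r (i x) +_P (dd P (h x) +_P h (dd P x)))" using h(2)[OF x] by simp
  also have "\<dots> = (f o r) (i x) +_N (dd N (f (h x)) +_N f (h (dd P x)))"
   using x f i r hD by simp
  also have "(f o r) (i x) = dd N (k (i x)) +_N k (i (dd P x))" using k(2) x i by simp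
  finally show ?thesis using x f i r hD kD by (simp add: N.d_add N.a_ac)
 qed
 then show "\<exists>h\<in>hom_deg E P N (- ddeg). \<forall>x\<in>carrier P. f x = dd N (h x) +_N h (dd P x)"
  using hom_deg_add[OF N(1) ki fh assms(2)] by (intro bexI) auto
qed

lemma K_isom:
 assumes "K_projective TYPE('u) E T" "dg_module E P" "dg_isom E T P"
 shows "K_projective TYPE('u) E P"
proof -
 obtain r i where ri: "dg_inv E T P r i" using assms(3) unfolding dg_isom_def by blast
 note riD = dg_invD[OF ri]
 have "homotopic E P P (r o i) id"
  by (rule homotopic_refl[OF assms(2,2) dg_hom_comp[OF riD(2,1)]]) (simp add: riD)
 then show ?thesis by (rule K_retract[OF assms(1,2) riD(2,1)])
qed

lemma K_shift:
 assumes "K_projective TYPE('u) E P"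
 shows "K_projective TYPE('u) E (shift s P)"
proof (rule K_projectiveI[OF shift_dgm[OF K_dgm[OF assms]]])
 fix N :: "('e, 'g, 'u) dg" and f assume N: "dg_module E N" "acyclic_dg N" "f \<in> dg_hom E (shift s P) N"
 interpret N: dgmod E N using N by blast
 interpret P: dgmod E P using K_dgm[OF assms] by blast
 have f0: "f \<in> dg_hom E (shift (- s) (shift s P)) (shift (- s) N)"
  by (rule dg_hom_shift[OF shift_dgm[OF P.dgm] N(1,3)])
 have f: "f \<in> dg_hom E P (shift (- s) N)"
  using dg_hom_comp[OF dg_invD(2)[OF shift_shift_inv(2)[OF P.dgm, of "- s" s]] f0] by simp
 obtain h where h: "h \<in> hom_deg E P (shift (- s) N) (- ddeg)"
  "\<And>x. x \<in> carrier P ==> f x = dd (shift (- s) N) (h x) +_N h (dd P x)"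
  using K_null[OF assms shift_dgm[OF N(1)] acyclic_shift[OF N(1,2)] _ f] by auto
 note hD = hom_degD[OF h(1), simplified]
 let ?h = "\<lambda>x. koszul N (cdeg s) (h x)"
 have hh: "h \<in> ahom P N" by (rule ahomI) (use hD in auto)
 have "?h \<in> hom_deg E (shift s P) N (- ddeg)"
 proof (rule hom_degI, rule ahomI)
  fix g x assume "x \<in> gr (shift s P) g"
  from hD(5)[of x "g + s"] this show "?h x \<in> gr N (g + - ddeg)"
   by (simp add: gr_koszul N.gg algebra_simps)
 next
  fix x e assume x: "x \<in> carrier (shift s P)" "e \<in> carrier E"
  then show "?h (ract (shift s P) x e) = ract N (?h x) e"
   using ahom_koszul[OF N.ag N.ag N.act_hom[OF x(2)], of "h x" "cdeg s"] hD(2,4) by simp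
 qed (use hD in "simp_all add: koszul_add N.ag")
 moreover have "f x = dd N (?h x) +_N ?h (dd (shift s P) x)" if x: "x \<in> carrier P" for x
  using h(2)[OF x] x hD(2) ahom_koszul[OF N.ag N.ag N.d_hom] ahom_koszul[OF P.ag N.ag hh]
  by (simp add: cdeg_minus koszul_koszul N.ag koszul_even koszul_def)
 ultimately show "\<exists>h\<in>hom_deg E (shift s P) N (- ddeg). \<forall>x\<in>carrier (shift s P).
   f x = dd N (h x) +_N h (dd (shift s P) x)" by auto
qed

text \<open>
A map \<open>g\<close> from the cone to an acyclic module restricts to a null-homotopic map on \<open>Y\<close>. Once \<open>g\<close> is
corrected by that homotopy, what remains is a morphism on a shift of \<open>X\<close>.
\<close>

lemma K_cone:
 assumes X: "K_projective TYPE('u) E X" and Y: "K_projective TYPE('u) E Y" and f: "f \<in> dg_hom E X Y"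
 shows "K_projective TYPE('u) E (cone X Y f)"
proof (rule K_projectiveI[OF cone_dgm[OF K_dgm[OF X] K_dgm[OF Y] f]])
 fix N :: "('e, 'g, 'u) dg" and g assume N: "dg_module E N" "acyclic_dg N" "g \<in> dg_hom E (cone X Y f) N"
 interpret N: dgmod E N using N by blast
 interpret X: dgmod E X using K_dgm[OF X] by blast
 interpret Y: dgmod E Y using K_dgm[OF Y] by blast
 note fD = dg_homD[OF f] and gD = dg_homD[OF N(3)] and f0 = dg_hom_zero[OF X.dgm Y.dgm f]
 define g1 g2 where "g1 = (\<lambda>y. g (y, 0_X))" and "g2 = (\<lambda>x. g (0_Y, x))"
 have gc: "g1 y \<in> carrier N" "g2 x \<in> carrier N" if "y \<in> carrier Y" "x \<in> carrier X" for x y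
  using that gD(2) by (simp_all add: g1_def g2_def)
 have g12: "g (y, x) = g1 y +_N g2 x" if "y \<in> carrier Y" "x \<in> carrier X" for y x
  using gD(3)[of "(y, 0_X)" "(0_Y, x)"] that by (simp add: g1_def g2_def)
 have "(\<lambda>y. (y, 0_X)) \<in> dg_hom E Y (cone X Y f)" by (rule dg_homI) (simp_all add: X.gg f0)
 from dg_hom_comp[OF this N(3)] have g1: "g1 \<in> dg_hom E Y N" by (simp add: g1_def comp_def)
 obtain h1 where h1: "h1 \<in> hom_deg E Y N (- ddeg)"
  "\<And>y. y \<in> carrier Y ==> g1 y = dd N (h1 y) +_N h1 (dd Y y)"
  using K_null[OF Y N(1,2) emb_self g1] by blast
 note h1D = hom_degD[OF h1(1)] and h1m = hom_deg_minus[OF Y.dgm N(1) h1(1)]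
 have g2a: "g2 (x +_X y) = g2 x +_N g2 y" if "x \<in> carrier X" "y \<in> carrier X" for x y
  using gD(3)[of "(0_Y, x)" "(0_Y, y)"] that by (simp add: g2_def)
 have g2e: "g2 (ract X x e) = ract N (g2 x) e" if "x \<in> carrier X" "e \<in> carrier E" for x e
  using gD(4)[of "(0_Y, x)" e] that by (simp add: g2_def)
 have g2g: "g2 x \<in> gr N a" if "x \<in> gr X (a + ddeg)" for x a
  using gD(5)[of "(0_Y, x)" a] that by (simp add: g2_def Y.gg)
 have g2d: "dd N (g2 x) = g1 (f x) +_N g2 (-_X dd X x)" if "x \<in> carrier X" for x
 proof -
  have "dd N (g (0_Y, x)) = g (f x, -_X dd X x)"
   using gD(6)[of "(0_Y, x)"] that fD by simp
  also have "\<dots> = g1 (f x) +_N g2 (-_X dd X x)" by (rule g12) (use that fD in simp_all)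
  finally show ?thesis by (simp add: g2_def)
 qed
 define k where "k = (\<lambda>x. g2 x +_N -_N h1 (f x))"
 have hf: "h1 (f x) \<in> carrier N" if "x \<in> carrier X" for x using that fD h1D by simp
 have k: "k \<in> dg_hom E (shift ddeg X) N"
 proof (rule dg_homI)
  fix x y assume x: "x \<in> carrier (shift ddeg X)" "y \<in> carrier (shift ddeg X)"
  then show "k (x +_(shift ddeg X) y) = k x +_N k y"
   using hf gc[OF Y.zero_closed] by (simp add: k_def g2a fD h1D N.minus_add N.a_ac)
 next
  fix x e assume x: "x \<in> carrier (shift ddeg X)" "e \<in> carrier E"
  then show "k (ract (shift ddeg X) x e) = ract N (k x) e"
   using hf gc[OF Y.zero_closed] by (simp add: k_def g2e fD h1D N.act_add N.act_minus)
 next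
  fix a x assume x: "x \<in> gr (shift ddeg X) a"
  have "h1 (f x) \<in> gr N (a + ddeg + - ddeg)" by (rule h1D(5)) (use x fD(5) in simp)
  then show "k x \<in> gr N a" using x g2g by (simp add: k_def gr_add gr_minus N.gg)
 next
  fix x assume "x \<in> carrier (shift ddeg X)"
  then have x: "x \<in> carrier X" by simp
  let ?a = "dd N (h1 (f x))" and ?b = "h1 (dd Y (f x))" and ?c = "g2 (-_X dd X x)"
  have c: "?a \<in> carrier N" "?b \<in> carrier N" "?c \<in> carrier N"
   using x fD h1D gc[OF Y.zero_closed] by simp_all
  have "dd N (k x) = ((?a +_N ?b) +_N ?c) +_N -_N ?a"
   using x hf gc[OF Y.zero_closed] by (simp add: k_def N.d_add N.d_minus g2d h1(2) fD)
  also have "\<dots> = (?c +_N ?b) +_N (?a +_N -_N ?a)" using c by (simp add: N.a_ac)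
  also have "\<dots> = k (dd (shift ddeg X) x)"
   using x c fD dg_hom_minus[OF X.dgm Y.dgm f] h1m h1D
   by (simp add: k_def cdeg_ddeg koszul_def N.r_neg N.minus_minus)
  finally show "k (dd (shift ddeg X) x) = dd N (k x)" by simp
 qed (use hf gc[OF Y.zero_closed] in "simp add: k_def")
 obtain h2 where h2: "h2 \<in> hom_deg E (shift ddeg X) N (- ddeg)"
  "\<And>x. x \<in> carrier (shift ddeg X) ==> k x = dd N (h2 x) +_N h2 (dd (shift ddeg X) x)"
  using K_null[OF K_shift[OF X] N(1,2) emb_self k] by blast
 note h2D = hom_degD[OF h2(1), simplified]
 define h where "h = (\<lambda>z. h1 (fst z) +_N h2 (snd z))"
 have "h \<in> hom_deg E (cone X Y f) N (- ddeg)"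
 proof (rule hom_degI, rule ahomI)
  fix a x assume "x \<in> gr (cone X Y f) a"
  then show "h x \<in> gr N (a + - ddeg)"
   using h1D(5)[of "fst x" a] h2D(5)[of "snd x" a] by (auto simp: h_def gr_add N.gg)
 qed (auto simp: h_def h1D h2D N.act_add N.a_ac cone_proj)
 moreover have "g z = dd N (h z) +_N h (dd (cone X Y f) z)" if "z \<in> carrier (cone X Y f)" for z
 proof -
  obtain y x where z: "z = (y, x)" "y \<in> carrier Y" "x \<in> carrier X" using \<open>z \<in> _\<close> by auto
  have kx: "k x = dd N (h2 x) +_N h2 (-_X dd X x)" using h2(2)[of x] z by (simp add: cdeg_ddeg koszul_def)
  have "g2 x = g2 x +_N (-_N h1 (f x) +_N h1 (f x))" using z hf gc[OF Y.zero_closed] by (simp add: N.l_neg)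
  then have "g2 x = k x +_N h1 (f x)" using z hf gc[OF Y.zero_closed] by (simp add: k_def N.a_assoc)
  then show ?thesis
   using z h1D h2D fD kx by (simp add: h_def g12 h1(2) N.d_add N.a_ac)
 qed
 ultimately show "\<exists>h\<in>hom_deg E (cone X Y f) N (- ddeg). \<forall>z\<in>carrier (cone X Y f).
   g z = dd N (h z) +_N h (dd (cone X Y f) z)" by blast
qed

lemma regular_simps [simp]:
 "carrier (regular E) = carrier E" "add (regular E) = add E" "zero (regular E) = zero E"
 "ract (regular E) x e = x \<otimes> e" "gr (regular E) = gr E" "dd (regular E) = dd E"
 by (simp_all add: regular_def mk_dg_def)

lemma regular_a_inv [simp]: "a_inv (regular E) = a_inv E"
 by (simp add: a_inv_def fun_eq_iff m_inv_def)

lemma regular_koszul [simp]: "koszul (regular E) = koszul E"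
 by (simp add: koszul_def fun_eq_iff)

lemma regular_dgm: "dg_module E (regular E)"
proof -
 have g: "graded_group (regular E)" by (rule graded_group_cong[OF gg]) simp_all
 have d: "dd (regular E) \<in> ahom (regular E) (regular E)" by (rule ahomI) (simp_all add: d0)
 have z: "\<zero> \<in> gr E g" for g using gg by simp
 show ?thesis
  by (rule dg_moduleI[OF g _ _ _ _ _ _ d]) (simp_all add: d l_distr r_distr m_assoc mult_gr d0 z gr_carrier[OF gg])
qed

lemma hcomp_d:
 assumes "dg_module E M" "x \<in> carrier M"
 shows "hcomp M (dd M x) (g + ddeg) = dd M (hcomp M x g)"
proof -
 interpret M: dgmod E M using assms by blast
 show ?thesis
 proof (rule ahom_eqI[OF M.gg M.ag _ _ _ assms(2)])
  show "(\<lambda>x. hcomp M (dd M x) (g + ddeg)) \<in> ahom M M"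
   using ahom_comp[OF M.d_hom hcomp_ahom[OF M.gg]] by (simp add: comp_def)
  show "(\<lambda>x. dd M (hcomp M x g)) \<in> ahom M M"
   using ahom_comp[OF hcomp_ahom[OF M.gg] M.d_hom] by (simp add: comp_def)
 next
  fix h x assume x: "x \<in> gr M h"
  show "hcomp M (dd M x) (g + ddeg) = dd M (hcomp M x g)"
   using hcomp_hom[OF M.gg x] hcomp_hom[OF M.gg M.d_gr[OF x]] by auto
 qed
qed

text \<open>
A morphism from the regular module is determined by the image of \<open>1\<close>, a cocycle of degree zero. In an acyclic
module it has a primitive, and the component of degree \<open>- ddeg\<close> of this primitive is again one.
\<close>

lemma K_regular: "K_projective TYPE('u) E (regular E)"
proof (rule K_projectiveI[OF regular_dgm])
 fix N :: "('e, 'g, 'u) dg" and f assume N: "dg_module E N" "acyclic_dg N" "f \<in> dg_hom E (regular E) N"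
 interpret N: dgmod E N using N by blast
 note f = dg_homD[OF N(3), simplified]
 have n: "f \<one> \<in> carrier N" "f \<one> \<in> gr N 0" using f(2) f(5)[OF one_gr] by auto
 have "f \<zero> = 0_N" using dg_hom_zero[OF regular_dgm N(1,3)] by simp
 then have "dd N (f \<one>) = 0_N" using f(6)[of \<one>] by (simp add: d0)
 then obtain m where m: "m \<in> carrier N" "f \<one> = dd N m"
  using N(2) n quasi_iso_acyclic[OF N.cx_axioms] by blast
 let ?m = "hcomp N m (- ddeg)"
 have mc: "?m \<in> carrier N" "?m \<in> gr N (- ddeg)" by (rule hcomp_closed[OF N.gg m(1)], rule hcomp_gr[OF N.gg m(1)])
 have "hcomp N (f \<one>) (- ddeg + ddeg) = dd N ?m" unfolding m(2) by (rule hcomp_d[OF N(1) m(1)])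
 then have dm: "dd N ?m = f \<one>" using hcomp_hom[OF N.gg n(2)] by simp
 have "(\<lambda>e. ract N ?m e) \<in> hom_deg E (regular E) N (- ddeg)"
 proof (rule hom_degI, rule ahomI)
  fix g x assume "x \<in> gr (regular E) g"
  then show "ract N ?m x \<in> gr N (g + - ddeg)" using N.act_gr[OF mc(2), of x g] by (simp add: add.commute)
 qed (use mc in "simp_all add: N.act_add_right N.act_act")
 moreover have "f x = dd N (ract N ?m x) +_N ract N ?m (dd E x)" if x: "x \<in> carrier E" for x
 proof -
  have "f x = ract N (f \<one>) x" using f(4)[of \<one> x] x by simp
  then show ?thesis using x mc n by (simp add: d0 act_ring_zero[OF N(1)] act_d[OF N(1)] dm)
 qed
 ultimately show "\<exists>h\<in>hom_deg E (regular E) N (- ddeg). \<forall>x\<in>carrier (regular E).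
   f x = dd N (h x) +_N h (dd (regular E) x)"
  by (intro bexI[of _ "\<lambda>e. ract N ?m e"]) auto
qed

end

text \<open>
The five lemma for cones. The square commutes only up to a homotopy \<open>h\<close>, which becomes the off-diagonal
entry of the map of cones; the diagram chase is carried out on elements.
\<close>

lemma cone_map_quasi_iso:
 assumes M: "dg_module E M" and N: "dg_module E N" and M': "dg_module E M'" and N': "dg_module E N'"
  and a: "a \<in> dg_hom E M N" and a': "a' \<in> dg_hom E M' N'"
  and u: "quasi_iso E M M' u" and v: "quasi_iso E N N' v"
  and sq: "homotopic E M N' (v o a) (a' o u)"
  and C: "dg_module E (cone M N a)" and C': "dg_module E (cone M' N' a')"
 obtains c where "quasi_iso E (cone M N a) (cone M' N' a') c"
proof -
 interpret M: dgmod E M using M by blast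
 interpret N: dgmod E N using N by blast
 interpret M': dgmod E M' using M' by blast
 interpret N': dgmod E N' using N' by blast
 note uq = quasi_isoD[OF u M M'.cx_axioms] and vq = quasi_isoD[OF v N N'.cx_axioms]
 note uD = dg_homD(2-6)[OF uq(1)] and vD = dg_homD(2-6)[OF vq(1)]
  and aD = dg_homD(2-6)[OF a] and a'D = dg_homD(2-6)[OF a']
 note um = dg_hom_minus[OF M M' uq(1)] and vm = dg_hom_minus[OF N N' vq(1)]
  and am = dg_hom_minus[OF M N a] and a'm = dg_hom_minus[OF M' N' a']
 note z = dg_hom_zero[OF M M' uq(1)] dg_hom_zero[OF N N' vq(1)] dg_hom_zero[OF M N a] dg_hom_zero[OF M' N' a']
 obtain h where h: "h \<in> hom_deg E M N' (- ddeg)"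
  "\<And>x. x \<in> carrier M ==> (v o a) x = (a' o u) x +_N' (dd N' (h x) +_N' h (dd M x))"
  by (rule homotopicE[OF sq M N']) (use uD vD aD a'D in auto)
 note hD = hom_degD(2-5)[OF h(1)] and hm = hom_deg_minus[OF M N' h(1)] and hz = hom_deg_zero[OF M N' h(1)]
 have hv: "v (a x) = a' (u x) +_N' (dd N' (h x) +_N' h (dd M x))" if "x \<in> carrier M" for x
  using h(2)[OF that] by simp
 note cl = uD(1) vD(1) aD(1) a'D(1) hD(1)
 define c where "c = (\<lambda>(n, m). (v n +_N' h m, u m))"
 have c: "c \<in> dg_hom E (cone M N a) (cone M' N' a')"
 proof (rule dg_homI)
  fix g x assume "x \<in> gr (cone M N a) g"
  then show "c x \<in> gr (cone M' N' a') g"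
   using uD(4)[of "snd x" "g + ddeg"] vD(4)[of "fst x" g] hD(4)[of "snd x" "g + ddeg"]
   by (auto simp: c_def gr_add N'.gg)
 next
  fix x assume "x \<in> carrier (cone M N a)"
  then obtain n m where x: "x = (n, m)" "n \<in> carrier N" "m \<in> carrier M" by auto
  have "v (dd N n +_N a m) +_N' h (-_M dd M m) =
    dd N' (v n) +_N' (a' (u m) +_N' (dd N' (h m) +_N' h (dd M m))) +_N' -_N' h (dd M m)"
   using x by (simp add: vD aD cl hv hm)
  also have "\<dots> = dd N' (v n +_N' h m) +_N' a' (u m)"
   using x cl by (simp add: N'.d_add)
    (rule lin_solve[OF N'.ag, of _ _ "[dd N' (v n), a' (u m), dd N' (h m), h (dd M m)]"],
     (rule lin_intros)+, simp_all add: x cl upt_conv_Cons)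
  finally show "c (dd (cone M N a) x) = dd (cone M' N' a') (c x)"
   using x by (simp add: c_def uD um)
 qed (auto simp: c_def cl uD vD hD N'.a_ac N'.act_add)
 have "hinj (cone M N a) (cone M' N' a') c"
  unfolding hinj_def
 proof (intro ballI impI)
  fix x x' assume "x \<in> carrier (cone M N a)" "x' \<in> carrier (cone M' N' a')" "dd (cone M N a) x = 0_(cone M N a)"
   "c x = dd (cone M' N' a') x'"
  then obtain n m n' m' where x: "x = (n, m)" "n \<in> carrier N" "m \<in> carrier M" "x' = (n', m')"
   "n' \<in> carrier N'" "m' \<in> carrier M'"
   and dx: "dd N n +_N a m = 0_N" "-_M dd M m = 0_M"
   and cx: "v n +_N' h m = dd N' n' +_N' a' m'" "u m = -_M' dd M' m'" by (auto simp: c_def)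
  have dm: "dd M m = 0_M" using dx x M.minus_minus[of "dd M m"] by simp
  have "u m = dd M' (-_M' m')" using cx x by (simp add: M'.d_minus)
  then obtain m1 where m1: "m1 \<in> carrier M" "m = dd M m1"
   using uq(2)[unfolded hinj_def] x dm M'.a_inv_closed by blast
  have "dd M' (m' +_M' u m1) = dd M' m' +_M' u m" using x m1 cl by (simp add: M'.d_add uD)
  also have "\<dots> = 0_M'" using cx x by (simp add: M'.r_neg)
  finally obtain m2 m3 where m2: "m2 \<in> carrier M" "dd M m2 = 0_M" "m3 \<in> carrier M'"
   "m' +_M' u m1 = u m2 +_M' dd M' m3"
   using uq(3)[unfolded hsurj_def, rule_format, of "m' +_M' u m1"] x m1 cl by auto
  let ?n = "n +_N (a m1 +_N -_N a m2)"
  let ?n' = "n' +_N' h m1 +_N' -_N' h m2 +_N' a' m3"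
  have n: "?n \<in> carrier N" "?n' \<in> carrier N'" using x m1 m2 cl by simp_all
  have dn: "dd N ?n = 0_N"
   using x m1 m2 cl dx z by (simp add: N.d_add N.d_minus aD(5)[symmetric])
  have vm1: "v (a m1) = a' (u m1) +_N' (dd N' (h m1) +_N' h m)"
   unfolding m1(2) by (rule hv[OF m1(1)])
  have vm2: "v (a m2) = a' (u m2) +_N' (dd N' (h m2) +_N' 0_N')"
   using hv[OF m2(1)] unfolding m2(2) hz .
  have "v ?n = v n +_N' (v (a m1) +_N' -_N' v (a m2))"
   using x m1 m2 cl by (simp add: vD vm)
  also have "\<dots> = (v n +_N' h m) +_N' (a' (u m1) +_N' dd N' (h m1) +_N' -_N' a' (u m2) +_N' -_N' dd N' (h m2))"
   unfolding vm1 vm2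
   by (rule lin_solve[OF N'.ag, of _ _ "[v n, a' (u m1), dd N' (h m1), h m, a' (u m2), dd N' (h m2)]"],
     (rule lin_intros)+, simp_all add: x m1(1) m2(1-3) cl upt_conv_Cons)
  also have "v n +_N' h m = dd N' n' +_N' a' m'" by (rule cx(1))
  also have "(dd N' n' +_N' a' m') +_N' (a' (u m1) +_N' dd N' (h m1) +_N' -_N' a' (u m2) +_N' -_N' dd N' (h m2))
   = a' (m' +_M' u m1) +_N' (dd N' n' +_N' dd N' (h m1) +_N' -_N' a' (u m2) +_N' -_N' dd N' (h m2))"
   using x m1(1) m2(1-3) cl by (simp add: a'D N'.a_ac)
  also have "\<dots> = dd N' ?n'"
   unfolding m2(4) using x m1 m2 cl by (simp add: a'D N'.d_add N'.d_minus)
    (rule lin_solve[OF N'.ag, of _ _ "[a' (u m2), dd N' (a' m3), dd N' n', dd N' (h m1), dd N' (h m2)]"],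
     (rule lin_intros)+, simp_all add: x m1(1) m2(1-3) cl upt_conv_Cons)
  finally obtain n3 where n3: "n3 \<in> carrier N" "?n = dd N n3"
   using vq(2)[unfolded hinj_def, rule_format, of ?n ?n'] n dn by blast
  have "n = ?n +_N (a m2 +_N -_N a m1)"
   by (rule lin_solve[OF N.ag, of _ _ "[n, a m1, a m2]"],
     (rule lin_intros)+, simp_all add: x m1(1) m2(1-3) cl upt_conv_Cons)
  then have "n = dd N n3 +_N a (m2 +_M -_M m1)"
   using n3 x m1(1) m2 by (simp add: aD am)
  moreover have "m = -_M dd M (m2 +_M -_M m1)"
   using m1 m2 by (simp add: M.d_add M.d_minus M.minus_minus)
  ultimately have "x = dd (cone M N a) (n3, m2 +_M -_M m1)" using x by simp
  then show "\<exists>w\<in>carrier (cone M N a). x = dd (cone M N a) w"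
   using n3 m1 m2 by (intro bexI[of _ "(n3, m2 +_M -_M m1)"]) simp_all
 qed
 moreover have "hsurj (cone M N a) (cone M' N' a') c"
  unfolding hsurj_def
 proof (intro ballI impI)
  fix y assume "y \<in> carrier (cone M' N' a')" "dd (cone M' N' a') y = 0_(cone M' N' a')"
  then obtain n' m' where y: "y = (n', m')" "n' \<in> carrier N'" "m' \<in> carrier M'"
   and dy: "dd N' n' +_N' a' m' = 0_N'" "-_M' dd M' m' = 0_M'" by auto
  have dm': "dd M' m' = 0_M'" using dy y M'.minus_minus[of "dd M' m'"] by simp
  then obtain m m3 where m: "m \<in> carrier M" "dd M m = 0_M" "m3 \<in> carrier M'" "m' = u m +_M' dd M' m3"
   using uq(3) y unfolding hsurj_def by blast
  have dam: "dd N (a m) = 0_N" using m z by (simp add: aD(5)[symmetric])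
  let ?p = "h m +_N' -_N' n' +_N' -_N' a' m3"
  have am': "dd N' n' +_N' (a' (u m) +_N' dd N' (a' m3)) = 0_N'"
   using dy m cl by (simp add: a'D)
  have "v (a m) = (dd N' n' +_N' (a' (u m) +_N' dd N' (a' m3))) +_N'
    (dd N' (h m) +_N' -_N' dd N' n' +_N' -_N' dd N' (a' m3))"
   unfolding hv[OF m(1)] m(2) hz
   by (rule lin_solve[OF N'.ag, of _ _ "[dd N' n', a' (u m), dd N' (a' m3), dd N' (h m)]"],
     (rule lin_intros)+, simp_all add: y m(1,3) cl upt_conv_Cons)
  also have "\<dots> = dd N' ?p" unfolding am' using y m cl by (simp add: N'.d_add N'.d_minus)
  finally obtain n0 where n0: "n0 \<in> carrier N" "a m = dd N n0"
   using vq(2)[unfolded hinj_def, rule_format, of "a m" ?p] m y cl dam by auto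
  let ?q = "n' +_N' v n0 +_N' -_N' h m +_N' a' m3"
  have q: "?q \<in> carrier N'" using y m n0 cl by simp
  have "dd N' ?q = dd N' n' +_N' v (a m) +_N' -_N' dd N' (h m) +_N' dd N' (a' m3)"
   using y m n0 cl by (simp add: N'.d_add N'.d_minus vD(5))
  also have "\<dots> = dd N' n' +_N' (a' (u m) +_N' dd N' (a' m3))"
   unfolding hv[OF m(1)] m(2) hz
   by (rule lin_solve[OF N'.ag, of _ _ "[dd N' n', a' (u m), dd N' (a' m3), dd N' (h m)]"],
     (rule lin_intros)+, simp_all add: y m(1,3) cl upt_conv_Cons)
  finally have "dd N' ?q = 0_N'" using am' by simp
  then obtain n2 n3 where n2: "n2 \<in> carrier N" "dd N n2 = 0_N" "n3 \<in> carrier N'" "?q = v n2 +_N' dd N' n3"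
   using vq(3)[unfolded hsurj_def, rule_format, of ?q] q by blast
  let ?w = "(n2 +_N -_N n0, m)" and ?r = "(n3, -_M' m3)"
  have "n' = ?q +_N' (-_N' v n0 +_N' h m +_N' -_N' a' m3)"
   by (rule lin_solve[OF N'.ag, of _ _ "[n', v n0, h m, a' m3]"],
     (rule lin_intros)+, simp_all add: y m(1,3) n0(1) cl upt_conv_Cons)
  also have "\<dots> = (v n2 +_N' -_N' v n0 +_N' h m) +_N' (dd N' n3 +_N' -_N' a' m3)"
   unfolding n2(4)
   by (rule lin_solve[OF N'.ag, of _ _ "[v n2, dd N' n3, v n0, h m, a' m3]"],
     (rule lin_intros)+, simp_all add: y m(1,3) n0(1) n2(1,3) cl upt_conv_Cons)
  finally have "y = c ?w +_(cone M' N' a') dd (cone M' N' a') ?r"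
   using y m n0 n2 cl by (simp add: c_def vD vm a'm M'.d_minus M'.minus_minus)
  moreover have "dd (cone M N a) ?w = 0_(cone M N a)"
   using m n0 n2 cl by (simp add: N.d_add N.d_minus N.l_neg)
  moreover have "?w \<in> carrier (cone M N a)" "?r \<in> carrier (cone M' N' a')" using m n0 n2 by simp_all
  ultimately show "\<exists>x\<in>carrier (cone M N a). dd (cone M N a) x = 0_(cone M N a) \<and>
    (\<exists>z\<in>carrier (cone M' N' a'). y = c x +_(cone M' N' a') dd (cone M' N' a') z)" by blast
 qed
 ultimately have "quasi_iso E (cone M N a) (cone M' N' a') c"
  by (rule quasi_isoI[OF c _ _ dgm_cx[OF C] dgm_cx[OF C']])
 then show ?thesis using that by blast
qed

lemma quasi_iso_dsum:
 assumes M: "dg_module E M" and N: "dg_module E N" and M': "dg_module E M'" and N': "dg_module E N'"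
  and f: "quasi_iso E M N f" and g: "quasi_iso E M' N' g"
  and C: "dg_module E (dsum M M')" and C': "dg_module E (dsum N N')"
 shows "quasi_iso E (dsum M M') (dsum N N') (map_prod f g)"
proof -
 note fq = quasi_isoD[OF f M dgm_cx[OF N]] and gq = quasi_isoD[OF g M' dgm_cx[OF N']]
 note fD = dg_homD(2-6)[OF fq(1)] and gD = dg_homD(2-6)[OF gq(1)]
 show ?thesis
 proof (rule quasi_isoI[OF _ _ _ dgm_cx[OF C] dgm_cx[OF C']])
  show "map_prod f g \<in> dg_hom E (dsum M M') (dsum N N')"
   by (rule dg_homI) (auto simp: fD gD)
  show "hinj (dsum M M') (dsum N N') (map_prod f g)"
   unfolding hinj_def
  proof (intro ballI impI)
   fix x z assume xz: "x \<in> carrier (dsum M M')" "z \<in> carrier (dsum N N')" "dd (dsum M M') x = 0_(dsum M M')"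
    "map_prod f g x = dd (dsum N N') z"
   obtain x1 x2 z1 z2 where e: "x = (x1, x2)" "z = (z1, z2)" by (cases x, cases z)
   obtain w1 where "w1 \<in> carrier M" "x1 = dd M w1" using fq(2) xz e unfolding hinj_def by auto
   moreover obtain w2 where "w2 \<in> carrier M'" "x2 = dd M' w2" using gq(2) xz e unfolding hinj_def by auto
   ultimately show "\<exists>w\<in>carrier (dsum M M'). x = dd (dsum M M') w"
    using e by (intro bexI[of _ "(w1, w2)"]) simp_all
  qed
  show "hsurj (dsum M M') (dsum N N') (map_prod f g)"
   unfolding hsurj_def
  proof (intro ballI impI)
   fix y assume y: "y \<in> carrier (dsum N N')" "dd (dsum N N') y = 0_(dsum N N')"
   obtain y1 y2 where e: "y = (y1, y2)" by (cases y)
   obtain x1 z1 where 1: "x1 \<in> carrier M" "dd M x1 = 0_M" "z1 \<in> carrier N" "y1 = f x1 +_N dd N z1"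
    using fq(3) y e unfolding hsurj_def by auto
   obtain x2 z2 where 2: "x2 \<in> carrier M'" "dd M' x2 = 0_M'" "z2 \<in> carrier N'" "y2 = g x2 +_N' dd N' z2"
    using gq(3) y e unfolding hsurj_def by auto
   show "\<exists>x\<in>carrier (dsum M M'). dd (dsum M M') x = 0_(dsum M M') \<and>
     (\<exists>z\<in>carrier (dsum N N'). y = map_prod f g x +_(dsum N N') dd (dsum N N') z)"
    by (rule bexI[of _ "(x1, x2)"], rule conjI, use 1 2 in simp,
     rule bexI[of _ "(z1, z2)"], use 1 2 e in simp_all)
  qed
 qed
qed

text \<open>
Modules obtained from the regular one by finitely many shifts and cones, without summands. K-projectivity,
perfectness, boundedness and compatibility with totalization are then simple inductions.
\<close>

inductive fcell :: "'u itself => ('k, 'g::dg_grading, 'e) dg => ('e, 'g, 'u) dg => bool"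
 for U :: "'u itself" and E :: "('k, 'g, 'e) dg" where
 fcell_regular: "dg_module E Z ==> dg_isom E (regular E) Z ==> fcell U E Z"
| fcell_shift: "fcell U E X ==> dg_module E Z ==> dg_isom E (shift s X) Z ==> fcell U E Z"
| fcell_cone: "fcell U E X ==> fcell U E Y ==> f \<in> dg_hom E X Y ==> dg_module E Z ==>
  dg_isom E (cone X Y f) Z ==> fcell U E Z"

lemma fcell_dgm: "fcell U E X ==> dg_module E X"
 by (erule fcell.cases) simp_all

lemma dg_inv_dsum:
 assumes "dg_inv E M N f g" "dg_inv E M' N' f' g'"
 shows "dg_inv E (dsum M M') (dsum N N') (map_prod f f') (map_prod g g')"
 using dg_homD(2-6)[OF dg_invD(1)[OF assms(1)]] dg_homD(2-6)[OF dg_invD(2)[OF assms(1)]]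
  dg_homD(2-6)[OF dg_invD(1)[OF assms(2)]] dg_homD(2-6)[OF dg_invD(2)[OF assms(2)]]
  dg_invD(3,4)[OF assms(1)] dg_invD(3,4)[OF assms(2)]
 unfolding dg_inv_def by (auto intro!: dg_homI)

lemma dsum_assoc_inv:
 "dg_inv E (dsum (dsum X Y) Z) (dsum X (dsum Y Z)) (\<lambda>((x, y), z). (x, (y, z))) (\<lambda>(x, (y, z)). ((x, y), z))"
 unfolding dg_inv_def by (auto intro!: dg_homI)

lemma cone_dsum_inv:
 "dg_inv E (cone (dsum X X') (dsum Y Y') (map_prod f f')) (dsum (cone X Y f) (cone X' Y' f'))
   (\<lambda>((y, y'), (x, x')). ((y, x), (y', x'))) (\<lambda>((y, x), (y', x')). ((y, y'), (x, x')))"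
 if "cx X" "cx X'"
 unfolding dg_inv_def using that
 by (auto intro!: dg_homI simp: dsum_a_inv cx.ag cx.d_closed)

text \<open>
A quasi-isomorphism onto the sum expresses an isomorphism in the derived category, because maps out of the K-projective
module \<open>T\<close> lift along quasi-isomorphisms.
\<close>

definition cell_summand :: "'u itself => ('k, 'g::dg_grading, 'e) dg => ('e, 'g, 'x) dg => bool" where
 "cell_summand U E X \<longleftrightarrow> (\<exists>(X' :: ('e, 'g, 'u) dg) (T :: ('e, 'g, 'u) dg) t.
   dg_module E X' \<and> fcell U E T \<and> quasi_iso E T (dsum X X') t)"

context zalg
begin

lemma fcell_isom: "fcell U E X ==> dg_module E Z ==> dg_isom E X Z ==> fcell U E Z"
proof -
 assume a: "fcell U E X" "dg_module E Z" "dg_isom E X Z"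
 have "dg_isom E (shift 0 X) X"
  unfolding dg_isom_def
  by (intro exI, rule dg_inv_id[of "shift 0 X" X])
   (simp_all add: shift_graded dgm_gg[OF fcell_dgm[OF a(1)]] koszul_even)
 then show ?thesis using fcell_shift[OF a(1,2)] dg_isom_trans a(3) by blast
qed

lemma fcell_K: "fcell TYPE('u) E X ==> K_projective TYPE('u) E X"
proof (induction rule: fcell.induct)
 case (fcell_regular Z)
 then show ?case using K_isom[OF K_regular] by blast
next
 case (fcell_shift X Z s)
 then show ?case using K_isom[OF K_shift] by blast
next
 case (fcell_cone X Y f Z)
 then show ?case using K_isom[OF K_cone] by blast
qed

lemma cell_summand_regroup:
 assumes "fcell TYPE('u) E T" "quasi_iso E T W t" "dg_module E W"
  "dg_isom E W (dsum X V)" "dg_module E X" "dg_module E V" "emb TYPE('u) V"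
 shows "cell_summand TYPE('u) E X"
proof -
 obtain V' :: "('e, 'g, 'u) dg" where V': "dg_module E V'" "dg_isom E V V'"
  by (rule emb_obtain[OF assms(6,7)])
 obtain a b where ab: "dg_inv E V V' a b" using V' unfolding dg_isom_def by blast
 obtain f g where fg: "dg_inv E W (dsum X V) f g" using assms(4) unfolding dg_isom_def by blast
 have i: "dg_inv E X X id id" by (simp add: dg_inv_def dg_hom_id)
 note c = dg_inv_comp[OF fg dg_inv_dsum[OF i ab]]
 have D: "dg_module E (dsum X V')" by (rule dsum_dgm[OF assms(5) V'(1)])
 have "quasi_iso E T (dsum X V') ((map_prod id a o f) o t)"
  by (rule quasi_iso_comp[OF assms(2) dg_inv_quasi_iso[OF c] fcell_dgm[OF assms(1)] assms(3)])
   (simp_all add: dgm_cx[OF D] dgm_cx[OF assms(3)])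
 then show ?thesis unfolding cell_summand_def using V'(1) assms(1) by blast
qed

lemma cell_summand_span:
 fixes X :: "('e, 'g, 'x) dg" and Y :: "('e, 'g, 'y) dg"
 assumes inf: "infinite (UNIV :: 'u set)" and s: "cell_summand TYPE('u) E X" and X: "dg_module E X" and Y: "dg_module E Y"
  and eX: "emb TYPE('u) X" and d: "derived_iso TYPE('u) E X Y"
 shows "cell_summand TYPE('u) E Y"
proof -
 obtain X' T :: "('e, 'g, 'u) dg" and t
  where T: "dg_module E X'" "fcell TYPE('u) E T" "quasi_iso E T (dsum X X') t"
  using s unfolding cell_summand_def by blast
 obtain Z :: "('e, 'g, 'u) dg" and a b where Z: "dg_module E Z" "quasi_iso E Z X a" "quasi_iso E Z Y b"
  by (rule derived_iso_spanD[OF d X Y])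
 have i: "quasi_iso E X' X' id"
  by (rule dg_inv_quasi_iso[of _ _ _ _ id]) (simp_all add: dg_inv_def dg_hom_id dgm_cx[OF T(1)])
 note DX = dsum_dgm[OF X T(1)] and DZ = dsum_dgm[OF Z(1) T(1)] and DY = dsum_dgm[OF Y T(1)]
 have qa: "quasi_iso E (dsum Z X') (dsum X X') (map_prod a id)"
  by (rule quasi_iso_dsum[OF Z(1) X T(1) T(1) Z(2) i DZ DX])
 have qb: "quasi_iso E (dsum Z X') (dsum Y X') (map_prod b id)"
  by (rule quasi_iso_dsum[OF Z(1) Y T(1) T(1) Z(3) i DZ DY])
 have e: "emb TYPE('u) (dsum Z X')" "emb TYPE('u) (dsum X X')"
  by (rule emb_dsum[OF inf]; simp add: eX)+
 note Td = fcell_dgm[OF T(2)]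
 note tD = quasi_isoD(1)[OF T(3) Td dgm_cx[OF DX]]
 obtain w where w: "w \<in> dg_hom E T (dsum Z X')" "homotopic E T (dsum X X') (map_prod a id o w) t"
  by (rule K_lift[OF inf e fcell_K[OF T(2)] DZ DX qa tD])
 have aw: "map_prod a id o w \<in> dg_hom E T (dsum X X')"
  by (rule dg_hom_comp[OF w(1) quasi_isoD(1)[OF qa DZ dgm_cx[OF DX]]])
 have "quasi_iso E T (dsum X X') (map_prod a id o w)"
  by (rule quasi_iso_homotopic[OF homotopic_sym[OF w(2) Td DX aw tD] Td DX aw T(3)])
 then have "quasi_iso E T (dsum Z X') w"
  by (rule quasi_iso_cancel_left[OF _ qa Td DZ DX w(1)])
 then have "quasi_iso E T (dsum Y X') (map_prod b id o w)"
  by (rule quasi_iso_comp[OF _ qb Td DZ dgm_cx[OF DY]])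
 then show ?thesis unfolding cell_summand_def using T by blast
qed

text \<open>
If \<open>T\<close> and \<open>S\<close> are finite cell modules for \<open>X\<close> and \<open>Y\<close>, with complements \<open>X'\<close> and \<open>Y'\<close>, the sum of \<open>f\<close> and the
zero map lifts to a morphism from \<open>T\<close> to \<open>S\<close>. Its cone is a finite cell module for the cone of \<open>f\<close>, with
complement the cone of the zero map from \<open>X'\<close> to \<open>Y'\<close>.
\<close>

lemma cell_summand_cone:
 fixes X Y :: "('e, 'g, 'u) dg"
 assumes inf: "infinite (UNIV :: 'u set)" and sX: "cell_summand TYPE('u) E X" and sY: "cell_summand TYPE('u) E Y"
  and X: "dg_module E X" and Y: "dg_module E Y" and f: "f \<in> dg_hom E X Y"
 shows "cell_summand TYPE('u) E (cone X Y f)"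
proof -
 obtain X' T :: "('e, 'g, 'u) dg" and t
  where T: "dg_module E X'" "fcell TYPE('u) E T" "quasi_iso E T (dsum X X') t"
  using sX unfolding cell_summand_def by blast
 obtain Y' S :: "('e, 'g, 'u) dg" and s
  where S: "dg_module E Y'" "fcell TYPE('u) E S" "quasi_iso E S (dsum Y Y') s"
  using sY unfolding cell_summand_def by blast
 note DX = dsum_dgm[OF X T(1)] and DY = dsum_dgm[OF Y S(1)]
 note Td = fcell_dgm[OF T(2)] and Sd = fcell_dgm[OF S(2)]
 note tD = quasi_isoD(1)[OF T(3) Td dgm_cx[OF DX]]
 define z where "z = (\<lambda>_ :: 'u. 0_Y')"
 have z: "z \<in> dg_hom E X' Y'" unfolding z_def by (rule dg_hom_zero_map[OF T(1) S(1)])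
 have F: "map_prod f z \<in> dg_hom E (dsum X X') (dsum Y Y')"
  using dg_homD(2-6)[OF f] dg_homD(2-6)[OF z] by (intro dg_homI) auto
 have e: "emb TYPE('u) (dsum Y Y')" by (rule emb_dsum[OF inf]) simp_all
 have Ft: "map_prod f z o t \<in> dg_hom E T (dsum Y Y')" by (rule dg_hom_comp[OF tD F])
 obtain w where w: "w \<in> dg_hom E T S" "homotopic E T (dsum Y Y') (s o w) (map_prod f z o t)"
  by (rule K_lift[OF inf emb_self e fcell_K[OF T(2)] Sd DY S(3) Ft])
 note C = cone_dgm[OF Td Sd w(1)] and C' = cone_dgm[OF DX DY F]
 obtain c where c: "quasi_iso E (cone T S w) (cone (dsum X X') (dsum Y Y') (map_prod f z)) c"
  by (rule cone_map_quasi_iso[OF Td Sd DX DY w(1) F T(3) S(3) w(2) C C'])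
 have eC: "emb TYPE('u) (cone T S w)" by (rule emb_cone[OF inf]) simp_all
 obtain W :: "('e, 'g, 'u) dg" where W: "dg_module E W" "dg_isom E (cone T S w) W"
  by (rule emb_obtain[OF C eC])
 obtain p q where pq: "dg_inv E W (cone T S w) p q"
  using dg_isom_sym[OF W(2)] unfolding dg_isom_def by blast
 have Wc: "fcell TYPE('u) E W" by (rule fcell_cone[OF T(2) S(2) w(1) W])
 have q: "quasi_iso E W (cone (dsum X X') (dsum Y Y') (map_prod f z)) (c o p)"
  by (rule quasi_iso_comp[OF dg_inv_quasi_iso[OF pq dgm_cx[OF W(1)] dgm_cx[OF C]] c W(1) C dgm_cx[OF C']])
 have i: "dg_isom E (cone (dsum X X') (dsum Y Y') (map_prod f z)) (dsum (cone X Y f) (cone X' Y' z))"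
  unfolding dg_isom_def using cone_dsum_inv[OF dgm_cx[OF X] dgm_cx[OF T(1)]] by blast
 show ?thesis
  by (rule cell_summand_regroup[OF Wc q C' i cone_dgm[OF X Y f] cone_dgm[OF T(1) S(1) z]])
   (rule emb_cone[OF inf]; simp)
qed

lemma cell_summand_shift:
 fixes X :: "('e, 'g, 'u) dg"
 assumes sX: "cell_summand TYPE('u) E X" and X: "dg_module E X"
 shows "cell_summand TYPE('u) E (shift s X)"
proof -
 obtain X' T :: "('e, 'g, 'u) dg" and t
  where T: "dg_module E X'" "fcell TYPE('u) E T" "quasi_iso E T (dsum X X') t"
  using sX unfolding cell_summand_def by blast
 note D = dsum_dgm[OF X T(1)] and Td = fcell_dgm[OF T(2)]
 have q: "quasi_iso E (shift s T) (shift s (dsum X X')) t" by (rule quasi_iso_shift[OF Td D T(3)])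
 have c: "fcell TYPE('u) E (shift s T)"
  by (rule fcell_shift[OF T(2) shift_dgm[OF Td] dg_isom_refl])
 have "dg_inv E (shift s (dsum X X')) (dsum (shift s X) (shift s X')) id id"
  by (rule dg_inv_id[OF shift_graded[OF dgm_gg[OF D]]])
   (auto simp: koszul_def dsum_a_inv dgm_ag[OF X] dgm_ag[OF T(1)] cx.d_closed[OF dgm_cx[OF X]] cx.d_closed[OF dgm_cx[OF T(1)]])
 then have i: "dg_isom E (shift s (dsum X X')) (dsum (shift s X) (shift s X'))"
  unfolding dg_isom_def by blast
 show ?thesis
  by (rule cell_summand_regroup[OF c q shift_dgm[OF D] i shift_dgm[OF X] shift_dgm[OF T(1)]]) simp
qed

lemma thick_dgm: "thick U E G X ==> dg_module E X"
 by (induction rule: thick.induct) (simp_all add: shift_dgm)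

text \<open>
Every operation of the thick closure preserves derived summands of finite cell modules; passing to a summand
merely enlarges the complement.
\<close>

lemma thick_cell_summand:
 fixes G :: "('e, 'g, 'u) dg => bool"
 assumes inf: "infinite (UNIV :: 'u set)"
  and gen: "\<And>X. dg_module E X ==> G X ==> cell_summand TYPE('u) E X"
  and "thick TYPE('u) E G X"
 shows "cell_summand TYPE('u) E X"
 using assms(3)
proof (induction rule: thick.induct)
 case (thick_gen X)
 then show ?case by (rule gen)
next
 case (thick_iso X Y)
 show ?case
  by (rule cell_summand_span[OF inf thick_iso(4) thick_dgm[OF thick_iso(1)] thick_iso(2) emb_self thick_iso(3)])
next
 case (thick_shift X)
 then show ?case using cell_summand_shift thick_dgm by blast
next
 case (thick_unshift X)
 then show ?case using cell_summand_shift thick_dgm by blast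
next
 case (thick_cone X Y f Z)
 note X = thick_dgm[OF thick_cone(1)] and Y = thick_dgm[OF thick_cone(2)]
 have e: "emb TYPE('u) (cone X Y f)" by (rule emb_cone[OF inf]) simp_all
 have "cell_summand TYPE('u) E (cone X Y f)"
  by (rule cell_summand_cone[OF inf _ _ X Y thick_cone(3)]) (use thick_cone in simp_all)
 then show ?case
  by (rule cell_summand_span[OF inf _ cone_dgm[OF X Y thick_cone(3)] thick_cone(4) e thick_cone(5)])
next
 case (thick_summand X Y Y')
 note X = thick_dgm[OF thick_summand(1)] and Y = thick_summand(2) and Y' = thick_summand(3)
 have "cell_summand TYPE('u) E (dsum Y Y')"
  by (rule cell_summand_span[OF inf thick_summand(5) X dsum_dgm[OF Y Y'] emb_self thick_summand(4)])
 then obtain X' T :: "('e, 'g, 'u) dg" and t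
  where T: "dg_module E X'" "fcell TYPE('u) E T" "quasi_iso E T (dsum (dsum Y Y') X') t"
  unfolding cell_summand_def by blast
 have i: "dg_isom E (dsum (dsum Y Y') X') (dsum Y (dsum Y' X'))"
  unfolding dg_isom_def using dsum_assoc_inv by blast
 show ?case
  by (rule cell_summand_regroup[OF T(2,3) dsum_dgm[OF dsum_dgm[OF Y Y'] T(1)] i Y dsum_dgm[OF Y' T(1)]])
   (rule emb_dsum[OF inf]; simp)
qed

lemma thick_isom:
 assumes "thick TYPE('u) E G X" "dg_module E Y" "dg_isom E X Y" shows "thick TYPE('u) E G Y"
 by (rule thick_iso[OF assms(1,2)]) (rule derived_iso_isom[OF assms(3) thick_dgm[OF assms(1)] assms(2)])

end

text \<open>
With integer grading every shift is an iterate of the shift by \<open>ddeg\<close> or its inverse, the only shifts under which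
the thick closure is closed by definition.
\<close>

lemma fcell_thick:
 fixes E :: "('k, int, 'e) dg" and X :: "('e, int, 'u) dg"
 assumes E: "zalg E" and X: "fcell TYPE('u) E X"
 shows "thick TYPE('u) E (\<lambda>P. derived_iso TYPE('u) E P (regular E)) X"
proof -
 interpret zalg E by fact
 let ?t = "thick TYPE('u) E (\<lambda>P. derived_iso TYPE('u) E P (regular E))"
 have sh1: "?t (shift 1 X) \<and> ?t (shift (- 1) X)" if "?t X" for X
  using thick_shift[OF that] thick_unshift[OF that] by (simp add: ddeg_int_def)
 have iso: "dg_isom E (shift a (shift b X)) (shift (a + b) X)" if "dg_module E X" for X :: "('e, int, 'u) dg" and a b
  unfolding dg_isom_def using shift_shift_inv(1)[OF that] by blast
 have sh: "?t (shift s X)" if t: "?t X" for X s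
 proof (induction s rule: int_induct[where k = 0])
  case base
  have "dg_isom E X (shift 0 X)"
   unfolding dg_isom_def by (intro exI, rule dg_inv_id) (simp_all add: dgm_gg[OF thick_dgm[OF t]] koszul_even)
  then show ?case by (rule thick_isom[OF t shift_dgm[OF thick_dgm[OF t]]])
 next
  case (step1 i)
  from iso[OF thick_dgm[OF t], of 1 i] have "dg_isom E (shift 1 (shift i X)) (shift (i + 1) X)" by (simp add: add.commute)
  then show ?case using thick_isom[OF conjunct1[OF sh1[OF step1(2)]] shift_dgm[OF thick_dgm[OF t]]] by blast
 next
  case (step2 i)
  from iso[OF thick_dgm[OF t], of "- 1" i] have "dg_isom E (shift (- 1) (shift i X)) (shift (i - 1) X)" by simp
  then show ?case using thick_isom[OF conjunct2[OF sh1[OF step2(2)]] shift_dgm[OF thick_dgm[OF t]]] by blast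
 qed
 show ?thesis using X
 proof (induction rule: fcell.induct)
  case (fcell_regular Z)
  show ?case by (rule thick_gen[OF fcell_regular(1)])
   (rule derived_iso_isom(1)[OF dg_isom_sym[OF fcell_regular(2)] fcell_regular(1) regular_dgm])
 next
  case (fcell_shift X Z s)
  then show ?case using thick_isom[OF sh] by blast
 next
  case (fcell_cone X Y f Z)
  have d: "derived_iso TYPE('u) E (cone X Y f) Z"
   by (rule derived_iso_isom(2)[OF dg_isom_sym[OF fcell_cone(5)] fcell_cone(4)])
    (rule cone_dgm[OF fcell_dgm[OF fcell_cone(1)] fcell_dgm[OF fcell_cone(2)] fcell_cone(3)])
  show ?case by (rule thick_cone[OF fcell_cone(6,7,3,4) d])
 qed
qed

section \<open>Finitely generated graded projective modules\<close>

lemma graded_mod_d0: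
 assumes "graded_mod E M" "x \<in> carrier M" shows "dd M x = 0_M"
proof -
 have M: "dg_module E M" and c: "\<And>p i. p \<noteq> 0 ==> gr M (p, i) = {0_M}"
  using assms(1) by (simp_all add: graded_mod_def)
 interpret M: dgmod E M using M by blast
 have z: "(\<lambda>_. 0_M) \<in> ahom M M" by (rule ahomI) simp_all
 have h: "dd M x = 0_M" if x: "x \<in> gr M g" for g x
 proof -
  obtain p i where g: "g = (p, i)" by (cases g)
  show ?thesis
  proof (cases "p = 0")
   case True
   have "dd M x \<in> gr M (1, i)" using M.d_gr[OF x] g True by (simp add: ddeg_prod_def ddeg_int_def)
   then show ?thesis using c[of 1 i] by simp
  next
   case False
   then show ?thesis using x g c by simp
  qed
 qed
 show ?thesis by (rule ahom_eqI[OF M.gg M.ag M.d_hom z h assms(2)])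
qed

lemma graded_mod_isom:
 assumes "graded_mod E M" "dg_module E N" "dg_isom E M N" shows "graded_mod E N"
proof -
 obtain f g where fg: "dg_inv E M N f g" using assms(3) unfolding dg_isom_def by blast
 note i = dg_invD[OF fg]
 have M: "dg_module E M" using assms(1) by (simp add: graded_mod_def)
 have "gr N (p, j) = {0_N}" if "p \<noteq> 0" for p j
 proof -
  have "x = 0_N" if "x \<in> gr N (p, j)" for x
  proof -
   have "g x = 0_M" using dg_homD(5)[OF i(2) that] assms(1) \<open>p \<noteq> 0\<close> by (auto simp: graded_mod_def)
   then show ?thesis using i(4)[OF gr_carrier[OF dgm_gg[OF assms(2)] that]]
     dg_hom_zero[OF M assms(2) i(1)] by simp
  qed
  then show ?thesis using gr_zero[OF dgm_gg[OF assms(2)]] by blast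
 qed
 then show ?thesis using assms(2) by (simp add: graded_mod_def)
qed

locale concentrated_alg = zalg E for E :: "('k, int \<times> int, 'e) dg" (structure) +
 assumes conc: "p \<noteq> 0 ==> gr E (p, i) = {\<zero>}"
begin

text \<open>
Each generator \<open>b\<close> contributes a shifted copy of the regular module. It is attached as the cone of a zero map, so
the free module that results is a finite cell module.
\<close>

lemma cover_homogeneous:
 fixes P :: "('e, int \<times> int, 'u) dg"
 assumes inf: "infinite (UNIV :: 'u set)" and e: "emb TYPE('u) (regular E)" and P: "graded_mod E P"
  and "finite B" "\<And>b. b \<in> B ==> \<exists>i. b \<in> gr P (0, i)"
 shows "\<exists>(F :: ('e, int \<times> int, 'u) dg) \<pi>. fcell TYPE('u) E F \<and> graded_mod E F \<and> \<pi> \<in> dg_hom E F P \<and> B \<subseteq> \<pi> ` carrier F"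
 using assms(4,5)
proof (induction B rule: finite_induct)
 case empty
 obtain F :: "('e, int \<times> int, 'u) dg" where F: "dg_module E F" "dg_isom E (regular E) F"
  by (rule emb_obtain[OF regular_dgm e])
 have "graded_mod E (regular E)" unfolding graded_mod_def using regular_dgm conc by simp
 then have "graded_mod E F" by (rule graded_mod_isom[OF _ F])
 moreover have "(\<lambda>_. 0_P) \<in> dg_hom E F P"
  by (rule dg_hom_zero_map[OF F(1)]) (use P in "simp add: graded_mod_def")
 ultimately show ?case using fcell_regular[OF F] by blast
next
 case (insert b B)
 have Pm: "dg_module E P" using P by (simp add: graded_mod_def)
 interpret P: dgmod E P using Pm by blast
 obtain F :: "('e, int \<times> int, 'u) dg" and \<pi>
  where F: "fcell TYPE('u) E F" "graded_mod E F" "\<pi> \<in> dg_hom E F P" "B \<subseteq> \<pi> ` carrier F"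
  using insert by blast
 note Fm = fcell_dgm[OF F(1)] and \<pi> = dg_homD[OF F(3)] and \<pi>0 = dg_hom_zero[OF fcell_dgm[OF F(1)] Pm F(3)]
 interpret F: dgmod E F using Fm by blast
 obtain i where b: "b \<in> gr P (0, i)" using insert by blast
 have bc: "b \<in> carrier P" by (rule P.gr_closed[OF b])
 define s :: "int \<times> int" where "s = (0, - i) - ddeg"
 obtain R :: "('e, int \<times> int, 'u) dg" where R: "dg_module E R" "dg_isom E (regular E) R"
  by (rule emb_obtain[OF regular_dgm e])
 have S: "dg_module E (shift s (regular E))" by (rule shift_dgm[OF regular_dgm])
 obtain X :: "('e, int \<times> int, 'u) dg" where X: "dg_module E X" "dg_isom E (shift s (regular E)) X"
  by (rule emb_obtain[OF S, unfolded emb_shift, OF e])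
 obtain \<alpha> \<beta> where ab: "dg_inv E (shift s (regular E)) X \<alpha> \<beta>" using X(2) unfolding dg_isom_def by blast
 note abD = dg_invD[OF ab, simplified]
 note \<alpha> = dg_homD[OF abD(1), simplified] and \<beta> = dg_homD[OF abD(2), simplified]
 have "dg_isom E (shift s R) X"
 proof -
  obtain p q where pq: "dg_inv E (regular E) R p q" using R(2) unfolding dg_isom_def by blast
  have "dg_inv E (shift s (regular E)) (shift s R) p q"
   using dg_invD[OF pq] dg_hom_shift[OF regular_dgm R(1)] dg_hom_shift[OF R(1) regular_dgm]
   by (simp add: dg_inv_def)
  then have "dg_isom E (shift s R) (shift s (regular E))" unfolding dg_isom_def using dg_invD(5) by blast
  then show ?thesis using X(2) by (rule dg_isom_trans)
 qed
 then have Xc: "fcell TYPE('u) E X" by (rule fcell_shift[OF fcell_regular[OF R] X(1)])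
 interpret X: dgmod E X using X(1) by blast
 define z where "z = (\<lambda>_ :: 'u. 0_F)"
 have z: "z \<in> dg_hom E X F" unfolding z_def by (rule dg_hom_zero_map[OF X(1) Fm])
 let ?C = "cone X F z"
 have C: "dg_module E ?C" by (rule cone_dgm[OF X(1) Fm z])
 have grC: "gr ?C (p, j) = {0_?C}" if "p \<noteq> 0" for p j
 proof -
  have "x = 0_X" if x: "x \<in> gr X ((p, j) + ddeg)" for x
  proof -
   have "\<beta> x \<in> gr E (p, j - i)" using \<beta>(5)[OF x] by (simp add: s_def ac_simps)
   then have "\<beta> x = \<zero>" using conc[OF \<open>p \<noteq> 0\<close>] by simp
   then show ?thesis using abD(4)[OF X.gr_closed[OF x]] dg_hom_zero[OF S X(1) abD(1)] by simp
  qed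
  then show ?thesis using F(2) that X.gg by (auto simp: graded_mod_def)
 qed
 have gC: "graded_mod E ?C" using C grC by (simp add: graded_mod_def)
 define \<phi> where "\<phi> = (\<lambda>u. \<pi> (fst u) +_P ract P b (\<beta> (snd u)))"
 have \<phi>: "\<phi> \<in> dg_hom E ?C P"
 proof (rule dg_homI)
  fix g u assume u: "u \<in> gr ?C g"
  have "\<beta> (snd u) \<in> gr E (g + ddeg + s)" using \<beta>(5)[of "snd u" "g + ddeg"] u by auto
  from P.act_gr[OF b this] have "ract P b (\<beta> (snd u)) \<in> gr P ((0, i) + (g + ddeg + s))" .
  also have "(0, i) + (g + ddeg + s) = g" by (simp add: s_def zero_prod_def[symmetric] prod_eq_iff)
  finally show "\<phi> u \<in> gr P g" using \<pi>(5)[of "fst u" g] u by (auto simp: \<phi>_def gr_add P.gg)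
 next
  fix u assume u: "u \<in> carrier ?C"
  have "dd P (\<phi> u) = 0_P" by (rule graded_mod_d0[OF P]) (use u \<pi>(2) \<beta>(2) bc in "auto simp: \<phi>_def")
  moreover have "dd ?C u = 0_?C" by (rule graded_mod_d0[OF gC u])
  moreover have "\<phi> 0_?C = 0_P"
   using dg_hom_zero[OF X(1) S abD(2)] by (simp add: \<phi>_def \<pi>0 act_ring_zero[OF Pm bc])
  ultimately show "\<phi> (dd ?C u) = dd P (\<phi> u)" by simp
 qed (auto simp: \<phi>_def \<pi> \<beta> bc P.a_ac P.act_add_right P.act_add P.act_act cone_proj)
 have eC: "emb TYPE('u) ?C" by (rule emb_cone[OF inf]) simp_all
 obtain W :: "('e, int \<times> int, 'u) dg" where W: "dg_module E W" "dg_isom E ?C W"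
  by (rule emb_obtain[OF C eC])
 obtain p q where pq: "dg_inv E ?C W p q" using W(2) unfolding dg_isom_def by blast
 note pqD = dg_invD[OF pq]
 have im: "x \<in> (\<phi> o q) ` carrier W" if "u \<in> carrier ?C" "x = \<phi> u" for u x
 proof -
  have "x = (\<phi> o q) (p u)" using that pqD(3)[OF that(1)] by simp
  then show ?thesis using dg_homD(2)[OF pqD(1) that(1)] by blast
 qed
 have "insert b B \<subseteq> (\<phi> o q) ` carrier W"
 proof (rule insert_subsetI)
  have "b = \<phi> (0_F, \<alpha> \<one>)" using bc abD(3)[of \<one>] by (simp add: \<phi>_def \<pi>0)
  then show "b \<in> (\<phi> o q) ` carrier W" by (rule im[rotated]) (simp add: \<alpha>)
  show "B \<subseteq> (\<phi> o q) ` carrier W"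
  proof
   fix x assume "x \<in> B"
   then obtain y where y: "y \<in> carrier F" "x = \<pi> y" using F(4) by blast
   have "x = \<phi> (y, 0_X)"
    using y \<pi> dg_hom_zero[OF X(1) S abD(2)] by (simp add: \<phi>_def act_ring_zero[OF Pm bc])
   then show "x \<in> (\<phi> o q) ` carrier W" by (rule im[rotated]) (simp add: y)
  qed
 qed
 moreover have "\<phi> o q \<in> dg_hom E W P" by (rule dg_hom_comp[OF pqD(2) \<phi>])
 moreover have "graded_mod E W" by (rule graded_mod_isom[OF gC W])
 moreover have "fcell TYPE('u) E W" by (rule fcell_cone[OF Xc F(1) z W])
 ultimately show ?case by blast
qed

text \<open>
A surjection \<open>\<pi>\<close> from a finite free module \<open>F\<close> to \<open>P\<close> has a section \<open>j\<close>, and \<open>F\<close> is the sum of \<open>P\<close> and a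
complement. The cone of \<open>j\<close>, which is quasi-isomorphic to the kernel of \<open>\<pi>\<close>, serves as the complement.
\<close>

lemma fg_graded_projective_cell_summand:
 fixes P :: "('e, int \<times> int, 'u) dg"
 assumes inf: "infinite (UNIV :: 'u set)" and e: "emb TYPE('u) (regular E)"
  and P: "fg_graded_projective TYPE('u) E P"
 shows "cell_summand TYPE('u) E P"
proof -
 have gP: "graded_mod E P" using P by (simp add: fg_graded_projective_def)
 then have Pm: "dg_module E P" by (simp add: graded_mod_def)
 interpret P: dgmod E P using Pm by blast
 obtain S where S: "finite S" "S \<subseteq> carrier P"
  "\<forall>x\<in>carrier P. \<exists>c\<in>S \<rightarrow> carrier E. x = (\<Oplus>\<^bsub>P\<^esub>s\<in>S. ract P s (c s))"
  using P unfolding fg_graded_projective_def by blast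
 have lift: "\<And>(M :: ('e, int \<times> int, 'u) dg) (N :: ('e, int \<times> int, 'u) dg) q f.
    graded_mod E M ==> graded_mod E N ==> q \<in> dg_hom E M N ==> q ` carrier M = carrier N ==>
    f \<in> dg_hom E P N ==> (\<exists>f'\<in>dg_hom E P M. \<forall>x\<in>carrier P. q (f' x) = f x)"
  using P unfolding fg_graded_projective_def by blast
 \<comment> \<open>The homogeneous components of the generators.\<close>
 define B where "B = (\<Union>s\<in>S. hcomp P s ` hsupp P s)"
 have B: "finite B" unfolding B_def
  using S(1,2) hsupp_finite[OF P.gg] by (intro finite_UN_I finite_imageI) auto
 have Bh: "\<exists>i. b \<in> gr P (0, i)" if "b \<in> B" for b
 proof -
  obtain s g where s: "s \<in> S" "g \<in> hsupp P s" "b = hcomp P s g" using \<open>b \<in> B\<close> unfolding B_def by blast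
  have bg: "b \<in> gr P g" using s(1,3) S(2) hcomp_gr[OF P.gg, of s g] by auto
  have "b \<noteq> 0_P" using s by (simp add: hsupp_def)
  then have "fst g = 0" using bg gP unfolding graded_mod_def by (metis prod.collapse singletonD)
  then show ?thesis using bg by (cases g) auto
 qed
 obtain F :: "('e, int \<times> int, 'u) dg" and \<pi>
  where F: "fcell TYPE('u) E F" "graded_mod E F" "\<pi> \<in> dg_hom E F P" "B \<subseteq> \<pi> ` carrier F"
  using cover_homogeneous[OF inf e gP B Bh] by blast
 note Fm = fcell_dgm[OF F(1)] and \<pi> = dg_homD[OF F(3)]
 interpret F: dgmod E F using Fm by blast
 let ?I = "\<pi> ` carrier F"
 have I0: "0_P \<in> ?I" using dg_hom_zero[OF Fm Pm F(3)] F.zero_closed by (metis imageI)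
 have Ia: "x +_P y \<in> ?I" if xy: "x \<in> ?I" "y \<in> ?I" for x y
 proof -
  obtain u v where "u \<in> carrier F" "v \<in> carrier F" "x = \<pi> u" "y = \<pi> v" using xy by auto
  then have "x +_P y = \<pi> (u +_F v)" "u +_F v \<in> carrier F" using \<pi> by simp_all
  then show ?thesis by blast
 qed
 have Ie: "ract P x c \<in> ?I" if xc: "x \<in> ?I" "c \<in> carrier E" for x c
 proof -
  obtain u where "u \<in> carrier F" "x = \<pi> u" using xc by auto
  then have "ract P x c = \<pi> (ract F u c)" "ract F u c \<in> carrier F" using \<pi> xc by simp_all
  then show ?thesis by blast
 qed
 have Isub: "?I \<subseteq> carrier P" using \<pi>(2) by auto
 have Isum: "(\<Oplus>\<^bsub>P\<^esub>i\<in>A. w i) \<in> ?I" if "finite A" "\<And>i. i \<in> A ==> w i \<in> ?I" for A and w :: "'c => 'u"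
  using that
 proof (induction A rule: finite_induct)
  case empty
  then show ?case using I0 by simp
 next
  case (insert i A)
  have "(\<Oplus>\<^bsub>P\<^esub>i\<in>insert i A. w i) = w i +_P (\<Oplus>\<^bsub>P\<^esub>i\<in>A. w i)"
   by (rule P.finsum_insert) (use insert Isub in blast)+
  then show ?case using insert Ia by simp
 qed
 have SI: "s \<in> ?I" if s: "s \<in> S" for s
 proof -
  have sc: "s \<in> carrier P" using s S by blast
  have "s = (\<Oplus>\<^bsub>P\<^esub>g\<in>hsupp P s. hcomp P s g)"
   by (rule hcomp_sum[OF P.gg sc hsupp_finite[OF P.gg sc] subset_refl])
  moreover have "(\<Oplus>\<^bsub>P\<^esub>g\<in>hsupp P s. hcomp P s g) \<in> ?I"
   by (rule Isum[OF hsupp_finite[OF P.gg sc]]) (use s F(4) in "auto simp: B_def")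
  ultimately show ?thesis by simp
 qed
 have surj: "\<pi> ` carrier F = carrier P"
 proof (rule subset_antisym[OF Isub], rule subsetI)
  fix x assume "x \<in> carrier P"
  then obtain c where c: "c \<in> S \<rightarrow> carrier E" "x = (\<Oplus>\<^bsub>P\<^esub>s\<in>S. ract P s (c s))" using S by blast
  show "x \<in> ?I" unfolding c(2) by (rule Isum[OF S(1)]) (use c SI Ie in blast)
 qed
 obtain j where j: "j \<in> dg_hom E P F" "\<forall>x\<in>carrier P. \<pi> (j x) = id x"
  using lift[OF F(2) gP F(3) surj dg_hom_id] by blast
 note jD = dg_homD[OF j(1)] and jm = dg_hom_minus[OF Pm Fm j(1)]
 let ?V = "cone P F j"
 have V: "dg_module E ?V" by (rule cone_dgm[OF Pm Fm j(1)])
 have D: "dg_module E (dsum P ?V)" by (rule dsum_dgm[OF Pm V])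
 note dF = graded_mod_d0[OF F(2)] and dP = graded_mod_d0[OF gP]
 let ?t = "\<lambda>y. (\<pi> y, (y, 0_P))"
 have t: "?t \<in> dg_hom E F (dsum P ?V)"
  by (rule dg_homI) (simp_all add: \<pi> P.gg dF dP dg_hom_zero[OF Pm Fm j(1)] dg_hom_zero[OF Fm Pm F(3)])
 have "quasi_iso E F (dsum P ?V) ?t"
 proof (rule quasi_isoI[OF t _ _ dgm_cx[OF Fm] dgm_cx[OF D]])
  show "hinj F (dsum P ?V) ?t"
   unfolding hinj_def
  proof (intro ballI impI)
   fix y z assume y: "y \<in> carrier F" "z \<in> carrier (dsum P ?V)" "?t y = dd (dsum P ?V) z"
   obtain a n m where z: "z = (a, (n, m))" by (metis prod.exhaust)
   have e: "\<pi> y = dd P a" "y = dd F n +_F j m"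
    using y(3) unfolding z dsum_simps cone_simps prod.inject by blast+
   have c: "a \<in> carrier P" "n \<in> carrier F" "m \<in> carrier P" using y(2) z by simp_all
   have "y = j m" using e c jD by (simp add: dF)
   moreover have "m = 0_P" using e(1) \<open>y = j m\<close> j(2) c by (simp add: dP)
   ultimately have "y = dd F 0_F" using dg_hom_zero[OF Pm Fm j(1)] by simp
   then show "\<exists>w\<in>carrier F. y = dd F w" by blast
  qed
  show "hsurj F (dsum P ?V) ?t"
   unfolding hsurj_def
  proof (intro ballI impI)
   fix x assume x: "x \<in> carrier (dsum P ?V)" "dd (dsum P ?V) x = 0_(dsum P ?V)"
   obtain a n m where z: "x = (a, (n, m))" by (metis prod.exhaust)
   have c: "a \<in> carrier P" "n \<in> carrier F" "m \<in> carrier P" and e: "dd F n +_F j m = 0_F"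
    using x z by simp_all
   have "j m = 0_F" using e c jD by (simp add: dF)
   then have m: "m = 0_P" using j(2) c dg_hom_zero[OF Fm Pm F(3)] by fastforce
   let ?w = "n +_F j (a -_P \<pi> n)" and ?r = "(0_P, (0_F, \<pi> n -_P a))"
   have w: "?w \<in> carrier F" "?r \<in> carrier (dsum P ?V)" using c \<pi> jD by simp_all
   have "\<pi> ?w = \<pi> n +_P (a -_P \<pi> n)" using c \<pi> jD j(2) by simp
   also have "\<dots> = a"
    by (rule lin_solve[OF P.ag, of _ _ "[a, \<pi> n]"], (rule lin_intros)+, simp_all add: c \<pi> upt_conv_Cons)
   finally have 1: "\<pi> ?w = a" .
   have "n = n +_F (j a +_F -_F j (\<pi> n)) +_F (j (\<pi> n) +_F -_F j a)"
    by (rule lin_solve[OF F.ag, of _ _ "[n, j a, j (\<pi> n)]"], (rule lin_intros)+, simp_all add: c \<pi> jD upt_conv_Cons)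
   then have "x = ?t ?w +_(dsum P ?V) dd (dsum P ?V) ?r"
    using c \<pi> jD w 1 m by (simp add: z a_minus_def jm P.minus_add P.d_add P.d_minus dP)
   then show "\<exists>y\<in>carrier F. dd F y = 0_F \<and> (\<exists>z\<in>carrier (dsum P ?V). x = ?t y +_(dsum P ?V) dd (dsum P ?V) z)"
    using w dF by blast
  qed
 qed
 then show ?thesis
  by (rule cell_summand_regroup[OF F(1) _ D dg_isom_refl Pm V]) (rule emb_cone[OF inf]; simp)
qed

end

section \<open>The enveloping algebra\<close>

lemma frag_cmul_diff2: "frag_cmul c (a - b) = frag_cmul c a - frag_cmul c b"
 using frag_cmul_distrib2[of c "a - b" b] by simp

lemma ksign_mult: "ksign a * ksign b = ksign (a + b)"
 by (simp add: ksign_def)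

lemma ksign_square [simp]: "ksign a * ksign a = 1"
 by (simp add: ksign_def)

locale env_alg =
 fixes K :: "('k, 'z) ring_scheme" and A :: "('k, 'g::dg_grading, 'a) dg"
 assumes alg: "graded_algebra K A" and dA: "dd A = (\<lambda>_. 0_A)"
begin

lemma ringA: "ring A" and ggA: "graded_group A" and oneA: "1_A \<in> gr A 0"
 and multA: "x \<in> gr A g ==> y \<in> gr A h ==> x *_A y \<in> gr A (g + h)"
 and subA: "submodule (gr A g) K A" and modA: "module K A"
 and smult_left: "c \<in> carrier K ==> x \<in> carrier A ==> y \<in> carrier A ==>
  (c \<odot>\<^bsub>A\<^esub> x) *_A y = c \<odot>\<^bsub>A\<^esub> (x *_A y)"
 and smult_right: "c \<in> carrier K ==> x \<in> carrier A ==> y \<in> carrier A ==>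
  x *_A (c \<odot>\<^bsub>A\<^esub> y) = c \<odot>\<^bsub>A\<^esub> (x *_A y)"
 using alg by (simp_all add: graded_algebra_def)

sublocale A: ring A by (rule ringA)

lemma smult_gr: "c \<in> carrier K ==> x \<in> gr A g ==> c \<odot>\<^bsub>A\<^esub> x \<in> gr A g"
 using subA[of g] by (simp add: submodule_def submodule_axioms_def)

lemma grc: "x \<in> gr A g ==> x \<in> carrier A"
 by (rule gr_carrier[OF ggA])

lemma multA': "x \<in> gr A g ==> y \<in> gr A h ==> x *_A y \<in> gr A (h + g)"
 using multA[of x g y h] by (simp add: add.commute)

lemmas grA_simps = gr_add[OF ggA] gr_minus[OF ggA] multA smult_gr gr_zero[OF ggA]

abbreviation F where "F \<equiv> {u. keys u \<subseteq> tsyms A}"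

lemma F_closed: "0 \<in> F" "u \<in> F ==> v \<in> F ==> u + v \<in> F" "u \<in> F ==> - u \<in> F" "u \<in> F ==> v \<in> F ==> u - v \<in> F"
 "frag_of p \<in> F \<longleftrightarrow> p \<in> tsyms A" "u \<in> F ==> frag_cmul c u \<in> F"
 using keys_add[of u v] keys_diff[of u v] keys_cmul[of c u] by auto

lemma F_extend: "(\<And>p. p \<in> S ==> keys (\<phi> p) \<subseteq> tsyms A) ==> keys u \<subseteq> S ==>
  frag_extend \<phi> u \<in> F"
 using keys_frag_extend[of \<phi> u] by blast

abbreviation N where "N \<equiv> tnull K A"

lemma trel_F: "trel K A \<subseteq> F"
proof
 fix r assume "r \<in> trel K A"
 then show "r \<in> F" unfolding trel_def
  by (elim UnE CollectE exE conjE; hypsubst; intro F_closed(4))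
   (simp_all only: F_closed(5), simp_all add: tsyms_def grA_simps)
qed

lemma N_induct [consumes 1, case_names zero rel minus add]:
 assumes "u \<in> N" "P 0" "\<And>r. r \<in> trel K A ==> P r" "\<And>r. r \<in> trel K A ==> P (- r)"
  "\<And>u v. u \<in> N ==> v \<in> N ==> P u ==> P v ==> P (u + v)"
 shows "P u"
 using assms(1) unfolding tnull_def
proof (induction rule: generate.induct)
 case one
 then show ?case using assms(2) by simp
next
 case (incl h)
 then show ?case by (rule assms(3))
next
 case (inv h)
 then have "keys h \<subseteq> tsyms A" using trel_F by auto
 then show ?case using assms(4)[OF inv] by simp
next
 case (eng h1 h2)
 then show ?case using assms(5) by (simp add: tnull_def)
qed

lemma N_subgroup: "subgroup N (free_Abelian_group (tsyms A))"
 unfolding tnull_def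
 by (rule group.generate_is_subgroup[OF group_free_Abelian_group]) (use trel_F in auto)

lemma N_F: "u \<in> N ==> u \<in> F"
 using subsetD[OF subgroup.subset[OF N_subgroup], of u] by simp

lemma N_closed: "0 \<in> N" "u \<in> N ==> v \<in> N ==> u + v \<in> N" "u \<in> N ==> - u \<in> N"
 "u \<in> N ==> v \<in> N ==> u - v \<in> N"
proof -
 show "0 \<in> N" using subgroup.one_closed[OF N_subgroup] by simp
 show a: "u \<in> N ==> v \<in> N ==> u + v \<in> N" for u v using subgroup.m_closed[OF N_subgroup, of u v] by simp
 show m: "u \<in> N ==> - u \<in> N" for u using subgroup.m_inv_closed[OF N_subgroup, of u] N_F[of u] by simp
 show "u \<in> N ==> v \<in> N ==> u - v \<in> N" using a[of u "- v"] m by simp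
qed

lemma N_rel: "r \<in> trel K A ==> r \<in> N"
 unfolding tnull_def by (rule generate.incl)

lemma N_cmul_sign: "u \<in> N ==> c = 1 \<or> c = - 1 \<or> c = 0 ==> frag_cmul c u \<in> N"
 using N_closed by auto

lemma N_extend:
 assumes "u \<in> N" "\<And>r. r \<in> trel K A ==> frag_extend \<phi> r \<in> tnull K B" "env_alg K B"
 shows "frag_extend \<phi> u \<in> tnull K B"
 using assms(1)
proof (induction rule: N_induct)
 case zero
 then show ?case using env_alg.N_closed(1)[OF assms(3)] by simp
next
 case (rel r)
 then show ?case by (rule assms(2))
next
 case (minus r)
 then show ?case using env_alg.N_closed(3)[OF assms(3)] assms(2) by (simp add: frag_extend_minus)
next
 case (add u v)
 then show ?case using env_alg.N_closed(2)[OF assms(3)] by (simp add: frag_extend_add)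
qed

lemma F_induct [consumes 1, case_names zero sym diff]:
 assumes "u \<in> F" "P 0" "\<And>p. p \<in> tsyms A ==> P (frag_of p)"
  "\<And>u v. u \<in> F ==> v \<in> F ==> P u ==> P v ==> P (u - v)"
 shows "P u"
 by (rule free_Abelian_group_induct[where S = "tsyms A"]) (use assms in simp_all)

lemma trelE:
 assumes "r \<in> trel K A"
 obtains (left) g h x x' y where "x \<in> gr A g" "x' \<in> gr A g" "y \<in> gr A h"
   "r = frag_of (g, x +_A x', h, y) - frag_of (g, x, h, y) - frag_of (g, x', h, y)"
 | (right) g h x y y' where "x \<in> gr A g" "y \<in> gr A h" "y' \<in> gr A h"
   "r = frag_of (g, x, h, y +_A y') - frag_of (g, x, h, y) - frag_of (g, x, h, y')"
 | (scalar) c g h x y where "c \<in> carrier K" "x \<in> gr A g" "y \<in> gr A h"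
   "r = frag_of (g, c \<odot>\<^bsub>A\<^esub> x, h, y) - frag_of (g, x, h, c \<odot>\<^bsub>A\<^esub> y)"
 using assms unfolding trel_def by blast

lemma trelI:
 "x \<in> gr A g ==> x' \<in> gr A g ==> y \<in> gr A h ==>
  frag_of (g, x +_A x', h, y) - frag_of (g, x, h, y) - frag_of (g, x', h, y) \<in> N"
 "x \<in> gr A g ==> y \<in> gr A h ==> y' \<in> gr A h ==>
  frag_of (g, x, h, y +_A y') - frag_of (g, x, h, y) - frag_of (g, x, h, y') \<in> N"
 "c \<in> carrier K ==> x \<in> gr A g ==> y \<in> gr A h ==>
  frag_of (g, c \<odot>\<^bsub>A\<^esub> x, h, y) - frag_of (g, x, h, c \<odot>\<^bsub>A\<^esub> y) \<in> N"
 by (rule N_rel; unfold trel_def; blast)+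

abbreviation T where "T \<equiv> tring A"

lemma T_simps [simp]: "carrier T = F" "zero T = 0" "add T = (+)"
 "mult T = (\<lambda>u v. frag_extend (\<lambda>p. frag_extend (sym_mult A p) v) u)"
 "one T = frag_of (0, 1_A, 0, 1_A)"
 by (auto simp: tring_def free_Abelian_group_def)

lemma T_abelian: "abelian_group T"
proof (rule abelian_groupI)
 fix u assume "u \<in> carrier T"
 then show "\<exists>v\<in>carrier T. v +_T u = 0_T" using F_closed(3)[of u] by (intro bexI[of _ "- u"]) simp_all
qed (use F_closed in "simp_all add: ac_simps del: mem_Collect_eq")

lemma sym_mult_F: "p \<in> tsyms A ==> q \<in> tsyms A ==> sym_mult A p q \<in> F"
 by (auto simp: tsyms_def sym_mult_def multA multA')

definition tm where "tm u v = frag_extend (\<lambda>p. frag_extend (sym_mult A p) v) u"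

lemma tm_F: "u \<in> F ==> v \<in> F ==> tm u v \<in> F"
 unfolding tm_def
 by (rule F_extend[of "tsyms A"], rule F_extend[of "tsyms A", simplified]) (use sym_mult_F in auto)

lemma tm_diff_left: "tm (u - u') v = tm u v - tm u' v"
 by (simp add: tm_def frag_extend_diff)

lemma tm_diff_right: "tm u (v - v') = tm u v - tm u v'"
proof -
 have "keys u \<subseteq> UNIV" by simp
 then show ?thesis
  by (induction u rule: frag_induction) (simp_all add: tm_def frag_extend_diff)
qed

lemma tm_zero [simp]: "tm 0 v = 0" "tm u 0 = 0"
 using tm_diff_right[of u 0 0] by (simp_all add: tm_def)

lemma tm_add_left: "tm (u + u') v = tm u v + tm u' v"
 by (simp add: tm_def frag_extend_add)

lemma tm_add_right: "tm u (v + v') = tm u v + tm u v'"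
 using tm_diff_right[of u v "- v'"] tm_diff_right[of u 0 v'] by simp

lemma tm_of [simp]: "tm (frag_of p) (frag_of q) = sym_mult A p q"
 by (simp add: tm_def)

lemma tm_cmul: "tm (frag_cmul c u) v = frag_cmul c (tm u v)" "tm u (frag_cmul c v) = frag_cmul c (tm u v)"
proof -
 show "tm (frag_cmul c u) v = frag_cmul c (tm u v)" by (simp add: tm_def frag_extend_cmul)
 have "keys u \<subseteq> UNIV" by simp
 then show "tm u (frag_cmul c v) = frag_cmul c (tm u v)"
  by (induction u rule: frag_induction)
   (simp_all add: tm_diff_left frag_cmul_diff2, simp add: tm_def frag_extend_cmul)
qed

lemma tm_assoc:
 assumes "u \<in> F" "v \<in> F" "w \<in> F" shows "tm (tm u v) w = tm u (tm v w)"
proof -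
 have 1: "tm (sym_mult A p q) (frag_of r) = tm (frag_of p) (sym_mult A q r)"
  if pqr: "p \<in> tsyms A" "q \<in> tsyms A" "r \<in> tsyms A" for p q r
 proof -
  obtain g x h y where p: "p = (g, x, h, y)" by (metis prod_cases4)
  obtain g' x' h' y' where q: "q = (g', x', h', y')" by (metis prod_cases4)
  obtain g'' x'' h'' y'' where r: "r = (g'', x'', h'', y'')" by (metis prod_cases4)
  have c: "x \<in> carrier A" "y \<in> carrier A" "x' \<in> carrier A" "y' \<in> carrier A" "x'' \<in> carrier A" "y'' \<in> carrier A"
   using pqr grc by (auto simp: tsyms_def p q r)
  show ?thesis
   using c by (simp add: p q r sym_mult_def tm_cmul ksign_mult cdeg_add add.assoc A.m_assoc)
    (rule arg_cong2[where f = frag_cmul]; simp add: ksign_def algebra_simps)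
 qed
 have 2: "tm (sym_mult A p q) w = tm (frag_of p) (tm (frag_of q) w)" if pq: "p \<in> tsyms A" "q \<in> tsyms A" for p q
  using assms(3) by (induction rule: F_induct) (simp_all add: 1[OF pq] tm_diff_right)
 have 3: "tm (tm (frag_of p) v) w = tm (frag_of p) (tm v w)" if p: "p \<in> tsyms A" for p
  using assms(2) by (induction rule: F_induct) (simp_all add: 2[OF p] tm_diff_right tm_diff_left)
 show ?thesis
  using assms(1) by (induction rule: F_induct) (simp_all add: 3 tm_diff_left)
qed

lemma tm_one:
 assumes "u \<in> F" shows "tm (frag_of (0, 1_A, 0, 1_A)) u = u" "tm u (frag_of (0, 1_A, 0, 1_A)) = u"
 using assms
 by (induction rule: F_induct)
  (auto simp: tm_diff_left tm_diff_right sym_mult_def tsyms_def grc ksign_def split: prod.splits)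

lemma one_F: "frag_of (0, 1_A, 0, 1_A) \<in> F"
 by (simp add: tsyms_def oneA)

lemma T_mult: "mult T = tm"
 by (simp add: tm_def fun_eq_iff)

lemma T_ring: "ring T"
proof (rule ringI[OF T_abelian])
 show "monoid T"
  by (rule monoidI) (use tm_F tm_assoc tm_one one_F in "simp_all add: T_mult del: T_simps(4) mem_Collect_eq")
qed (simp_all add: T_mult tm_add_left tm_add_right del: T_simps(4))

text \<open>
The relations generate an ideal. By bilinearity it is enough to multiply a single relation by a single symbol,
which gives a relation up to sign.
\<close>

lemma tm_null:
 assumes "u \<in> F" "n \<in> N" shows "tm u n \<in> N" "tm n u \<in> N"
proof -
 have 1: "frag_extend (sym_mult A p) r \<in> N" if p: "p \<in> tsyms A" and r: "r \<in> trel K A" for p r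
 proof -
  obtain a u b v where pe: "p = (a, u, b, v)" by (metis prod_cases4)
  have uv: "u \<in> gr A a" "v \<in> gr A b" using p by (auto simp: tsyms_def pe)
  show ?thesis using r
  proof (cases rule: trelE)
   case (left g h x x' y)
   have "frag_extend (sym_mult A p) r = frag_cmul (ksign (cdeg b * cdeg g + cdeg a * cdeg g))
    (frag_of (a + g, x *_A u +_A x' *_A u, b + h, v *_A y) - frag_of (a + g, x *_A u, b + h, v *_A y)
     - frag_of (a + g, x' *_A u, b + h, v *_A y))"
    using left uv grc by (simp add: pe sym_mult_def frag_extend_diff A.l_distr ksign_def)
   moreover have "frag_of (a + g, x *_A u +_A x' *_A u, b + h, v *_A y) - frag_of (a + g, x *_A u, b + h, v *_A y)
     - frag_of (a + g, x' *_A u, b + h, v *_A y) \<in> N"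
    by (rule trelI(1)) (use left uv in "simp_all add: multA multA'")
   ultimately show ?thesis using N_cmul_sign by (simp add: ksign_def)
  next
   case (right g h x y y')
   have "frag_extend (sym_mult A p) r = frag_cmul (ksign (cdeg b * cdeg g + cdeg a * cdeg g))
    (frag_of (a + g, x *_A u, b + h, v *_A y +_A v *_A y') - frag_of (a + g, x *_A u, b + h, v *_A y)
     - frag_of (a + g, x *_A u, b + h, v *_A y'))"
    using right uv grc by (simp add: pe sym_mult_def frag_extend_diff A.r_distr ksign_def)
   moreover have "frag_of (a + g, x *_A u, b + h, v *_A y +_A v *_A y') - frag_of (a + g, x *_A u, b + h, v *_A y)
     - frag_of (a + g, x *_A u, b + h, v *_A y') \<in> N"
    by (rule trelI(2)) (use right uv in "simp_all add: multA multA'")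
   ultimately show ?thesis using N_cmul_sign by (simp add: ksign_def)
  next
   case (scalar c g h x y)
   have "frag_extend (sym_mult A p) r = frag_cmul (ksign (cdeg b * cdeg g + cdeg a * cdeg g))
    (frag_of (a + g, c \<odot>\<^bsub>A\<^esub> (x *_A u), b + h, v *_A y) - frag_of (a + g, x *_A u, b + h, c \<odot>\<^bsub>A\<^esub> (v *_A y)))"
    using scalar uv grc by (simp add: pe sym_mult_def frag_extend_diff smult_left smult_right ksign_def)
   moreover have "frag_of (a + g, c \<odot>\<^bsub>A\<^esub> (x *_A u), b + h, v *_A y) - frag_of (a + g, x *_A u, b + h, c \<odot>\<^bsub>A\<^esub> (v *_A y)) \<in> N"
    by (rule trelI(3)) (use scalar uv in "simp_all add: multA multA'")
   ultimately show ?thesis using N_cmul_sign by (simp add: ksign_def)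
  qed
 qed
 have 2: "frag_extend (\<lambda>q. sym_mult A q p) r \<in> N" if p: "p \<in> tsyms A" and r: "r \<in> trel K A" for p r
 proof -
  obtain a u b v where pe: "p = (a, u, b, v)" by (metis prod_cases4)
  have uv: "u \<in> gr A a" "v \<in> gr A b" using p by (auto simp: tsyms_def pe)
  show ?thesis using r
  proof (cases rule: trelE)
   case (left g h x x' y)
   have "frag_extend (\<lambda>q. sym_mult A q p) r = frag_cmul (ksign (cdeg h * cdeg a + cdeg g * cdeg a))
    (frag_of (g + a, u *_A x +_A u *_A x', h + b, y *_A v) - frag_of (g + a, u *_A x, h + b, y *_A v)
     - frag_of (g + a, u *_A x', h + b, y *_A v))"
    using left uv grc by (simp add: pe sym_mult_def frag_extend_diff A.r_distr ksign_def)
   moreover have "frag_of (g + a, u *_A x +_A u *_A x', h + b, y *_A v) - frag_of (g + a, u *_A x, h + b, y *_A v)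
     - frag_of (g + a, u *_A x', h + b, y *_A v) \<in> N"
    by (rule trelI(1)) (use left uv in "simp_all add: multA multA'")
   ultimately show ?thesis using N_cmul_sign by (simp add: ksign_def)
  next
   case (right g h x y y')
   have "frag_extend (\<lambda>q. sym_mult A q p) r = frag_cmul (ksign (cdeg h * cdeg a + cdeg g * cdeg a))
    (frag_of (g + a, u *_A x, h + b, y *_A v +_A y' *_A v) - frag_of (g + a, u *_A x, h + b, y *_A v)
     - frag_of (g + a, u *_A x, h + b, y' *_A v))"
    using right uv grc by (simp add: pe sym_mult_def frag_extend_diff A.l_distr ksign_def)
   moreover have "frag_of (g + a, u *_A x, h + b, y *_A v +_A y' *_A v) - frag_of (g + a, u *_A x, h + b, y *_A v)
     - frag_of (g + a, u *_A x, h + b, y' *_A v) \<in> N"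
    by (rule trelI(2)) (use right uv in "simp_all add: multA multA'")
   ultimately show ?thesis using N_cmul_sign by (simp add: ksign_def)
  next
   case (scalar c g h x y)
   have "frag_extend (\<lambda>q. sym_mult A q p) r = frag_cmul (ksign (cdeg h * cdeg a + cdeg g * cdeg a))
    (frag_of (g + a, c \<odot>\<^bsub>A\<^esub> (u *_A x), h + b, y *_A v) - frag_of (g + a, u *_A x, h + b, c \<odot>\<^bsub>A\<^esub> (y *_A v)))"
    using scalar uv grc by (simp add: pe sym_mult_def frag_extend_diff smult_left smult_right ksign_def)
   moreover have "frag_of (g + a, c \<odot>\<^bsub>A\<^esub> (u *_A x), h + b, y *_A v) - frag_of (g + a, u *_A x, h + b, c \<odot>\<^bsub>A\<^esub> (y *_A v)) \<in> N"
    by (rule trelI(3)) (use scalar uv in "simp_all add: multA multA'")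
   ultimately show ?thesis using N_cmul_sign by (simp add: ksign_def)
  qed
 qed
 have e: "env_alg K A" by unfold_locales
 have e1: "tm (frag_of p) n \<in> N" if p: "p \<in> tsyms A" for p
  unfolding tm_def frag_extend_of by (rule N_extend[OF assms(2) 1[OF p] e])
 have tm_flip: "tm w (frag_of p) = frag_extend (\<lambda>q. sym_mult A q p) w" for w p
  by (simp add: tm_def)
 have e2: "tm n (frag_of p) \<in> N" if p: "p \<in> tsyms A" for p
  unfolding tm_flip by (rule N_extend[OF assms(2) 2[OF p] e])
 show "tm u n \<in> N" using assms(1)
  by (induction rule: F_induct) (simp_all add: e1 tm_diff_left N_closed)
 show "tm n u \<in> N" using assms(1)
  by (induction rule: F_induct) (simp_all add: e2 tm_diff_right N_closed)
qed

lemma T_a_inv: "u \<in> F ==> -_T u = - u"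
 by (rule abelian_group.minus_equality[OF T_abelian]) (use F_closed in auto)

lemma N_ideal: "ideal N T"
proof (rule idealI[OF T_ring])
 show "subgroup N (add_monoid T)"
 proof (rule group.subgroupI)
  show "group (add_monoid T)" using abelian_group.a_group[OF T_abelian] .
  show "\<And>a. a \<in> N ==> inv\<^bsub>add_monoid T\<^esub> a \<in> N"
   using T_a_inv N_F N_closed(3) by (simp add: a_inv_def)
 qed (use N_F N_closed in auto)
qed (use tm_null in "simp_all add: T_mult del: T_simps(4)")

end

definition compat where
 "compat K A B \<phi> \<longleftrightarrow> (\<forall>p\<in>tsyms A. keys (\<phi> p) \<subseteq> tsyms B) \<and>
   (\<forall>r\<in>trel K A. frag_extend \<phi> r \<in> tnull K B)"

text \<open>
All maps between enveloping algebras in this proof (projections, the flip, the twists) arise from maps of symbols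
that are compatible with the relations.
\<close>

definition tmap where
 "tmap K B \<phi> U = tclass K B (frag_extend \<phi> (trep U))"

context env_alg
begin

abbreviation cl where "cl \<equiv> tclass K A"
abbreviation E where "E \<equiv> env K A"

lemma env_alg_self: "env_alg K A" by unfold_locales

lemma cl_set: "cl u = {n + u | n. n \<in> N}"
 by (auto simp: tclass_def a_r_coset_def r_coset_def)

lemma cl_eq_iff: "cl u = cl v \<longleftrightarrow> u - v \<in> N"
proof
 assume "cl u = cl v"
 moreover have "u \<in> cl u" unfolding cl_set using N_closed(1) by force
 ultimately have "u \<in> cl v" by simp
 then show "u - v \<in> N" unfolding cl_set by auto
next
 assume d: "u - v \<in> N"
 have "n + u \<in> cl v" if "n \<in> N" for n
 proof -
  have "n + u = (n + (u - v)) + v" by simp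
  then show ?thesis unfolding cl_set using N_closed(2)[OF that d] by blast
 qed
 moreover have "n + v \<in> cl u" if "n \<in> N" for n
 proof -
  have "n + v = (n - (u - v)) + u" by simp
  then show ?thesis unfolding cl_set using N_closed(4)[OF that d] by blast
 qed
 ultimately show "cl u = cl v" unfolding cl_set[of u] cl_set[of v] by (auto simp: cl_set)
qed

lemma cl_eqI: "u - v \<in> N ==> cl u = cl v"
 by (simp add: cl_eq_iff)

lemma trep_cl: "trep (cl u) - u \<in> N"
proof -
 have "u \<in> cl u" unfolding cl_set using N_closed(1) by force
 then have "trep (cl u) \<in> cl u" unfolding trep_def by (rule someI)
 then show ?thesis unfolding cl_set by auto
qed

lemma trep_F: "u \<in> F ==> trep (cl u) \<in> F"
 using F_closed(2)[OF N_F[OF trep_cl[of u]], of u] by simp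

lemma carrier_E: "carrier E = cl ` F"
 by (auto simp: env_def Let_def FactRing_def A_RCOSETS_def' tclass_def image_iff)

lemma cl_carrier [simp]: "u \<in> F ==> cl u \<in> carrier E"
 unfolding carrier_E by blast

lemma carrier_E_cases:
 assumes "U \<in> carrier E" obtains u where "u \<in> F" "U = cl u"
 using assms unfolding carrier_E by blast

lemma zero_E: "0_E = cl 0"
 by (simp add: env_def Let_def FactRing_def cl_set)

lemma one_E: "1_E = cl (frag_of (0, 1_A, 0, 1_A))"
 by (simp add: env_def Let_def FactRing_def tclass_def)

lemma add_E: "u \<in> F ==> v \<in> F ==> cl u +_E cl v = cl (u + v)"
 using ideal.a_rcos_sum[OF N_ideal, of u v]
 by (simp add: env_def Let_def FactRing_def tclass_def)

lemma mult_E: "u \<in> F ==> v \<in> F ==> cl u *_E cl v = cl (tm u v)"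
 using ideal.rcoset_mult_add[OF N_ideal, of u v]
 by (simp add: env_def Let_def FactRing_def tclass_def T_mult del: T_simps(4))

lemma E_ring: "ring E"
proof -
 \<comment> \<open>A name for the set of representatives, so that its definition is not unfolded.\<close>
 define G :: "(('g, 'a) sym \<Rightarrow>\<^sub>0 int) set" where "G = F"
 have c: "carrier E = cl ` G" by (simp add: G_def carrier_E)
 have G: "0 \<in> G" "\<And>u v. u \<in> G ==> v \<in> G ==> u + v \<in> G" "\<And>u. u \<in> G ==> - u \<in> G"
  "\<And>u v. u \<in> G ==> v \<in> G ==> tm u v \<in> G" "frag_of (0, 1_A, 0, 1_A) \<in> G"
  unfolding G_def by (rule F_closed tm_F one_F; assumption?)+
 have t: "\<And>u v w. u \<in> G ==> v \<in> G ==> w \<in> G ==> tm (tm u v) w = tm u (tm v w)"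
  "\<And>u. u \<in> G ==> tm (frag_of (0, 1_A, 0, 1_A)) u = u"
  "\<And>u. u \<in> G ==> tm u (frag_of (0, 1_A, 0, 1_A)) = u"
  unfolding G_def by (rule tm_assoc tm_one; assumption)+
 have e: "\<And>u v. u \<in> G ==> v \<in> G ==> cl u +_E cl v = cl (u + v)"
  "\<And>u v. u \<in> G ==> v \<in> G ==> cl u *_E cl v = cl (tm u v)"
  unfolding G_def by (rule add_E mult_E; assumption)+
 show ?thesis
 proof (rule ringI)
  show "abelian_group E"
  proof (rule abelian_groupI)
   fix U assume "U \<in> carrier E"
   then obtain u where u: "u \<in> G" "U = cl u" using c by blast
   have "cl (- u) +_E U = 0_E" using u G e by (simp add: zero_E)
   moreover have "cl (- u) \<in> carrier E" unfolding c by (rule imageI, rule G(3), rule u(1))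
   ultimately show "\<exists>V\<in>carrier E. V +_E U = 0_E" by blast
  qed (use G in "auto simp: c e zero_E ac_simps")
  show "monoid E"
   by (rule monoidI) (use G t in "auto simp: c e one_E")
 qed (use G in "auto simp: c e tm_add_left tm_add_right")
qed

sublocale E: ring E by (rule E_ring)

lemma minus_E: "u \<in> F ==> -_E cl u = cl (- u)"
 by (rule E.minus_equality) (use F_closed in "simp_all add: add_E zero_E del: mem_Collect_eq")

definition pu where "pu g x h y = cl (frag_of (g, x, h, y))"

lemma pu_closed [simp]: "x \<in> gr A g ==> y \<in> gr A h ==> pu g x h y \<in> carrier E"
 unfolding pu_def by (rule cl_carrier) (simp add: tsyms_def)

lemma E_induct [consumes 1, case_names zero pure add minus]:
 assumes "U \<in> carrier E" "P 0_E" "\<And>g x h y. x \<in> gr A g ==> y \<in> gr A h ==> P (pu g x h y)"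
  and add: "\<And>U V. U \<in> carrier E ==> V \<in> carrier E ==> P U ==> P V ==> P (U +_E V)"
  and minus: "\<And>U. U \<in> carrier E ==> P U ==> P (-_E U)"
 shows "P U"
proof -
 obtain u where u: "u \<in> F" "U = cl u" using assms(1) by (rule carrier_E_cases)
 have "P (cl u)" using u(1)
 proof (induction rule: F_induct)
  case zero
  then show ?case using assms(2) by (simp add: zero_E)
 next
  case (sym p)
  obtain g x h y where "p = (g, x, h, y)" by (metis prod_cases4)
  then show ?case using assms(3)[of x g y h] sym by (simp add: tsyms_def pu_def)
 next
  case (diff u v)
  have "cl (u - v) = cl u +_E -_E cl v"
   using diff F_closed(3)[OF diff(2)] by (simp add: minus_E add_E del: mem_Collect_eq)
  then show ?case using add minus diff cl_carrier E.a_inv_closed by metis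
 qed
 then show ?thesis using u by simp
qed

lemma E_ahom_eq:
 assumes "abelian_group G" "f \<in> ahom E G" "f' \<in> ahom E G"
  "\<And>g x h y. x \<in> gr A g ==> y \<in> gr A h ==> f (pu g x h y) = f' (pu g x h y)" "U \<in> carrier E"
 shows "f U = f' U"
 using assms(5)
proof (induction rule: E_induct)
 case zero
 then show ?case using ahom_zero[OF E.abgrp assms(1)] assms(2,3) by metis
next
 case (pure g x h y)
 then show ?case by (rule assms(4))
next
 case (add U V)
 then show ?case using ahom_add[OF assms(2)] ahom_add[OF assms(3)] by metis
next
 case (minus U)
 then show ?case using ahom_minus[OF E.abgrp assms(1)] assms(2,3) by metis
qed

lemma sym_zero_N: "y \<in> gr A h ==> frag_of (g, 0_A, h, y) \<in> N" "y \<in> gr A h ==> frag_of (h, y, g, 0_A) \<in> N"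
 using N_closed(3)[OF trelI(1)[OF gr_zero[OF ggA, of g] gr_zero[OF ggA, of g], of y h]]
  N_closed(3)[OF trelI(2)[OF _ gr_zero[OF ggA, of g] gr_zero[OF ggA, of g], of y h]] by simp_all

lemma pu_zero: "y \<in> gr A h ==> pu g 0_A h y = 0_E" "y \<in> gr A h ==> pu h y g 0_A = 0_E"
 unfolding pu_def zero_E by (rule cl_eqI; simp add: sym_zero_N)+

lemma cl_sign:
 assumes "u \<in> F" shows "cl (frag_cmul (ksign n) u) = koszul E n (cl u)"
 using assms by (simp add: ksign_def koszul_def minus_E del: mem_Collect_eq)

lemma pu_mult:
 assumes "x \<in> gr A g" "y \<in> gr A h" "x' \<in> gr A g'" "y' \<in> gr A h'"
 shows "pu g x h y *_E pu g' x' h' y' =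
  koszul E (cdeg h * cdeg g' + cdeg g * cdeg g') (pu (g + g') (x' *_A x) (h + h') (y *_A y'))"
proof -
 have "(g, x, h, y) \<in> tsyms A" "(g', x', h', y') \<in> tsyms A" "(g + g', x' *_A x, h + h', y *_A y') \<in> tsyms A"
  using assms by (simp_all add: tsyms_def multA multA')
 then have F: "frag_of (g, x, h, y) \<in> F" "frag_of (g', x', h', y') \<in> F"
  "frag_of (g + g', x' *_A x, h + h', y *_A y') \<in> F" by simp_all
 show ?thesis unfolding pu_def using F
  by (simp add: mult_E cl_sign[symmetric] sym_mult_def del: mem_Collect_eq)
qed

lemma N_extend':
 assumes "compat K A B \<phi>" "env_alg K B" "u \<in> N" shows "frag_extend \<phi> u \<in> tnull K B"
 by (rule N_extend[OF assms(3) _ assms(2)]) (use assms(1) in "simp add: compat_def")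

lemma tmap_cl:
 assumes r: "compat K A B \<phi>" and B: "env_alg K B"
 shows "tmap K B \<phi> (cl u) = tclass K B (frag_extend \<phi> u)"
 unfolding tmap_def env_alg.cl_eq_iff[OF B]
 using N_extend'[OF r B trep_cl[of u]] by (simp add: frag_extend_diff)

lemma compat_F:
 assumes r: "compat K A B \<phi>" and B: "env_alg K B" and "u \<in> F"
 shows "keys (frag_extend \<phi> u) \<subseteq> tsyms B"
 using keys_frag_extend[of \<phi> u] r assms(3) unfolding compat_def by blast

lemma tmap_hom:
 assumes r: "compat K A B \<phi>" and B: "env_alg K B"
 shows "tmap K B \<phi> \<in> ahom E (env K B)"
proof (rule ahomI)
 interpret B: env_alg K B by fact
 fix U assume "U \<in> carrier E"
 then obtain u where u: "u \<in> F" "U = cl u" by (rule carrier_E_cases)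
 then show "tmap K B \<phi> U \<in> carrier (env K B)"
  using compat_F[OF r B] by (simp add: tmap_cl[OF r B])
next
 interpret B: env_alg K B by fact
 fix U V assume "U \<in> carrier E" "V \<in> carrier E"
 then obtain u v where u: "u \<in> F" "U = cl u" "v \<in> F" "V = cl v" by (metis carrier_E_cases)
 then show "tmap K B \<phi> (U +_E V) = tmap K B \<phi> U +_(env K B) tmap K B \<phi> V"
  using compat_F[OF r B] by (simp add: tmap_cl[OF r B] add_E B.add_E frag_extend_add)
qed

lemma compatI:
 assumes B: "env_alg K B" and ops: "add B = add A" "smult B = smult A"
  and gr: "\<And>g. gr A g \<subseteq> gr B (\<alpha> g)"
 shows "compat K A B (\<lambda>(g, x, h, y). frag_cmul (c g h) (frag_of (\<alpha> g, x, \<alpha> h, y)))" (is "compat _ _ _ ?f")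
  and "compat K A B (\<lambda>(g, x, h, y). frag_cmul (c g h) (frag_of (\<alpha> h, y, \<alpha> g, x)))" (is "compat _ _ _ ?f'")
proof -
 interpret B: env_alg K B by fact
 have cm: "frag_cmul k u \<in> tnull K B" if "u \<in> tnull K B" for k u
 proof (cases "k \<ge> 0")
  case True
  then show ?thesis
  proof (induction k rule: int_ge_induct)
   case (step i)
   then show ?case using B.N_closed(2)[OF _ that] by (simp add: frag_cmul_distrib)
  qed (simp add: B.N_closed)
 next
  case False
  then have "k \<le> 0" by simp
  then show ?thesis
  proof (induction k rule: int_le_induct)
   case (step i)
   then show ?case using B.N_closed(4)[OF _ that] by (simp add: frag_cmul_diff_distrib)
  qed (simp add: B.N_closed)
 qed
 note g = subsetD[OF gr]
 have 1: "frag_extend ?f r \<in> tnull K B" if "r \<in> trel K A" for r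
  using that
 proof (cases rule: trelE)
  case (left g h x x' y)
  then show ?thesis using cm[OF B.trelI(1)[OF g g g, of x g x' y h], of "c g h"]
   by (simp add: frag_extend_diff frag_cmul_diff2 ops)
 next
  case (right g h x y y')
  then show ?thesis using cm[OF B.trelI(2)[OF g g g, of x g y h y'], of "c g h"]
   by (simp add: frag_extend_diff frag_cmul_diff2 ops)
 next
  case (scalar k g h x y)
  then show ?thesis using cm[OF B.trelI(3)[OF _ g g, of k x g y h], of "c g h"]
   by (simp add: frag_extend_diff frag_cmul_diff2 ops)
 qed
 have 2: "frag_extend ?f' r \<in> tnull K B" if "r \<in> trel K A" for r
  using that
 proof (cases rule: trelE)
  case (left g h x x' y)
  then show ?thesis using cm[OF B.trelI(2)[OF g g g, of y h x g x'], of "c g h"]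
   by (simp add: frag_extend_diff frag_cmul_diff2 ops)
 next
  case (right g h x y y')
  then show ?thesis using cm[OF B.trelI(1)[OF g g g, of y h y' x g], of "c g h"]
   by (simp add: frag_extend_diff frag_cmul_diff2 ops)
 next
  case (scalar k g h x y)
  then show ?thesis using cm[OF B.N_closed(3)[OF B.trelI(3)[OF _ g g, of k y h x g]], of "c g h"]
   by (simp add: frag_extend_diff frag_cmul_diff2 ops)
 qed
 show "compat K A B ?f" "compat K A B ?f'"
  unfolding compat_def using 1 2 g by (auto simp: tsyms_def)
qed

subsection \<open>The grading of the enveloping algebra\<close>

definition homog where "homog n u \<longleftrightarrow> (\<forall>(g, x, h, y)\<in>keys u. g + h = n)"

lemma gr_E: "gr E n = cl ` {u \<in> F. homog n u}"
 by (simp add: env_def Let_def homog_def)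

definition prj :: "'g => ('g, 'a) tensor => ('g, 'a) tensor" where
 "prj n = tmap K A (\<lambda>(g, x, h, y). frag_cmul (if g + h = n then 1 else 0) (frag_of (g, x, h, y)))"

lemma prj_resp: "compat K A A (\<lambda>(g, x, h, y). frag_cmul (if g + h = n then 1 else 0) (frag_of (g, x, h, y)))"
 using compatI(1)[OF env_alg_self, of "\<lambda>g. g" "\<lambda>g h. if g + h = n then 1 else 0"] by simp

lemma prj_homog:
 assumes "homog m u" shows "prj n (cl u) = (if m = n then cl u else 0_E)"
proof -
 let ?f = "\<lambda>(g, x, h, y). frag_cmul (if g + h = n then 1 else 0) (frag_of (g, x, h, y))"
 have "frag_extend ?f u = (if m = n then u else 0)"
 proof (cases "m = n")
  case True
  have "frag_extend ?f u = frag_extend frag_of u"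
   by (rule frag_extend_eq) (use assms True in "auto simp: homog_def")
  then show ?thesis using True frag_expansion[of u] by simp
 next
  case False
  have "frag_extend ?f u = 0"
   by (rule frag_extend_eq_0) (use assms False in "auto simp: homog_def")
  then show ?thesis using False by simp
 qed
 then show ?thesis unfolding prj_def tmap_cl[OF prj_resp env_alg_self] by (simp add: zero_E)
qed

lemma homog_closed: "homog n 0" "homog n u ==> homog n v ==> homog n (u + v)" "homog n u ==> homog n (- u)"
 "homog (g + h) (frag_of (g, x, h, y))"
 using keys_add[of u v] by (auto simp: homog_def)

lemma pu_gr: "x \<in> gr A g ==> y \<in> gr A h ==> pu g x h y \<in> gr E (g + h)"
 unfolding gr_E pu_def by (rule imageI) (simp add: tsyms_def homog_closed)

lemma gr_E_carrier: "U \<in> gr E n ==> U \<in> carrier E"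
 unfolding gr_E carrier_E by blast

lemma gr_E_minus: "U \<in> gr E n ==> -_E U \<in> gr E n"
proof -
 assume "U \<in> gr E n"
 then obtain u where u: "u \<in> F" "homog n u" "U = cl u" unfolding gr_E by blast
 then have "-_E U = cl (- u)" using minus_E by simp
 then show ?thesis unfolding gr_E using u homog_closed(3) F_closed(3) by blast
qed

lemma E_graded: "graded_group E"
proof (rule graded_groupI[where N = E])
 fix n U V assume "U \<in> gr E n" "V \<in> gr E n"
 then obtain u v where u: "u \<in> F" "homog n u" "U = cl u" "v \<in> F" "homog n v" "V = cl v" unfolding gr_E by blast
 then have "U +_E V = cl (u + v)" using add_E by simp
 then show "U +_E V \<in> gr E n" unfolding gr_E using u homog_closed(2) F_closed(2) by blast
next
 fix U assume "U \<in> carrier E"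
 then have "U \<in> hspan E \<and> -_E U \<in> hspan E"
 proof (induction rule: E_induct)
  case zero
  then show ?case by (simp add: hspan_zero)
 next
  case (pure g x h y)
  then show ?case
   using hspan_gr[OF E.abgrp pu_gr] hspan_gr[OF E.abgrp gr_E_minus[OF pu_gr]]
   by simp
 next
  case (add U V)
  then show ?case using hspan_sum[OF E.abgrp gr_E_carrier] by (simp add: E.minus_add)
 next
  case (minus U)
  then show ?case by (simp add: E.minus_minus)
 qed
 then show "U \<in> hspan E" by simp
next
 fix n
 show "\<exists>pr\<in>ahom E E. (\<forall>x\<in>gr E n. pr x = 0_E --> x = 0_E) \<and> (\<forall>h. \<forall>x\<in>gr E h. h \<noteq> n --> pr x = 0_E)"
 proof (rule bexI[of _ "prj n"], intro conjI allI ballI impI)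
  fix U assume "U \<in> gr E n" "prj n U = 0_E"
  then show "U = 0_E" unfolding gr_E using prj_homog[of n _ n] by auto
 next
  fix h U assume "U \<in> gr E h" "h \<noteq> n"
  then show "prj n U = 0_E" unfolding gr_E using prj_homog[of h _ n] by auto
 qed (unfold prj_def, rule tmap_hom[OF prj_resp env_alg_self])
next
 fix n show "0_E \<in> gr E n" unfolding gr_E zero_E using homog_closed(1) F_closed(1) by blast
qed (use gr_E_carrier gr_E_minus E.abgrp in auto)

lemma gr_E_induct [consumes 1, case_names zero pure add minus]:
 assumes U: "U \<in> gr E n" and P0: "P 0_E"
  and P1: "\<And>g x h y. x \<in> gr A g ==> y \<in> gr A h ==> g + h = n ==> P (pu g x h y)"
  and P2: "\<And>U V. U \<in> carrier E ==> V \<in> carrier E ==> P U ==> P V ==> P (U +_E V)"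
  and P3: "\<And>U. U \<in> carrier E ==> P U ==> P (-_E U)"
 shows "P U"
proof -
 note h = tmap_hom[OF prj_resp env_alg_self, folded prj_def]
 have "P (prj n U)" using gr_E_carrier[OF U]
 proof (induction rule: E_induct)
  case zero
  then show ?case using P0 ahom_zero[OF E.abgrp E.abgrp h] by simp
 next
  case (pure g x h y)
  then show ?case using P0 P1 prj_homog[OF homog_closed(4), of n g x h y] by (auto simp: pu_def)
 next
  case (add U V)
  then show ?case using P2 by (simp add: ahom_add[OF h] ahom_closed[OF h])
 next
  case (minus U)
  then show ?case using P3 by (simp add: ahom_minus[OF E.abgrp E.abgrp h] ahom_closed[OF h])
 qed
 moreover have "prj n U = U" using U prj_homog[of n _ n] unfolding gr_E by auto
 ultimately show ?thesis by simp
qed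

lemma ahom_gr_E:
 assumes "U \<in> gr E n" and G: "graded_group G" and f: "f \<in> ahom E G"
  and pure: "\<And>g x h y. x \<in> gr A g ==> y \<in> gr A h ==> g + h = n ==> f (pu g x h y) \<in> gr G m"
 shows "f U \<in> gr G m"
 using assms(1)
proof (induction rule: gr_E_induct)
 note h = ahom_zero[OF E.abgrp graded_ag[OF G] f] ahom_minus[OF E.abgrp graded_ag[OF G] f] ahom_add[OF f]
 {
  case zero
  then show ?case by (simp add: h G)
 next
  case (add U V)
  then show ?case by (simp add: h gr_add[OF G])
 next
  case (minus U)
  then show ?case by (simp add: h gr_minus[OF G])
 }
qed (rule pure)

lemma gr_E_ahom_eq:
 assumes "U \<in> gr E n" and G: "abelian_group G" and f: "f \<in> ahom E G" "f' \<in> ahom E G"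
  and pure: "\<And>g x h y. x \<in> gr A g ==> y \<in> gr A h ==> g + h = n ==> f (pu g x h y) = f' (pu g x h y)"
 shows "f U = f' U"
 using assms(1)
proof (induction rule: gr_E_induct)
 note h = ahom_zero[OF E.abgrp G] ahom_minus[OF E.abgrp G]
 {
  case zero
  then show ?case using f by (simp add: h)
 next
  case (add U V)
  then show ?case using f by (simp add: ahom_add)
 next
  case (minus U)
  then show ?case using f by (simp add: h)
 }
qed (rule pure)

lemma gr_E_mult:
 assumes U: "U \<in> gr E g" and V: "V \<in> gr E h" shows "U *_E V \<in> gr E (g + h)"
proof (rule ahom_gr_E[OF U E_graded])
 note Vc = gr_E_carrier[OF V]
 show "(\<lambda>U. U *_E V) \<in> ahom E E" by (rule ahomI) (use Vc in "simp_all add: E.l_distr")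
 fix k x l y assume p: "x \<in> gr A k" "y \<in> gr A l" "k + l = g"
 note pc = pu_closed[OF p(1,2)]
 show "pu k x l y *_E V \<in> gr E (g + h)"
 proof (rule ahom_gr_E[OF V E_graded])
  show "(\<lambda>V. pu k x l y *_E V) \<in> ahom E E" by (rule ahomI) (use pc in "simp_all add: E.r_distr")
  fix k' x' l' y' assume p': "x' \<in> gr A k'" "y' \<in> gr A l'" "k' + l' = h"
  have "pu (k + k') (x' *_A x) (l + l') (y *_A y') \<in> gr E ((k + k') + (l + l'))"
   by (rule pu_gr) (use p p' multA multA' in auto)
  moreover have "(k + k') + (l + l') = g + h" by (simp add: p(3)[symmetric] p'(3)[symmetric] ac_simps)
  ultimately show "pu k x l y *_E pu k' x' l' y' \<in> gr E (g + h)"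
   by (simp add: pu_mult[OF p(1,2) p'(1,2)] gr_koszul[OF E_graded])
 qed
qed

lemma dd_E: assumes "U \<in> carrier E" shows "dd E U = 0_E"
proof -
 obtain u where u: "u \<in> F" "U = cl u" using assms by (rule carrier_E_cases)
 let ?f = "\<lambda>(g, x, h, y). frag_of (g + ddeg, dd A x, h, y) + frag_cmul (ksign (cdeg g)) (frag_of (g, x, h + ddeg, dd A y))"
 have "frag_extend ?f v \<in> N" if "v \<in> F" for v
  using that
 proof (induction rule: F_induct)
  case (sym p)
  obtain g x h y where p: "p = (g, x, h, y)" by (metis prod_cases4)
  show ?case using sym sym_zero_N(1)[of y h "g + ddeg"] N_cmul_sign[OF sym_zero_N(2)[of x g "h + ddeg"], of "ksign (cdeg g)"]
   by (simp add: p dA tsyms_def N_closed(2) ksign_def)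
 qed (simp_all add: N_closed frag_extend_diff)
 from this[OF trep_F[OF u(1)]] show ?thesis
  by (simp add: env_def Let_def u cl_eq_iff zero_E[unfolded env_def Let_def, simplified])
qed

lemma zalg_E: "zalg E"
proof (rule zalg.intro[OF E_ring], unfold_locales)
 show "1_E \<in> gr E 0" using pu_gr[OF oneA oneA] by (simp add: one_E pu_def)
qed (use E_graded gr_E_mult dd_E in auto)

sublocale zalg E by (rule zalg_E)

text \<open>
A symbol consists of two degrees and two elements, so symbols embed into the universe; finite integer combinations of
them do too, and a tensor is determined by a representing combination.
\<close>

lemma emb_E:
 assumes "infinite (UNIV :: 'u set)" "\<exists>\<iota> :: 'a => 'u. inj_on \<iota> (carrier A)" "countable (UNIV :: 'g set)"
 shows "emb TYPE('u) (regular E)"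
proof -
 obtain i :: "'a => 'u" where i: "inj_on i (carrier A)" using assms(2) by blast
 obtain n :: "'g => nat" where n: "inj n" using assms(3) unfolding countable_def by blast
 obtain m :: "nat => 'u" where m: "inj m" using assms(1) infinite_countable_subset by blast
 define j where "j = m o n"
 have j: "inj j" unfolding j_def by (rule inj_compose[OF m n])
 have "|UNIV \<times> UNIV :: ('u \<times> 'u) set| \<le>o |UNIV :: 'u set|"
  using card_of_Times_same_infinite[OF assms(1)] ordIso_iff_ordLeq by blast
 then obtain q :: "'u \<times> 'u => 'u" where "inj_on q (UNIV \<times> UNIV)"
  using card_of_ordLeq[of "UNIV \<times> UNIV :: ('u \<times> 'u) set" "UNIV :: 'u set"] by auto
 then have q: "inj q" by simp
 let ?s = "\<lambda>(g, x, h, y). q (j g, q (i x, q (j h, i y)))"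
 have s: "inj_on ?s (tsyms A)"
 proof (rule inj_onI)
  fix p p' assume p: "p \<in> tsyms A" "p' \<in> tsyms A" and e: "?s p = ?s p'"
  obtain g x h y where pe: "p = (g, x, h, y)" by (metis prod_cases4)
  obtain g' x' h' y' where pe': "p' = (g', x', h', y')" by (metis prod_cases4)
  have "j g = j g'" "i x = i x'" "j h = j h'" "i y = i y'" using e by (simp_all add: pe pe' inj_eq[OF q])
  moreover have "x \<in> carrier A" "x' \<in> carrier A" "y \<in> carrier A" "y' \<in> carrier A"
   using p grc by (auto simp: tsyms_def pe pe')
  ultimately show "p = p'" using inj_onD[OF i] by (simp add: pe pe' inj_eq[OF j])
 qed
 define r where "r u = frag_extend (\<lambda>p. frag_of (?s p)) u" for u
 have lk: "lookup (r u) (?s p) = lookup u p" if u: "u \<in> F" and p: "p \<in> tsyms A" for u p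
  using u
 proof (induction rule: F_induct)
  case (sym p')
  then show ?case using inj_on_eq_iff[OF s, of p' p] p by (auto simp: r_def lookup_frag_of)
 qed (simp_all add: r_def frag_extend_diff lookup_minus)
 have ri: "inj_on r F"
 proof (rule inj_onI)
  fix u v assume u: "u \<in> F" "v \<in> F" "r u = r v"
  show "u = v"
  proof (rule poly_mapping_eqI)
   fix p
   show "lookup u p = lookup v p"
   proof (cases "p \<in> tsyms A")
    case True
    then show ?thesis using lk[OF u(1) True] lk[OF u(2) True] u(3) by simp
   next
    case False
    then have "p \<notin> keys u" "p \<notin> keys v" using u(1,2) by auto
    then show ?thesis by (simp add: in_keys_iff)
   qed
  qed
 qed
 have "carrier (free_Abelian_group (UNIV :: 'u set)) \<approx> (UNIV :: 'u set)"
  by (rule eqpoll_free_Abelian_group_infinite[OF assms(1)])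
 then obtain k :: "('u \<Rightarrow>\<^sub>0 int) => 'u" where k: "inj_on k (carrier (free_Abelian_group UNIV))"
  unfolding eqpoll_def bij_betw_def by blast
 have "inj_on (\<lambda>U. k (r (trep U))) (carrier E)"
 proof (rule inj_onI)
  fix U V assume U: "U \<in> carrier E" "V \<in> carrier E" and e: "k (r (trep U)) = k (r (trep V))"
  obtain u v where uv: "u \<in> F" "U = cl u" "v \<in> F" "V = cl v" using U by (metis carrier_E_cases)
  have "r (trep U) = r (trep V)" by (rule inj_onD[OF k e]) simp_all
  then have "trep U = trep V" by (rule inj_onD[OF ri]) (use uv trep_F in auto)
  moreover have "cl (trep U) = U" "cl (trep V) = V" using trep_cl uv by (simp_all add: cl_eq_iff)
  ultimately show "U = V" by metis
 qed
 then show ?thesis unfolding emb_def by (simp add: regular_simps) blast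
qed

end

section \<open>Totalization along a twist\<close>

text \<open>
Actions, differentials and comparison maps are given on homogeneous elements by formulas whose signs depend on the
degree; this is the common form of their additive extensions.
\<close>

definition gext where
 "gext M N \<phi> x = (\<Oplus>\<^bsub>N\<^esub>g\<in>hsupp M x. \<phi> g (hcomp M x g))"

lemma gext_sum:
 assumes "graded_group M" "abelian_group N" "\<And>g. \<phi> g \<in> ahom M N" "x \<in> carrier M" "finite S" "hsupp M x \<subseteq> S"
 shows "gext M N \<phi> x = (\<Oplus>\<^bsub>N\<^esub>g\<in>S. \<phi> g (hcomp M x g))"
proof -
 have "\<phi> g (hcomp M x g) \<in> carrier N" for g
  by (rule ahom_closed[OF assms(3) hcomp_closed[OF assms(1,4)]])
 moreover have "\<phi> g 0_M = 0_N" for g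
  by (rule ahom_zero[OF graded_ag[OF assms(1)] assms(2,3)])
 ultimately show ?thesis unfolding gext_def
  by (intro finsum_mono_zero[symmetric] assms) (auto simp: hsupp_def)
qed

lemma gext_hom_eq:
 assumes "graded_group M" "abelian_group N" "\<And>g. \<phi> g \<in> ahom M N" "x \<in> gr M g"
 shows "gext M N \<phi> x = \<phi> g x"
proof -
 interpret N: abelian_group N by fact
 note x = gr_carrier[OF assms(1,4)]
 have s: "hsupp M x \<subseteq> {g}" using hsupp_homogeneous[OF assms(1,4)] by auto
 have "gext M N \<phi> x = (\<Oplus>\<^bsub>N\<^esub>h\<in>{g}. \<phi> h (hcomp M x h))"
  by (rule gext_sum[OF assms(1-3) x _ s]) simp
 also have "\<dots> = \<phi> g x"
  using hcomp_hom[OF assms(1,4)] ahom_closed[OF assms(3) x] by simp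
 finally show ?thesis .
qed

lemma gext_hom:
 assumes "graded_group M" "abelian_group N" "\<And>g. \<phi> g \<in> ahom M N"
 shows "gext M N \<phi> \<in> ahom M N"
proof (rule ahomI)
 interpret M: abelian_group M using assms(1) by (rule graded_ag)
 interpret N: abelian_group N by fact
 have c: "\<phi> g (hcomp M x g) \<in> carrier N" if "x \<in> carrier M" for x g
  by (rule ahom_closed[OF assms(3) hcomp_closed[OF assms(1) that]])
 show "gext M N \<phi> x \<in> carrier N" if "x \<in> carrier M" for x
  unfolding gext_def by (rule N.finsum_closed) (use c[OF that] in auto)
 fix x y assume x: "x \<in> carrier M" "y \<in> carrier M"
 have fin: "finite (hsupp M x \<union> hsupp M y)" using x assms(1) by (simp add: hsupp_finite)
 have "gext M N \<phi> (x +_M y) = (\<Oplus>\<^bsub>N\<^esub>g\<in>hsupp M x \<union> hsupp M y. \<phi> g (hcomp M (x +_M y) g))"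
  by (rule gext_sum[OF assms _ fin]) (use x assms in "auto simp: hsupp_def hcomp_add")
 also have "\<dots> = (\<Oplus>\<^bsub>N\<^esub>g\<in>hsupp M x \<union> hsupp M y. \<phi> g (hcomp M x g) +_N \<phi> g (hcomp M y g))"
  by (rule N.finsum_cong')
   (use c[OF x(1)] c[OF x(2)] ahom_add[OF assms(3)] x assms(1) in "auto simp: hcomp_add hcomp_closed")
 also have "\<dots> = (\<Oplus>\<^bsub>N\<^esub>g\<in>hsupp M x \<union> hsupp M y. \<phi> g (hcomp M x g)) +_N
   (\<Oplus>\<^bsub>N\<^esub>g\<in>hsupp M x \<union> hsupp M y. \<phi> g (hcomp M y g))"
  by (rule N.finsum_addf) (use c x in auto)
 also have "(\<Oplus>\<^bsub>N\<^esub>g\<in>hsupp M x \<union> hsupp M y. \<phi> g (hcomp M x g)) = gext M N \<phi> x"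
  by (rule gext_sum[OF assms _ fin, symmetric]) (use x in auto)
 also have "(\<Oplus>\<^bsub>N\<^esub>g\<in>hsupp M x \<union> hsupp M y. \<phi> g (hcomp M y g)) = gext M N \<phi> y"
  by (rule gext_sum[OF assms _ fin, symmetric]) (use x in auto)
 finally show "gext M N \<phi> (x +_M y) = gext M N \<phi> x +_N gext M N \<phi> y" .
qed

text \<open>
 A complex of graded modules becomes a DG module: the grading is the total one, and the action on
 a component of internal degree \<open>i\<close> is twisted by \<open>\<Psi> i\<close>.  The underlying group and the
 differential do not change.
\<close>

definition tot :: "(int => 'f => 'e) => ('e, int \<times> int, 'm) dg => ('f, int, 'm) dg" where
 "tot \<Psi> M = mk_dg (carrier M) (add M) 0_M
   (\<lambda>e. gext M M (\<lambda>g x. ract M x (\<Psi> (snd g) e)))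
   (\<lambda>n. {x \<in> carrier M. \<forall>g. hcomp M x g \<noteq> 0_M --> fst g + snd g = n}) (dd M)"

lemma tot_simps [simp]:
 "carrier (tot \<Psi> M) = carrier M" "add (tot \<Psi> M) = add M" "zero (tot \<Psi> M) = zero M" "dd (tot \<Psi> M) = dd M"
 by (simp_all add: tot_def mk_dg_def)

lemma tot_gr: "gr (tot \<Psi> M) n = {x \<in> carrier M. \<forall>g. hcomp M x g \<noteq> 0_M --> fst g + snd g = n}"
 by (simp add: tot_def mk_dg_def)

lemma tot_abelian: "abelian_group M ==> abelian_group (tot \<Psi> M)"
 by (rule abelian_group_add_cong) simp_all

lemma tot_a_inv: "abelian_group M ==> x \<in> carrier M ==> -_(tot \<Psi> M) x = -_M x"
 by (rule a_inv_cong) simp_all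

lemma tot_grI:
 assumes "graded_group M" "x \<in> gr M (p, i)" "p + i = n" shows "x \<in> gr (tot \<Psi> M) n"
 using gr_carrier[OF assms(1,2)] hcomp_hom[OF assms(1,2)] assms(3) by (auto simp: tot_gr split: if_splits)

lemma tot_gr_zero: "graded_group M ==> 0_M \<in> gr (tot \<Psi> M) n"
 by (simp add: tot_gr hcomp_zero abelian_groupE(2) graded_ag)

lemma tot_gr_add:
 assumes "graded_group M" "x \<in> gr (tot \<Psi> M) n" "y \<in> gr (tot \<Psi> M) n"
 shows "x +_M y \<in> gr (tot \<Psi> M) n"
proof -
 interpret M: abelian_group M using assms(1) by (rule graded_ag)
 show ?thesis using assms(2,3) hcomp_add[OF assms(1), of x y] by (auto simp: tot_gr) (metis M.l_zero M.zero_closed)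
qed

lemma tot_gr_induct [consumes 2, case_names zero add]:
 assumes M: "graded_group M" and x: "x \<in> gr (tot \<Psi> M) n"
  and P0: "P 0_M"
  and P1: "\<And>x p i y. x \<in> gr M (p, i) ==> p + i = n ==> y \<in> carrier M ==> P y ==> P (x +_M y)"
 shows "P x"
proof -
 interpret abelian_group M using M by (rule graded_ag)
 have xc: "x \<in> carrier M" using x by (simp add: tot_gr)
 have hc: "hcomp M x g \<in> carrier M" for g by (rule hcomp_closed[OF M xc])
 have "(\<Oplus>\<^bsub>M\<^esub>g\<in>S. hcomp M x g) \<in> carrier M \<and> P (\<Oplus>\<^bsub>M\<^esub>g\<in>S. hcomp M x g)" if "finite S" "S \<subseteq> hsupp M x" for S
  using that
 proof (induction S rule: finite_induct)
  case empty
  then show ?case using P0 by simp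
 next
  case (insert g S)
  have "hcomp M x g \<in> gr M (fst g, snd g)" using hcomp_gr[OF M xc, of g] by simp
  moreover have "fst g + snd g = n" using insert x by (auto simp: tot_gr hsupp_def)
  moreover have "(\<Oplus>\<^bsub>M\<^esub>g\<in>insert g S. hcomp M x g) = hcomp M x g +_M (\<Oplus>\<^bsub>M\<^esub>g\<in>S. hcomp M x g)"
   by (rule finsum_insert) (use insert hc in auto)
  ultimately show ?case
   using P1[of "hcomp M x g" "fst g" "snd g" "\<Oplus>\<^bsub>M\<^esub>g\<in>S. hcomp M x g"] insert hc by simp
 qed
 from this[OF hsupp_finite[OF M xc] subset_refl] hcomp_sum[OF M xc hsupp_finite[OF M xc] subset_refl]
 show ?thesis by simp
qed

lemma tot_graded:
 assumes M: "graded_group M" shows "graded_group (tot \<Psi> M)"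
proof -
 interpret abelian_group M using M by (rule graded_ag)
 have sp: "x \<in> hspan (tot \<Psi> M)" if "x \<in> carrier M" for x
  using M that
 proof (induction rule: graded_induct)
  case zero
  then show ?case using hspan_zero[of "tot \<Psi> M"] by simp
 next
  case (add x g y)
  have "x \<in> gr (tot \<Psi> M) (fst g + snd g)" by (rule tot_grI[OF M, of _ "fst g" "snd g"]) (use add in simp_all)
  from hspan_add[OF this add(3)] show ?case by simp
 qed
 show ?thesis
 proof (rule graded_groupI[where N = M])
  fix n
  let ?\<phi> = "\<lambda>(g :: int \<times> int) x. if fst g + snd g = n then x else 0_M"
  have \<phi>: "?\<phi> g \<in> ahom M M" for g by (rule ahomI) auto
  note h = gext_hom[OF M abgrp, of ?\<phi>, OF \<phi>]
  have v: "gext M M ?\<phi> x = (if m = n then x else 0_M)" if "x \<in> gr (tot \<Psi> M) m" for x m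
   using M that
  proof (induction rule: tot_gr_induct)
   case zero
   then show ?case using ahom_zero[OF abgrp abgrp h] by simp
  next
   case (add x p i y)
   then show ?case
    using ahom_add[OF h gr_carrier[OF M add(1)] add(3)] gext_hom_eq[OF M abgrp \<phi> add(1)]
     gr_carrier[OF M add(1)] by auto
  qed
  show "\<exists>pr\<in>ahom (tot \<Psi> M) M. (\<forall>x\<in>gr (tot \<Psi> M) n. pr x = 0_M --> x = 0_(tot \<Psi> M)) \<and>
    (\<forall>h. \<forall>x\<in>gr (tot \<Psi> M) h. h \<noteq> n --> pr x = 0_M)"
   using h v by (intro bexI[of _ "gext M M ?\<phi>"]) (auto simp: hom_def)
 next
  fix g x assume x: "x \<in> gr (tot \<Psi> M) g"
  then have xc: "x \<in> carrier M" by (simp add: tot_gr)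
  have "hcomp M x h \<noteq> 0_M" if "hcomp M (-_M x) h \<noteq> 0_M" for h
   using that ahom_minus[OF abgrp abgrp hcomp_ahom[OF M] xc, of h]
    minus_zero_ag[OF abgrp] by metis
  then show "-_(tot \<Psi> M) x \<in> gr (tot \<Psi> M) g"
   using x xc by (auto simp: tot_gr tot_a_inv[OF abgrp])
 next
  fix g x y assume "x \<in> gr (tot \<Psi> M) g" "y \<in> gr (tot \<Psi> M) g"
  then show "x +_(tot \<Psi> M) y \<in> gr (tot \<Psi> M) g" using tot_gr_add[OF M] by simp
 qed (use sp M abgrp hcomp_zero[OF M] in "simp_all add: tot_abelian tot_gr")
qed

text \<open>
The abstract situation for totalization: a system of additive bijections indexed by internal degrees, multiplicative up
to moving the index past a homogeneous factor. Since \<open>E0\<close> sits in cohomological degree zero, acting does not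
change the cohomological degree.
\<close>

locale zhang = E0: concentrated_alg E0 + E1: zalg E1
 for E0 :: "('k, int \<times> int, 'e) dg" and E1 :: "('k, int, 'f) dg" +
 fixes \<Psi> :: "int => 'f => 'e" and \<Omega> :: "int => 'e => 'f"
 assumes \<Psi>_hom: "\<Psi> i \<in> ahom E1 E0" and \<Omega>_hom: "\<Omega> i \<in> ahom E0 E1"
  and \<Omega>_\<Psi>: "e \<in> carrier E1 ==> \<Omega> i (\<Psi> i e) = e" and \<Psi>_\<Omega>: "w \<in> carrier E0 ==> \<Psi> i (\<Omega> i w) = w"
  and \<Psi>_gr: "e \<in> gr E1 n ==> \<Psi> i e \<in> gr E0 (0, n)" and \<Omega>_gr: "w \<in> gr E0 (0, n) ==> \<Omega> i w \<in> gr E1 n"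
  and \<Psi>_one: "\<Psi> i 1_E1 = 1_E0"
  and \<Psi>_mult: "e \<in> gr E1 n ==> e' \<in> carrier E1 ==> \<Psi> i (e *_E1 e') = \<Psi> i e *_E0 \<Psi> (i + n) e'"
begin

lemma \<Psi>_closed [simp]: "e \<in> carrier E1 ==> \<Psi> i e \<in> carrier E0"
 by (rule ahom_closed[OF \<Psi>_hom])

lemma \<Omega>_closed [simp]: "w \<in> carrier E0 ==> \<Omega> i w \<in> carrier E1"
 by (rule ahom_closed[OF \<Omega>_hom])

context
 fixes M :: "('e, int \<times> int, 'm) dg"
 assumes M: "dg_module E0 M"
begin

interpretation M: dgmod E0 M using M by blast

lemma tot_act_part: "e \<in> carrier E1 ==> (\<lambda>x. ract M x (\<Psi> (snd g) e)) \<in> ahom M M"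
 by (rule M.act_hom) simp

lemma tot_act:
 assumes "e \<in> carrier E1" "x \<in> gr M (p, i)" shows "ract (tot \<Psi> M) x e = ract M x (\<Psi> i e)"
proof -
 have "(\<lambda>x. ract M x (\<Psi> (snd g) e)) \<in> ahom M M" for g :: "int \<times> int" by (rule tot_act_part[OF assms(1)])
 from gext_hom_eq[OF M.gg M.ag this assms(2)] show ?thesis by (simp add: tot_def mk_dg_def)
qed

lemma tot_act_hom:
 assumes "e \<in> carrier E1" shows "(\<lambda>x. ract (tot \<Psi> M) x e) \<in> ahom M M"
proof -
 have "(\<lambda>x. ract M x (\<Psi> (snd g) e)) \<in> ahom M M" for g :: "int \<times> int" by (rule tot_act_part[OF assms(1)])
 from gext_hom[OF M.gg M.ag this] show ?thesis by (simp add: tot_def mk_dg_def)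
qed

lemma tot_dgm: "dg_module E1 (tot \<Psi> M)"
proof (rule E1.dg_moduleI[OF tot_graded[OF M.gg]])
 note cl = ahom_closed[OF tot_act_hom]
 fix x e assume x: "x \<in> carrier (tot \<Psi> M)" and e: "e \<in> carrier E1"
 then have xc: "x \<in> carrier M" by simp
 show "ract (tot \<Psi> M) x e \<in> carrier (tot \<Psi> M)" using cl[OF e xc] by simp
 show "ract (tot \<Psi> M) (x +_(tot \<Psi> M) y) e = ract (tot \<Psi> M) x e +_(tot \<Psi> M) ract (tot \<Psi> M) y e"
  if "y \<in> carrier (tot \<Psi> M)" for y
  using ahom_add[OF tot_act_hom[OF e] xc] that by simp
 show "ract (tot \<Psi> M) x (e +_E1 e') = ract (tot \<Psi> M) x e +_(tot \<Psi> M) ract (tot \<Psi> M) x e'"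
  if e': "e' \<in> carrier E1" for e'
 proof -
  have "ract (tot \<Psi> M) x (e +_E1 e') = ract (tot \<Psi> M) x e +_M ract (tot \<Psi> M) x e'"
  proof (rule ahom_eqI[OF M.gg M.ag tot_act_hom _ _ xc])
   show "(\<lambda>x. ract (tot \<Psi> M) x e +_M ract (tot \<Psi> M) x e') \<in> ahom M M"
    by (rule M.ahom_plus[OF tot_act_hom[OF e] tot_act_hom[OF e'] M.ag])
   fix g x assume "x \<in> gr M g"
   then show "ract (tot \<Psi> M) x (e +_E1 e') = ract (tot \<Psi> M) x e +_M ract (tot \<Psi> M) x e'"
    using e e' by (cases g) (simp add: tot_act M.act_add_right M.gr_closed ahom_add[OF \<Psi>_hom])
  qed (use e e' in simp)
  then show ?thesis by simp
 qed
 show "ract (tot \<Psi> M) (ract (tot \<Psi> M) x e) e' = ract (tot \<Psi> M) x (e *_E1 e')"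
  if e': "e' \<in> carrier E1" for e'
 proof (rule ahom_eqI[OF M.gg M.ag _ _ _ xc])
  show "(\<lambda>x. ract (tot \<Psi> M) (ract (tot \<Psi> M) x e) e') \<in> ahom M M"
   using ahom_comp[OF tot_act_hom[OF e] tot_act_hom[OF e']] by (simp add: comp_def)
  show "(\<lambda>x. ract (tot \<Psi> M) x (e *_E1 e')) \<in> ahom M M" by (rule tot_act_hom) (use e e' in simp)
  fix g x assume "x \<in> gr M g"
  moreover obtain p i where g: "g = (p, i)" by (cases g)
  ultimately have x: "x \<in> gr M (p, i)" by simp
  note xc = M.gr_closed[OF x]
  show "ract (tot \<Psi> M) (ract (tot \<Psi> M) x e) e' = ract (tot \<Psi> M) x (e *_E1 e')"
  proof (rule ahom_eqI[OF E1.gg M.ag _ _ _ e])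
   show "(\<lambda>e. ract (tot \<Psi> M) (ract (tot \<Psi> M) x e) e') \<in> ahom E1 M"
   proof (rule ahomI)
    fix a b assume ab: "a \<in> carrier E1" "b \<in> carrier E1"
    then show "ract (tot \<Psi> M) (ract (tot \<Psi> M) x (a +_E1 b)) e' =
     ract (tot \<Psi> M) (ract (tot \<Psi> M) x a) e' +_M ract (tot \<Psi> M) (ract (tot \<Psi> M) x b) e'"
     using x xc ahom_add[OF tot_act_hom[OF e']] by (simp add: tot_act ahom_add[OF \<Psi>_hom] M.act_add_right)
   qed (use cl xc e' in simp)
   show "(\<lambda>e. ract (tot \<Psi> M) x (e *_E1 e')) \<in> ahom E1 M"
    by (rule ahomI) (use x xc e' in "simp_all add: tot_act E1.l_distr ahom_add[OF \<Psi>_hom] M.act_add_right")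
   fix n a assume a: "a \<in> gr E1 n"
   have ac: "a \<in> carrier E1" by (rule gr_carrier[OF E1.gg a])
   have "ract M x (\<Psi> i a) \<in> gr M (p, i + n)" using M.act_gr[OF x \<Psi>_gr[OF a, of i]] by simp
   then show "ract (tot \<Psi> M) (ract (tot \<Psi> M) x a) e' = ract (tot \<Psi> M) x (a *_E1 e')"
    using x xc ac e' by (simp add: tot_act M.act_act \<Psi>_mult[OF a e'])
  qed
 qed
 show "dd (tot \<Psi> M) (ract (tot \<Psi> M) x e) = ract (tot \<Psi> M) (dd (tot \<Psi> M) x) e"
 proof -
  have "dd M (ract (tot \<Psi> M) x e) = ract (tot \<Psi> M) (dd M x) e"
  proof (rule ahom_eqI[OF M.gg M.ag _ _ _ xc])
   show "(\<lambda>x. dd M (ract (tot \<Psi> M) x e)) \<in> ahom M M"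
    using ahom_comp[OF tot_act_hom[OF e] M.d_hom] by (simp add: comp_def)
   show "(\<lambda>x. ract (tot \<Psi> M) (dd M x) e) \<in> ahom M M"
    using ahom_comp[OF M.d_hom tot_act_hom[OF e]] by (simp add: comp_def)
   fix g x assume "x \<in> gr M g"
   moreover obtain p i where g: "g = (p, i)" by (cases g)
   ultimately have x: "x \<in> gr M (p, i)" by simp
   have "dd M x \<in> gr M (p + 1, i)" using M.d_gr[OF x] by (simp add: ddeg_prod_def ddeg_int_def)
   then show "dd M (ract (tot \<Psi> M) x e) = ract (tot \<Psi> M) (dd M x) e"
    using x e M.gr_closed[OF x] by (simp add: tot_act E0.act_d[OF M])
  qed
  then show ?thesis by simp
 qed
next
 fix x assume x: "x \<in> carrier (tot \<Psi> M)"
 then have xc: "x \<in> carrier M" by simp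
 have "ract (tot \<Psi> M) x 1_E1 = id x"
 proof (rule ahom_eqI[OF M.gg M.ag tot_act_hom _ _ xc])
  fix g x assume "x \<in> gr M g"
  then show "ract (tot \<Psi> M) x 1_E1 = id x" by (cases g) (simp add: tot_act \<Psi>_one M.gr_closed)
 qed (simp_all add: hom_def)
 then show "ract (tot \<Psi> M) x 1_E1 = x" by simp
next
 fix g h x e assume x: "x \<in> gr (tot \<Psi> M) g" and e: "e \<in> gr E1 h"
 note ec = gr_carrier[OF E1.gg e]
 show "ract (tot \<Psi> M) x e \<in> gr (tot \<Psi> M) (g + h)"
  using M.gg x
 proof (induction rule: tot_gr_induct)
  case zero
  then show ?case using ahom_zero[OF M.ag M.ag tot_act_hom[OF ec]] tot_gr_zero[OF M.gg] by simp
 next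
  case (add x p i y)
  have "ract M x (\<Psi> i e) \<in> gr M (p, i + h)" using M.act_gr[OF add(1) \<Psi>_gr[OF e, of i]] by simp
  then have "ract M x (\<Psi> i e) \<in> gr (tot \<Psi> M) (g + h)" by (rule tot_grI[OF M.gg]) (use add in simp)
  then show ?case using add ec
   by (simp add: ahom_add[OF tot_act_hom] M.gr_closed tot_act tot_gr_add[OF M.gg])
 qed
next
 fix g x assume x: "x \<in> gr (tot \<Psi> M) g"
 have "dd M x \<in> gr (tot \<Psi> M) (g + ddeg)"
  using M.gg x
 proof (induction rule: tot_gr_induct)
  case zero
  then show ?case using tot_gr_zero[OF M.gg] by simp
 next
  case (add x p i y)
  have "dd M x \<in> gr M (p + 1, i)" using M.d_gr[OF add(1)] by (simp add: ddeg_prod_def ddeg_int_def)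
  then have "dd M x \<in> gr (tot \<Psi> M) (g + ddeg)" by (rule tot_grI[OF M.gg]) (use add in "simp add: ddeg_int_def")
  then show ?case using add by (simp add: M.d_add M.gr_closed tot_gr_add[OF M.gg])
 qed
 then show "dd (tot \<Psi> M) x \<in> gr (tot \<Psi> M) (g + ddeg)" by simp
next
 show "dd (tot \<Psi> M) \<in> ahom (tot \<Psi> M) (tot \<Psi> M)" using M.d_hom by (auto simp: hom_def)
qed (simp add: M.d_d)

end

text \<open>To define a morphism of totalizations it suffices to check homogeneous elements.\<close>

lemma tot_hom_degI:
 fixes M :: "('e, int \<times> int, 'm) dg" and N :: "('f, int, 'n) dg"
 assumes M: "dg_module E0 M" and N: "dg_module E1 N" and f: "f \<in> ahom M N"
  and act: "\<And>p i x e. x \<in> gr M (p, i) ==> e \<in> carrier E1 ==> f (ract M x (\<Psi> i e)) = ract N (f x) e"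
  and gr: "\<And>p i x. x \<in> gr M (p, i) ==> f x \<in> gr N (p + i + s)"
 shows "f \<in> hom_deg E1 (tot \<Psi> M) N s"
proof -
 interpret M: dgmod E0 M using M by blast
 interpret N: dgmod E1 N using N by blast
 show ?thesis
 proof (rule hom_degI)
  show "f \<in> ahom (tot \<Psi> M) N" using f by (auto simp: hom_def)
  fix x e assume x: "x \<in> carrier (tot \<Psi> M)" and e: "e \<in> carrier E1"
  show "f (ract (tot \<Psi> M) x e) = ract N (f x) e"
  proof (rule ahom_eqI[OF M.gg N.ag])
   show "(\<lambda>x. f (ract (tot \<Psi> M) x e)) \<in> ahom M N"
    using ahom_comp[OF tot_act_hom[OF M e] f] by (simp add: comp_def)
   show "(\<lambda>x. ract N (f x) e) \<in> ahom M N"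
    using ahom_comp[OF f N.act_hom[OF e]] by (simp add: comp_def)
   fix g x assume "x \<in> gr M g"
   then show "f (ract (tot \<Psi> M) x e) = ract N (f x) e"
    using e act by (cases g) (simp add: tot_act[OF M])
  qed (use x in simp)
 next
  fix n x assume "x \<in> gr (tot \<Psi> M) n"
  with M.gg show "f x \<in> gr N (n + s)"
  proof (induction rule: tot_gr_induct)
   case zero
   then show ?case using ahom_zero[OF M.ag N.ag f] N.gg by simp
  next
   case (add x p i y)
   then show ?case using gr[OF add(1)] ahom_add[OF f M.gr_closed[OF add(1)] add(3)] by (simp add: gr_add[OF N.gg])
  qed
 qed
qed

lemma tot_dg_homI:
 fixes M :: "('e, int \<times> int, 'm) dg" and N :: "('f, int, 'n) dg"
 assumes "dg_module E0 M" "dg_module E1 N" "f \<in> ahom M N"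
  and "\<And>p i x e. x \<in> gr M (p, i) ==> e \<in> carrier E1 ==> f (ract M x (\<Psi> i e)) = ract N (f x) e"
  and "\<And>p i x. x \<in> gr M (p, i) ==> f x \<in> gr N (p + i)"
  and "\<And>x. x \<in> carrier M ==> f (dd M x) = dd N (f x)"
 shows "f \<in> dg_hom E1 (tot \<Psi> M) N"
 unfolding dg_hom_def using tot_hom_degI[OF assms(1-4), where s = 0] assms(5,6) by simp

lemma tot_hom_deg:
 assumes M: "dg_module E0 M" and N: "dg_module E0 N" and f: "f \<in> hom_deg E0 M N (s, 0)"
 shows "f \<in> hom_deg E1 (tot \<Psi> M) (tot \<Psi> N) s"
proof -
 interpret M: dgmod E0 M using M by blast
 interpret N: dgmod E0 N using N by blast
 note fD = hom_degD[OF f]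
 show ?thesis
 proof (rule tot_hom_degI[OF M tot_dgm[OF N]])
  show "f \<in> ahom M (tot \<Psi> N)" using fD(1) by (auto simp: hom_def)
  fix p i x assume x: "x \<in> gr M (p, i)"
  have fx: "f x \<in> gr N (p + s, i)" using fD(5)[OF x] by simp
  then show "f x \<in> gr (tot \<Psi> N) (p + i + s)" by (rule tot_grI[OF N.gg]) simp
  fix e assume "e \<in> carrier E1"
  then show "f (ract M x (\<Psi> i e)) = ract (tot \<Psi> N) (f x) e"
   using fD(4) M.gr_closed[OF x] by (simp add: tot_act[OF N _ fx])
 qed
qed

lemma tot_dg_hom:
 assumes "dg_module E0 M" "dg_module E0 N" "f \<in> dg_hom E0 M N"
 shows "f \<in> dg_hom E1 (tot \<Psi> M) (tot \<Psi> N)"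
proof -
 have "f \<in> hom_deg E0 M N (0, 0)" using dg_hom_hom_deg[OF assms(3)] by (simp add: zero_prod_def)
 from tot_hom_deg[OF assms(1,2) this] show ?thesis using dg_homD(6)[OF assms(3)] by (simp add: dg_hom_def)
qed

lemma tot_inv:
 assumes "dg_module E0 M" "dg_module E0 N" "dg_inv E0 M N f g"
 shows "dg_inv E1 (tot \<Psi> M) (tot \<Psi> N) f g"
 using dg_invD[OF assms(3)] tot_dg_hom[OF assms(1,2)] tot_dg_hom[OF assms(2,1)] by (simp add: dg_inv_def)

lemma tot_quasi_iso:
 assumes M: "dg_module E0 M" and N: "dg_module E0 N" and f: "quasi_iso E0 M N f"
 shows "quasi_iso E1 (tot \<Psi> M) (tot \<Psi> N) f"
proof -
 note q = quasi_isoD[OF f M dgm_cx[OF N]]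
 show ?thesis
  by (rule quasi_isoI[OF tot_dg_hom[OF M N q(1)] _ _ dgm_cx[OF tot_dgm[OF M]] dgm_cx[OF tot_dgm[OF N]]])
   (use q(2,3) in "simp_all add: hinj_def hsurj_def")
qed

lemma tot_homotopic:
 assumes M: "dg_module E0 M" and N: "dg_module E0 N" and f: "f \<in> dg_hom E0 M N" "f' \<in> dg_hom E0 M N"
  and "homotopic E0 M N f f'"
 shows "homotopic E1 (tot \<Psi> M) (tot \<Psi> N) f f'"
proof -
 interpret M: dgmod E0 M using M by blast
 note fD = dg_homD(2)[OF f(1)] and f'D = dg_homD(2)[OF f(2)]
 obtain h where h: "h \<in> hom_deg E0 M N (- ddeg)"
  "\<And>x. x \<in> carrier M ==> f x = f' x +_N (dd N (h x) +_N h (dd M x))"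
  by (rule homotopicE[OF assms(5) M N fD f'D]) blast+
 have "h \<in> hom_deg E0 M N (- 1, 0)" using h(1) by (simp add: ddeg_prod_def ddeg_int_def)
 from tot_hom_deg[OF M N this] have "h \<in> hom_deg E1 (tot \<Psi> M) (tot \<Psi> N) (- ddeg)" by (simp add: ddeg_int_def)
 then show ?thesis
  by (rule homotopicI[OF tot_dgm[OF N]]) (use h(2) fD f'D in simp_all)
qed

lemma tot_derived_iso:
 fixes X :: "('e, int \<times> int, 'x) dg" and Y :: "('e, int \<times> int, 'y) dg"
 assumes X: "dg_module E0 X" and Y: "dg_module E0 Y" and d: "derived_iso TYPE('u) E0 X Y"
 shows "derived_iso TYPE('u) E1 (tot \<Psi> X) (tot \<Psi> Y)"
proof -
 obtain Z :: "('e, int \<times> int, 'u) dg" and s f where Z: "dg_module E0 Z" "quasi_iso E0 Z X s" "quasi_iso E0 Z Y f"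
  by (rule derived_iso_spanD[OF d X Y])
 show ?thesis
  by (rule derived_iso_spanI[OF tot_dgm[OF Z(1)] tot_dgm[OF X] tot_dgm[OF Y]
   tot_quasi_iso[OF Z(1) X Z(2)] tot_quasi_iso[OF Z(1) Y Z(3)]])
qed

lemma tot_dsum_inv:
 assumes X: "dg_module E0 X" and Y: "dg_module E0 Y"
 shows "dg_inv E1 (tot \<Psi> (dsum X Y)) (dsum (tot \<Psi> X) (tot \<Psi> Y)) id id"
proof -
 interpret X: dgmod E0 X using X by blast
 interpret Y: dgmod E0 Y using Y by blast
 note D = E0.dsum_dgm[OF X Y] and D1 = E1.dsum_dgm[OF tot_dgm[OF X] tot_dgm[OF Y]]
 interpret D: dgmod E0 "dsum X Y" using D by blast
 have ih: "id \<in> ahom (dsum X Y) (dsum (tot \<Psi> X) (tot \<Psi> Y))" by (rule ahomI) auto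
 have 1: "id \<in> dg_hom E1 (tot \<Psi> (dsum X Y)) (dsum (tot \<Psi> X) (tot \<Psi> Y))"
  by (rule tot_dg_homI[OF D D1 ih]) (auto simp: tot_act[OF X] tot_act[OF Y] tot_grI[OF X.gg] tot_grI[OF Y.gg])
 have gx: "(x, 0_Y) \<in> gr (tot \<Psi> (dsum X Y)) n" if "x \<in> gr (tot \<Psi> X) n" for x n
  using X.gg that
 proof (induction rule: tot_gr_induct)
  case zero
  then show ?case using tot_gr_zero[OF D.gg] by simp
 next
  case (add x p i y)
  have "(x, 0_Y) \<in> gr (tot \<Psi> (dsum X Y)) n"
   by (rule tot_grI[OF D.gg, of _ p i]) (use add Y.gg in simp_all)
  from tot_gr_add[OF D.gg this add(4)] show ?case by simp
 qed
 have gy: "(0_X, x) \<in> gr (tot \<Psi> (dsum X Y)) n" if "x \<in> gr (tot \<Psi> Y) n" for x n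
  using Y.gg that
 proof (induction rule: tot_gr_induct)
  case zero
  then show ?case using tot_gr_zero[OF D.gg] by simp
 next
  case (add x p i y)
  have "(0_X, x) \<in> gr (tot \<Psi> (dsum X Y)) n"
   by (rule tot_grI[OF D.gg, of _ p i]) (use add X.gg in simp_all)
  from tot_gr_add[OF D.gg this add(4)] show ?case by simp
 qed
 have 2: "id \<in> dg_hom E1 (dsum (tot \<Psi> X) (tot \<Psi> Y)) (tot \<Psi> (dsum X Y))"
 proof (rule dg_homI)
  fix g u assume u: "u \<in> gr (dsum (tot \<Psi> X) (tot \<Psi> Y)) g"
  then obtain x y where xy: "u = (x, y)" "x \<in> gr (tot \<Psi> X) g" "y \<in> gr (tot \<Psi> Y) g" by auto
  have "x \<in> carrier X" "y \<in> carrier Y" using xy by (simp_all add: tot_gr)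
  then show "id u \<in> gr (tot \<Psi> (dsum X Y)) g" using tot_gr_add[OF D.gg gx[OF xy(2)] gy[OF xy(3)]] xy by simp
 qed (use dg_homD(4)[OF 1] in auto)
 show ?thesis unfolding dg_inv_def using 1 2 by simp
qed

lemma tot_cone_inv:
 assumes X: "dg_module E0 X" and Y: "dg_module E0 Y" and f: "f \<in> dg_hom E0 X Y"
 shows "dg_inv E1 (tot \<Psi> (cone X Y f)) (cone (tot \<Psi> X) (tot \<Psi> Y) f) id id"
proof -
 interpret X: dgmod E0 X using X by blast
 interpret Y: dgmod E0 Y using Y by blast
 note fD = dg_homD[OF f]
 note D = E0.cone_dgm[OF X Y f] and D1 = E1.cone_dgm[OF tot_dgm[OF X] tot_dgm[OF Y] tot_dg_hom[OF X Y f]]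
 interpret D: dgmod E0 "cone X Y f" using D by blast
 have dg: "(p, i) + (ddeg :: int \<times> int) = (p + 1, i)" for p i by (simp add: ddeg_prod_def ddeg_int_def)
 have ih: "id \<in> ahom (cone X Y f) (cone (tot \<Psi> X) (tot \<Psi> Y) f)" by (rule ahomI) auto
 have 1: "id \<in> dg_hom E1 (tot \<Psi> (cone X Y f)) (cone (tot \<Psi> X) (tot \<Psi> Y) f)"
  by (rule tot_dg_homI[OF D D1 ih])
   (auto simp: dg tot_act[OF X] tot_act[OF Y] tot_grI[OF X.gg] tot_grI[OF Y.gg] ddeg_int_def
    tot_a_inv[OF X.ag] fD)
 have gx: "(0_Y, x) \<in> gr (tot \<Psi> (cone X Y f)) n" if "x \<in> gr (tot \<Psi> X) (n + 1)" for x n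
  using X.gg that
 proof (induction rule: tot_gr_induct)
  case zero
  then show ?case using tot_gr_zero[OF D.gg] by simp
 next
  case (add x p i y)
  have "(0_Y, x) \<in> gr (tot \<Psi> (cone X Y f)) n"
   by (rule tot_grI[OF D.gg, of _ "p - 1" i]) (use add Y.gg in "simp_all add: dg")
  from tot_gr_add[OF D.gg this add(4)] show ?case by simp
 qed
 have gy: "(x, 0_X) \<in> gr (tot \<Psi> (cone X Y f)) n" if "x \<in> gr (tot \<Psi> Y) n" for x n
  using Y.gg that
 proof (induction rule: tot_gr_induct)
  case zero
  then show ?case using tot_gr_zero[OF D.gg] by simp
 next
  case (add x p i y)
  have "(x, 0_X) \<in> gr (tot \<Psi> (cone X Y f)) n"
   by (rule tot_grI[OF D.gg, of _ p i]) (use add X.gg in simp_all)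
  from tot_gr_add[OF D.gg this add(4)] show ?case by simp
 qed
 have 2: "id \<in> dg_hom E1 (cone (tot \<Psi> X) (tot \<Psi> Y) f) (tot \<Psi> (cone X Y f))"
 proof (rule dg_homI)
  fix g u assume u: "u \<in> gr (cone (tot \<Psi> X) (tot \<Psi> Y) f) g"
  then obtain x y where xy: "u = (y, x)" "x \<in> gr (tot \<Psi> X) (g + 1)" "y \<in> gr (tot \<Psi> Y) g"
   by (auto simp: ddeg_int_def)
  have "x \<in> carrier X" "y \<in> carrier Y" using xy by (simp_all add: tot_gr)
  then show "id u \<in> gr (tot \<Psi> (cone X Y f)) g" using tot_gr_add[OF D.gg gy[OF xy(3)] gx[OF xy(2)]] xy by simp
 qed (use dg_homD(4,6)[OF 1] in auto)
 show ?thesis unfolding dg_inv_def using 1 2 by simp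
qed

text \<open>The twist that the internal degree shift produces is absorbed by the regular module.\<close>

lemma tot_shift_regular_inv:
 "dg_inv E1 (tot \<Psi> (shift (p, n) (regular E0))) (shift (p + n) (regular E1)) (\<Omega> (- n)) (\<Psi> (- n))"
proof -
 note S = E0.shift_dgm[OF E0.regular_dgm, of "(p, n)"] and S1 = E1.shift_dgm[OF E1.regular_dgm, of "p + n"]
 have z: "x = 0_E0" if "x \<in> gr E0 (q, m)" "q \<noteq> 0" for x q m using E0.conc that by blast
 have 1: "\<Omega> (- n) \<in> dg_hom E1 (tot \<Psi> (shift (p, n) (regular E0))) (shift (p + n) (regular E1))"
 proof (rule tot_dg_homI[OF S S1])
  show "\<Omega> (- n) \<in> ahom (shift (p, n) (regular E0)) (shift (p + n) (regular E1))"
   using \<Omega>_hom[of "- n"] by (auto simp: hom_def)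
  fix q i x assume "x \<in> gr (shift (p, n) (regular E0)) (q, i)"
  then have x: "x \<in> gr E0 (q + p, i + n)" by simp
  then have xc: "x \<in> carrier E0" by (rule gr_carrier[OF E0.gg])
  note O0 = ahom_zero[OF E0.abgrp E1.abgrp \<Omega>_hom]
  show "\<Omega> (- n) x \<in> gr (shift (p + n) (regular E1)) (q + i)"
  proof (cases "q + p = 0")
   case True
   have e: "q + i + (p + n) = i + n" using True by simp
   show ?thesis using x True \<Omega>_gr[of x "i + n" "- n"] by (simp add: e)
  next
   case False
   then show ?thesis using z[OF x] O0 E1.gg by simp
  qed
  fix e assume e: "e \<in> carrier E1"
  have "\<Omega> (- n) (x *_E0 \<Psi> i e) = \<Omega> (- n) x *_E1 e"
  proof (cases "q + p = 0")
   case True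
   have "\<Omega> (- n) x \<in> gr E1 (i + n)" using x True \<Omega>_gr[of x "i + n" "- n"] by simp
   then have "\<Psi> (- n) (\<Omega> (- n) x *_E1 e) = \<Psi> (- n) (\<Omega> (- n) x) *_E0 \<Psi> (- n + (i + n)) e"
    by (rule \<Psi>_mult[OF _ e])
   then have "\<Psi> (- n) (\<Omega> (- n) x *_E1 e) = x *_E0 \<Psi> i e" using xc by (simp add: \<Psi>_\<Omega>)
   then show ?thesis using \<Omega>_\<Psi>[of "\<Omega> (- n) x *_E1 e" "- n"] xc e by simp
  next
   case False
   then show ?thesis using z[OF x] O0 e by simp
  qed
  then show "\<Omega> (- n) (ract (shift (p, n) (regular E0)) x (\<Psi> i e)) = ract (shift (p + n) (regular E1)) (\<Omega> (- n) x) e"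
   by simp
 qed (simp_all add: E0.d0 E1.d0 E0.abgrp E1.abgrp
   ahom_zero[OF E0.abgrp E1.abgrp \<Omega>_hom])
 have 2: "\<Psi> (- n) \<in> dg_hom E1 (shift (p + n) (regular E1)) (tot \<Psi> (shift (p, n) (regular E0)))"
 proof (rule dg_homI)
  fix x e assume x: "x \<in> carrier (shift (p + n) (regular E1))" and e: "e \<in> carrier E1"
  have "\<Psi> (- n) (\<Omega> (- n) (ract (tot \<Psi> (shift (p, n) (regular E0))) (\<Psi> (- n) x) e)) =
    \<Psi> (- n) (ract (shift (p + n) (regular E1)) (\<Omega> (- n) (\<Psi> (- n) x)) e)"
   using dg_homD(4)[OF 1, of "\<Psi> (- n) x" e] x e by simp
  then show "\<Psi> (- n) (ract (shift (p + n) (regular E1)) x e) =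
    ract (tot \<Psi> (shift (p, n) (regular E0))) (\<Psi> (- n) x) e"
   using x e ahom_closed[OF tot_act_hom[OF S e], of "\<Psi> (- n) x"] by (simp add: \<Psi>_\<Omega> \<Omega>_\<Psi>)
 next
  fix g x assume "x \<in> gr (shift (p + n) (regular E1)) g"
  then have "\<Psi> (- n) x \<in> gr E0 (0, g + (p + n))" using \<Psi>_gr[of x "g + (p + n)" "- n"] by simp
  then show "\<Psi> (- n) x \<in> gr (tot \<Psi> (shift (p, n) (regular E0))) g"
   by (intro tot_grI[OF dgm_gg[OF S], of _ "- p" "g + p"]) (simp_all add: add.assoc)
 qed (simp_all add: E0.d0 E1.d0 ahom_add[OF \<Psi>_hom] E0.abgrp E1.abgrp
   ahom_zero[OF E1.abgrp E0.abgrp \<Psi>_hom])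
 show ?thesis unfolding dg_inv_def using 1 2 by (simp add: \<Psi>_\<Omega> \<Omega>_\<Psi>)
qed

end

lemma (in zalg) shift_cone_inv:
 assumes X: "dg_module E X" and Y: "dg_module E Y" and f: "f \<in> dg_hom E X Y"
 shows "koszul Y (cdeg s) o f \<in> dg_hom E (shift s X) (shift s Y)"
  "dg_inv E (cone (shift s X) (shift s Y) (koszul Y (cdeg s) o f)) (shift s (cone X Y f)) id id"
proof -
 interpret X: dgmod E X using X by blast
 interpret Y: dgmod E Y using Y by blast
 note fD = dg_homD[OF f]
 have ka: "koszul Y n (ract Y y e) = ract Y (koszul Y n y) e" if "y \<in> carrier Y" "e \<in> carrier E" for n y e
  using ahom_koszul[OF Y.ag Y.ag Y.act_hom[OF that(2)] that(1)] by simp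
 have kd: "koszul Y n (dd Y y) = dd Y (koszul Y n y)" if "y \<in> carrier Y" for n y
  using ahom_koszul[OF Y.ag Y.ag Y.d_hom that] by simp
 show k: "koszul Y (cdeg s) o f \<in> dg_hom E (shift s X) (shift s Y)"
  by (rule dg_homI)
   (simp_all add: fD koszul_add Y.ag ka gr_koszul[OF Y.gg] ahom_koszul[OF X.ag Y.ag fD(1)] kd)
 note C = cone_dgm[OF shift_dgm[OF X] shift_dgm[OF Y] k]
 show "dg_inv E (cone (shift s X) (shift s Y) (koszul Y (cdeg s) o f)) (shift s (cone X Y f)) id id"
  by (rule dg_inv_id[OF dgm_gg[OF C]])
   (auto simp: add.assoc add.commute[of ddeg s] koszul_def cone_a_inv[OF X.ag Y.ag] fD Y.minus_add)
qed

context zhang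
begin

text \<open>
An internal shift of \<open>X\<close> changes the twists, so its totalization is not a shift of the totalization
of \<open>X\<close>. The induction therefore treats all shifts of \<open>X\<close> at once.
\<close>

lemma fcell_tot_shift:
 assumes "fcell TYPE('u) E0 (X :: ('e, int \<times> int, 'u) dg)"
 shows "\<forall>s. fcell TYPE('u) E1 (tot \<Psi> (shift s X))"
 using assms
proof (induction rule: fcell.induct)
 case (fcell_regular Z)
 show ?case
 proof
  fix s :: "int \<times> int"
  obtain p n where s: "s = (p, n)" by (cases s)
  obtain f g where fg: "dg_inv E0 (regular E0) Z f g" using fcell_regular(2) unfolding dg_isom_def by blast
  note S = E0.shift_dgm[OF E0.regular_dgm, of s] and SZ = E0.shift_dgm[OF fcell_regular(1), of s]
  have "dg_inv E0 (shift s (regular E0)) (shift s Z) f g"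
   using dg_invD[OF fg] E0.dg_hom_shift[OF E0.regular_dgm fcell_regular(1)]
    E0.dg_hom_shift[OF fcell_regular(1) E0.regular_dgm] by (simp add: dg_inv_def)
  from dg_inv_comp[OF dg_invD(5)[OF tot_shift_regular_inv[of p n, folded s]] tot_inv[OF S SZ this]]
  have i: "dg_inv E1 (shift (p + n) (regular E1)) (tot \<Psi> (shift s Z)) (f o \<Psi> (- n)) (\<Omega> (- n) o g)" .
  note W = E1.shift_dgm[OF tot_dgm[OF SZ], of "- (p + n)"]
  have j: "dg_inv E1 (shift (- (p + n)) (shift (p + n) (regular E1))) (shift (- (p + n)) (tot \<Psi> (shift s Z)))
    (f o \<Psi> (- n)) (\<Omega> (- n) o g)"
   using dg_invD[OF i] E1.dg_hom_shift[OF E1.shift_dgm[OF E1.regular_dgm] tot_dgm[OF SZ]]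
    E1.dg_hom_shift[OF tot_dgm[OF SZ] E1.shift_dgm[OF E1.regular_dgm]] unfolding dg_inv_def shift_simps(1) by blast
  have "dg_inv E1 (shift (- (p + n)) (shift (p + n) (regular E1))) (regular E1) id id"
   by (rule E1.shift_shift_inv(2)[OF E1.regular_dgm]) simp
  from dg_inv_comp[OF dg_invD(5)[OF this] j]
  have r: "fcell TYPE('u) E1 (shift (- (p + n)) (tot \<Psi> (shift s Z)))"
   by (intro fcell.fcell_regular[OF W]) (auto simp: dg_isom_def)
  have "dg_inv E1 (shift (p + n) (shift (- (p + n)) (tot \<Psi> (shift s Z)))) (tot \<Psi> (shift s Z)) id id"
   by (rule E1.shift_shift_inv(2)[OF tot_dgm[OF SZ]]) simp
  then show "fcell TYPE('u) E1 (tot \<Psi> (shift s Z))"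
   by (intro fcell.fcell_shift[OF r tot_dgm[OF SZ], of "p + n"]) (auto simp: dg_isom_def)
 qed
next
 case (fcell_shift X Z t)
 show ?case
 proof
  fix s :: "int \<times> int"
  note X = fcell_dgm[OF fcell_shift(1)]
  obtain f g where fg: "dg_inv E0 (shift t X) Z f g" using fcell_shift(3) unfolding dg_isom_def by blast
  note T = E0.shift_dgm[OF X, of t]
  note S = E0.shift_dgm[OF T, of s] and SZ = E0.shift_dgm[OF fcell_shift(2), of s]
  have a: "dg_inv E0 (shift s (shift t X)) (shift s Z) f g"
   using dg_invD[OF fg] E0.dg_hom_shift[OF T fcell_shift(2)] E0.dg_hom_shift[OF fcell_shift(2) T]
   by (simp add: dg_inv_def)
  note b = dg_inv_comp[OF dg_invD(5)[OF E0.shift_shift_inv(1)[OF X, of s t]] a]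
  have "dg_isom E1 (tot \<Psi> (shift (s + t) X)) (tot \<Psi> (shift s Z))"
   unfolding dg_isom_def using tot_inv[OF E0.shift_dgm[OF X] SZ b] by blast
  then show "fcell TYPE('u) E1 (tot \<Psi> (shift s Z))"
   using E1.fcell_isom[OF _ tot_dgm[OF SZ]] fcell_shift(4) by blast
 qed
next
 case (fcell_cone X Y f Z)
 show ?case
 proof
  fix s :: "int \<times> int"
  note X = fcell_dgm[OF fcell_cone(1)] and Y = fcell_dgm[OF fcell_cone(2)]
  note C = E0.cone_dgm[OF X Y fcell_cone(3)]
  obtain a b where ab: "dg_inv E0 (cone X Y f) Z a b" using fcell_cone(5) unfolding dg_isom_def by blast
  note SX = E0.shift_dgm[OF X, of s] and SY = E0.shift_dgm[OF Y, of s] and SZ = E0.shift_dgm[OF fcell_cone(4), of s]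
   and SC = E0.shift_dgm[OF C, of s]
  note k = E0.shift_cone_inv[OF X Y fcell_cone(3), of s]
  note CS = E0.cone_dgm[OF SX SY k(1)]
  have sab: "dg_inv E0 (shift s (cone X Y f)) (shift s Z) a b"
   using dg_invD[OF ab] E0.dg_hom_shift[OF C fcell_cone(4)] E0.dg_hom_shift[OF fcell_cone(4) C]
   by (simp add: dg_inv_def)
  note i = dg_inv_comp[OF dg_invD(5)[OF tot_cone_inv[OF SX SY k(1)]] tot_inv[OF CS SZ dg_inv_comp[OF k(2) sab]]]
  show "fcell TYPE('u) E1 (tot \<Psi> (shift s Z))"
   by (rule fcell.fcell_cone[OF spec[OF fcell_cone(6), of s] spec[OF fcell_cone(7), of s]
     tot_dg_hom[OF SX SY k(1)] tot_dgm[OF SZ]])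
    (use i in "auto simp: dg_isom_def")
 qed
qed

lemma fcell_tot:
 assumes X: "fcell TYPE('u) E0 (X :: ('e, int \<times> int, 'u) dg)"
 shows "fcell TYPE('u) E1 (tot \<Psi> X)"
proof -
 note Xd = fcell_dgm[OF X]
 have "dg_inv E0 (shift 0 X) X id id"
  by (rule dg_inv_id) (simp_all add: shift_graded dgm_gg[OF Xd] koszul_even)
 then have "dg_isom E1 (tot \<Psi> (shift 0 X)) (tot \<Psi> X)"
  unfolding dg_isom_def using tot_inv[OF E0.shift_dgm[OF Xd] Xd] by blast
 then show ?thesis using E1.fcell_isom[OF _ tot_dgm[OF Xd]] fcell_tot_shift[OF X] by blast
qed

end

section \<open>The diagonal bimodule\<close>

text \<open>
The counterpart of \<open>frag_extend\<close> for values in an arbitrary abelian group.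
\<close>

definition fext where
 "fext G b (u :: 'p \<Rightarrow>\<^sub>0 int) = (\<Oplus>\<^bsub>G\<^esub>p\<in>keys u. [lookup u p] \<cdot>\<^bsub>G\<^esub> b p)"

lemma fext_sum:
 assumes "abelian_group G" "\<And>p. p \<in> S ==> b p \<in> carrier G" "finite S" "keys u \<subseteq> S"
 shows "fext G b u = (\<Oplus>\<^bsub>G\<^esub>p\<in>S. [lookup u p] \<cdot>\<^bsub>G\<^esub> b p)"
proof -
 interpret abelian_group G by fact
 have z: "[(0 :: int)] \<cdot>\<^bsub>G\<^esub> y = 0_G" for y by (simp add: add_pow_def)
 show ?thesis unfolding fext_def
  by (rule finsum_mono_zero[symmetric]) (use assms in "auto simp: in_keys_iff z")
qed

lemma fext_add:
 assumes "abelian_group G" "\<And>p. p \<in> S ==> b p \<in> carrier G" "keys u \<subseteq> S" "keys v \<subseteq> S"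
 shows "fext G b (u + v) = fext G b u +_G fext G b v"
proof -
 interpret abelian_group G by fact
 let ?T = "keys u \<union> keys v"
 have b: "\<And>p. p \<in> ?T ==> b p \<in> carrier G" using assms by auto
 have "fext G b (u + v) = (\<Oplus>\<^bsub>G\<^esub>p\<in>?T. [lookup (u + v) p] \<cdot>\<^bsub>G\<^esub> b p)"
  by (rule fext_sum[OF assms(1) b]) (use keys_add[of u v] in auto)
 also have "\<dots> = (\<Oplus>\<^bsub>G\<^esub>p\<in>?T. [lookup u p] \<cdot>\<^bsub>G\<^esub> b p +_G [lookup v p] \<cdot>\<^bsub>G\<^esub> b p)"
  by (rule finsum_cong') (use b in "auto simp: lookup_add add.int_pow_mult")
 also have "\<dots> = (\<Oplus>\<^bsub>G\<^esub>p\<in>?T. [lookup u p] \<cdot>\<^bsub>G\<^esub> b p) +_G (\<Oplus>\<^bsub>G\<^esub>p\<in>?T. [lookup v p] \<cdot>\<^bsub>G\<^esub> b p)"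
  by (rule finsum_addf) (use b in auto)
 also have "(\<Oplus>\<^bsub>G\<^esub>p\<in>?T. [lookup u p] \<cdot>\<^bsub>G\<^esub> b p) = fext G b u"
  by (rule fext_sum[OF assms(1) b, symmetric]) auto
 also have "(\<Oplus>\<^bsub>G\<^esub>p\<in>?T. [lookup v p] \<cdot>\<^bsub>G\<^esub> b p) = fext G b v"
  by (rule fext_sum[OF assms(1) b, symmetric]) auto
 finally show ?thesis .
qed

lemma fext_closed:
 assumes "abelian_group G" "\<And>p. p \<in> S ==> b p \<in> carrier G" "keys u \<subseteq> S"
 shows "fext G b u \<in> carrier G"
proof -
 interpret abelian_group G by fact
 show ?thesis unfolding fext_def by (rule finsum_closed) (use assms in auto)
qed

lemma fext_of:
 assumes "abelian_group G" "b p \<in> carrier G"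
 shows "fext G b (frag_of p) = b p"
proof -
 interpret abelian_group G by fact
 show ?thesis using assms(2) by (simp add: fext_def add.int_pow_1)
qed

lemma fext_diff:
 assumes "abelian_group G" "\<And>p. p \<in> S ==> b p \<in> carrier G" "keys u \<subseteq> S" "keys v \<subseteq> S"
 shows "fext G b (u - v) = fext G b u -_G fext G b v"
proof -
 interpret abelian_group G by fact
 have k: "keys (u - v) \<subseteq> S" using keys_diff[of u v] assms by auto
 have "fext G b ((u - v) + v) = fext G b (u - v) +_G fext G b v"
  by (rule fext_add[OF assms(1,2) k assms(4)])
 then show ?thesis
  using fext_closed[OF assms(1,2) assms(4)] fext_closed[OF assms(1,2) k]
  by (simp add: a_minus_def a_assoc r_neg)
qed

lemma fext_add_fun:
 assumes "abelian_group G" "\<And>p. p \<in> S ==> b p \<in> carrier G" "\<And>p. p \<in> S ==> b' p \<in> carrier G" "keys u \<subseteq> S"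
 shows "fext G (\<lambda>p. b p +_G b' p) u = fext G b u +_G fext G b' u"
proof -
 interpret abelian_group G by fact
 have "fext G (\<lambda>p. b p +_G b' p) u =
  (\<Oplus>\<^bsub>G\<^esub>p\<in>keys u. [lookup u p] \<cdot>\<^bsub>G\<^esub> b p +_G [lookup u p] \<cdot>\<^bsub>G\<^esub> b' p)"
  unfolding fext_def
  by (rule finsum_cong') (use assms in "auto simp: add.int_pow_distrib")
 also have "\<dots> = fext G b u +_G fext G b' u"
  unfolding fext_def by (rule finsum_addf) (use assms in auto)
 finally show ?thesis .
qed

text \<open>
The diagonal bimodule is treated together with its twists, since it is the twist by the identity.
\<close>

locale twist_aut = env_alg +
 fixes \<sigma>
 assumes \<sigma>_hom: "\<sigma> \<in> ahom A A" and \<sigma>_gr: "x \<in> gr A g ==> \<sigma> x \<in> gr A g"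
  and \<sigma>_smult: "c \<in> carrier K ==> x \<in> carrier A ==> \<sigma> (c \<odot>\<^bsub>A\<^esub> x) = c \<odot>\<^bsub>A\<^esub> \<sigma> x"
  and \<sigma>_mult: "x \<in> carrier A ==> y \<in> carrier A ==> \<sigma> (x *_A y) = \<sigma> x *_A \<sigma> y"
  and \<sigma>_one: "\<sigma> 1_A = 1_A"
begin

abbreviation D where "D \<equiv> twisted_diag A \<sigma>"

lemma D_simps [simp]:
 "carrier D = carrier A" "add D = add A" "zero D = 0_A" "gr D = gr A" "dd D = dd A"
 by (simp_all add: twisted_diag_def mk_dg_def)

definition bs where
 "bs n x = (\<lambda>(g, l, h, y). koszul A (cdeg g * cdeg n) ((l *_A x) *_A \<sigma> y))"

lemma \<sigma>_closed [simp]: "x \<in> carrier A ==> \<sigma> x \<in> carrier A"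
 by (rule ahom_closed[OF \<sigma>_hom])

lemma kz [simp]: "x \<in> carrier A ==> koszul A n x \<in> carrier A"
 by (rule koszul_closed[OF A.abgrp])

lemma bs_closed: "x \<in> carrier A ==> p \<in> tsyms A ==> bs n x p \<in> carrier A"
 by (auto simp: bs_def tsyms_def grc)

lemma bs_null:
 assumes x: "x \<in> carrier A" and "u \<in> N" shows "fext A (bs n x) u = 0_A"
proof -
 note ag = A.abgrp
 have bc: "\<And>p. p \<in> tsyms A ==> bs n x p \<in> carrier A" using x by (rule bs_closed)
 note ad = fext_add[OF ag bc] and df = fext_diff[OF ag bc]
 have fo: "fext A (bs n x) (frag_of p) = bs n x p" if "p \<in> tsyms A" for p by (rule fext_of[where b = "bs n x", OF ag bc[OF that]])
 have z: "fext A (bs n x) 0 = 0_A" by (simp add: fext_def)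
 have k: "koszul A m (a +_A b) -_A koszul A m a -_A koszul A m b = 0_A"
  if ab: "a \<in> carrier A" "b \<in> carrier A" for m a b
  unfolding koszul_add[OF ag ab]
  by (rule lin_solve[OF ag, of _ _ "[koszul A m a, koszul A m b]"], (rule lin_intros)+, simp_all add: ab upt_conv_Cons)
 have tr: "fext A (bs n x) r = 0_A" if "r \<in> trel K A" for r
  using that
 proof (cases rule: trelE)
  case (left g h l l' y)
  have s: "(g, l +_A l', h, y) \<in> tsyms A" "(g, l, h, y) \<in> tsyms A" "(g, l', h, y) \<in> tsyms A"
   using left by (simp_all add: tsyms_def grA_simps)
  have c: "l \<in> carrier A" "l' \<in> carrier A" "y \<in> carrier A" using left grc by auto
  have kk: "keys (frag_of (g, l +_A l', h, y) - frag_of (g, l, h, y)) \<subseteq> tsyms A"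
   using s keys_diff[of "frag_of (g, l +_A l', h, y)" "frag_of (g, l, h, y)"] by auto
  have "fext A (bs n x) r = bs n x (g, l +_A l', h, y) -_A bs n x (g, l, h, y) -_A bs n x (g, l', h, y)"
   using left s kk by (simp add: df fo)
  also have "\<dots> = 0_A" using c x by (simp add: bs_def A.l_distr k)
  finally show ?thesis .
 next
  case (right g h l y y')
  have s: "(g, l, h, y +_A y') \<in> tsyms A" "(g, l, h, y) \<in> tsyms A" "(g, l, h, y') \<in> tsyms A"
   using right by (simp_all add: tsyms_def grA_simps)
  have c: "l \<in> carrier A" "y' \<in> carrier A" "y \<in> carrier A" using right grc by auto
  have kk: "keys (frag_of (g, l, h, y +_A y') - frag_of (g, l, h, y)) \<subseteq> tsyms A"
   using s keys_diff[of "frag_of (g, l, h, y +_A y')" "frag_of (g, l, h, y)"] by auto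
  have "fext A (bs n x) r = bs n x (g, l, h, y +_A y') -_A bs n x (g, l, h, y) -_A bs n x (g, l, h, y')"
   using right s kk by (simp add: df fo)
  also have "\<dots> = 0_A" using c x by (simp add: bs_def A.r_distr ahom_add[OF \<sigma>_hom] k)
  finally show ?thesis .
 next
  case (scalar c g h l y)
  have s: "(g, c \<odot>\<^bsub>A\<^esub> l, h, y) \<in> tsyms A" "(g, l, h, c \<odot>\<^bsub>A\<^esub> y) \<in> tsyms A"
   using scalar by (simp_all add: tsyms_def grA_simps)
  have cc: "l \<in> carrier A" "y \<in> carrier A" using scalar grc by auto
  have "fext A (bs n x) r = bs n x (g, c \<odot>\<^bsub>A\<^esub> l, h, y) -_A bs n x (g, l, h, c \<odot>\<^bsub>A\<^esub> y)"
   using scalar s by (simp add: df fo)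
  also have "\<dots> = 0_A"
   using cc x scalar module.smult_closed[OF modA] by (simp add: bs_def smult_left smult_right \<sigma>_smult a_minus_def A.r_neg)
  finally show ?thesis .
 qed
 show ?thesis using assms(2)
 proof (induction rule: N_induct)
  case (minus r)
  have "keys r \<subseteq> tsyms A" using trel_F minus by auto
  then show ?case using df[where u = 0 and v = r] tr[OF minus] by (simp add: z a_minus_def)
 next
  case (add u v)
  then show ?case using ad[where u = u and v = v] N_F by simp
 qed (simp_all add: z tr)
qed

lemma fext_cl:
 assumes x: "x \<in> carrier A" and u: "u \<in> F" shows "fext A (bs n x) (trep (cl u)) = fext A (bs n x) u"
proof -
 have bc: "\<And>p. p \<in> tsyms A ==> bs n x p \<in> carrier A" using x by (rule bs_closed)
 have "fext A (bs n x) ((trep (cl u) - u) + u) = fext A (bs n x) (trep (cl u) - u) +_A fext A (bs n x) u"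
  by (rule fext_add[OF A.abgrp bc]) (use N_F[OF trep_cl[of u]] u in auto)
 moreover have "fext A (bs n x) u \<in> carrier A"
  by (rule fext_closed[OF A.abgrp bc]) (use u in auto)
 ultimately show ?thesis using bs_null[OF x trep_cl[of u], where n = n] by simp
qed

lemma D_act_part:
 assumes "U \<in> carrier E" shows "(\<lambda>x. fext A (bs n x) (trep U)) \<in> ahom A A"
proof -
 obtain u where u: "u \<in> F" "U = cl u" using assms by (rule carrier_E_cases)
 then have t: "keys (trep U) \<subseteq> tsyms A" using trep_F[OF u(1)] by simp
 show ?thesis
 proof (rule ahomI)
  fix x y assume xy: "x \<in> carrier A" "y \<in> carrier A"
  have "fext A (bs n (x +_A y)) (trep U) = fext A (\<lambda>p. bs n x p +_A bs n y p) (trep U)"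
   unfolding fext_def
   by (rule A.finsum_cong')
    (use t xy grc in "auto simp: bs_def tsyms_def A.r_distr A.l_distr koszul_add A.abgrp
      split: prod.splits dest!: subsetD")
  also have "\<dots> = fext A (bs n x) (trep U) +_A fext A (bs n y) (trep U)"
   by (rule fext_add_fun[OF A.abgrp bs_closed[OF xy(1)] bs_closed[OF xy(2)] t])
  finally show "fext A (bs n (x +_A y)) (trep U) = fext A (bs n x) (trep U) +_A fext A (bs n y) (trep U)" .
 qed (rule fext_closed[OF A.abgrp bs_closed t])
qed

lemma D_act_gext: "ract D x U = gext A A (\<lambda>n x. fext A (bs n x) (trep U)) x"
 by (simp add: twisted_diag_def mk_dg_def gext_def fext_def bs_def case_prod_unfold)

lemma D_act_hom:
 assumes "U \<in> carrier E" shows "(\<lambda>x. ract D x U) \<in> ahom A A"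
proof -
 have "(\<lambda>x. fext A (bs n x) (trep U)) \<in> ahom A A" for n by (rule D_act_part[OF assms])
 from gext_hom[OF ggA A.abgrp this] show ?thesis by (simp add: D_act_gext)
qed

lemma D_act_cl:
 assumes "u \<in> F" "x \<in> gr A n" shows "ract D x (cl u) = fext A (bs n x) u"
proof -
 have "(\<lambda>x. fext A (bs n x) (trep (cl u))) \<in> ahom A A" for n by (rule D_act_part[OF cl_carrier[OF assms(1)]])
 from gext_hom_eq[OF ggA A.abgrp, of "\<lambda>n x. fext A (bs n x) (trep (cl u))", OF this assms(2)]
 show ?thesis using fext_cl[OF grc[OF assms(2)] assms(1)] by (simp add: D_act_gext)
qed

lemma D_act_pu:
 assumes "x \<in> gr A n" "l \<in> gr A g" "y \<in> gr A h"
 shows "ract D x (pu g l h y) = koszul A (cdeg g * cdeg n) ((l *_A x) *_A \<sigma> y)"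
 using assms grc unfolding pu_def
 by (subst D_act_cl) (simp_all add: tsyms_def fext_of[OF A.abgrp] bs_def)

lemma D_act_hom_right:
 assumes "x \<in> carrier A" shows "(\<lambda>U. ract D x U) \<in> ahom E A"
proof (rule ahomI)
 fix U assume U: "U \<in> carrier E"
 then show "ract D x U \<in> carrier A" using ahom_closed[OF D_act_hom[OF U] assms] by simp
next
 fix U V assume UV: "U \<in> carrier E" "V \<in> carrier E"
 obtain u v where u: "u \<in> F" "U = cl u" "v \<in> F" "V = cl v" using UV by (metis carrier_E_cases)
 show "ract D x (U +_E V) = ract D x U +_A ract D x V"
 proof (rule ahom_eqI[OF ggA A.abgrp D_act_hom _ _ assms])
  show "(\<lambda>x. ract D x U +_A ract D x V) \<in> ahom A A"
   by (rule A.ahom_plus[OF D_act_hom[OF UV(1)] D_act_hom[OF UV(2)] A.abgrp])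
  fix n x assume x: "x \<in> gr A n"
  have bc: "\<And>p. p \<in> tsyms A ==> bs n x p \<in> carrier A" using grc[OF x] by (rule bs_closed)
  have "fext A (bs n x) (u + v) = fext A (bs n x) u +_A fext A (bs n x) v"
   by (rule fext_add[OF A.abgrp bc]) (use u in auto)
  then show "ract D x (U +_E V) = ract D x U +_A ract D x V"
   using u x F_closed(2)[OF u(1,3)] by (simp add: add_E D_act_cl del: mem_Collect_eq)
 qed (use UV in simp)
qed

lemma D_act_gr:
 assumes x: "x \<in> gr A n" and "U \<in> gr E m" shows "ract D x U \<in> gr A (n + m)"
 using assms(2)
proof (rule ahom_gr_E[OF _ ggA D_act_hom_right[OF grc[OF x]]])
 fix g l h y assume ly: "l \<in> gr A g" "y \<in> gr A h" "g + h = m"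
 have "(l *_A x) *_A \<sigma> y \<in> gr A (g + n + h)" using x ly \<sigma>_gr multA by metis
 moreover have "g + n + h = n + m" using ly by (simp add: ac_simps)
 ultimately show "ract D x (pu g l h y) \<in> gr A (n + m)" using x ly by (simp add: D_act_pu gr_koszul[OF ggA])
qed

lemma D_act_act:
 assumes "x \<in> carrier A" "U \<in> carrier E" "V \<in> carrier E"
 shows "ract D (ract D x U) V = ract D x (U *_E V)"
proof (rule ahom_eqI[OF ggA A.abgrp _ _ _ assms(1)])
 note ag = A.abgrp
 show "(\<lambda>x. ract D (ract D x U) V) \<in> ahom A A"
  using ahom_comp[OF D_act_hom[OF assms(2)] D_act_hom[OF assms(3)]] by (simp add: comp_def)
 show "(\<lambda>x. ract D x (U *_E V)) \<in> ahom A A" by (rule D_act_hom) (use assms in simp)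
 fix n x assume x: "x \<in> gr A n"
 note xc = grc[OF x]
 note r = D_act_hom_right
 show "ract D (ract D x U) V = ract D x (U *_E V)"
 proof (rule E_ahom_eq[OF ag _ _ _ assms(2)])
  show "(\<lambda>U. ract D (ract D x U) V) \<in> ahom E A"
   using ahom_comp[OF r[OF xc] D_act_hom[OF assms(3)]] by (simp add: comp_def)
  show "(\<lambda>U. ract D x (U *_E V)) \<in> ahom E A"
   by (rule ahomI) (use assms(3) ahom_closed[OF r[OF xc]] ahom_add[OF r[OF xc]] in "simp_all add: E.l_distr")
  fix g l h y assume ly: "l \<in> gr A g" "y \<in> gr A h"
  have p1: "ract D x (pu g l h y) \<in> gr A (n + (g + h))" by (rule D_act_gr[OF x pu_gr[OF ly]])
  have pc: "pu g l h y \<in> carrier E" using ly by simp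
  show "ract D (ract D x (pu g l h y)) V = ract D x (pu g l h y *_E V)"
  proof (rule E_ahom_eq[OF ag _ _ _ assms(3)])
   show "ract D (ract D x (pu g l h y)) \<in> ahom E A" by (rule r[OF grc[OF p1]])
   show "(\<lambda>V. ract D x (pu g l h y *_E V)) \<in> ahom E A"
    by (rule ahomI) (use pc ahom_closed[OF r[OF xc]] ahom_add[OF r[OF xc]] in "simp_all add: E.r_distr")
   fix g' l' h' y' assume ly': "l' \<in> gr A g'" "y' \<in> gr A h'"
   have c: "l \<in> carrier A" "y \<in> carrier A" "l' \<in> carrier A" "y' \<in> carrier A" using ly ly' grc by auto
   have m: "l' *_A l \<in> gr A (g + g')" "y *_A y' \<in> gr A (h + h')" using ly ly' multA multA' by auto
   let ?w = "(l *_A x) *_A \<sigma> y"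
   have w: "?w \<in> carrier A" using c xc by simp
   have hm: "(\<lambda>w. (l' *_A w) *_A \<sigma> y') \<in> ahom A A"
    by (rule ahomI) (use c in "simp_all add: A.r_distr A.l_distr")
   have p2: "koszul A (cdeg g * cdeg n) ?w \<in> gr A (n + (g + h))"
    using p1 by (simp add: D_act_pu[OF x ly])
   have "ract D (ract D x (pu g l h y)) (pu g' l' h' y') =
    koszul A (cdeg g' * cdeg (n + (g + h)) + cdeg g * cdeg n) ((l' *_A ?w) *_A \<sigma> y')"
    using ahom_koszul[OF ag ag hm w] w c
    by (simp add: D_act_pu[OF x ly] D_act_pu[OF p2 ly'] koszul_koszul[OF ag])
   also have "(l' *_A ?w) *_A \<sigma> y' = ((l' *_A l) *_A x) *_A \<sigma> (y *_A y')"
    using c xc by (simp add: A.m_assoc \<sigma>_mult)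
   also have "koszul A (cdeg g' * cdeg (n + (g + h)) + cdeg g * cdeg n) \<dots> =
     koszul A (cdeg h * cdeg g' + cdeg g * cdeg g' + cdeg (g + g') * cdeg n) \<dots>"
    by (rule koszul_cong) (simp add: cdeg_add algebra_simps)
   also have "\<dots> = ract D x (pu g l h y *_E pu g' l' h' y')"
    using ahom_koszul[OF E.abgrp ag r[OF xc], of "pu (g + g') (l' *_A l) (h + h') (y *_A y')"]
     m xc c by (simp add: pu_mult[OF ly ly'] D_act_pu[OF x m] koszul_koszul[OF ag])
   finally show "ract D (ract D x (pu g l h y)) (pu g' l' h' y') = ract D x (pu g l h y *_E pu g' l' h' y')" .
  qed
 qed
qed

lemma D_dgm: "dg_module E D"
proof (rule dg_moduleI)
 show "graded_group D" by (rule graded_group_cong[OF ggA]) simp_all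
 show "dd D \<in> ahom D D" by (rule ahomI) (simp_all add: dA)
 fix x assume x: "x \<in> carrier D"
 have "ract D x 1_E = id x"
 proof (rule ahom_eqI[OF ggA A.abgrp D_act_hom])
  fix n x assume x: "x \<in> gr A n"
  show "ract D x 1_E = id x"
   using D_act_pu[OF x oneA oneA] grc[OF x] by (simp add: one_E pu_def[symmetric] \<sigma>_one koszul_even)
 qed (use x in "simp_all add: hom_def")
 then show "ract D x 1_E = x" by simp
next
 fix x e assume x: "x \<in> carrier D" and e: "e \<in> carrier E"
 show "dd D (ract D x e) = ract D (dd D x) e"
  using ahom_zero[OF A.abgrp A.abgrp D_act_hom[OF e]] by (simp add: dA)
qed (use D_act_hom D_act_hom_right D_act_act D_act_gr in "auto simp: hom_def dA grA_simps Pi_def")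

end

lemma (in env_alg) twist_id: "twist_aut K A id"
 by unfold_locales (auto simp: hom_def)

lemma (in env_alg) sign_aut_hom: "sign_aut A \<in> ahom A A"
 and sign_aut_gr: "x \<in> gr A n ==> sign_aut A x = koszul A (cdeg n) x"
proof -
 have k: "koszul A (cdeg n) \<in> ahom A A" for n by (rule koszul_ahom[OF A.abgrp])
 have s: "sign_aut A = gext A A (\<lambda>n. koszul A (cdeg n))" by (simp add: sign_aut_def gext_def fun_eq_iff)
 show "sign_aut A \<in> ahom A A" unfolding s by (rule gext_hom[OF ggA A.abgrp k])
 show "x \<in> gr A n ==> sign_aut A x = koszul A (cdeg n) x"
  unfolding s by (rule gext_hom_eq[OF ggA A.abgrp k])
qed

lemma (in env_alg) twist_sign: "twist_aut K A (sign_aut A)"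
proof unfold_locales
 note ag = A.abgrp
 note h = sign_aut_hom
 show "sign_aut A \<in> ahom A A" by (rule h)
 show "sign_aut A x \<in> gr A g" if "x \<in> gr A g" for x g
  using that by (simp add: sign_aut_gr gr_koszul[OF ggA])
 show "sign_aut A 1_A = 1_A" using sign_aut_gr[OF oneA] by (simp add: koszul_even)
 show "sign_aut A (c \<odot>\<^bsub>A\<^esub> x) = c \<odot>\<^bsub>A\<^esub> sign_aut A x" if c: "c \<in> carrier K" and x: "x \<in> carrier A" for c x
 proof -
  interpret M: module K A by (rule modA)
  have sm: "(\<lambda>x. c \<odot>\<^bsub>A\<^esub> x) \<in> ahom A A" by (rule ahomI) (use c in "simp_all add: M.smult_r_distr")
  show ?thesis
  proof (rule ahom_eqI[OF ggA ag _ _ _ x])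
   show "(\<lambda>x. sign_aut A (c \<odot>\<^bsub>A\<^esub> x)) \<in> ahom A A" using ahom_comp[OF sm h] by (simp add: comp_def)
   show "(\<lambda>x. c \<odot>\<^bsub>A\<^esub> sign_aut A x) \<in> ahom A A" using ahom_comp[OF h sm] by (simp add: comp_def)
   fix g x assume x: "x \<in> gr A g"
   show "sign_aut A (c \<odot>\<^bsub>A\<^esub> x) = c \<odot>\<^bsub>A\<^esub> sign_aut A x"
    using ahom_koszul[OF ag ag sm grc[OF x]] x by (simp add: sign_aut_gr[OF smult_gr[OF c x]] sign_aut_gr[OF x])
  qed
 qed
 show "sign_aut A (x *_A y) = sign_aut A x *_A sign_aut A y" if x: "x \<in> carrier A" and y: "y \<in> carrier A" for x y
 proof -
  have lm: "(\<lambda>x. x *_A z) \<in> ahom A A" "(\<lambda>x. z *_A x) \<in> ahom A A" if "z \<in> carrier A" for z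
   using that by (auto intro!: ahomI simp: A.l_distr A.r_distr)
  have hc: "sign_aut A z \<in> carrier A" if "z \<in> carrier A" for z by (rule ahom_closed[OF h that])
  show ?thesis
  proof (rule ahom_eqI[OF ggA ag _ _ _ x])
   show "(\<lambda>x. sign_aut A (x *_A y)) \<in> ahom A A" using ahom_comp[OF lm(1)[OF y] h] by (simp add: comp_def)
   show "(\<lambda>x. sign_aut A x *_A sign_aut A y) \<in> ahom A A"
    using ahom_comp[OF h lm(1)[OF hc[OF y]]] by (simp add: comp_def)
   fix g x assume x: "x \<in> gr A g"
   note xc = grc[OF x]
   show "sign_aut A (x *_A y) = sign_aut A x *_A sign_aut A y"
   proof (rule ahom_eqI[OF ggA ag _ _ _ y])
    show "(\<lambda>y. sign_aut A (x *_A y)) \<in> ahom A A" using ahom_comp[OF lm(2)[OF xc] h] by (simp add: comp_def)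
    show "(\<lambda>y. sign_aut A x *_A sign_aut A y) \<in> ahom A A"
     using ahom_comp[OF h lm(2)[OF hc[OF xc]]] by (simp add: comp_def)
    fix k y assume y: "y \<in> gr A k"
    note yc = grc[OF y]
    have kc: "koszul A m y \<in> carrier A" for m using yc by (simp add: ag)
    show "sign_aut A (x *_A y) = sign_aut A x *_A sign_aut A y"
     using ahom_koszul[OF ag ag lm(1)[OF kc] xc] ahom_koszul[OF ag ag lm(2)[OF xc] yc] xc yc
     by (simp add: sign_aut_gr[OF multA[OF x y]] sign_aut_gr[OF x] sign_aut_gr[OF y] koszul_koszul[OF ag] cdeg_add)
   qed
  qed
 qed
qed

section \<open>The two enveloping algebras of a graded algebra\<close>

lemma graded_algebra_cong:
 fixes N :: "('k, 'h::ab_group_add, 'a, 'n) graded_scheme" and R :: "('k, 'g::ab_group_add, 'a, 'r) graded_scheme"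
 assumes R: "graded_algebra K R" and eq: "carrier N = carrier R" "mult N = mult R" "one N = one R"
  "zero N = zero R" "add N = add R" "smult N = smult R"
  and gN: "graded_group N" and gr: "\<And>g. (\<exists>i. gr N g = gr R i) \<or> gr N g = {0_R}"
  and one: "1_R \<in> gr N 0"
  and mult: "\<And>g h x y. x \<in> gr N g ==> y \<in> gr N h ==> x *_R y \<in> gr N (g + h)"
 shows "graded_algebra K N"
proof -
 have r: "field K" "ring R" "module K R" "\<And>g. submodule (gr R g) K R"
  using R by (simp_all add: graded_algebra_def)
 interpret R: ring R by (rule r)
 interpret M: module K R by (rule r)
 have ag: "abelian_group N" by (rule graded_ag[OF gN])
 have ring: "ring N"
 proof (rule ringI[OF ag])
  show "monoid N" by (rule monoidI) (simp_all add: eq R.m_assoc)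
 qed (simp_all add: eq R.l_distr R.r_distr)
 have mod: "module K N"
  by (rule moduleI[OF M.R.cring_axioms ag])
   (simp_all add: eq M.smult_l_distr M.smult_r_distr M.smult_assoc1)
 have "submodule (gr N g) K N" for g
 proof -
  have "c \<odot>\<^bsub>R\<^esub> x \<in> gr N g" if "c \<in> carrier K" "x \<in> gr N g" for c x
   using gr[of g] that r(4) by (auto simp: submodule_def submodule_axioms_def M.smult_r_null)
  then show ?thesis using gr_subgroup[OF gN, of g] by (simp add: submodule_def submodule_axioms_def eq)
 qed
 then show ?thesis using R ring mod gN one mult r(1) by (simp add: graded_algebra_def eq)
qed

type_synonym ('a, 'm) bicomplex = "((int \<times> int, 'a) tensor, int \<times> int, 'm) dg"

text \<open>
The two DG algebras made from a graded algebra: \<open>A0\<close> concentrated in cohomological degree zero, \<open>A1\<close> with the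
grading as cohomological grading.
\<close>

locale ralg =
 fixes K :: "('k, 'z) ring_scheme" and R :: "('k, int, 'a) graded"
 assumes R: "graded_algebra K R"
begin

abbreviation A0 where "A0 \<equiv> internal_graded R"
abbreviation A1 where "A1 \<equiv> dg_of_graded R"
abbreviation E0 where "E0 \<equiv> env K A0"
abbreviation E1 where "E1 \<equiv> env K A1"

lemma gR: "graded_group R" and ringR: "ring R" and oneR: "1_R \<in> gr R 0"
 and multR: "x \<in> gr R g ==> y \<in> gr R h ==> x *_R y \<in> gr R (g + h)"
 using R by (simp_all add: graded_algebra_def)

lemma A1_simps [simp]: "carrier A1 = carrier R" "mult A1 = mult R" "one A1 = one R" "zero A1 = zero R"
  "add A1 = add R" "smult A1 = smult R" "gr A1 = gr R"
 by (simp_all add: dg_of_graded_def)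

lemma A0_simps [simp]: "carrier A0 = carrier R" "mult A0 = mult R" "one A0 = one R" "zero A0 = zero R"
  "add A0 = add R" "smult A0 = smult R" "gr A0 (p, i) = (if p = 0 then gr R i else {0_R})"
 by (simp_all add: internal_graded_def)

lemma A1_graded: "graded_group A1"
 by (rule graded_group_cong[OF gR]) simp_all

lemma A0_graded: "graded_group A0"
proof -
 interpret R: ring R by (rule ringR)
 have ag: "abelian_group A0" by (rule abelian_group_add_cong[OF R.abgrp]) simp_all
 have ai: "-_A0 x = -_R x" if "x \<in> carrier R" for x
  by (rule a_inv_cong[OF R.abgrp]) (use that in simp_all)
 have sp: "x \<in> hspan A0" if "x \<in> carrier R" for x
  using gR that
 proof (induction rule: graded_induct)
  case zero
  then show ?case using hspan_zero[of A0] by simp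
 next
  case (add x g y)
  have "x \<in> gr A0 (0, g)" using add by simp
  from hspan_add[OF this add(3)] show ?case by simp
 qed
 show ?thesis
 proof (rule graded_groupI[where N = R])
  fix g :: "int \<times> int"
  obtain p i where g: "g = (p, i)" by (cases g)
  let ?pr = "\<lambda>x. if p = 0 then hcomp R x i else 0_R"
  have 1: "?pr \<in> ahom A0 R"
   by (rule ahomI) (auto simp: hcomp_closed[OF gR] hcomp_add[OF gR])
  have 2: "?pr x = 0_R --> x = 0_A0" if "x \<in> gr A0 g" for x
   using that hcomp_hom[OF gR, of x i] by (auto simp: g split: if_splits)
  have 3: "?pr x = 0_R" if "x \<in> gr A0 h" "h \<noteq> g" for x h
   using that hcomp_hom[OF gR, of x "snd h"] by (cases h) (auto simp: g hcomp_zero[OF gR] split: if_splits)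
  show "\<exists>pr\<in>ahom A0 R. (\<forall>x\<in>gr A0 g. pr x = 0_R --> x = 0_A0) \<and>
    (\<forall>h. \<forall>x\<in>gr A0 h. h \<noteq> g --> pr x = 0_R)"
   by (rule bexI[OF _ 1]) (intro conjI ballI allI impI, erule (1) 2[rule_format], erule (1) 3)
 next
  fix g x assume "x \<in> gr A0 g"
  then show "-_A0 x \<in> gr A0 g"
   using gr_carrier[OF gR, of x "snd g"] by (cases g) (auto simp: ai gr_minus[OF gR] split: if_splits)
 next
  fix g x y assume "x \<in> gr A0 g" "y \<in> gr A0 g"
  then show "x +_A0 y \<in> gr A0 g"
   by (cases g) (auto simp: gr_add[OF gR] split: if_splits)
 next
  fix g x assume "x \<in> gr A0 g"
  then show "x \<in> carrier A0" using gr_carrier[OF gR, of x "snd g"] by (cases g) (auto split: if_splits)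
 next
  fix g show "0_A0 \<in> gr A0 g" by (cases g) (simp add: gr_zero[OF gR])
 qed (use sp ag R.abgrp in auto)
qed

lemma A1_env: "env_alg K A1"
proof
 show "graded_algebra K A1"
  by (rule graded_algebra_cong[OF R]) (use A1_graded oneR multR in auto)
qed (simp add: dg_of_graded_def)

lemma A0_env: "env_alg K A0"
proof
 interpret R: ring R by (rule ringR)
 show "graded_algebra K A0"
 proof (rule graded_algebra_cong[OF R])
  fix g h :: "int \<times> int" and x y assume xy: "x \<in> gr A0 g" "y \<in> gr A0 h"
  obtain p i where g: "g = (p, i)" by (cases g)
  obtain q j where h: "h = (q, j)" by (cases h)
  have c: "x \<in> carrier R" "y \<in> carrier R"
   using xy gr_carrier[OF gR, of x i] gr_carrier[OF gR, of y j] by (auto simp: g h split: if_splits)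
  show "x *_R y \<in> gr A0 (g + h)"
   using xy c multR[of x i y j] gr_zero[OF gR] by (auto simp: g h split: if_splits)
 next
  fix g :: "int \<times> int" show "(\<exists>i. gr A0 g = gr R i) \<or> gr A0 g = {0_R}" by (cases g) auto
 qed (use A0_graded oneR in "auto simp: zero_prod_def")
qed (simp add: internal_graded_def)

sublocale B0: env_alg K A0 by (rule A0_env)
sublocale B1: env_alg K A1 by (rule A1_env)

text \<open>
The twists and their inverses. The exponent \<open>i|l|\<close> is the Koszul sign for moving the left factor \<open>l\<close> past an
element of degree \<open>i\<close>. The exponent \<open>\<epsilon>|y|\<close> comes from an automorphism of the right factor and is the freedom that
the duality needs.
\<close>

definition \<Psi> :: "int => int => (int, 'a) tensor => (int \<times> int, 'a) tensor" where
 "\<Psi> \<epsilon> i = tmap K A0 (\<lambda>(g, x, h, y). frag_cmul (ksign (i * g + \<epsilon> * h)) (frag_of ((0, g), x, (0, h), y)))"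

definition \<Omega> :: "int => int => (int \<times> int, 'a) tensor => (int, 'a) tensor" where
 "\<Omega> \<epsilon> i = tmap K A1 (\<lambda>(g, x, h, y). frag_cmul (ksign (i * snd g + \<epsilon> * snd h)) (frag_of (snd g, x, snd h, y)))"

lemma \<Psi>_compat:
 "compat K A1 A0 (\<lambda>(g, x, h, y). frag_cmul (ksign (i * g + \<epsilon> * h)) (frag_of ((0, g), x, (0, h), y)))"
 by (rule B1.compatI(1)[OF A0_env, of "\<lambda>g. (0, g)" "\<lambda>g h. ksign (i * g + \<epsilon> * h)"]) simp_all

lemma \<Omega>_compat:
 "compat K A0 A1 (\<lambda>(g, x, h, y). frag_cmul (ksign (i * snd g + \<epsilon> * snd h)) (frag_of (snd g, x, snd h, y)))"
 by (rule B0.compatI(1)[OF A1_env, of snd "\<lambda>g h. ksign (i * snd g + \<epsilon> * snd h)"])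
  (auto simp: gr_zero[OF gR] split: if_splits)

lemma \<Psi>_hom: "\<Psi> \<epsilon> i \<in> ahom E1 E0"
 unfolding \<Psi>_def by (rule B1.tmap_hom[OF \<Psi>_compat A0_env])

lemma \<Omega>_hom: "\<Omega> \<epsilon> i \<in> ahom E0 E1"
 unfolding \<Omega>_def by (rule B0.tmap_hom[OF \<Omega>_compat A1_env])

lemma \<Psi>_pu:
 assumes "x \<in> gr R g" "y \<in> gr R h"
 shows "\<Psi> \<epsilon> i (B1.pu g x h y) = koszul E0 (i * g + \<epsilon> * h) (B0.pu (0, g) x (0, h) y)"
proof -
 have "((0, g), x, (0, h), y) \<in> tsyms A0" using assms by (simp add: tsyms_def)
 then show ?thesis
  by (simp add: \<Psi>_def B1.pu_def B0.pu_def B1.tmap_cl[OF \<Psi>_compat A0_env] B0.cl_sign)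
qed

lemma \<Omega>_pu:
 assumes "x \<in> gr A0 g" "y \<in> gr A0 h"
 shows "\<Omega> \<epsilon> i (B0.pu g x h y) = koszul E1 (i * snd g + \<epsilon> * snd h) (B1.pu (snd g) x (snd h) y)"
proof -
 have "(snd g, x, snd h, y) \<in> tsyms A1"
  using assms by (cases g; cases h) (auto simp: tsyms_def gr_zero[OF gR] split: if_splits)
 then show ?thesis
  by (simp add: \<Omega>_def B1.pu_def B0.pu_def B0.tmap_cl[OF \<Omega>_compat A1_env] B1.cl_sign)
qed

lemma pu0_normal:
 assumes "x \<in> gr A0 g" "y \<in> gr A0 h"
 shows "B0.pu g x h y = B0.pu (0, snd g) x (0, snd h) y" "x \<in> gr R (snd g)" "y \<in> gr R (snd h)"
proof -
 obtain p i where g: "g = (p, i)" by (cases g)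
 obtain q j where h: "h = (q, j)" by (cases h)
 show xy: "x \<in> gr R (snd g)" "y \<in> gr R (snd h)"
  using assms gr_zero[OF gR] by (auto simp: g h split: if_splits)
 then have xy0: "x \<in> gr A0 (0, i)" "y \<in> gr A0 (0, j)" by (simp_all add: g h)
 have z: "x = 0_A0" if "p \<noteq> 0" using assms(1) that by (simp add: g)
 have z': "y = 0_A0" if "q \<noteq> 0" using assms(2) that by (simp add: h)
 show "B0.pu g x h y = B0.pu (0, snd g) x (0, snd h) y"
 proof (cases "p = 0")
  case False
  then show ?thesis
   using B0.pu_zero(1)[OF assms(2), of g] B0.pu_zero(1)[OF xy0(2), of "(0, i)"] z by (simp add: g h del: A0_simps)
 next
  case p: True
  show ?thesis
  proof (cases "q = 0")
   case False
   then show ?thesis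
    using B0.pu_zero(2)[OF assms(1), of h] B0.pu_zero(2)[OF xy0(1), of "(0, j)"] z' by (simp add: g h del: A0_simps)
  next
   case True
   then show ?thesis using p by (simp add: g h)
  qed
 qed
qed

lemma E0_conc: "p \<noteq> 0 ==> gr E0 (p, i) = {0_E0}"
proof -
 assume p: "p \<noteq> 0"
 have "U = 0_E0" if "U \<in> gr E0 (p, i)" for U
  using that
 proof (induction rule: B0.gr_E_induct)
  case (pure g x h y)
  have "fst g \<noteq> 0 \<or> fst h \<noteq> 0" using pure(3) p by (metis add.right_neutral fst_add fst_conv)
  then show ?case
  proof
   assume "fst g \<noteq> 0"
   then have "x = 0_A0" using pure(1) by (cases g) simp
   then show ?thesis using B0.pu_zero(1)[OF pure(2)] by metis
  next
   assume "fst h \<noteq> 0"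
   then have "y = 0_A0" using pure(2) by (cases h) simp
   then show ?thesis using B0.pu_zero(2)[OF pure(1)] by metis
  qed
 qed (simp_all add: minus_zero_ag[OF B0.E.abgrp])
 then show ?thesis using gr_zero[OF B0.E_graded] by blast
qed

text \<open>
The multiplication of \<open>E1\<close> has the sign with exponent \<open>(m + g) g'\<close> for factors of degrees \<open>(g, m)\<close> and
\<open>(g', m')\<close>, and \<open>n = g + m\<close> is the degree of the first one. Replacing \<open>i\<close> by \<open>i + n\<close> in the exponent \<open>i g'\<close>
produces the same sign.
\<close>

lemma zhang: "zhang E0 E1 (\<Psi> \<epsilon>) (\<Omega> \<epsilon>)"
proof (rule zhang.intro)
 show "concentrated_alg E0"
  by (rule concentrated_alg.intro[OF B0.zalg_E]) (unfold_locales, rule E0_conc)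
 show "zalg E1" by (rule B1.zalg_E)
 note a0 = B0.E.abgrp and a1 = B1.E.abgrp
 note h = \<Psi>_hom[of \<epsilon>] and k = \<Omega>_hom[of \<epsilon>]
 show "zhang_axioms E0 E1 (\<Psi> \<epsilon>) (\<Omega> \<epsilon>)"
 proof
  fix i
  show "\<Psi> \<epsilon> i \<in> ahom E1 E0" "\<Omega> \<epsilon> i \<in> ahom E0 E1" by (rule h, rule k)
  show "\<Psi> \<epsilon> i 1_E1 = 1_E0"
   using \<Psi>_pu[OF oneR oneR, of \<epsilon> i] by (simp add: B0.one_E B1.one_E B0.pu_def B1.pu_def koszul_even zero_prod_def)
 next
  fix e i assume e: "e \<in> carrier E1"
  have "(\<lambda>e. \<Omega> \<epsilon> i (\<Psi> \<epsilon> i e)) e = id e"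
  proof (rule B1.E_ahom_eq[OF a1 _ _ _ e])
   show "(\<lambda>e. \<Omega> \<epsilon> i (\<Psi> \<epsilon> i e)) \<in> ahom E1 E1" using ahom_comp[OF h k] by (simp add: comp_def)
   show "id \<in> ahom E1 E1" by (simp add: hom_def)
   fix g x n y assume xy: "x \<in> gr A1 g" "y \<in> gr A1 n"
   then have xy0: "x \<in> gr A0 (0, g)" "y \<in> gr A0 (0, n)" by simp_all
   show "\<Omega> \<epsilon> i (\<Psi> \<epsilon> i (B1.pu g x n y)) = id (B1.pu g x n y)"
    using xy ahom_koszul[OF a0 a1 k B0.pu_closed[OF xy0]] B1.pu_closed[OF xy]
    by (simp add: \<Psi>_pu \<Omega>_pu[OF xy0] koszul_koszul[OF a1] koszul_even)
  qed
  then show "\<Omega> \<epsilon> i (\<Psi> \<epsilon> i e) = e" by simp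
 next
  fix w i assume w: "w \<in> carrier E0"
  have "(\<lambda>e. \<Psi> \<epsilon> i (\<Omega> \<epsilon> i e)) w = id w"
  proof (rule B0.E_ahom_eq[OF a0 _ _ _ w])
   show "(\<lambda>e. \<Psi> \<epsilon> i (\<Omega> \<epsilon> i e)) \<in> ahom E0 E0" using ahom_comp[OF k h] by (simp add: comp_def)
   show "id \<in> ahom E0 E0" by (simp add: hom_def)
   fix g x n y assume xy: "x \<in> gr A0 g" "y \<in> gr A0 n"
   note nf = pu0_normal[OF xy]
   have c1: "B1.pu (snd g) x (snd n) y \<in> carrier E1" by (rule B1.pu_closed) (use nf in simp_all)
   show "\<Psi> \<epsilon> i (\<Omega> \<epsilon> i (B0.pu g x n y)) = id (B0.pu g x n y)"
    using ahom_koszul[OF a1 a0 h c1] B0.pu_closed[OF xy]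
    by (simp add: \<Omega>_pu[OF xy] \<Psi>_pu[OF nf(2,3)] nf(1)[symmetric] koszul_koszul[OF a0] koszul_even)
  qed
  then show "\<Psi> \<epsilon> i (\<Omega> \<epsilon> i w) = w" by simp
 next
  fix e n i assume "e \<in> gr E1 n"
  then show "\<Psi> \<epsilon> i e \<in> gr E0 (0, n)"
  proof (rule B1.ahom_gr_E[OF _ B0.E_graded h])
   fix g x m y assume p: "x \<in> gr A1 g" "y \<in> gr A1 m" "g + m = n"
   have "B0.pu (0, g) x (0, m) y \<in> gr E0 ((0, g) + (0, m))" by (rule B0.pu_gr) (use p in simp_all)
   then show "\<Psi> \<epsilon> i (B1.pu g x m y) \<in> gr E0 (0, n)" using p by (simp add: \<Psi>_pu gr_koszul[OF B0.E_graded])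
  qed
 next
  fix w n i assume "w \<in> gr E0 (0, n)"
  then show "\<Omega> \<epsilon> i w \<in> gr E1 n"
  proof (rule B0.ahom_gr_E[OF _ B1.E_graded k])
   fix g x m y assume p: "x \<in> gr A0 g" "y \<in> gr A0 m" "g + m = (0, n)"
   note nf = pu0_normal[OF p(1,2)]
   have "B1.pu (snd g) x (snd m) y \<in> gr E1 (snd g + snd m)" by (rule B1.pu_gr) (use nf in simp_all)
   moreover have "snd g + snd m = n" using p(3) by (metis snd_add snd_conv)
   ultimately show "\<Omega> \<epsilon> i (B0.pu g x m y) \<in> gr E1 n" using p by (simp add: \<Omega>_pu gr_koszul[OF B1.E_graded])
  qed
 next
  fix e n e' i assume e: "e \<in> gr E1 n" and e': "e' \<in> carrier E1"
  note hc = ahom_closed[OF h]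
  show "\<Psi> \<epsilon> i (e *_E1 e') = \<Psi> \<epsilon> i e *_E0 \<Psi> \<epsilon> (i + n) e'"
  proof (rule B1.gr_E_ahom_eq[OF e a0])
   show "(\<lambda>e. \<Psi> \<epsilon> i (e *_E1 e')) \<in> ahom E1 E0"
    by (rule ahomI) (use e' hc in "simp_all add: B1.E.l_distr ahom_add[OF h]")
   show "(\<lambda>e. \<Psi> \<epsilon> i e *_E0 \<Psi> \<epsilon> (i + n) e') \<in> ahom E1 E0"
    by (rule ahomI) (use e' hc in "simp_all add: B0.E.l_distr ahom_add[OF h]")
   fix g x m y assume pure: "x \<in> gr A1 g" "y \<in> gr A1 m" "g + m = n"
   have xy: "x \<in> gr A1 g" "y \<in> gr A1 m" using pure by simp_all
   have xy0: "x \<in> gr A0 (0, g)" "y \<in> gr A0 (0, m)" using pure by simp_all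
   note pc = B1.pu_closed[OF xy]
   show "\<Psi> \<epsilon> i (B1.pu g x m y *_E1 e') = \<Psi> \<epsilon> i (B1.pu g x m y) *_E0 \<Psi> \<epsilon> (i + n) e'"
   proof (rule B1.E_ahom_eq[OF a0 _ _ _ e'])
    show "(\<lambda>e'. \<Psi> \<epsilon> i (B1.pu g x m y *_E1 e')) \<in> ahom E1 E0"
     by (rule ahomI) (use pc hc in "simp_all add: B1.E.r_distr ahom_add[OF h]")
    show "(\<lambda>e'. \<Psi> \<epsilon> i (B1.pu g x m y) *_E0 \<Psi> \<epsilon> (i + n) e') \<in> ahom E1 E0"
     by (rule ahomI) (use pc hc in "simp_all add: B0.E.r_distr ahom_add[OF h]")
    fix g' x' m' y' assume xy': "x' \<in> gr A1 g'" "y' \<in> gr A1 m'"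
    then have xy0': "x' \<in> gr A0 (0, g')" "y' \<in> gr A0 (0, m')" by simp_all
    have mm: "x' *_R x \<in> gr R (g + g')" "y *_R y' \<in> gr R (m + m')"
     using xy xy' multR[of x' g' x g] multR[of y m y' m'] by (simp_all add: add.commute)
    have c: "B1.pu (g + g') (x' *_R x) (m + m') (y *_R y') \<in> carrier E1"
     by (rule B1.pu_closed) (use mm in simp_all)
    let ?P = "B0.pu (0, g + g') (x' *_R x) (0, m + m') (y *_R y')"
    have cP: "?P \<in> carrier E0" by (rule B0.pu_closed) (use mm in simp_all)
    have m0: "B0.pu (0, g) x (0, m) y *_E0 B0.pu (0, g') x' (0, m') y' = ?P"
     using B0.pu_mult[OF xy0 xy0'] by (simp add: cdeg_prod_def cdeg_int_def koszul_even)
    have km: "koszul E0 a U *_E0 koszul E0 b V = koszul E0 (a + b) (U *_E0 V)"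
     if "U \<in> carrier E0" "V \<in> carrier E0" for a b U V
     using that by (auto simp: koszul_def B0.E.l_minus B0.E.r_minus B0.E.minus_minus)
    have "\<Psi> \<epsilon> i (B1.pu g x m y *_E1 B1.pu g' x' m' y') =
     koszul E0 (m * g' + g * g' + (i * (g + g') + \<epsilon> * (m + m'))) ?P"
     using ahom_koszul[OF a1 a0 h c] cP
     by (simp add: B1.pu_mult[OF xy xy'] \<Psi>_pu[OF mm] koszul_koszul[OF a0] cdeg_int_def)
    also have "\<dots> = koszul E0 ((i * g + \<epsilon> * m) + ((i + n) * g' + \<epsilon> * m')) ?P"
     by (rule koszul_cong) (simp add: pure(3)[symmetric] algebra_simps)
    also have "\<dots> = \<Psi> \<epsilon> i (B1.pu g x m y) *_E0 \<Psi> \<epsilon> (i + n) (B1.pu g' x' m' y')"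
     using xy xy' km[OF B0.pu_closed[OF xy0] B0.pu_closed[OF xy0']] by (simp add: \<Psi>_pu m0)
    finally show "\<Psi> \<epsilon> i (B1.pu g x m y *_E1 B1.pu g' x' m' y') =
      \<Psi> \<epsilon> i (B1.pu g x m y) *_E0 \<Psi> \<epsilon> (i + n) (B1.pu g' x' m' y')" .
   qed
  qed
 qed
qed

text \<open>
For \<open>x\<close> of degree \<open>i\<close>, the exponent \<open>i|l|\<close> of the twist is the Koszul sign in the diagonal bimodule of \<open>A1\<close>; the
exponent \<open>\<epsilon>|y|\<close> is absorbed by \<open>\<sigma>\<close>.
\<close>

lemma tot_diag_inv:
 assumes \<sigma>: "twist_aut K A1 \<sigma>" and v: "\<And>y n. y \<in> gr R n ==> \<sigma> y = koszul A1 (\<epsilon> * n) y"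
 shows "dg_inv E1 (tot (\<Psi> \<epsilon>) (diag A0)) (twisted_diag A1 \<sigma>) id id"
proof -
 interpret z: zhang E0 E1 "\<Psi> \<epsilon>" "\<Omega> \<epsilon>" by (rule zhang)
 interpret T0: twist_aut K A0 id by (rule B0.twist_id)
 interpret T1: twist_aut K A1 \<sigma> by (rule \<sigma>)
 note D0 = T0.D_dgm[folded diag_def]
 note a0 = B0.E.abgrp and a1 = B1.E.abgrp
  and r0 = B0.A.abgrp and r1 = B1.A.abgrp
 have k01: "koszul A0 n x = koszul A1 n x" if "x \<in> carrier R" for n x
  using a_inv_cong[OF r1, of A0 x] that by (simp add: koszul_def)
 have 1: "id \<in> dg_hom E1 (tot (\<Psi> \<epsilon>) (diag A0)) (twisted_diag A1 \<sigma>)"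
 proof (rule z.tot_dg_homI[OF D0 T1.D_dgm])
  show "id \<in> ahom (diag A0) (twisted_diag A1 \<sigma>)" unfolding diag_def by (rule ahomI) simp_all
  fix p i x assume "x \<in> gr (diag A0) (p, i)"
  then have x0: "x \<in> gr A0 (p, i)" by (simp add: diag_def del: A0_simps)
  then have x: "x \<in> gr R i" using gr_zero[OF gR] by (auto split: if_splits)
  have xc: "x \<in> carrier R" by (rule gr_carrier[OF gR x])
  show "id x \<in> gr (twisted_diag A1 \<sigma>) (p + i)" using x0 gr_zero[OF gR] by (auto split: if_splits)
  fix e assume e: "e \<in> carrier E1"
  have "ract (diag A0) x (\<Psi> \<epsilon> i e) = ract (twisted_diag A1 \<sigma>) x e"
  proof (rule B1.E_ahom_eq[OF r1 _ _ _ e])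
   have "ract (diag A0) x \<in> ahom E0 A1"
    using T0.D_act_hom_right[of x] xc by (auto simp: diag_def hom_def)
   from ahom_comp[OF \<Psi>_hom this] show "(\<lambda>e. ract (diag A0) x (\<Psi> \<epsilon> i e)) \<in> ahom E1 A1" by (simp add: comp_def)
   show "ract (twisted_diag A1 \<sigma>) x \<in> ahom E1 A1" by (rule T1.D_act_hom_right) (use xc in simp)
   fix g l h y assume ly: "l \<in> gr A1 g" "y \<in> gr A1 h"
   then have ly0: "l \<in> gr A0 (0, g)" "y \<in> gr A0 (0, h)" by simp_all
   have c: "l \<in> carrier R" "y \<in> carrier R" using ly gr_carrier[OF gR] by auto
   interpret R: ring R by (rule ringR)
   have m: "(l *_R x) *_R y \<in> carrier R" using c xc by simp
   have hr: "(\<lambda>y. (l *_R x) *_R y) \<in> ahom A1 A1" by (rule ahomI) (use c xc in "simp_all add: R.r_distr")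
   have x1: "x \<in> gr A1 i" using x by simp
   have "ract (diag A0) x (\<Psi> \<epsilon> i (B1.pu g l h y)) = koszul A1 (i * g + \<epsilon> * h) ((l *_R x) *_R y)"
    using ahom_koszul[OF a0 r0 T0.D_act_hom_right B0.pu_closed[OF ly0], of x] ly xc m
     T0.D_act_pu[OF x0 ly0]
    by (simp add: \<Psi>_pu diag_def koszul_even cdeg_prod_def cdeg_int_def k01)
   also have "\<dots> = koszul A1 (g * i) (koszul A1 (\<epsilon> * h) ((l *_R x) *_R y))"
    using m by (simp add: koszul_koszul[OF r1] mult.commute)
   also have "koszul A1 (\<epsilon> * h) ((l *_R x) *_R y) = (l *_R x) *_R \<sigma> y"
    using ahom_koszul[OF r1 r1 hr] ly c by (simp add: v)
   also have "koszul A1 (g * i) \<dots> = ract (twisted_diag A1 \<sigma>) x (B1.pu g l h y)"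
    using T1.D_act_pu[OF x1 ly] by (simp add: cdeg_int_def)
   finally show "ract (diag A0) x (\<Psi> \<epsilon> i (B1.pu g l h y)) = ract (twisted_diag A1 \<sigma>) x (B1.pu g l h y)" .
  qed
  then show "id (ract (diag A0) x (\<Psi> \<epsilon> i e)) = ract (twisted_diag A1 \<sigma>) (id x) e" by simp
 qed (simp add: diag_def B0.dA B1.dA)
 have 2: "id \<in> dg_hom E1 (twisted_diag A1 \<sigma>) (tot (\<Psi> \<epsilon>) (diag A0))"
 proof (rule dg_homI)
  fix g x assume "x \<in> gr (twisted_diag A1 \<sigma>) g"
  then show "id x \<in> gr (tot (\<Psi> \<epsilon>) (diag A0)) g"
   by (intro tot_grI[OF dgm_gg[OF D0], of _ 0 g]) (simp_all add: diag_def)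
 next
  fix x e assume "x \<in> carrier (twisted_diag A1 \<sigma>)" "e \<in> carrier E1"
  then show "id (ract (twisted_diag A1 \<sigma>) x e) = ract (tot (\<Psi> \<epsilon>) (diag A0)) (id x) e"
   using dg_homD(4)[OF 1, of x e] by (simp add: diag_def)
 qed (simp_all add: diag_def B0.dA B1.dA)
 show ?thesis unfolding dg_inv_def using 1 2 by simp
qed

end

section \<open>The dual of a bimodule\<close>

definition precomp where "precomp P u f = (\<lambda>x\<in>carrier P. f (u x))"

lemma hom_deg_restrict:
 assumes "dg_module E P" "c \<in> hom_deg E P N g" shows "restrict c (carrier P) \<in> hom_deg E P N g"
proof -
 interpret P: dgmod E P using assms(1) by blast
 note h = hom_degD[OF assms(2)]
 show ?thesis
  by (rule hom_degI) (auto intro!: ahomI simp: h P.gr_closed h(4))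
qed

lemma gext_param:
 assumes "graded_group G" "abelian_group N" "e \<in> carrier G" "\<And>h e. e \<in> carrier G ==> (\<lambda>f. \<phi> f h e) \<in> ahom M N"
 shows "(\<lambda>f. gext G N (\<phi> f) e) \<in> ahom M N"
proof -
 interpret N: abelian_group N by fact
 note h = assms(4)[OF hcomp_closed[OF assms(1,3)]]
 show ?thesis unfolding gext_def
 proof (rule ahomI)
  fix f f' assume f: "f \<in> carrier M" "f' \<in> carrier M"
  have "(\<Oplus>\<^bsub>N\<^esub>g\<in>hsupp G e. \<phi> (f +_M f') g (hcomp G e g)) =
   (\<Oplus>\<^bsub>N\<^esub>g\<in>hsupp G e. \<phi> f g (hcomp G e g) +_N \<phi> f' g (hcomp G e g))"
   by (rule N.finsum_cong') (use f ahom_closed[OF h] ahom_add[OF h] in auto)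
  also have "\<dots> = (\<Oplus>\<^bsub>N\<^esub>g\<in>hsupp G e. \<phi> f g (hcomp G e g)) +_N (\<Oplus>\<^bsub>N\<^esub>g\<in>hsupp G e. \<phi> f' g (hcomp G e g))"
   by (rule N.finsum_addf) (use f ahom_closed[OF h] in auto)
  finally show "(\<Oplus>\<^bsub>N\<^esub>g\<in>hsupp G e. \<phi> (f +_M f') g (hcomp G e g)) =
   (\<Oplus>\<^bsub>N\<^esub>g\<in>hsupp G e. \<phi> f g (hcomp G e g)) +_N (\<Oplus>\<^bsub>N\<^esub>g\<in>hsupp G e. \<phi> f' g (hcomp G e g))" .
 qed (rule N.finsum_closed, use ahom_closed[OF h] in auto)
qed

context zalg
begin

abbreviation H where "H \<equiv> hom_graded E"

lemma H_simps [simp]: "add (H P) = (\<lambda>f f'. \<lambda>x\<in>carrier P. f x \<oplus> f' x)" "zero (H P) = (\<lambda>x\<in>carrier P. \<zero>)"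
 "gr (H P) g = hom_deg E P (regular E) g \<inter> extensional (carrier P)"
 by (simp_all add: hom_graded_def mk_dg_def)

lemma H_carrierI:
 assumes "f \<in> extensional (carrier P)" "finite S" "\<And>g. g \<in> S ==> c g \<in> hom_deg E P (regular E) g"
  "\<And>x. x \<in> carrier P ==> f x = (\<Oplus>g\<in>S. c g x)"
 shows "f \<in> carrier (H P)"
 using assms by (auto simp: hom_graded_def mk_dg_def)

lemma H_ext: "f \<in> carrier (H P) ==> f \<in> extensional (carrier P)"
 by (simp add: hom_graded_def mk_dg_def)

lemma H_eqI: "f \<in> carrier (H P) ==> f' \<in> carrier (H P) ==> (\<And>x. x \<in> carrier P ==> f x = f' x) ==> f = f'"
 by (rule extensionalityI[OF H_ext H_ext])

context
 fixes P :: "('e, 'g, 'p) dg"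
 assumes P: "dg_module E P"
begin

interpretation P: dgmod E P using P by blast

lemma H_carrierE:
 assumes "f \<in> carrier (H P)"
 obtains S c where "finite S" "\<And>g. c g \<in> hom_deg E P (regular E) g"
  "\<And>x T. x \<in> carrier P ==> finite T ==> S \<subseteq> T ==> f x = (\<Oplus>g\<in>T. c g x)"
proof -
 obtain S c where S: "finite S" and c: "\<And>g. g \<in> S ==> c g \<in> hom_deg E P (regular E) g"
  and f: "\<And>x. x \<in> carrier P ==> f x = (\<Oplus>g\<in>S. c g x)"
  using assms by (auto simp: hom_graded_def mk_dg_def)
 define c' where "c' g = (if g \<in> S then c g else (\<lambda>_. \<zero>))" for g
 have z: "(\<lambda>_. \<zero>) \<in> hom_deg E P (regular E) g" for g
  by (rule hom_degI, rule ahomI) (simp_all add: gr_zero[OF gg])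
 have c': "c' g \<in> hom_deg E P (regular E) g" for g using c z by (simp add: c'_def)
 have "f x = (\<Oplus>g\<in>T. c' g x)" if x: "x \<in> carrier P" and T: "finite T" "S \<subseteq> T" for x T
 proof -
  have "(\<Oplus>g\<in>T. c' g x) = (\<Oplus>g\<in>S. c' g x)"
   by (rule finsum_mono_zero[OF abgrp T])
    (use hom_degD(2)[OF c' x] in "auto simp: c'_def")
  also have "\<dots> = (\<Oplus>g\<in>S. c g x)"
   by (rule finsum_cong') (use hom_degD(2)[OF c x] in "auto simp: c'_def")
  finally show ?thesis using f[OF x] by simp
 qed
 from that[OF S c' this] show thesis .
qed

lemma H_closed: assumes "f \<in> carrier (H P)" "x \<in> carrier P" shows "f x \<in> carrier E"
proof -
 obtain S c where S: "finite S" and c: "\<And>g. c g \<in> hom_deg E P (regular E) g"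
  and f: "\<And>x T. x \<in> carrier P ==> finite T ==> S \<subseteq> T ==> f x = (\<Oplus>g\<in>T. c g x)"
  using H_carrierE[OF assms(1)] by metis
 show ?thesis unfolding f[OF assms(2) S order_refl] by (rule finsum_closed) (use hom_degD(2)[OF c assms(2)] in auto)
qed

lemma H_ahom: assumes "f \<in> carrier (H P)" shows "f \<in> ahom P E"
proof (rule ahomI)
 obtain S c where S: "finite S" and c: "\<And>g. c g \<in> hom_deg E P (regular E) g"
  and f: "\<And>x T. x \<in> carrier P ==> finite T ==> S \<subseteq> T ==> f x = (\<Oplus>g\<in>T. c g x)"
  using H_carrierE[OF assms(1)] by metis
 fix x y assume xy: "x \<in> carrier P" "y \<in> carrier P"
 have "f (x +_P y) = (\<Oplus>g\<in>S. c g (x +_P y))" by (rule f) (use xy S in simp_all)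
 also have "\<dots> = (\<Oplus>g\<in>S. c g x \<oplus> c g y)"
  by (rule finsum_cong') (use xy hom_degD(2,3)[OF c] in auto)
 also have "\<dots> = f x \<oplus> f y"
  unfolding f[OF xy(1) S order_refl] f[OF xy(2) S order_refl]
  by (rule finsum_addf) (use xy hom_degD(2)[OF c] in auto)
 finally show "f (x +_P y) = f x \<oplus> f y" .
qed (rule H_closed[OF assms])

lemma H_add_closed:
 assumes "f \<in> carrier (H P)" "f' \<in> carrier (H P)" shows "(\<lambda>x\<in>carrier P. f x \<oplus> f' x) \<in> carrier (H P)"
proof -
 obtain S c where S: "finite S" and c: "\<And>g. c g \<in> hom_deg E P (regular E) g"
  and f: "\<And>x T. x \<in> carrier P ==> finite T ==> S \<subseteq> T ==> f x = (\<Oplus>g\<in>T. c g x)"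
  using H_carrierE[OF assms(1)] by metis
 obtain S' c' where S': "finite S'" and c': "\<And>g. c' g \<in> hom_deg E P (regular E) g"
  and f': "\<And>x T. x \<in> carrier P ==> finite T ==> S' \<subseteq> T ==> f' x = (\<Oplus>g\<in>T. c' g x)"
  using H_carrierE[OF assms(2)] by metis
 have fin: "finite (S \<union> S')" using S S' by simp
 show ?thesis
 proof (rule H_carrierI[OF _ fin])
  fix g show "(\<lambda>x. c g x \<oplus> c' g x) \<in> hom_deg E P (regular E) g"
   using hom_deg_add[OF regular_dgm c c' P] by simp
  fix x assume x: "x \<in> carrier P"
  have "f x \<oplus> f' x = (\<Oplus>g\<in>S \<union> S'. c g x) \<oplus> (\<Oplus>g\<in>S \<union> S'. c' g x)"
   using f[OF x fin] f'[OF x fin] by simp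
  also have "\<dots> = (\<Oplus>g\<in>S \<union> S'. c g x \<oplus> c' g x)"
   by (rule finsum_addf[symmetric]) (use hom_degD(2)[OF c x] hom_degD(2)[OF c' x] in auto)
  finally show "(\<lambda>x\<in>carrier P. f x \<oplus> f' x) x = (\<Oplus>g\<in>S \<union> S'. c g x \<oplus> c' g x)" using x by simp
 qed simp
qed

lemma H_zero_closed: "(\<lambda>x\<in>carrier P. \<zero>) \<in> carrier (H P)"
 by (rule H_carrierI[of _ _ "{}"]) auto

lemma H_transform:
 fixes P' :: "('e, 'g, 'q) dg"
 assumes f: "f \<in> carrier (H P)" and \<phi>: "\<phi> \<in> ahom E E" and u: "\<And>x. x \<in> carrier P' ==> u x \<in> carrier P"
  and deg: "\<And>g c. c \<in> hom_deg E P (regular E) g ==> (\<lambda>x. \<phi> (c (u x))) \<in> hom_deg E P' (regular E) (g + s)"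
 shows "(\<lambda>x\<in>carrier P'. \<phi> (f (u x))) \<in> carrier (H P')"
proof -
 obtain S c where S: "finite S" and c: "\<And>g. c g \<in> hom_deg E P (regular E) g"
  and fs: "\<And>x T. x \<in> carrier P ==> finite T ==> S \<subseteq> T ==> f x = (\<Oplus>g\<in>T. c g x)"
  using H_carrierE[OF f] by metis
 show ?thesis
 proof (rule H_carrierI)
  show "finite ((\<lambda>g. g + s) ` S)" using S by simp
  show "(\<lambda>x. \<phi> (c (h - s) (u x))) \<in> hom_deg E P' (regular E) h" if "h \<in> (\<lambda>g. g + s) ` S" for h
   using deg[OF c, of "h - s"] by simp
  fix x assume x: "x \<in> carrier P'"
  have cl: "\<And>g. c g (u x) \<in> carrier E" using hom_degD(2)[OF c u[OF x]] by simp
  have "\<phi> (f (u x)) = (\<Oplus>g\<in>S. \<phi> (c g (u x)))"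
   unfolding fs[OF u[OF x] S order_refl]
   by (rule ahom_finsum[OF abgrp abgrp \<phi> S cl])
  also have "\<dots> = (\<Oplus>h\<in>(\<lambda>g. g + s) ` S. \<phi> (c (h - s) (u x)))"
   by (subst finsum_reindex) (auto simp: inj_on_def cl intro: ahom_closed[OF \<phi>])
  finally show "(\<lambda>x\<in>carrier P'. \<phi> (f (u x))) x = (\<Oplus>h\<in>(\<lambda>g. g + s) ` S. \<phi> (c (h - s) (u x)))" using x by simp
 qed simp
qed

lemma H_abelian: "abelian_group (H P)"
proof (rule abelian_groupI)
 fix f assume f: "f \<in> carrier (H P)"
 have "(\<lambda>x\<in>carrier P. \<ominus> f (id x)) \<in> carrier (H P)"
 proof (rule H_transform[OF f, where s = 0])
  show "(\<lambda>x. \<ominus> x) \<in> ahom E E" by (rule ahomI) (simp_all add: minus_add)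
  fix g c assume "c \<in> hom_deg E P (regular E) g"
  from hom_deg_uminus[OF regular_dgm this] show "(\<lambda>x. \<ominus> c (id x)) \<in> hom_deg E P (regular E) (g + 0)" by simp
 qed simp
 then show "\<exists>f'\<in>carrier (H P). f' +_(H P) f = 0_(H P)"
  by (rule bexI[rotated]) (use H_closed[OF f] in "auto simp: l_neg fun_eq_iff")
 show "0_(H P) +_(H P) f = f"
  by (rule H_eqI) (use f H_closed[OF f] H_add_closed[OF H_zero_closed f] in auto)
qed (use H_closed H_add_closed H_zero_closed in "auto simp: fun_eq_iff a_ac")

lemma H_ev: "x \<in> carrier P ==> (\<lambda>f. f x) \<in> ahom (H P) E"
 by (rule ahomI) (simp_all add: H_closed)

lemma H_minus: assumes "f \<in> carrier (H P)" "x \<in> carrier P" shows "(-_(H P) f) x = \<ominus> f x"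
 by (rule ahom_minus[OF H_abelian abgrp H_ev[OF assms(2)] assms(1)])

lemma H_koszul: assumes "f \<in> carrier (H P)" "x \<in> carrier P" shows "koszul (H P) n f x = koszul E n (f x)"
 by (rule ahom_koszul[OF H_abelian abgrp H_ev[OF assms(2)] assms(1)])

lemma H_gr_carrier: assumes "f \<in> gr (H P) g" shows "f \<in> carrier (H P)"
 by (rule H_carrierI[of _ _ "{g}" "\<lambda>_. f"]) (use assms hom_degD(2)[of f E P "regular E" g] in auto)

text \<open>
The component of degree \<open>g\<close> of a map \<open>f\<close> is detected by the values: on \<open>x\<close> of degree \<open>k\<close> it is the component of
\<open>f x\<close> in degree \<open>k + g\<close>. These projections take values in a group of functions.
\<close>

lemma H_graded: "graded_group (H P)"
proof -
 define N where "N = (\<lparr>carrier = {\<phi> :: 'g \<times> 'p => 'e. \<forall>z. \<phi> z \<in> carrier E}, monoid.mult = undefined, one = undefined,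
   zero = (\<lambda>_. \<zero>), add = (\<lambda>\<phi> \<phi>' z. \<phi> z \<oplus> \<phi>' z)\<rparr> :: ('g \<times> 'p => 'e) ring)"
 have N: "abelian_group N"
 proof (rule abelian_groupI)
  fix \<phi> assume "\<phi> \<in> carrier N"
  then show "\<exists>\<phi>'\<in>carrier N. \<phi>' +_N \<phi> = 0_N"
   by (intro bexI[of _ "\<lambda>z. \<ominus> \<phi> z"]) (auto simp: N_def l_neg)
 qed (auto simp: N_def fun_eq_iff a_ac)
 have gd: "f x \<in> gr E (k + g)" if "f \<in> gr (H P) g" "x \<in> gr P k" for f x g k
  using that hom_degD(5)[of f E P "regular E" g x k] by simp
 show ?thesis
 proof (rule graded_groupI[OF H_abelian _ _ _ H_gr_carrier _ _ N])
  fix f assume "f \<in> carrier (H P)"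
  then obtain S c where S: "finite S" and c: "\<And>g. c g \<in> hom_deg E P (regular E) g"
   and f: "\<And>x T. x \<in> carrier P ==> finite T ==> S \<subseteq> T ==> f x = (\<Oplus>g\<in>T. c g x)" and fc: "f \<in> carrier (H P)"
   using H_carrierE by metis
  have "(\<lambda>x\<in>carrier P. \<Oplus>g\<in>S. c g x) \<in> hspan (H P)"
   using S
  proof (induction S)
   case empty
   then show ?case using hspan_zero[of "H P"] by (simp only: H_simps finsum_empty)
  next
   case (insert g S)
   have "restrict (c g) (carrier P) \<in> gr (H P) g" using hom_deg_restrict[OF P c] by simp
   from hspan_add[OF this insert.IH]
   have "restrict (c g) (carrier P) +_(H P) (\<lambda>x\<in>carrier P. \<Oplus>g\<in>S. c g x) \<in> hspan (H P)" .
   also have "restrict (c g) (carrier P) +_(H P) (\<lambda>x\<in>carrier P. \<Oplus>g\<in>S. c g x) =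
    (\<lambda>x\<in>carrier P. \<Oplus>g\<in>insert g S. c g x)"
    using insert hom_degD(2)[OF c] by (auto simp: fun_eq_iff Pi_def)
   finally show ?case .
  qed
  moreover have "(\<lambda>x\<in>carrier P. \<Oplus>g\<in>S. c g x) = f"
   using f[OF _ S order_refl] H_ext[OF fc] by (auto simp: fun_eq_iff extensional_def)
  ultimately show "f \<in> hspan (H P)" by simp
 next
  fix g
  define pr where "pr f = (\<lambda>(k, x). if x \<in> gr P k then hcomp E (f x) (k + g) else \<zero>)" for f :: "'p => 'e"
  have 1: "pr \<in> ahom (H P) N"
   by (rule ahomI)
    (auto simp: pr_def N_def fun_eq_iff P.gr_closed H_closed hcomp_closed[OF gg] hcomp_add[OF gg])
  have 2: "f = 0_(H P)" if f: "f \<in> gr (H P) g" and z: "pr f = 0_N" for f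
  proof (rule H_eqI[OF H_gr_carrier[OF f]])
   show "0_(H P) \<in> carrier (H P)" using H_zero_closed by simp
   fix x assume x: "x \<in> carrier P"
   have "f x = (\<lambda>_. \<zero>) x"
   proof (rule ahom_eqI[OF P.gg abgrp H_ahom[OF H_gr_carrier[OF f]] _ _ x])
    fix k x assume x: "x \<in> gr P k"
    have "pr f (k, x) = \<zero>" using z by (simp add: N_def)
    then show "f x = (\<lambda>_. \<zero>) x" using x hcomp_hom[OF gg gd[OF f x]] by (simp add: pr_def)
   qed (rule ahomI, simp_all)
   then show "f x = 0_(H P) x" using x by simp
  qed
  have 3: "pr f = 0_N" if f: "f \<in> gr (H P) h" and h: "h \<noteq> g" for f h
   using hcomp_hom[OF gg gd[OF f]] h by (auto simp: pr_def N_def fun_eq_iff)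
  show "\<exists>pr\<in>ahom (H P) N. (\<forall>f\<in>gr (H P) g. pr f = 0_N --> f = 0_(H P)) \<and>
   (\<forall>h. \<forall>f\<in>gr (H P) h. h \<noteq> g --> pr f = 0_N)"
   by (rule bexI[OF _ 1]) (intro conjI ballI allI impI, erule (1) 2, erule (1) 3)
 next
  fix g
  have "(\<lambda>_. \<zero>) \<in> hom_deg E P (regular E) g"
   by (rule hom_degI, rule ahomI) (simp_all add: gr_zero[OF gg])
  from hom_deg_restrict[OF P this] show "0_(H P) \<in> gr (H P) g" by simp
 next
  fix g f f' assume "f \<in> gr (H P) g" "f' \<in> gr (H P) g"
  then show "f +_(H P) f' \<in> gr (H P) g"
   using hom_deg_restrict[OF P hom_deg_add[OF regular_dgm _ _ P, of f g f']] by simp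
 next
  fix g f assume f: "f \<in> gr (H P) g"
  have "-_(H P) f = (\<lambda>x\<in>carrier P. \<ominus> f x)"
   using H_ext[OF abelian_group.a_inv_closed[OF H_abelian H_gr_carrier[OF f]]] H_minus[OF H_gr_carrier[OF f]]
   by (auto simp: fun_eq_iff extensional_def)
  then show "-_(H P) f \<in> gr (H P) g"
   using hom_deg_restrict[OF P hom_deg_uminus[OF regular_dgm, of f P g]] f by simp
 qed
qed

lemma precomp_hom:
 fixes P' :: "('e, 'g, 'q) dg"
 assumes "u \<in> hom_deg E P' P s" shows "precomp P' u \<in> ahom (H P) (H P')"
proof (rule ahomI)
 fix f assume f: "f \<in> carrier (H P)"
 have "(\<lambda>x\<in>carrier P'. id (f (u x))) \<in> carrier (H P')"
 proof (rule H_transform[OF f, where s = s])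
  fix g c assume "c \<in> hom_deg E P (regular E) g"
  from hom_deg_comp[OF assms this] show "(\<lambda>x. id (c (u x))) \<in> hom_deg E P' (regular E) (g + s)"
   by (simp add: comp_def add.commute)
 qed (use hom_degD(2)[OF assms] in "auto simp: hom_def")
 then show "precomp P' u f \<in> carrier (H P')" by (simp add: precomp_def)
qed (auto simp: precomp_def fun_eq_iff hom_degD(2)[OF assms])

lemma precomp_gr:
 fixes P' :: "('e, 'g, 'q) dg"
 assumes "u \<in> hom_deg E P' P s" "f \<in> gr (H P) g" "dg_module E P'" shows "precomp P' u f \<in> gr (H P') (s + g)"
 using hom_deg_restrict[OF assms(3) hom_deg_comp[OF assms(1)], of f "regular E" g] assms(2)
 by (simp add: precomp_def comp_def)

definition lmul where "lmul w f = (\<lambda>x\<in>carrier P. w \<otimes> f x)"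

lemma lmul_hom_deg:
 assumes "w \<in> gr E h" "c \<in> hom_deg E P (regular E) g" shows "(\<lambda>x. w \<otimes> c x) \<in> hom_deg E P (regular E) (g + h)"
proof (rule hom_degI)
 note c = hom_degD[OF assms(2)] and w = gr_carrier[OF gg assms(1)]
 have cc: "\<And>x. x \<in> carrier P ==> c x \<in> carrier E" using c(2) by simp
 show "(\<lambda>x. w \<otimes> c x) \<in> ahom P (regular E)"
  by (rule ahomI) (use c(3) w in "simp_all add: r_distr cc")
 show "w \<otimes> c (ract P x e) = ract (regular E) (w \<otimes> c x) e" if "x \<in> carrier P" "e \<in> carrier E" for x e
  using that c(4) w by (simp add: m_assoc cc)
 fix k x assume "x \<in> gr P k"
 then have "w \<otimes> c x \<in> gr E (h + (k + g))" using mult_gr[OF assms(1)] c(5) by simp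
 then show "w \<otimes> c x \<in> gr (regular E) (k + (g + h))" by (simp add: ac_simps)
qed

lemma lmul_gr: "w \<in> gr E h ==> f \<in> gr (H P) g ==> lmul w f \<in> gr (H P) (g + h)"
 using hom_deg_restrict[OF P lmul_hom_deg] by (simp add: lmul_def)

lemma lmul_add: "w \<in> carrier E ==> w' \<in> carrier E ==> f \<in> carrier (H P) ==>
  lmul (w \<oplus> w') f = lmul w f +_(H P) lmul w' f"
 by (auto simp: lmul_def fun_eq_iff l_distr H_closed)

lemma lmul_closed:
 assumes "w \<in> carrier E" "f \<in> carrier (H P)" shows "lmul w f \<in> carrier (H P)"
 using gg assms(1)
proof (induction rule: graded_induct)
 case zero
 have "lmul \<zero> f = (\<lambda>x\<in>carrier P. \<zero>)" using assms(2) by (auto simp: lmul_def fun_eq_iff H_closed)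
 with H_zero_closed show ?case by (simp only:)
next
 case (add w h w')
 note wc = gr_carrier[OF gg add(1)]
 have "(\<lambda>x\<in>carrier P. w \<otimes> f (id x)) \<in> carrier (H P)"
  by (rule H_transform[OF assms(2), where s = h])
   (use wc lmul_hom_deg[OF add(1)] in "auto intro!: ahomI simp: r_distr")
 then have "lmul w f \<in> carrier (H P)" by (simp add: lmul_def)
 then show ?case unfolding lmul_add[OF wc add(2) assms(2)] H_simps by (rule H_add_closed[OF _ add(3)])
qed

lemma lmul_hom: "w \<in> carrier E ==> lmul w \<in> ahom (H P) (H P)"
 by (rule ahomI) (auto simp: lmul_closed, auto simp: lmul_def fun_eq_iff r_distr H_closed)

lemma lmul_hom_left: "f \<in> carrier (H P) ==> (\<lambda>w. lmul w f) \<in> ahom E (H P)"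
 by (rule ahomI) (simp_all only: lmul_closed lmul_add)

lemma d_hom_deg: "dd P \<in> hom_deg E P P ddeg"
 by (rule hom_degI) (use P.d_hom P.d_gr act_d[OF P] in simp_all)

end

end

context env_alg
begin

abbreviation flip where "flip \<equiv> env_flip K A"

lemma flip_compat: "compat K A A (\<lambda>(g, x, h, y). frag_cmul (ksign (cdeg g * cdeg h)) (frag_of (h, y, g, x)))"
 by (rule compatI(2)[OF env_alg_self, of id "\<lambda>g h. ksign (cdeg g * cdeg h)", simplified])

lemma flip_tmap: "flip = tmap K A (\<lambda>(g, x, h, y). frag_cmul (ksign (cdeg g * cdeg h)) (frag_of (h, y, g, x)))"
 by (simp add: fun_eq_iff env_flip_def tmap_def)

lemma flip_hom: "flip \<in> ahom E E"
 unfolding flip_tmap by (rule tmap_hom[OF flip_compat env_alg_self])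

lemma flip_pu:
 assumes "x \<in> gr A g" "y \<in> gr A h" shows "flip (pu g x h y) = koszul E (cdeg g * cdeg h) (pu h y g x)"
 using assms by (simp add: flip_tmap pu_def tmap_cl[OF flip_compat env_alg_self] cl_sign tsyms_def)

lemma flip_closed [simp]: "e \<in> carrier E ==> flip e \<in> carrier E"
 by (rule ahom_closed[OF flip_hom])

lemma flip_gr: "e \<in> gr E n ==> flip e \<in> gr E n"
proof (erule ahom_gr_E[OF _ E_graded flip_hom])
 fix g x h y assume p: "x \<in> gr A g" "y \<in> gr A h" "g + h = n"
 then show "flip (pu g x h y) \<in> gr E n" using pu_gr[OF p(2,1)] by (simp add: flip_pu gr_koszul[OF E_graded] add.commute)
qed

lemma flip_one: "flip 1_E = 1_E"
 using flip_pu[OF oneA oneA] by (simp add: one_E pu_def[symmetric] koszul_even)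

lemma koszul_mult:
 assumes "U \<in> carrier E" "V \<in> carrier E"
 shows "koszul E a U *_E koszul E b V = koszul E (a + b) (U *_E V)"
 using assms by (auto simp: koszul_def E.l_minus E.r_minus E.minus_minus)

text \<open>
The flip is an isomorphism with the opposite algebra, whose multiplication carries the Koszul sign.
\<close>

lemma flip_mult:
 assumes e: "e \<in> gr E n" and e': "e' \<in> gr E m"
 shows "flip (e *_E e') = koszul E (cdeg n * cdeg m) (flip e' *_E flip e)"
proof (rule gr_E_ahom_eq[OF e E.abgrp])
 note ag = E.abgrp and fa = ahom_add[OF flip_hom]
 have e'c: "e' \<in> carrier E" by (rule gr_E_carrier[OF e'])
 show "(\<lambda>e. flip (e *_E e')) \<in> ahom E E" by (rule ahomI) (use e'c in "simp_all add: E.l_distr fa")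
 show "(\<lambda>e. koszul E (cdeg n * cdeg m) (flip e' *_E flip e)) \<in> ahom E E"
  by (rule ahomI) (use e'c in "simp_all add: E.r_distr fa koszul_add[OF ag] ag")
 fix g x h y assume xy: "x \<in> gr A g" "y \<in> gr A h" "g + h = n"
 note p = pu_closed[OF xy(1,2)]
 show "flip (pu g x h y *_E e') = koszul E (cdeg n * cdeg m) (flip e' *_E flip (pu g x h y))"
 proof (rule gr_E_ahom_eq[OF e' ag])
  show "(\<lambda>e'. flip (pu g x h y *_E e')) \<in> ahom E E" by (rule ahomI) (use p in "simp_all add: E.r_distr fa")
  show "(\<lambda>e'. koszul E (cdeg n * cdeg m) (flip e' *_E flip (pu g x h y))) \<in> ahom E E"
   by (rule ahomI) (use p in "simp_all add: E.l_distr fa koszul_add[OF ag] ag")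
  fix g' x' h' y' assume p': "x' \<in> gr A g'" "y' \<in> gr A h'" "g' + h' = m"
  note nm = xy(3)[symmetric] p'(3)[symmetric]
  have m: "x' *_A x \<in> gr A (g + g')" "y *_A y' \<in> gr A (h + h')" using xy p' multA multA' by auto
  have "flip (pu g x h y *_E pu g' x' h' y') =
   koszul E (cdeg h * cdeg g' + cdeg g * cdeg g' + cdeg (g + g') * cdeg (h + h')) (pu (h + h') (y *_A y') (g + g') (x' *_A x))"
   using ahom_koszul[OF ag ag flip_hom pu_closed[OF m]] m
   by (simp add: pu_mult[OF xy(1,2) p'(1,2)] flip_pu koszul_koszul[OF ag])
  also have "\<dots> = koszul E (cdeg n * cdeg m + (cdeg g' * cdeg h' + cdeg g * cdeg h) + (cdeg g' * cdeg h + cdeg h' * cdeg h))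
    (pu (h + h') (y *_A y') (g + g') (x' *_A x))"
   by (rule koszul_cong) (simp add: nm cdeg_add algebra_simps)
  also have "\<dots> = koszul E (cdeg n * cdeg m) (flip (pu g' x' h' y') *_E flip (pu g x h y))"
   using m by (simp add: flip_pu[OF xy(1,2)] flip_pu[OF p'(1,2)] koszul_mult pu_closed[OF xy(2,1)] pu_closed[OF p'(2,1)]
     pu_mult[OF p'(2,1) xy(2,1)] koszul_koszul[OF ag] add.commute[of h'] add.commute[of g'] add.assoc)
  finally show "flip (pu g x h y *_E pu g' x' h' y') =
   koszul E (cdeg n * cdeg m) (flip (pu g' x' h' y') *_E flip (pu g x h y))" .
 qed
qed

abbreviation dual where "dual \<equiv> env_dual K A"

lemma dual_simps [simp]: "carrier (dual P) = carrier (H P)" "add (dual P) = add (H P)" "zero (dual P) = zero (H P)"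
 "gr (dual P) = gr (H P)"
 by (simp_all add: env_dual_def Let_def del: H_simps)

lemma dual_monoid [simp]: "add_monoid (dual P) = add_monoid (H P)"
 by (simp del: H_simps)

context
 fixes P :: "(('g, 'a) tensor, 'g, 'p) dg"
 assumes P: "dg_module E P"
begin

interpretation P: dgmod E P using P by blast
interpretation HP: abelian_group "H P" by (rule H_abelian[OF P])

lemmas HPg = H_graded[OF P]

lemma lmul_koszul:
 assumes "w \<in> carrier E" "f \<in> carrier (H P)"
 shows "lmul P (koszul E n w) f = koszul (H P) n (lmul P w f)" "lmul P w (koszul (H P) n f) = koszul (H P) n (lmul P w f)"
 using ahom_koszul[OF E.abgrp HP.abgrp lmul_hom_left[OF P assms(2)] assms(1)]
  ahom_koszul[OF HP.abgrp HP.abgrp lmul_hom[OF P assms(1)] assms(2)] by simp_all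

lemma lmul_lmul:
 "w \<in> carrier E ==> w' \<in> carrier E ==> f \<in> carrier (H P) ==> lmul P w (lmul P w' f) = lmul P (w *_E w') f"
 by (auto simp: lmul_def[OF P] fun_eq_iff H_closed[OF P] E.m_assoc)

definition act_term where
 "act_term g f h e = koszul (H P) (cdeg h * cdeg g) (lmul P (flip e) f)"

lemma act_term_hom:
 assumes "f \<in> carrier (H P)" shows "act_term g f h \<in> ahom E (H P)"
 using ahom_comp[OF ahom_comp[OF flip_hom lmul_hom_left[OF P assms]] koszul_ahom[OF HP.abgrp, of "cdeg h * cdeg g"]]
 by (simp add: comp_def act_term_def[abs_def] del: H_simps)

lemma act_term_hom':
 assumes "e \<in> carrier E" shows "(\<lambda>f. act_term g f h e) \<in> ahom (H P) (H P)"
 using ahom_comp[OF lmul_hom[OF P flip_closed[OF assms]] koszul_ahom[OF HP.abgrp, of "cdeg h * cdeg g"]]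
 by (simp add: comp_def act_term_def[abs_def] del: H_simps)

lemma H_finsum:
 assumes "finite S" "\<And>i. i \<in> S ==> c i \<in> carrier (H P)" "x \<in> carrier P"
 shows "(\<Oplus>\<^bsub>H P\<^esub>i\<in>S. c i) x = (\<Oplus>\<^bsub>E\<^esub>i\<in>S. c i x)"
 by (rule ahom_finsum[OF HP.abgrp E.abgrp H_ev[OF P assms(3)] assms(1,2)])

lemma dual_act_gext:
 assumes f: "f \<in> carrier (H P)" and e: "e \<in> carrier E"
 shows "ract (dual P) f e = gext (H P) (H P) (\<lambda>g f. gext E (H P) (act_term g f) e) f"
proof -
 note fc = hcomp_closed[OF HPg f] and ec = hcomp_closed[OF E_graded e]
 have c1: "act_term g (hcomp (H P) f g) h (hcomp E e h) \<in> carrier (H P)" for g h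
  by (rule ahom_closed[OF act_term_hom[OF fc] ec])
 have c2: "gext E (H P) (act_term g (hcomp (H P) f g)) e \<in> carrier (H P)" for g
  unfolding gext_def by (rule HP.finsum_closed) (use c1 in auto)
 have c3: "gext (H P) (H P) (\<lambda>g f. gext E (H P) (act_term g f) e) f \<in> carrier (H P)"
  unfolding gext_def[of "H P"] by (rule HP.finsum_closed) (use c2 in auto)
 have "gext (H P) (H P) (\<lambda>g f. gext E (H P) (act_term g f) e) f x = ract (dual P) f e x" if x: "x \<in> carrier P" for x
 proof -
  have "act_term g (hcomp (H P) f g) h (hcomp E e h) x =
    koszul E (cdeg h * cdeg g) (flip (hcomp E e h) *_E hcomp (H P) f g x)" for g h
   using x H_koszul[OF P lmul_closed[OF P flip_closed[OF ec] fc] x]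
   by (simp add: act_term_def lmul_def[OF P] del: H_simps)
  then have "gext E (H P) (act_term g (hcomp (H P) f g)) e x =
    (\<Oplus>\<^bsub>E\<^esub>h\<in>hsupp E e. koszul E (cdeg h * cdeg g) (flip (hcomp E e h) *_E hcomp (H P) f g x))" for g
   unfolding gext_def using H_finsum[OF hsupp_finite[OF E_graded e] c1 x] by simp
  then show ?thesis
   unfolding gext_def[of "H P"] using H_finsum[OF hsupp_finite[OF HPg f] c2 x] x
   by (simp add: env_dual_def Let_def del: H_simps)
 qed
 moreover have "ract (dual P) f e \<in> extensional (carrier P)" by (simp add: env_dual_def Let_def)
 ultimately show ?thesis using H_ext[OF c3] by (intro extensionalityI) auto
qed

lemma dual_act_hom: "e \<in> carrier E ==> (\<lambda>f. ract (dual P) f e) \<in> ahom (H P) (H P)"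
proof -
 assume e: "e \<in> carrier E"
 have "(\<lambda>f. gext E (H P) (act_term g f) e) \<in> ahom (H P) (H P)" for g
  by (rule gext_param[OF E_graded HP.abgrp e act_term_hom'])
 from gext_hom[OF HPg HP.abgrp, of "\<lambda>g f. gext E (H P) (act_term g f) e", OF this] show ?thesis
  by (simp add: hom_def Pi_def dual_act_gext e HP.a_closed del: H_simps)
qed

lemma dual_act_hom_right: "f \<in> carrier (H P) ==> (\<lambda>e. ract (dual P) f e) \<in> ahom E (H P)"
proof -
 assume f: "f \<in> carrier (H P)"
 have "(\<lambda>e. gext (H P) (H P) (\<lambda>g f. gext E (H P) (act_term g f) e) f) \<in> ahom E (H P)"
  by (rule gext_param[OF HPg HP.abgrp f]) (rule gext_hom[OF E_graded HP.abgrp act_term_hom])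
 then show ?thesis by (simp add: hom_def Pi_def dual_act_gext f del: H_simps)
qed

lemma dual_act:
 assumes f: "f \<in> gr (H P) g" and e: "e \<in> gr E h"
 shows "ract (dual P) f e = koszul (H P) (cdeg h * cdeg g) (lmul P (flip e) f)"
proof -
 note ec = gr_E_carrier[OF e] and fc = H_gr_carrier[OF P f]
 have "(\<lambda>f. gext E (H P) (act_term g f) e) \<in> ahom (H P) (H P)" for g
  by (rule gext_param[OF E_graded HP.abgrp ec act_term_hom'])
 from gext_hom_eq[OF HPg HP.abgrp, of "\<lambda>g f. gext E (H P) (act_term g f) e", OF this f]
 show ?thesis
  using gext_hom_eq[OF E_graded HP.abgrp act_term_hom[OF fc, of g] e]
  by (simp add: dual_act_gext[OF fc ec] act_term_def del: H_simps)
qed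

lemma d_term_hom: "(\<lambda>f. koszul (H P) n (precomp P (dd P) f)) \<in> ahom (H P) (H P)"
 using ahom_comp[OF precomp_hom[OF P d_hom_deg[OF P]] koszul_ahom[OF HP.abgrp, of n]]
 by (simp add: comp_def del: H_simps)

lemma dual_d_gext:
 assumes f: "f \<in> carrier (H P)"
 shows "dd (dual P) f = gext (H P) (H P) (\<lambda>g f. koszul (H P) (cdeg g + 1) (precomp P (dd P) f)) f"
proof -
 note fc = hcomp_closed[OF HPg f]
 have c: "koszul (H P) (cdeg g + 1) (precomp P (dd P) (hcomp (H P) f g)) \<in> carrier (H P)" for g
  by (rule ahom_closed[OF d_term_hom fc])
 have c3: "gext (H P) (H P) (\<lambda>g f. koszul (H P) (cdeg g + 1) (precomp P (dd P) f)) f \<in> carrier (H P)"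
  unfolding gext_def by (rule HP.finsum_closed) (use c in auto)
 have "gext (H P) (H P) (\<lambda>g f. koszul (H P) (cdeg g + 1) (precomp P (dd P) f)) f x = dd (dual P) f x"
  if x: "x \<in> carrier P" for x
 proof -
  have "koszul (H P) (cdeg g + 1) (precomp P (dd P) (hcomp (H P) f g)) x =
    dd E (hcomp (H P) f g x) -_E koszul E (cdeg g) (hcomp (H P) f g (dd P x))" for g
  proof -
   have "hcomp (H P) f g (dd P x) \<in> carrier E" by (rule H_closed[OF P fc]) (use x in simp)
   moreover have "koszul (H P) (cdeg g + 1) (precomp P (dd P) (hcomp (H P) f g)) x =
     koszul E (cdeg g + 1) (hcomp (H P) f g (dd P x))"
    using H_koszul[OF P ahom_closed[OF precomp_hom[OF P d_hom_deg[OF P]] fc] x] x by (simp add: precomp_def del: H_simps)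
   ultimately show ?thesis
    using dd_E[OF H_closed[OF P fc x]] by (simp add: koszul_def a_minus_def E.minus_minus del: H_simps)
  qed
  then show ?thesis
   unfolding gext_def using H_finsum[OF hsupp_finite[OF HPg f] c x] x
   by (simp add: env_dual_def Let_def del: H_simps)
 qed
 moreover have "dd (dual P) f \<in> extensional (carrier P)" by (simp add: env_dual_def Let_def)
 ultimately show ?thesis using H_ext[OF c3] by (intro extensionalityI) auto
qed

lemma dual_d_hom: "dd (dual P) \<in> ahom (H P) (H P)"
 using gext_hom[OF HPg HP.abgrp, of "\<lambda>g f. koszul (H P) (cdeg g + 1) (precomp P (dd P) f)", OF d_term_hom]
 by (simp add: hom_def Pi_def dual_d_gext HP.a_closed del: H_simps)

lemma dual_d:
 assumes "f \<in> gr (H P) g" shows "dd (dual P) f = koszul (H P) (cdeg g + 1) (precomp P (dd P) f)"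
 using gext_hom_eq[OF HPg HP.abgrp, of "\<lambda>g f. koszul (H P) (cdeg g + 1) (precomp P (dd P) f)", OF d_term_hom assms]
 by (simp add: dual_d_gext[OF H_gr_carrier[OF P assms]] del: H_simps)

lemma dual_d_gr: "f \<in> gr (H P) g ==> dd (dual P) f \<in> gr (H P) (ddeg + g)"
 by (simp only: dual_d gr_koszul[OF HPg precomp_gr[OF P d_hom_deg[OF P] _ P]])

lemma dual_act_gr: "f \<in> gr (H P) g ==> e \<in> gr E h ==> ract (dual P) f e \<in> gr (H P) (g + h)"
 by (simp only: dual_act gr_koszul[OF HPg lmul_gr[OF P flip_gr]])

lemma koszul_precomp_d:
 "f \<in> carrier (H P) ==> precomp P (dd P) (koszul (H P) n f) = koszul (H P) n (precomp P (dd P) f)"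
 by (rule ahom_koszul[OF HP.abgrp HP.abgrp precomp_hom[OF P d_hom_deg[OF P]]])

lemma dual_act_act:
 assumes "f \<in> carrier (H P)" "e \<in> carrier E" "e' \<in> carrier E"
 shows "ract (dual P) (ract (dual P) f e) e' = ract (dual P) f (e *_E e')"
proof (rule ahom_eqI[OF HPg HP.abgrp _ dual_act_hom _ assms(1)])
 note ag = HP.abgrp
 note hl = dual_act_hom and hr = dual_act_hom_right
 note Hs = H_simps[simp del]
 show "(\<lambda>f. ract (dual P) (ract (dual P) f e) e') \<in> ahom (H P) (H P)"
  using ahom_comp[OF hl[OF assms(2)] hl[OF assms(3)]] by (simp add: comp_def)
 show "e *_E e' \<in> carrier E" using assms by simp
 fix g f assume f: "f \<in> gr (H P) g"
 note fc = H_gr_carrier[OF P f]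
 have rc: "(\<lambda>e. ract (dual P) f (e *_E e')) \<in> ahom E (H P)" if "e' \<in> carrier E" for e'
  by (rule ahomI) (use that ahom_closed[OF hr[OF fc]] ahom_add[OF hr[OF fc]] in "simp_all add: E.l_distr")
 have rc': "(\<lambda>e'. ract (dual P) f (e *_E e')) \<in> ahom E (H P)" if "e \<in> carrier E" for e
  by (rule ahomI) (use that ahom_closed[OF hr[OF fc]] ahom_add[OF hr[OF fc]] in "simp_all add: E.r_distr")
 show "ract (dual P) (ract (dual P) f e) e' = ract (dual P) f (e *_E e')"
 proof (rule ahom_eqI[OF E_graded ag _ rc[OF assms(3)] _ assms(2)])
  show "(\<lambda>e. ract (dual P) (ract (dual P) f e) e') \<in> ahom E (H P)"
   using ahom_comp[OF hr[OF fc] hl[OF assms(3)]] by (simp add: comp_def)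
  fix h e assume e: "e \<in> gr E h"
  note ec = gr_E_carrier[OF e]
  show "ract (dual P) (ract (dual P) f e) e' = ract (dual P) f (e *_E e')"
  proof (rule ahom_eqI[OF E_graded ag hr rc'[OF ec] _ assms(3)])
   show "ract (dual P) f e \<in> carrier (H P)" by (rule ahom_closed[OF hl[OF ec] fc])
   fix h' e' assume e': "e' \<in> gr E h'"
   note e'c = gr_E_carrier[OF e']
   have l: "lmul P (flip e) f \<in> carrier (H P)" by (rule lmul_closed[OF P flip_closed[OF ec] fc])
   have fe: "flip e' *_E flip e \<in> carrier E" using ec e'c by simp
   have lc: "lmul P (flip e' *_E flip e) f \<in> carrier (H P)" by (rule lmul_closed[OF P fe fc])
   have "ract (dual P) (ract (dual P) f e) e' = koszul (H P) (cdeg h' * cdeg (g + h)) (lmul P (flip e') (ract (dual P) f e))"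
    by (rule dual_act[OF dual_act_gr[OF f e] e'])
   also have "\<dots> = koszul (H P) (cdeg h' * cdeg (g + h) + cdeg h * cdeg g) (lmul P (flip e' *_E flip e) f)"
    by (simp add: dual_act[OF f e] lmul_koszul(2)[OF flip_closed[OF e'c] l] lmul_lmul[OF flip_closed[OF e'c] flip_closed[OF ec] fc]
      koszul_koszul[OF ag lc])
   also have "\<dots> = koszul (H P) (cdeg (h + h') * cdeg g + cdeg h * cdeg h') (lmul P (flip e' *_E flip e) f)"
    by (rule koszul_cong) (simp add: cdeg_add algebra_simps)
   also have "\<dots> = ract (dual P) f (e *_E e')"
    by (simp add: dual_act[OF f gr_E_mult[OF e e']] flip_mult[OF e e'] lmul_koszul(1)[OF fe fc] koszul_koszul[OF ag lc])
   finally show "ract (dual P) (ract (dual P) f e) e' = ract (dual P) f (e *_E e')" .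
  qed
 qed
qed

lemma dual_d_act:
 assumes "f \<in> carrier (H P)" "e \<in> carrier E"
 shows "dd (dual P) (ract (dual P) f e) = ract (dual P) (dd (dual P) f) e"
proof (rule ahom_eqI[OF HPg HP.abgrp _ _ _ assms(1)])
 note ag = HP.abgrp
 note hl = dual_act_hom and hr = dual_act_hom_right
 note Hs = H_simps[simp del]
 show "(\<lambda>f. dd (dual P) (ract (dual P) f e)) \<in> ahom (H P) (H P)"
  using ahom_comp[OF hl[OF assms(2)] dual_d_hom] by (simp add: comp_def)
 show "(\<lambda>f. ract (dual P) (dd (dual P) f) e) \<in> ahom (H P) (H P)"
  using ahom_comp[OF dual_d_hom hl[OF assms(2)]] by (simp add: comp_def)
 fix g f assume f: "f \<in> gr (H P) g"
 note fc = H_gr_carrier[OF P f]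
 show "dd (dual P) (ract (dual P) f e) = ract (dual P) (dd (dual P) f) e"
 proof (rule ahom_eqI[OF E_graded ag _ hr _ assms(2)])
  show "(\<lambda>e. dd (dual P) (ract (dual P) f e)) \<in> ahom E (H P)"
   using ahom_comp[OF hr[OF fc] dual_d_hom] by (simp add: comp_def)
  show "dd (dual P) f \<in> carrier (H P)" by (rule ahom_closed[OF dual_d_hom fc])
  fix h e assume e: "e \<in> gr E h"
  note ec = flip_closed[OF gr_E_carrier[OF e]]
  let ?p = "precomp P (dd P)"
  have l: "lmul P (flip e) f \<in> carrier (H P)" by (rule lmul_closed[OF P ec fc])
  have pc: "?p f \<in> carrier (H P)" by (rule ahom_closed[OF precomp_hom[OF P d_hom_deg[OF P]] fc])
  have lp: "lmul P (flip e) (?p f) \<in> carrier (H P)" by (rule lmul_closed[OF P ec pc])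
  have c: "?p (lmul P (flip e) f) = lmul P (flip e) (?p f)"
   by (auto simp: precomp_def lmul_def[OF P] fun_eq_iff)
  have "dd (dual P) (ract (dual P) f e) = koszul (H P) (cdeg (g + h) + 1) (?p (ract (dual P) f e))"
   by (rule dual_d[OF dual_act_gr[OF f e]])
  also have "\<dots> = koszul (H P) (cdeg (g + h) + 1 + cdeg h * cdeg g) (lmul P (flip e) (?p f))"
   by (simp add: dual_act[OF f e] koszul_precomp_d[OF l] c koszul_koszul[OF ag lp])
  also have "\<dots> = koszul (H P) (cdeg h * cdeg (ddeg + g) + (cdeg g + 1)) (lmul P (flip e) (?p f))"
   by (rule koszul_cong) (simp add: cdeg_add cdeg_ddeg algebra_simps)
  also have "\<dots> = ract (dual P) (dd (dual P) f) e"
   unfolding dual_act[OF dual_d_gr[OF f] e] unfolding dual_d[OF f] lmul_koszul(2)[OF ec pc] koszul_koszul[OF ag lp]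
   by (rule refl)
  finally show "dd (dual P) (ract (dual P) f e) = ract (dual P) (dd (dual P) f) e" .
 qed
qed

lemma dual_d_d:
 assumes "f \<in> carrier (H P)" shows "dd (dual P) (dd (dual P) f) = 0_(H P)"
proof -
 have "(\<lambda>f. dd (dual P) (dd (dual P) f)) f = (\<lambda>_. 0_(H P)) f"
 proof (rule ahom_eqI[OF HPg HP.abgrp _ _ _ assms])
  note Hs = H_simps[simp del]
  show "(\<lambda>f. dd (dual P) (dd (dual P) f)) \<in> ahom (H P) (H P)"
   using ahom_comp[OF dual_d_hom dual_d_hom] by (simp add: comp_def)
  show "(\<lambda>_. 0_(H P)) \<in> ahom (H P) (H P)" by (rule ahomI) simp_all
  fix g f assume f: "f \<in> gr (H P) g"
  note fc = H_gr_carrier[OF P f]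
  have pc: "precomp P (dd P) f \<in> carrier (H P)" by (rule ahom_closed[OF precomp_hom[OF P d_hom_deg[OF P]] fc])
  have "precomp P (dd P) (precomp P (dd P) f) = 0_(H P)"
   using ahom_zero[OF P.abgrp E.abgrp H_ahom[OF P fc]]
   by (auto simp: precomp_def fun_eq_iff P.d_d H_simps)
  then show "dd (dual P) (dd (dual P) f) = 0_(H P)"
   unfolding dual_d[OF dual_d_gr[OF f]] unfolding dual_d[OF f] koszul_precomp_d[OF pc]
   by (simp add: HP.abgrp)
 qed
 then show ?thesis .
qed

text \<open>
The right action on the dual is a left multiplication through the flip. It is associative because the flip reverses products,
the signs being those of the opposite algebra.
\<close>

lemma dual_dgm: "dg_module E (dual P)"
proof (rule dg_moduleI)
 note Hs = H_simps[simp del]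
 show "graded_group (dual P)" by (rule graded_group_cong[OF HPg]) simp_all
 show "dd (dual P) \<in> ahom (dual P) (dual P)" using dual_d_hom by simp
 fix f assume f: "f \<in> carrier (dual P)"
 have "ract (dual P) f 1_E = id f"
 proof (rule ahom_eqI[OF HPg HP.abgrp dual_act_hom])
  fix g f assume f: "f \<in> gr (H P) g"
  note fc = H_gr_carrier[OF P f]
  have "lmul P 1_E f = f"
   using H_ext[OF fc] H_closed[OF P fc] by (auto simp: lmul_def[OF P] fun_eq_iff extensional_def)
  then show "ract (dual P) f 1_E = id f"
   using dual_act[OF f one_gr] by (simp add: flip_one koszul_even)
 qed (use f in "simp_all add: hom_def")
 then show "ract (dual P) f 1_E = f" by simp
next
 fix g f assume "f \<in> gr (dual P) g"
 then show "dd (dual P) f \<in> gr (dual P) (g + ddeg)" by (simp only: dual_simps add.commute[of g ddeg] dual_d_gr)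
qed (use ahom_closed[OF dual_act_hom] ahom_add[OF dual_act_hom] ahom_add[OF dual_act_hom_right] dual_act_act dual_act_gr
  dual_d_d dual_d_act in "simp_all del: H_simps")

end

context
 fixes P :: "(('g, 'a) tensor, 'g, 'p) dg" and P' :: "(('g, 'a) tensor, 'g, 'q) dg"
 assumes P: "dg_module E P" and P': "dg_module E P'"
begin

interpretation P: dgmod E P using P by blast
interpretation P': dgmod E P' using P' by blast
interpretation HP: abelian_group "H P" by (rule H_abelian[OF P])
interpretation HP': abelian_group "H P'" by (rule H_abelian[OF P'])

lemma precomp_koszul:
 assumes "u \<in> hom_deg E P' P s" "f \<in> carrier (H P)"
 shows "precomp P' u (koszul (H P) n f) = koszul (H P') n (precomp P' u f)"
 by (rule ahom_koszul[OF HP.abgrp HP'.abgrp precomp_hom[OF P assms(1)] assms(2)])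

lemma precomp_d:
 assumes u: "u \<in> dg_hom E P' P" and f: "f \<in> carrier (H P)"
 shows "dd (dual P') (precomp P' u f) = precomp P' u (dd (dual P) f)"
proof (rule ahom_eqI[OF H_graded[OF P] HP'.abgrp _ _ _ f])
 note Hs = H_simps[simp del]
 note u0 = dg_hom_hom_deg[OF u]
 show "(\<lambda>f. dd (dual P') (precomp P' u f)) \<in> ahom (H P) (H P')"
  using ahom_comp[OF precomp_hom[OF P u0] dual_d_hom[OF P']] by (simp add: comp_def)
 show "(\<lambda>f. precomp P' u (dd (dual P) f)) \<in> ahom (H P) (H P')"
  using ahom_comp[OF dual_d_hom[OF P] precomp_hom[OF P u0]] by (simp add: comp_def)
 fix g f assume f: "f \<in> gr (H P) g"
 note fc = H_gr_carrier[OF P f]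
 have uf: "precomp P' u f \<in> gr (H P') g" using precomp_gr[OF P u0 f P'] by simp
 have pc: "precomp P (dd P) f \<in> carrier (H P)" by (rule ahom_closed[OF precomp_hom[OF P d_hom_deg[OF P]] fc])
 have "precomp P' (dd P') (precomp P' u f) = precomp P' u (precomp P (dd P) f)"
  by (auto simp: precomp_def fun_eq_iff dg_homD(2)[OF u] dg_homD(6)[OF u])
 then show "dd (dual P') (precomp P' u f) = precomp P' u (dd (dual P) f)"
  by (simp add: dual_d[OF P' uf] dual_d[OF P f] precomp_koszul[OF u0 pc])
qed

text \<open>
If \<open>h\<close> is a homotopy, precomposition with \<open>h\<close> on maps of degree \<open>g\<close>, with the sign of exponent \<open>g\<close>, is a
contraction of the difference of the two precompositions. On a cocycle only the term with \<open>dd\<close> outside survives.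
\<close>

lemma precomp_homotopic:
 assumes u: "u \<in> dg_hom E P' P" "u' \<in> dg_hom E P' P" and hom: "homotopic E P' P u u'"
  and f: "f \<in> carrier (H P)" and df: "dd (dual P) f = 0_(H P)"
 obtains z where "z \<in> carrier (H P')" "precomp P' u f = precomp P' u' f +_(H P') dd (dual P') z"
proof -
 note Hs = H_simps[simp del]
 note ag = HP.abgrp and ag' = HP'.abgrp
 note u0 = dg_hom_hom_deg[OF u(1)] and u0' = dg_hom_hom_deg[OF u(2)]
 obtain h where h: "h \<in> hom_deg E P' P (- ddeg)"
  and uh: "\<And>x. x \<in> carrier P' ==> u x = u' x +_P (dd P (h x) +_P h (dd P' x))"
  using homotopicE[OF hom P' P dg_homD(2)[OF u(1)] dg_homD(2)[OF u(2)]] by metis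
 have th: "(\<lambda>f. koszul (H P') n (precomp P' h f)) \<in> ahom (H P) (H P')" for n
  using ahom_comp[OF precomp_hom[OF P h] koszul_ahom[OF ag', of n]] by (simp add: comp_def)
 define k where "k = gext (H P) (H P') (\<lambda>g f. koszul (H P') (cdeg g) (precomp P' h f))"
 have kh: "k \<in> ahom (H P) (H P')" unfolding k_def by (rule gext_hom[OF H_graded[OF P] ag' th])
 have kg: "k f = koszul (H P') (cdeg g) (precomp P' h f)" if "f \<in> gr (H P) g" for f g
  unfolding k_def by (rule gext_hom_eq[OF H_graded[OF P] ag', of "\<lambda>g f. koszul (H P') (cdeg g) (precomp P' h f)", OF th that])
 have eq: "precomp P' u f = precomp P' u' f +_(H P') (dd (dual P') (k f) +_(H P') k (dd (dual P) f))"
 proof (rule ahom_eqI[OF H_graded[OF P] ag' precomp_hom[OF P u0] _ _ f])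
  have 1: "(\<lambda>f. dd (dual P') (k f)) \<in> ahom (H P) (H P')"
   using ahom_comp[OF kh dual_d_hom[OF P']] by (simp add: comp_def)
  have 2: "(\<lambda>f. k (dd (dual P) f)) \<in> ahom (H P) (H P')"
   using ahom_comp[OF dual_d_hom[OF P] kh] by (simp add: comp_def)
  show "(\<lambda>f. precomp P' u' f +_(H P') (dd (dual P') (k f) +_(H P') k (dd (dual P) f))) \<in> ahom (H P) (H P')"
   by (rule HP'.ahom_plus[OF precomp_hom[OF P u0'] HP'.ahom_plus[OF 1 2 ag] ag])
  fix g f assume f: "f \<in> gr (H P) g"
  note fc = H_gr_carrier[OF P f]
  have hc: "precomp P' h f \<in> carrier (H P')" by (rule ahom_closed[OF precomp_hom[OF P h] fc])
  have hk: "koszul (H P') (cdeg g) (precomp P' h f) \<in> gr (H P') (- ddeg + g)"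
   by (rule gr_koszul[OF H_graded[OF P'] precomp_gr[OF P h f P']])
  have dc: "precomp P (dd P) f \<in> carrier (H P)" by (rule ahom_closed[OF precomp_hom[OF P d_hom_deg[OF P]] fc])
  have hd: "precomp P' h (precomp P (dd P) f) \<in> carrier (H P')" by (rule ahom_closed[OF precomp_hom[OF P h] dc])
  have dh: "precomp P' (dd P') (precomp P' h f) \<in> carrier (H P')"
   by (rule ahom_closed[OF precomp_hom[OF P' d_hom_deg[OF P']] hc])
  have 3: "dd (dual P') (k f) = precomp P' (dd P') (precomp P' h f)"
   unfolding kg[OF f] dual_d[OF P' hk] koszul_precomp_d[OF P' hc] koszul_koszul[OF ag' dh]
   by (simp add: koszul_even cdeg_diff cdeg_ddeg)
  have 4: "k (dd (dual P) f) = precomp P' h (precomp P (dd P) f)"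
   unfolding kg[OF dual_d_gr[OF P f]] unfolding dual_d[OF P f] precomp_koszul[OF h dc] koszul_koszul[OF ag' hd]
   by (simp add: koszul_even cdeg_add cdeg_ddeg)
  note fa = ahom_add[OF H_ahom[OF P fc]]
  show "precomp P' u f = precomp P' u' f +_(H P') (dd (dual P') (k f) +_(H P') k (dd (dual P) f))"
   unfolding 3 4
   by (auto simp: precomp_def fun_eq_iff H_simps uh fa hom_degD(2)[OF h] dg_homD(2)[OF u(2)]
     H_closed[OF P fc] E.a_comm)
 qed
 have kz: "k 0_(H P) = 0_(H P')" by (rule ahom_zero[OF ag ag' kh])
 have kc: "k f \<in> carrier (H P')" by (rule ahom_closed[OF kh f])
 have "dd (dual P') (k f) \<in> carrier (H P')" by (rule ahom_closed[OF dual_d_hom[OF P'] kc])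
 then show thesis using that[OF kc] eq by (simp add: df kz)
qed

end

end

section \<open>Comparison of the duals\<close>

lemma (in zhang) \<Omega>_mult:
 assumes w: "w \<in> gr E0 (0, n)" and w': "w' \<in> carrier E0"
 shows "\<Omega> i (w *_E0 w') = \<Omega> i w *_E1 \<Omega> (i + n) w'"
proof -
 have wc: "w \<in> carrier E0" by (rule gr_carrier[OF E0.gg w])
 have "w *_E0 w' = \<Psi> i (\<Omega> i w *_E1 \<Omega> (i + n) w')"
  using \<Psi>_mult[OF \<Omega>_gr[OF w, of i], of "\<Omega> (i + n) w'" i] wc w' by (simp add: \<Psi>_\<Omega>)
 then show ?thesis using wc w' by (simp add: \<Omega>_\<Psi>)
qed

definition bounded where
 "bounded T \<longleftrightarrow> (\<exists>Q :: int set. finite Q \<and> (\<forall>q. \<forall>i :: int. \<forall>x \<in> gr T (q, i). q \<notin> Q --> x = 0_T))"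

lemma bounded_isom:
 assumes "bounded X" "dg_isom E X Z" "dg_module E X" "dg_module E Z" shows "bounded Z"
proof -
 obtain f g where fg: "dg_inv E X Z f g" using assms(2) by (auto simp: dg_isom_def)
 note i = dg_invD[OF fg]
 obtain Q where Q: "finite Q" "\<And>q i x. x \<in> gr X (q, i) ==> q \<notin> Q ==> x = 0_X"
  using assms(1) by (auto simp: bounded_def)
 have "x = 0_Z" if x: "x \<in> gr Z (q, n)" and q: "q \<notin> Q" for q n x
  using i(4)[OF gr_carrier[OF dgm_gg[OF assms(4)] x]] Q(2)[OF dg_homD(5)[OF i(2) x] q]
   dg_hom_zero[OF assms(3,4) i(1)] by simp
 then show ?thesis using Q(1) unfolding bounded_def by blast
qed

lemma (in concentrated_alg) fcell_bounded:
 assumes "fcell U E X" shows "bounded X"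
 using assms
proof (induction rule: fcell.induct)
 case (fcell_regular Z)
 have "bounded (regular E)" unfolding bounded_def by (rule exI[of _ "{0}"]) (auto simp: conc)
 then show ?case by (rule bounded_isom[OF _ fcell_regular(2) regular_dgm fcell_regular(1)])
next
 case (fcell_shift X Z s)
 obtain Q where Q: "finite Q" "\<And>q i x. x \<in> gr X (q, i) ==> q \<notin> Q ==> x = 0_X"
  using fcell_shift.IH by (auto simp: bounded_def)
 have *: "x = 0_X" if "x \<in> gr X ((q, i) + s)" "q \<notin> (\<lambda>q. q - fst s) ` Q" for q i x
  using Q(2)[of x "q + fst s" "i + snd s"] that by (cases s) (force simp: image_iff)
 have "bounded (shift s X)" unfolding bounded_def
  by (rule exI[of _ "(\<lambda>q. q - fst s) ` Q"]) (use Q(1) * in simp)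
 then show ?case by (rule bounded_isom[OF _ fcell_shift(3) shift_dgm[OF fcell_dgm[OF fcell_shift(1)]] fcell_shift(2)])
next
 case (fcell_cone X Y f Z)
 obtain Q where Q: "finite Q" "\<And>q i x. x \<in> gr X (q, i) ==> q \<notin> Q ==> x = 0_X"
  using fcell_cone.IH(1) by (auto simp: bounded_def)
 obtain Q' where Q': "finite Q'" "\<And>q i x. x \<in> gr Y (q, i) ==> q \<notin> Q' ==> x = 0_Y"
  using fcell_cone.IH(2) by (auto simp: bounded_def)
 have *: "x = 0_X" if "x \<in> gr X (q + 1, i)" "q \<notin> (\<lambda>q. q - 1) ` Q" for q i x
  using Q(2)[OF that(1)] that(2) by (force simp: image_iff)
 have "bounded (cone X Y f)" unfolding bounded_def
  by (rule exI[of _ "(\<lambda>q. q - 1) ` Q \<union> Q'"])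
   (use Q(1) Q' * in "auto simp: ddeg_prod_def ddeg_int_def")
 then show ?case
  by (rule bounded_isom[OF _ fcell_cone(5) cone_dgm[OF fcell_dgm[OF fcell_cone(1)] fcell_dgm[OF fcell_cone(2)] fcell_cone(3)] fcell_cone(4)])
qed

context ralg
begin

lemmas e0 = B0.E.abgrp and e1 = B1.E.abgrp

abbreviation "D0 \<equiv> env_dual K A0"
abbreviation "D1 P \<equiv> env_dual K A1 (tot (\<Psi> 0) P)"
abbreviation "H0 \<equiv> hom_graded E0"
abbreviation "H1 P \<equiv> hom_graded E1 (tot (\<Psi> 0) P)"

text \<open>
The comparison of duals on maps of bidegree \<open>(p, j)\<close>. A map of internal degree \<open>j\<close> intertwines the twist \<open>\<Psi> i\<close> of the
source with \<open>\<Psi> (i + j)\<close>, and composing with \<open>\<Omega> (- j)\<close> restores linearity. The dependence of the sign on \<open>p\<close> is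
dictated by the shifted differentials, see \<open>eta_d\<close>.
\<close>

definition eta_part where
 "eta_part a P = (\<lambda>(p, j) \<psi>. \<lambda>x\<in>carrier P. koszul E1 ((p + a) * (j + a)) (\<Omega> 0 (- j) (\<psi> x)))"

text \<open>
The component is taken inside, since the formula on a fixed bidegree gives a linear map for maps of that bidegree only.
\<close>

definition eta where
 "eta a P = gext (H0 P) (H1 P) (\<lambda>g \<psi>. eta_part a P g (hcomp (H0 P) \<psi> g))"

context
 fixes P :: "('a, 'p) bicomplex"
 assumes P: "dg_module E0 P"
begin

interpretation z: zhang E0 E1 "\<Psi> 0" "\<Omega> 0" by (rule zhang)
interpretation P: dgmod E0 P using P by blast

lemmas tP = z.tot_dgm[OF P]
lemmas g0 = B0.H_graded[OF P] and g1 = B1.H_graded[OF tP]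
lemmas h0 = B0.H_abelian[OF P] and h1 = B1.H_abelian[OF tP]
lemmas Hdel = B0.H_simps[simp del] B1.H_simps[simp del]

lemma H0_value:
 assumes "\<psi> \<in> gr (H0 P) (p, j)" "x \<in> gr P (q, i)"
 shows "\<psi> x \<in> gr E0 (0, i + j)" "q + p \<noteq> 0 ==> \<psi> x = 0_E0"
proof -
 have v: "\<psi> x \<in> gr E0 (q + p, i + j)" using assms hom_degD(5)[of \<psi> E0 P "regular E0" "(p, j)" x "(q, i)"] by (simp add: B0.H_simps)
 show z: "q + p \<noteq> 0 ==> \<psi> x = 0_E0" using v E0_conc[of "q + p" "i + j"] by simp
 show "\<psi> x \<in> gr E0 (0, i + j)" using v z gr_zero[OF B0.E_graded] by (cases "q + p = 0") simp_all
qed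

lemma eta_part_value:
 assumes "\<psi> \<in> gr (H0 P) (p, j)" "x \<in> gr P (q, i)"
 shows "eta_part a P (p, j) \<psi> x \<in> gr E1 (i + j)" "q + p \<noteq> 0 ==> eta_part a P (p, j) \<psi> x = 0_E1"
 using z.\<Omega>_gr[OF H0_value(1)[OF assms]] H0_value(2)[OF assms] P.gr_closed[OF assms(2)]
 by (simp_all add: eta_part_def gr_koszul[OF B1.E_graded] ahom_zero[OF e0 e1 \<Omega>_hom] e1)

lemma eta_part_gr:
 assumes \<psi>: "\<psi> \<in> gr (H0 P) (p, j)" shows "eta_part a P (p, j) \<psi> \<in> gr (H1 P) (p + j)"
proof -
 note \<psi>h = B0.H_ahom[OF P B0.H_gr_carrier[OF P \<psi>]]
 have ec: "ract P x e \<in> carrier P" if "x \<in> gr P g" "e \<in> carrier E0" for x g e using that P.gr_closed by simp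
 let ?f = "\<lambda>x. koszul E1 ((p + a) * (j + a)) (\<Omega> 0 (- j) (\<psi> x))"
 have "?f \<in> hom_deg E1 (tot (\<Psi> 0) P) (regular E1) (p + j)"
 proof (rule z.tot_hom_degI[OF P B1.regular_dgm])
  show "?f \<in> ahom P (regular E1)"
   using ahom_comp[OF ahom_comp[OF \<psi>h \<Omega>_hom[of 0 "- j"]] koszul_ahom[OF e1, of "(p + a) * (j + a)"]]
   by (simp add: comp_def hom_def)
  fix q i x assume x: "x \<in> gr P (q, i)"
  note v = H0_value[OF \<psi> x]
  show "?f x \<in> gr (regular E1) (q + i + (p + j))"
  proof (cases "q + p = 0")
   case True
   then have "q + i + (p + j) = i + j" by simp
   then show ?thesis using gr_koszul[OF B1.E_graded z.\<Omega>_gr[OF v(1)]] by (simp only: B1.regular_simps)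
  next
   case False
   then show ?thesis using v(2) by (simp add: ahom_zero[OF e0 e1 \<Omega>_hom] e1 gr_zero[OF B1.E_graded])
  qed
  fix e assume e: "e \<in> carrier E1"
  have "\<psi> \<in> hom_deg E0 P (regular E0) (p, j)" using \<psi> by (simp add: B0.H_simps)
  from hom_degD(4)[OF this P.gr_closed[OF x] z.\<Psi>_closed[OF e]]
  have l: "\<psi> (ract P x (\<Psi> 0 i e)) = \<psi> x *_E0 \<Psi> 0 i e" by simp
  have vc: "\<Omega> 0 (- j) (\<psi> x) \<in> carrier E1" by (rule gr_carrier[OF B1.E_graded z.\<Omega>_gr[OF v(1)]])
  show "?f (ract P x (\<Psi> 0 i e)) = ract (regular E1) (?f x) e"
   using z.\<Omega>_mult[OF v(1), of "\<Psi> 0 i e" "- j"] e vc B1.koszul_mult[OF vc e, of _ 0]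
   by (simp add: l z.\<Omega>_\<Psi> koszul_even)
 qed
 from hom_deg_restrict[OF tP this] show ?thesis by (simp add: eta_part_def B1.H_simps)
qed

lemma eta_term_hom: "(\<lambda>\<psi>. eta_part a P g (hcomp (H0 P) \<psi> g)) \<in> ahom (H0 P) (H1 P)"
proof (rule ahomI)
 obtain p j where g: "g = (p, j)" by (cases g)
 fix \<psi> assume \<psi>: "\<psi> \<in> carrier (H0 P)"
 show "eta_part a P g (hcomp (H0 P) \<psi> g) \<in> carrier (H1 P)"
  unfolding g by (rule B1.H_gr_carrier[OF tP eta_part_gr[OF hcomp_gr[OF g0 \<psi>]]])
 fix \<psi>' assume \<psi>': "\<psi>' \<in> carrier (H0 P)"
 have c: "hcomp (H0 P) \<psi> g x \<in> carrier E0" "hcomp (H0 P) \<psi>' g x \<in> carrier E0" if "x \<in> carrier P" for x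
  by (rule B0.H_closed[OF P hcomp_closed[OF g0 \<psi>] that], rule B0.H_closed[OF P hcomp_closed[OF g0 \<psi>'] that])
 show "eta_part a P g (hcomp (H0 P) (\<psi> +_(H0 P) \<psi>') g) =
   eta_part a P g (hcomp (H0 P) \<psi> g) +_(H1 P) eta_part a P g (hcomp (H0 P) \<psi>' g)"
  unfolding hcomp_add[OF g0 \<psi> \<psi>']
  by (auto simp: B0.H_simps B1.H_simps g eta_part_def fun_eq_iff c[unfolded g] ahom_add[OF \<Omega>_hom] ahom_closed[OF \<Omega>_hom] koszul_add[OF e1])
qed

lemma eta_hom: "eta a P \<in> ahom (H0 P) (H1 P)"
 unfolding eta_def by (rule gext_hom[OF g0 h1 eta_term_hom])

lemma eta_homogeneous:
 assumes "\<psi> \<in> gr (H0 P) g" shows "eta a P \<psi> = eta_part a P g \<psi>"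
 unfolding eta_def
 using gext_hom_eq[OF g0 h1, of "\<lambda>g \<psi>. eta_part a P g (hcomp (H0 P) \<psi> g)", OF eta_term_hom assms]
  hcomp_hom[OF g0 assms] by simp

text \<open>
Left multiplication by the flip of \<open>l \<otimes> y\<close> has \<open>y \<otimes> l\<close> in both duals, and the twist \<open>\<Omega>\<close> contributes
the degree of \<open>y\<close>, whereas \<open>\<Psi> \<epsilon> (j - a)\<close> contributes that of \<open>l\<close>. After cancellation the exponents differ by
\<open>(\<epsilon> + a + 1)|y|\<close> up to even numbers, so a suitable parity of \<open>\<epsilon>\<close> makes the comparison linear.
\<close>

lemma eta_act:
 assumes \<epsilon>: "even (\<epsilon> + a + 1)" and \<psi>: "\<psi> \<in> gr (H0 P) (p, j)" and e: "e \<in> carrier E1"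
 shows "eta a P (ract (D0 P) \<psi> (\<Psi> \<epsilon> (j - a) e)) = ract (D1 P) (eta a P \<psi>) e"
proof (rule B1.E_ahom_eq[OF h1 _ _ _ e])
 note Hs = Hdel
 note \<psi>c = B0.H_gr_carrier[OF P \<psi>]
 have etac: "eta a P \<psi> \<in> carrier (H1 P)" by (rule ahom_closed[OF eta_hom \<psi>c])
 have etag: "eta a P \<psi> \<in> gr (H1 P) (p + j)" unfolding eta_homogeneous[OF \<psi>] by (rule eta_part_gr[OF \<psi>])
 note r0 = B0.dual_act_hom_right[OF P \<psi>c]
 show "(\<lambda>e. eta a P (ract (D0 P) \<psi> (\<Psi> \<epsilon> (j - a) e))) \<in> ahom E1 (H1 P)"
  using ahom_comp[OF ahom_comp[OF \<Psi>_hom[of \<epsilon> "j - a"] r0] eta_hom[of a]] by (simp add: comp_def)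
 show "ract (D1 P) (eta a P \<psi>) \<in> ahom E1 (H1 P)" using B1.dual_act_hom_right[OF tP etac] by simp
 fix g l h y assume ly: "l \<in> gr A1 g" "y \<in> gr A1 h"
 then have lyR: "l \<in> gr R g" "y \<in> gr R h" and ly0: "l \<in> gr A0 (0, g)" "y \<in> gr A0 (0, h)" by simp_all
 \<comment> \<open>The parity in explicit form, so that the difference of the exponents is visibly even.\<close>
 obtain t where t: "\<epsilon> = 2 * t - a - 1" using \<epsilon> by (elim evenE) (auto simp: algebra_simps intro: that)
 let ?w = "B0.pu (0, g) l (0, h) y" and ?w' = "B0.pu (0, h) y (0, g) l" and ?u = "B1.pu h y g l"
 have wc: "?w \<in> carrier E0" and w'c: "?w' \<in> carrier E0" and uc: "?u \<in> carrier E1"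
  using B0.pu_closed[OF ly0] B0.pu_closed[OF ly0(2,1)] B1.pu_closed[OF ly(2,1)] by auto
 have wg: "?w \<in> gr E0 (0, g + h)" and w'g: "?w' \<in> gr E0 (0, h + g)"
  using B0.pu_gr[OF ly0] B0.pu_gr[OF ly0(2,1)] by simp_all
 let ?m = "(j - a) * g + \<epsilon> * h"
 have lw: "lmul0 \<in> gr (H0 P) (p, j + (h + g))" if "lmul0 = B0.lmul P ?w' \<psi>" for lmul0
  using B0.lmul_gr[OF P w'g \<psi>] that by simp
 note lw = lw[OF refl]
 have "ract (D0 P) \<psi> ?w = B0.lmul P ?w' \<psi>"
  using B0.dual_act[OF P \<psi> wg] B0.flip_pu[OF ly0] by (simp add: cdeg_prod_def cdeg_int_def koszul_even)
 then have "ract (D0 P) \<psi> (\<Psi> \<epsilon> (j - a) (B1.pu g l h y)) = koszul (H0 P) ?m (B0.lmul P ?w' \<psi>)"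
  using ahom_koszul[OF e0 h0 r0 wc] by (simp add: \<Psi>_pu[OF lyR])
 then have L: "eta a P (ract (D0 P) \<psi> (\<Psi> \<epsilon> (j - a) (B1.pu g l h y))) =
   koszul (H1 P) ?m (eta_part a P (p, j + (h + g)) (B0.lmul P ?w' \<psi>))"
  using ahom_koszul[OF h0 h1 eta_hom B0.H_gr_carrier[OF P lw]] by (simp add: eta_homogeneous[OF lw])
 have Rr: "ract (D1 P) (eta a P \<psi>) (B1.pu g l h y) =
   koszul (H1 P) ((g + h) * (p + j)) (B1.lmul (tot (\<Psi> 0) P) (koszul E1 (g * h) ?u) (eta_part a P (p, j) \<psi>))"
  using B1.dual_act[OF tP etag B1.pu_gr[OF ly]] B1.flip_pu[OF ly] by (simp add: eta_homogeneous[OF \<psi>] cdeg_int_def)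
 have c1: "eta_part a P (p, j + (h + g)) (B0.lmul P ?w' \<psi>) \<in> carrier (H1 P)"
  by (rule B1.H_gr_carrier[OF tP eta_part_gr[OF lw]])
 have c2: "B1.lmul (tot (\<Psi> 0) P) (koszul E1 (g * h) ?u) (eta_part a P (p, j) \<psi>) \<in> carrier (H1 P)"
  by (rule B1.lmul_closed[OF tP koszul_closed[OF e1 uc] B1.H_gr_carrier[OF tP eta_part_gr[OF \<psi>]]])
 show "eta a P (ract (D0 P) \<psi> (\<Psi> \<epsilon> (j - a) (B1.pu g l h y))) = ract (D1 P) (eta a P \<psi>) (B1.pu g l h y)"
  unfolding L Rr
 proof (rule B1.H_eqI[OF ahom_closed[OF koszul_ahom[OF h1] c1] ahom_closed[OF koszul_ahom[OF h1] c2]])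
  fix x assume "x \<in> carrier (tot (\<Psi> 0) P)"
  then have x: "x \<in> carrier (tot (\<Psi> 0) P)" "x \<in> carrier P" by simp_all
  have v: "\<psi> x \<in> carrier E0" by (rule B0.H_closed[OF P \<psi>c x(2)])
  let ?v = "\<Omega> 0 (- j) (\<psi> x)"
  have vc: "?v \<in> carrier E1" by (rule ahom_closed[OF \<Omega>_hom v])
  have uv: "?u *_E1 ?v \<in> carrier E1" using uc vc by simp
  have "\<Omega> 0 (- (j + (h + g))) (?w' *_E0 \<psi> x) = koszul E1 (- (j + (h + g)) * h) ?u *_E1 ?v"
   using z.\<Omega>_mult[OF w'g v, of "- (j + (h + g))"] by (simp add: \<Omega>_pu[OF ly0(2,1)])
  also have "\<dots> = koszul E1 (- (j + (h + g)) * h) (?u *_E1 ?v)"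
   using B1.koszul_mult[OF uc vc, of "- (j + (h + g)) * h" 0] by (simp add: koszul_even)
  finally have m: "\<Omega> 0 (- (j + (h + g))) (?w' *_E0 \<psi> x) = koszul E1 (- (j + (h + g)) * h) (?u *_E1 ?v)" .
  have "koszul (H1 P) ?m (eta_part a P (p, j + (h + g)) (B0.lmul P ?w' \<psi>)) x =
    koszul E1 (?m + ((p + a) * (j + (h + g) + a) + - (j + (h + g)) * h)) (?u *_E1 ?v)"
   unfolding B1.H_koszul[OF tP c1 x(1)]
   using x by (simp add: eta_part_def B0.lmul_def[OF P] m koszul_koszul[OF e1 uv] del: minus_add_distrib mult_minus_left)
  also have "\<dots> = koszul E1 ((g + h) * (p + j) + (g * h + (p + a) * (j + a))) (?u *_E1 ?v)"
  proof (rule koszul_cong)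
   have "?m + ((p + a) * (j + (h + g) + a) + - (j + (h + g)) * h) - ((g + h) * (p + j) + (g * h + (p + a) * (j + a))) =
    2 * (h * (t - j - g)) - h * (h + 1)" by (simp add: t algebra_simps)
   then show "even (?m + ((p + a) * (j + (h + g) + a) + - (j + (h + g)) * h) - ((g + h) * (p + j) + (g * h + (p + a) * (j + a))))"
    by simp
  qed
  also have "\<dots> = koszul (H1 P) ((g + h) * (p + j)) (B1.lmul (tot (\<Psi> 0) P) (koszul E1 (g * h) ?u) (eta_part a P (p, j) \<psi>)) x"
   unfolding B1.H_koszul[OF tP c2 x(1)]
   using x by (simp add: eta_part_def B1.lmul_def[OF tP] B1.koszul_mult[OF uc vc] koszul_koszul[OF e1 uv])
  finally show "koszul (H1 P) ?m (eta_part a P (p, j + (h + g)) (B0.lmul P ?w' \<psi>)) x =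
   koszul (H1 P) ((g + h) * (p + j)) (B1.lmul (tot (\<Psi> 0) P) (koszul E1 (g * h) ?u) (eta_part a P (p, j) \<psi>)) x" .
 qed
qed

text \<open>
The differential raises \<open>p\<close> by one, which changes the exponent \<open>(p + a)(j + a)\<close> by \<open>j + a\<close>. This is the difference
between the exponents \<open>(d + 1) + (p + 1)\<close> and \<open>(d + a + 1) + (p + j + 1)\<close> of the two shifted differentials.
\<close>

lemma eta_d:
 assumes \<psi>: "\<psi> \<in> carrier (H0 P)"
 shows "eta a P (koszul (H0 P) (d + 1) (dd (D0 P) \<psi>)) = koszul (H1 P) (d + a + 1) (dd (D1 P) (eta a P \<psi>))"
proof (rule ahom_eqI[OF g0 h1 _ _ _ \<psi>])
 note Hs = Hdel
 show "(\<lambda>\<psi>. eta a P (koszul (H0 P) (d + 1) (dd (D0 P) \<psi>))) \<in> ahom (H0 P) (H1 P)"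
  using ahom_comp[OF ahom_comp[OF B0.dual_d_hom[OF P] koszul_ahom[OF h0, of "d + 1"]] eta_hom[of a]] by (simp add: comp_def)
 show "(\<lambda>\<psi>. koszul (H1 P) (d + a + 1) (dd (D1 P) (eta a P \<psi>))) \<in> ahom (H0 P) (H1 P)"
  using ahom_comp[OF ahom_comp[OF eta_hom[of a] B1.dual_d_hom[OF tP]] koszul_ahom[OF h1, of "d + a + 1"]] by (simp add: comp_def)
 fix g \<psi> assume \<psi>': "\<psi> \<in> gr (H0 P) g"
 obtain p j where g: "g = (p, j)" by (cases g)
 note \<psi> = \<psi>'[unfolded g]
 let ?q = "precomp P (dd P) \<psi>" and ?r = "precomp (tot (\<Psi> 0) P) (dd (tot (\<Psi> 0) P)) (eta_part a P (p, j) \<psi>)"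
 have qg: "?q \<in> gr (H0 P) (1 + p, j)"
  using B0.precomp_gr[OF P B0.d_hom_deg[OF P] \<psi> P] by (simp add: ddeg_prod_def ddeg_int_def)
 note qc = B0.H_gr_carrier[OF P qg]
 have pg: "eta_part a P (p, j) \<psi> \<in> gr (H1 P) (p + j)" by (rule eta_part_gr[OF \<psi>])
 have rc: "?r \<in> carrier (H1 P)"
  by (rule ahom_closed[OF B1.precomp_hom[OF tP B1.d_hom_deg[OF tP]] B1.H_gr_carrier[OF tP pg]])
 have ec: "eta_part a P (1 + p, j) ?q \<in> carrier (H1 P)" by (rule B1.H_gr_carrier[OF tP eta_part_gr[OF qg]])
 have L: "eta a P (koszul (H0 P) (d + 1) (dd (D0 P) \<psi>)) = koszul (H1 P) (d + 1 + (p + 1)) (eta_part a P (1 + p, j) ?q)"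
  unfolding B0.dual_d[OF P \<psi>] koszul_koszul[OF h0 qc] ahom_koszul[OF h0 h1 eta_hom qc] eta_homogeneous[OF qg]
  by (simp add: cdeg_prod_def cdeg_int_def)
 have Rr: "koszul (H1 P) (d + a + 1) (dd (D1 P) (eta a P \<psi>)) = koszul (H1 P) (d + a + 1 + (p + j + 1)) ?r"
  unfolding eta_homogeneous[OF \<psi>] B1.dual_d[OF tP pg] koszul_koszul[OF h1 rc] by (simp add: cdeg_int_def)
 show "eta a P (koszul (H0 P) (d + 1) (dd (D0 P) \<psi>)) = koszul (H1 P) (d + a + 1) (dd (D1 P) (eta a P \<psi>))"
  unfolding L Rr
 proof (rule B1.H_eqI[OF ahom_closed[OF koszul_ahom[OF h1] ec] ahom_closed[OF koszul_ahom[OF h1] rc]])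
  fix x assume "x \<in> carrier (tot (\<Psi> 0) P)"
  then have x: "x \<in> carrier (tot (\<Psi> 0) P)" "x \<in> carrier P" by simp_all
  let ?v = "\<Omega> 0 (- j) (\<psi> (dd P x))"
  have vc: "?v \<in> carrier E1"
   by (rule ahom_closed[OF \<Omega>_hom B0.H_closed[OF P B0.H_gr_carrier[OF P \<psi>]]]) (use x in simp)
  have "koszul (H1 P) (d + 1 + (p + 1)) (eta_part a P (1 + p, j) ?q) x =
    koszul E1 (d + 1 + (p + 1) + (1 + p + a) * (j + a)) ?v"
   unfolding B1.H_koszul[OF tP ec x(1)] using x by (simp add: eta_part_def precomp_def koszul_koszul[OF e1 vc])
  also have "\<dots> = koszul E1 (d + a + 1 + (p + j + 1) + (p + a) * (j + a)) ?v"
   by (rule koszul_cong) (simp add: algebra_simps)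
  also have "\<dots> = koszul (H1 P) (d + a + 1 + (p + j + 1)) ?r x"
   unfolding B1.H_koszul[OF tP rc x(1)] using x by (simp add: eta_part_def precomp_def koszul_koszul[OF e1 vc])
  finally show "koszul (H1 P) (d + 1 + (p + 1)) (eta_part a P (1 + p, j) ?q) x = koszul (H1 P) (d + a + 1 + (p + j + 1)) ?r x" .
 qed
qed

end

lemma D0_koszul: "koszul (D0 P) = koszul (H0 P)" for P :: "('a, 'p) bicomplex"
 by (simp only: koszul_def[abs_def] a_inv_def B0.dual_monoid)

lemma D1_koszul: "koszul (env_dual K A1 Q) = koszul (hom_graded E1 Q)" for Q :: "((int, 'a) tensor, int, 'p) dg"
 by (simp only: koszul_def[abs_def] a_inv_def B1.dual_monoid)

lemma eta_dg_hom:
 fixes P :: "('a, 'p) bicomplex"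
 assumes P: "dg_module E0 P" and \<epsilon>: "even (\<epsilon> + a + 1)"
 shows "eta a P \<in> dg_hom E1 (tot (\<Psi> \<epsilon>) (shift (d + 1, a) (D0 P))) (shift (d + a + 1) (D1 P))"
proof -
 interpret z: zhang E0 E1 "\<Psi> \<epsilon>" "\<Omega> \<epsilon>" by (rule zhang)
 note Hs = Hdel[OF P]
 show ?thesis
 proof (rule z.tot_dg_homI[OF B0.shift_dgm[OF B0.dual_dgm[OF P]] B1.shift_dgm[OF B1.dual_dgm[OF tP[OF P]]]])
  show "eta a P \<in> ahom (shift (d + 1, a) (D0 P)) (shift (d + a + 1) (D1 P))"
   using eta_hom[OF P, of a] by (simp del: B0.H_simps B1.H_simps)
  fix p i \<psi> assume "\<psi> \<in> gr (shift (d + 1, a) (D0 P)) (p, i)"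
  then have \<psi>: "\<psi> \<in> gr (H0 P) (p + (d + 1), i + a)" by (simp del: B0.H_simps B1.H_simps)
  have eq: "p + (d + 1) + (i + a) = p + i + (d + a + 1)" by simp
  then show "eta a P \<psi> \<in> gr (shift (d + a + 1) (D1 P)) (p + i)"
   using eta_part_gr[OF P \<psi>, of a, unfolded eq] by (simp add: eta_homogeneous[OF P \<psi>] del: B0.H_simps B1.H_simps)
  fix e assume "e \<in> carrier E1"
  from eta_act[OF P \<epsilon> \<psi> this]
  show "eta a P (ract (shift (d + 1, a) (D0 P)) \<psi> (\<Psi> \<epsilon> i e)) = ract (shift (d + a + 1) (D1 P)) (eta a P \<psi>) e"
   by (simp del: B0.H_simps B1.H_simps)
 next
  fix \<psi> assume "\<psi> \<in> carrier (shift (d + 1, a) (D0 P))"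
  then show "eta a P (dd (shift (d + 1, a) (D0 P)) \<psi>) = dd (shift (d + a + 1) (D1 P)) (eta a P \<psi>)"
   using eta_d[OF P, of \<psi> a d]
   by (simp add: cdeg_prod_def cdeg_int_def D0_koszul D1_koszul del: B0.H_simps B1.H_simps)
 qed
qed

context
 fixes P :: "('a, 'p) bicomplex"
 assumes P: "dg_module E0 P"
begin

interpretation z: zhang E0 E1 "\<Psi> 0" "\<Omega> 0" by (rule zhang)
interpretation P: dgmod E0 P using P by blast

lemmas g0' = g0[OF P] and g1' = g1[OF P] and h0' = h0[OF P] and h1' = h1[OF P]

text \<open>
\<open>E0\<close> is concentrated in cohomological degree zero, so only the parts of bidegree \<open>(p, j)\<close> contribute to the value at
\<open>x\<close> of bidegree \<open>(- p, i)\<close>, and different \<open>j\<close> land in different degrees of \<open>E1\<close>.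
\<close>

lemma eta_component:
 assumes \<psi>: "\<psi> \<in> carrier (H0 P)" and x: "x \<in> gr P (- p, i)"
 shows "hcomp E1 (eta a P \<psi> x) (i + j) = eta_part a P (p, j) (hcomp (H0 P) \<psi> (p, j)) x"
proof (rule ahom_eqI[OF g0' e1 _ _ _ \<psi>])
 note Hs = B0.H_simps[simp del] B1.H_simps[simp del]
 have xc: "x \<in> carrier P" "x \<in> carrier (tot (\<Psi> 0) P)" using P.gr_closed[OF x] by simp_all
 show "(\<lambda>\<psi>. hcomp E1 (eta a P \<psi> x) (i + j)) \<in> ahom (H0 P) E1"
  using ahom_comp[OF ahom_comp[OF eta_hom[OF P] B1.H_ev[OF tP[OF P] xc(2)]] hcomp_ahom[OF B1.E_graded, of "i + j"]]
  by (simp add: comp_def)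
 show "(\<lambda>\<psi>. eta_part a P (p, j) (hcomp (H0 P) \<psi> (p, j)) x) \<in> ahom (H0 P) E1"
  using ahom_comp[OF eta_term_hom[OF P] B1.H_ev[OF tP[OF P] xc(2)], of a "(p, j)"] by (simp add: comp_def)
 fix g \<psi> assume \<psi>: "\<psi> \<in> gr (H0 P) g"
 obtain p' j' where g: "g = (p', j')" by (cases g)
 note v = eta_part_value[OF P \<psi>[unfolded g] x, of a]
 have z: "eta_part a P (p, j) 0_(H0 P) x = 0_E1"
  using xc by (simp add: eta_part_def B0.H_simps ahom_zero[OF e0 e1 \<Omega>_hom] e1)
 have "hcomp E1 (eta_part a P (p', j') \<psi> x) (i + j) = (if p' = p \<and> j' = j then eta_part a P (p, j) \<psi> x else 0_E1)"
 proof (cases "p' = p")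
  case True
  then show ?thesis using hcomp_hom[OF B1.E_graded v(1)] by auto
 next
  case False
  then show ?thesis using v(2) hcomp_zero[OF B1.E_graded] by simp
 qed
 then show "hcomp E1 (eta a P \<psi> x) (i + j) = eta_part a P (p, j) (hcomp (H0 P) \<psi> (p, j)) x"
  unfolding eta_homogeneous[OF P \<psi>] hcomp_hom[OF g0' \<psi>] by (auto simp: g z)
qed

lemma eta_inj:
 assumes \<psi>: "\<psi> \<in> carrier (H0 P)" and e: "eta a P \<psi> = 0_(H1 P)" shows "\<psi> = 0_(H0 P)"
proof -
 note Hs = B0.H_simps[simp del] B1.H_simps[simp del]
 have "hcomp (H0 P) \<psi> g = 0_(H0 P)" for g
 proof (rule B0.H_eqI[OF hcomp_closed[OF g0' \<psi>]])
  obtain p j where g: "g = (p, j)" by (cases g)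
  show "0_(H0 P) \<in> carrier (H0 P)" using B0.H_zero_closed[OF P] by (simp add: B0.H_simps)
  have pg: "hcomp (H0 P) \<psi> g \<in> gr (H0 P) (p, j)" using hcomp_gr[OF g0' \<psi>] g by simp
  fix x assume x: "x \<in> carrier P"
  have "hcomp (H0 P) \<psi> g x = (\<lambda>_. 0_E0) x"
  proof (rule ahom_eqI[OF P.gg e0 B0.H_ahom[OF P hcomp_closed[OF g0' \<psi>]] _ _ x])
   show "(\<lambda>_. 0_E0) \<in> ahom P E0" by (rule ahomI) simp_all
   fix k x assume "x \<in> gr P k"
   then obtain q i where x: "x \<in> gr P (q, i)" by (cases k) auto
   note xc = P.gr_closed[OF x]
   show "hcomp (H0 P) \<psi> g x = (\<lambda>_. 0_E0) x"
   proof (cases "q + p = 0")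
    case True
    then have "q = - p" by simp
    note x' = x[unfolded this]
    have wc: "hcomp (H0 P) \<psi> g x \<in> carrier E0" by (rule B0.H_closed[OF P hcomp_closed[OF g0' \<psi>] xc])
    have Oc: "\<Omega> 0 (- j) (hcomp (H0 P) \<psi> g x) \<in> carrier E1" by (rule ahom_closed[OF \<Omega>_hom wc])
    have "eta_part a P (p, j) (hcomp (H0 P) \<psi> (p, j)) x = 0_E1"
     using eta_component[OF \<psi> x', of a j] xc by (simp add: e B1.H_simps hcomp_zero[OF B1.E_graded])
    then have "\<Omega> 0 (- j) (hcomp (H0 P) \<psi> g x) = 0_E1"
     using koszul_eq_zero[OF e1 Oc] xc by (simp add: eta_part_def g)
    then show ?thesis using z.\<Psi>_\<Omega>[OF wc, of "- j"] ahom_zero[OF e1 e0 \<Psi>_hom[of 0 "- j"]] by simp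
   next
    case False
    then show ?thesis using H0_value(2)[OF P pg x] by simp
   qed
  qed
  then show "hcomp (H0 P) \<psi> g x = 0_(H0 P) x" using x by (simp add: B0.H_simps)
 qed
 then have "hsupp (H0 P) \<psi> = {}" by (simp add: hsupp_def)
 then show ?thesis
  using hcomp_sum[OF g0' \<psi>, of "{}"]
  by (simp add: abelian_monoid.finsum_empty[OF abelian_group.axioms(1)[OF h0']])
qed

text \<open>
A linear map of total degree \<open>n\<close> is the sum over \<open>p\<close> of its restrictions to the cohomological degrees \<open>- p\<close>, untwisted
to maps of bidegree \<open>(p, n - p)\<close>. The sum is finite because \<open>P\<close> is bounded.
\<close>

lemma eta_surj:
 assumes b: "bounded P" and f: "f \<in> carrier (H1 P)" shows "\<exists>\<psi>\<in>carrier (H0 P). eta a P \<psi> = f"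
 using g1' f
proof (induction rule: graded_induct)
 note Hs = B0.H_simps[simp del] B1.H_simps[simp del]
 interpret HP: abelian_group "H0 P" by (rule h0')
 case zero
 show ?case by (rule bexI[of _ "0_(H0 P)"]) (simp_all add: ahom_zero[OF h0' h1' eta_hom[OF P]])
next
 note Hs = B0.H_simps[simp del] B1.H_simps[simp del]
 interpret HP: abelian_group "H0 P" by (rule h0')
 case (add f n f')
 note f = add(1)
 note fc = B1.H_gr_carrier[OF tP[OF P] f]
 have fh: "f \<in> ahom P E1" using B1.H_ahom[OF tP[OF P] fc] by (simp add: hom_def)
 have fd: "f \<in> hom_deg E1 (tot (\<Psi> 0) P) (regular E1) n" using f by (simp add: B1.H_simps)
 obtain Q where Q: "finite Q" "\<And>q i x. x \<in> gr P (q, i) ==> q \<notin> Q ==> x = 0_P"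
  using b by (auto simp: bounded_def)
 define c where "c p = (p + a) * (n - p + a)" for p
 \<comment> \<open>The sign of \<open>eta_part\<close> is its own inverse, so the same sign occurs here.\<close>
 define t where "t p = (\<lambda>(g :: int \<times> int) x. if fst g = - p then koszul E0 (c p) (\<Psi> 0 (- (n - p)) (f x)) else 0_E0)" for p
 have th: "t p g \<in> ahom P E0" for p g
 proof (cases "fst g = - p")
  case True
  then show ?thesis
   using ahom_comp[OF ahom_comp[OF fh \<Psi>_hom[of 0 "- (n - p)"]] koszul_ahom[OF e0, of "c p"]] by (simp add: comp_def t_def[abs_def])
 next
  case False
  then show ?thesis by (simp add: t_def[abs_def]) (rule ahomI, simp_all)
 qed
 define u where "u p = gext P E0 (t p)" for p
 have uh: "u p \<in> ahom P E0" for p unfolding u_def by (rule gext_hom[OF P.gg e0 th])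
 have uv: "u p x = t p g x" if "x \<in> gr P g" for p g x
  unfolding u_def by (rule gext_hom_eq[OF P.gg e0, of "t p", OF th that])
 have fg: "f x \<in> gr E1 (i + q + n)" if "x \<in> gr P (q, i)" for q i x
  using hom_degD(5)[OF fd tot_grI[OF P.gg that refl]] by (simp add: add.commute)
 have ud: "u p \<in> hom_deg E0 P (regular E0) (p, n - p)" for p
 proof (rule hom_degI)
  show "u p \<in> ahom P (regular E0)" using uh by (simp add: hom_def)
  fix g x assume "x \<in> gr P g"
  then obtain q i where x: "x \<in> gr P (q, i)" and g: "g = (q, i)" by (cases g) auto
  have "t p (q, i) x \<in> gr E0 (q + p, i + (n - p))"
  proof (cases "q = - p")
   case True
   have "f x \<in> gr E1 (i + (n - p))" using fg[OF x] True by (simp add: algebra_simps)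
   then show ?thesis using True z.\<Psi>_gr by (simp add: t_def gr_koszul[OF B0.E_graded])
  next
   case False
   then show ?thesis by (simp add: t_def gr_zero[OF B0.E_graded])
  qed
  then show "u p x \<in> gr (regular E0) (g + (p, n - p))" by (simp add: uv[OF x] g)
 next
  fix x e assume x: "x \<in> carrier P" and e: "e \<in> carrier E0"
  have uc: "u p x \<in> carrier E0" if "x \<in> carrier P" for x by (rule ahom_closed[OF uh that])
  have "u p (ract P x e) = u p x *_E0 e"
  proof (rule ahom_eqI[OF P.gg e0 _ _ _ x])
   show "(\<lambda>x. u p (ract P x e)) \<in> ahom P E0" using ahom_comp[OF P.act_hom[OF e] uh] by (simp add: comp_def)
   show "(\<lambda>x. u p x *_E0 e) \<in> ahom P E0"
    by (rule ahomI) (use uc e ahom_add[OF uh] in "simp_all add: B0.E.l_distr")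
   fix g x assume "x \<in> gr P g"
   then obtain q i where x: "x \<in> gr P (q, i)" by (cases g) auto
   note xc = P.gr_closed[OF x]
   show "u p (ract P x e) = u p x *_E0 e"
   proof (rule ahom_eqI[OF B0.E_graded e0 _ _ _ e])
    show "(\<lambda>e. u p (ract P x e)) \<in> ahom E0 E0"
     by (rule ahomI) (use xc uc ahom_add[OF uh] in "simp_all add: P.act_add_right")
    show "(\<lambda>e. u p x *_E0 e) \<in> ahom E0 E0"
     by (rule ahomI) (use uc[OF xc] in "simp_all add: B0.E.r_distr")
    fix h e assume e: "e \<in> gr E0 h"
    obtain r m where h: "h = (r, m)" by (cases h)
    note ec = B0.gr_E_carrier[OF e]
    show "u p (ract P x e) = u p x *_E0 e"
    proof (cases "r = 0")
     case False
     then have "e = 0_E0" using e E0_conc by (simp add: h)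
     then show ?thesis using B0.act_ring_zero[OF P xc] uc[OF xc] ahom_zero[OF P.abgrp e0 uh] by simp
    next
     case True
     have xe: "ract P x e \<in> gr P (q, i + m)" using P.act_gr[OF x e] by (simp add: h True)
     show ?thesis
     proof (cases "q = - p")
      case False
      then show ?thesis using ec by (simp add: uv[OF x] uv[OF xe] t_def)
     next
      case q: True
      have fx: "f x \<in> gr E1 (i + (n - p))" using fg[OF x] q by (simp add: algebra_simps)
      have oc: "\<Omega> 0 i e \<in> carrier E1" by (rule ahom_closed[OF \<Omega>_hom ec])
      have "ract P x e = ract (tot (\<Psi> 0) P) x (\<Omega> 0 i e)"
       using z.tot_act[OF P oc x] ec by (simp add: z.\<Psi>_\<Omega>)
      then have "f (ract P x e) = f x *_E1 \<Omega> 0 i e"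
       using hom_degD(4)[OF fd, of x "\<Omega> 0 i e"] xc oc by simp
      then have "\<Psi> 0 (- (n - p)) (f (ract P x e)) = \<Psi> 0 (- (n - p)) (f x) *_E0 e"
       using z.\<Psi>_mult[OF fx oc, of "- (n - p)"] ec by (simp add: z.\<Psi>_\<Omega>)
      moreover have "\<Psi> 0 (- (n - p)) (f x) \<in> carrier E0" by (rule gr_carrier[OF B0.E_graded z.\<Psi>_gr[OF fx]])
      ultimately show ?thesis
       using q B0.koszul_mult[OF _ ec, of "\<Psi> 0 (- (n - p)) (f x)" "c p" 0]
       by (simp add: uv[OF x] uv[OF xe] t_def koszul_even)
     qed
    qed
   qed
  qed
  then show "u p (ract P x e) = ract (regular E0) (u p x) e" by simp
 qed
 define v where "v p = restrict (u p) (carrier P)" for p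
 have vg: "v p \<in> gr (H0 P) (p, n - p)" for p
  using hom_deg_restrict[OF P ud] by (simp add: v_def B0.H_simps)
 note vc = B0.H_gr_carrier[OF P vg]
 let ?S = "uminus ` Q"
 have S: "finite ?S" using Q by simp
 define \<psi> where "\<psi> = (\<Oplus>\<^bsub>H0 P\<^esub>p\<in>?S. v p)"
 have \<psi>c: "\<psi> \<in> carrier (H0 P)" unfolding \<psi>_def by (rule HP.finsum_closed) (use vc in auto)
 note etc = ahom_closed[OF eta_hom[OF P] vc]
 have "eta a P \<psi> = f"
 proof (rule B1.H_eqI[OF ahom_closed[OF eta_hom[OF P] \<psi>c] fc])
  fix x assume "x \<in> carrier (tot (\<Psi> 0) P)"
  then have x: "x \<in> carrier P" by simp
  show "eta a P \<psi> x = f x"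
  proof (rule ahom_eqI[OF P.gg e1 _ fh _ x])
   show "eta a P \<psi> \<in> ahom P E1" using B1.H_ahom[OF tP[OF P] ahom_closed[OF eta_hom[OF P] \<psi>c]] by (simp add: hom_def)
   fix g x assume "x \<in> gr P g"
   then obtain q i where x: "x \<in> gr P (q, i)" by (cases g) auto
   note xc = P.gr_closed[OF x]
   have fxc: "f x \<in> carrier E1" by (rule ahom_closed[OF fh xc])
   have val: "eta a P (v p) x = (if p = - q then f x else 0_E1)" for p
   proof -
    have P1: "\<Psi> 0 (- (n - p)) (f x) \<in> carrier E0" by (rule ahom_closed[OF \<Psi>_hom fxc])
    have O1: "\<Omega> 0 (- (n - p)) (\<Psi> 0 (- (n - p)) (f x)) = f x" by (rule z.\<Omega>_\<Psi>[OF fxc])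
    have "eta a P (v p) x = koszul E1 (c p) (\<Omega> 0 (- (n - p)) (t p (q, i) x))"
     unfolding eta_homogeneous[OF P vg] using xc by (simp add: eta_part_def v_def uv[OF x] c_def)
    also have "\<dots> = (if p = - q then f x else 0_E1)"
    proof (cases "p = - q")
     case True
     then have "q = - p" by simp
     then show ?thesis
      using ahom_koszul[OF e0 e1 \<Omega>_hom P1, of 0 "- (n - p)" "c p"] O1 fxc True
      by (simp add: t_def koszul_koszul[OF e1] koszul_even)
    next
     case False
     then have "q \<noteq> - p" by simp
     then show ?thesis using False by (simp add: t_def ahom_zero[OF e0 e1 \<Omega>_hom] e1)
    qed
    finally show ?thesis .
   qed
   have "eta a P \<psi> x = (\<Oplus>\<^bsub>H1 P\<^esub>p\<in>?S. eta a P (v p)) x"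
    unfolding \<psi>_def using ahom_finsum[OF h0' h1' eta_hom[OF P] S vc] by simp
   also have "\<dots> = (\<Oplus>\<^bsub>E1\<^esub>p\<in>?S. eta a P (v p) x)"
    by (rule B1.H_finsum[OF tP[OF P] S etc]) (use xc in simp)
   also have "\<dots> = (\<Oplus>\<^bsub>E1\<^esub>p\<in>?S. if p = - q then f x else 0_E1)"
    by (rule B1.E.finsum_cong') (use fxc in "auto simp: val")
   also have "\<dots> = f x"
   proof (cases "q \<in> Q")
    case True
    have "(\<Oplus>\<^bsub>E1\<^esub>p\<in>?S. if p = - q then f x else 0_E1) = (\<Oplus>\<^bsub>E1\<^esub>p\<in>{- q}. if p = - q then f x else 0_E1)"
     by (rule finsum_mono_zero[OF e1 S]) (use True fxc in auto)
    then show ?thesis using fxc by simp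
   next
    case False
    then have "x = 0_P" by (rule Q(2)[OF x])
    then have "f x = 0_E1" using ahom_zero[OF P.abgrp e1 fh] by simp
    then have "(\<Oplus>\<^bsub>E1\<^esub>p\<in>?S. if p = - q then f x else 0_E1) = (\<Oplus>\<^bsub>E1\<^esub>p\<in>?S. 0_E1)"
     by (intro B1.E.finsum_cong') auto
    then show ?thesis using \<open>f x = 0_E1\<close> by (simp add: B1.E.finsum_zero)
   qed
   finally show "eta a P \<psi> x = f x" .
  qed
 qed
 moreover obtain \<psi>' where "\<psi>' \<in> carrier (H0 P)" "eta a P \<psi>' = f'" using add by blast
 ultimately show ?case
  using \<psi>c ahom_add[OF eta_hom[OF P] \<psi>c, of \<psi>'] by (intro bexI[of _ "\<psi> +_(H0 P) \<psi>'"]) auto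
qed

end

end

section \<open>The inverse dualizing complex of the DG algebra\<close>

lemma dg_inv_refl: "dg_inv E M M id id"
 by (simp add: dg_inv_def dg_hom_id)

lemma derived_iso_quasi_iso_right:
 fixes U :: "'u itself"
 assumes "derived_iso TYPE('u) E X Y" "quasi_iso E Y Y' f" "dg_module E X" "dg_module E Y" "dg_module E Y'"
 shows "derived_iso TYPE('u) E X Y'"
proof -
 obtain Z :: "(_, _, 'u) dg" and s g where Z: "dg_module E Z" "quasi_iso E Z X s" "quasi_iso E Z Y g"
  using assms(1,3,4) by (rule derived_iso_spanD)
 show ?thesis
  by (rule derived_iso_spanI[OF Z(1) assms(3,5) Z(2) quasi_iso_comp[OF Z(3) assms(2) Z(1) assms(4) dgm_cx[OF assms(5)]]])
qed

lemma derived_iso_quasi_iso_left: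
 assumes "derived_iso TYPE('u) E X Y" "quasi_iso E X X' f" "dg_module E X" "dg_module E X'" "dg_module E Y"
 shows "derived_iso TYPE('u) E X' Y"
proof -
 obtain Z :: "(_, _, 'u) dg" and s g where Z: "dg_module E Z" "quasi_iso E Z X s" "quasi_iso E Z Y g"
  using assms(1,3,5) by (rule derived_iso_spanD)
 show ?thesis
  by (rule derived_iso_spanI[OF Z(1) assms(4,5) quasi_iso_comp[OF Z(2) assms(2) Z(1) assms(3) dgm_cx[OF assms(4)]] Z(3)])
qed

lemma precomp_id: "f \<in> extensional (carrier P) ==> precomp P id f = f"
 by (auto simp: precomp_def extensional_def fun_eq_iff)

context ralg
begin

lemma eta_precomp:
 fixes P :: "('a, 'p) bicomplex" and P' :: "('a, 'q) bicomplex"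
 assumes P: "dg_module E0 P" and P': "dg_module E0 P'" and u: "u \<in> dg_hom E0 P' P" and \<psi>: "\<psi> \<in> carrier (H0 P)"
 shows "eta a P' (precomp P' u \<psi>) = precomp (tot (\<Psi> 0) P') u (eta a P \<psi>)"
proof (rule ahom_eqI[OF g0[OF P] h1[OF P'] _ _ _ \<psi>])
 interpret z: zhang E0 E1 "\<Psi> 0" "\<Omega> 0" by (rule zhang)
 note Hs = B0.H_simps[simp del] B1.H_simps[simp del]
 note u0 = dg_hom_hom_deg[OF u] and u1 = dg_hom_hom_deg[OF z.tot_dg_hom[OF P' P u]]
 show "(\<lambda>\<psi>. eta a P' (precomp P' u \<psi>)) \<in> ahom (H0 P) (H1 P')"
  using ahom_comp[OF B0.precomp_hom[OF P u0] eta_hom[OF P', of a]] by (simp add: comp_def)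
 show "(\<lambda>\<psi>. precomp (tot (\<Psi> 0) P') u (eta a P \<psi>)) \<in> ahom (H0 P) (H1 P')"
  using ahom_comp[OF eta_hom[OF P, of a] B1.precomp_hom[OF tP[OF P] u1]] by (simp add: comp_def)
 fix g \<psi> assume \<psi>: "\<psi> \<in> gr (H0 P) g"
 have pg: "precomp P' u \<psi> \<in> gr (H0 P') g" using B0.precomp_gr[OF P u0 \<psi> P'] by simp
 show "eta a P' (precomp P' u \<psi>) = precomp (tot (\<Psi> 0) P') u (eta a P \<psi>)"
  unfolding eta_homogeneous[OF P \<psi>] eta_homogeneous[OF P' pg]
  by (cases g) (auto simp: eta_part_def precomp_def fun_eq_iff dg_homD(2)[OF u])
qed

context
 fixes P :: "('a, 'p) bicomplex" and T :: "('a, 't) bicomplex"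
  and i r and \<epsilon> a d :: int
 assumes P: "dg_module E0 P" and T: "dg_module E0 T" and b: "bounded T"
  and i: "i \<in> dg_hom E0 P T" and r: "r \<in> dg_hom E0 T P" and ri: "homotopic E0 P P (r o i) id"
  and \<epsilon>: "even (\<epsilon> + a + 1)"
begin

interpretation z: zhang E0 E1 "\<Psi> 0" "\<Omega> 0" by (rule zhang)
interpretation ze: zhang E0 E1 "\<Psi> \<epsilon>" "\<Omega> \<epsilon>" by (rule zhang)

text \<open>
Precomposition with \<open>i\<close> and \<open>r\<close> exhibits the comparison for \<open>P\<close> as a retract, up to coboundaries, of the one for \<open>T\<close>,
which is bijective by \<open>eta_inj\<close> and \<open>eta_surj\<close>.
\<close>

lemma eta_quasi_iso:
 "quasi_iso E1 (tot (\<Psi> \<epsilon>) (shift (d + 1, a) (D0 P))) (shift (d + a + 1) (D1 P)) (eta a P)"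
proof -
 note Hs = B0.H_simps[simp del] B1.H_simps[simp del]
 interpret HP: abelian_group "H0 P" by (rule h0[OF P])
 interpret HT: abelian_group "H0 T" by (rule h0[OF T])
 interpret HP1: abelian_group "H1 P" by (rule h1[OF P])
 interpret HT1: abelian_group "H1 T" by (rule h1[OF T])
 note tP = tP[OF P] and tT = tP[OF T]
 define dM where "dM \<psi> = koszul (H0 P) (d + 1) (dd (D0 P) \<psi>)" for \<psi>
 define dT where "dT \<psi> = koszul (H0 T) (d + 1) (dd (D0 T) \<psi>)" for \<psi>
 define dN where "dN \<psi> = koszul (H1 P) (d + a + 1) (dd (D1 P) \<psi>)" for \<psi>
 define dS where "dS \<psi> = koszul (H1 T) (d + a + 1) (dd (D1 T) \<psi>)" for \<psi>
 have sM: "dd (tot (\<Psi> \<epsilon>) (shift (d + 1, a) (D0 P))) \<psi> = dM \<psi>" for \<psi>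
  by (simp add: dM_def cdeg_prod_def cdeg_int_def D0_koszul)
 have sN: "dd (shift (d + a + 1) (D1 P)) \<psi> = dN \<psi>" for \<psi> by (simp add: dN_def cdeg_int_def D1_koszul)
 note i0 = dg_hom_hom_deg[OF i] and r0 = dg_hom_hom_deg[OF r]
 note i1d = z.tot_dg_hom[OF P T i] and r1d = z.tot_dg_hom[OF T P r]
 note i1 = dg_hom_hom_deg[OF i1d] and r1 = dg_hom_hom_deg[OF r1d]
 note rid = dg_hom_comp[OF i r]
 have h: "homotopic E0 P P id (r o i)" by (rule homotopic_sym[OF ri P P rid dg_hom_id])
 have h': "homotopic E1 (tot (\<Psi> 0) P) (tot (\<Psi> 0) P) id (r o i)"
  by (rule z.tot_homotopic[OF P P dg_hom_id rid h])
 let ?i = "precomp P i" and ?r = "precomp T r" and ?i1 = "precomp (tot (\<Psi> 0) P) i" and ?r1 = "precomp (tot (\<Psi> 0) T) r"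
 have ih: "?i \<in> ahom (H0 T) (H0 P)" by (rule B0.precomp_hom[OF T i0])
 have rh: "?r \<in> ahom (H0 P) (H0 T)" by (rule B0.precomp_hom[OF P r0])
 have r1h: "?r1 \<in> ahom (H1 P) (H1 T)" by (rule B1.precomp_hom[OF tP r1])
 have dMh: "dM \<in> ahom (H0 P) (H0 P)"
  using ahom_comp[OF B0.dual_d_hom[OF P] koszul_ahom[OF HP.abgrp, of "d + 1"]] by (simp add: comp_def dM_def[abs_def])
 have dTh: "dT \<in> ahom (H0 T) (H0 T)"
  using ahom_comp[OF B0.dual_d_hom[OF T] koszul_ahom[OF HT.abgrp, of "d + 1"]] by (simp add: comp_def dT_def[abs_def])
 have ic: "?i (dT w) = dM (?i w)" if w: "w \<in> carrier (H0 T)" for w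
  using ahom_koszul[OF HT.abgrp HP.abgrp ih ahom_closed[OF B0.dual_d_hom[OF T] w]]
  by (simp add: dT_def dM_def B0.precomp_d[OF T P i w])
 have rc1: "?r1 (dN w) = dS (?r1 w)" if w: "w \<in> carrier (H1 P)" for w
  using ahom_koszul[OF HP1.abgrp HT1.abgrp r1h ahom_closed[OF B1.dual_d_hom[OF tP] w]]
  by (simp add: dN_def dS_def B1.precomp_d[OF tP tT r1d w])
 have ed: "eta a T (dT w) = dS (eta a T w)" if w: "w \<in> carrier (H0 T)" for w
  using eta_d[OF T w, of a d] by (simp add: dT_def dS_def)
 note eh = eta_hom[OF T, of a]
 have inj: "w = w'" if w: "w \<in> carrier (H0 T)" "w' \<in> carrier (H0 T)" and eq: "eta a T w = eta a T w'" for w w'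
 proof -
  have "eta a T (w -_(H0 T) w') = 0_(H1 T)"
   using ahom_add[OF eh w(1), of "-_(H0 T) w'"] ahom_minus[OF HT.abgrp HT1.abgrp eh w(2)]
    w eq ahom_closed[OF eh w(2)] by (simp add: a_minus_def HT1.r_neg)
  then have "w -_(H0 T) w' = 0_(H0 T)" using eta_inj[OF T _, of "w -_(H0 T) w'" a] w by simp
  then show ?thesis using HT.minus_eq_zero_iff[OF w] by simp
 qed
 have k0: "dd (D0 P) x = 0_(H0 P)" if "x \<in> carrier (H0 P)" "dM x = 0_(H0 P)" for x
  using that koszul_eq_zero[OF HP.abgrp ahom_closed[OF B0.dual_d_hom[OF P] that(1)]] by (simp add: dM_def)
 have k1: "dd (D1 P) x = 0_(H1 P)" if "x \<in> carrier (H1 P)" "dN x = 0_(H1 P)" for x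
  using that koszul_eq_zero[OF HP1.abgrp ahom_closed[OF B1.dual_d_hom[OF tP] that(1)]] by (simp add: dN_def)
 have b0: "dd (D0 P) y = dM (koszul (H0 P) (d + 1) y)" if y: "y \<in> carrier (H0 P)" for y
  using ahom_koszul[OF HP.abgrp HP.abgrp B0.dual_d_hom[OF P] y, of "d + 1"]
   koszul_koszul[OF HP.abgrp ahom_closed[OF B0.dual_d_hom[OF P] y], of "d + 1" "d + 1"]
  by (simp add: dM_def koszul_even)
 have b1: "dd (D1 P) y = dN (koszul (H1 P) (d + a + 1) y)" if y: "y \<in> carrier (H1 P)" for y
  using ahom_koszul[OF HP1.abgrp HP1.abgrp B1.dual_d_hom[OF tP] y, of "d + a + 1"]
   koszul_koszul[OF HP1.abgrp ahom_closed[OF B1.dual_d_hom[OF tP] y], of "d + a + 1" "d + a + 1"]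
  by (simp add: dN_def koszul_even)
 show ?thesis
 proof (rule quasi_isoI[OF eta_dg_hom[OF P \<epsilon>]])
  show "cx (tot (\<Psi> \<epsilon>) (shift (d + 1, a) (D0 P)))"
   by (rule dgm_cx[OF ze.tot_dgm[OF B0.shift_dgm[OF B0.dual_dgm[OF P]]]])
  show "cx (shift (d + a + 1) (D1 P))" by (rule dgm_cx[OF B1.shift_dgm[OF B1.dual_dgm[OF tP]]])
  show "hinj (tot (\<Psi> \<epsilon>) (shift (d + 1, a) (D0 P))) (shift (d + a + 1) (D1 P)) (eta a P)"
   unfolding hinj_def sM sN
  proof (intro ballI impI)
   fix x z assume "x \<in> carrier (tot (\<Psi> \<epsilon>) (shift (d + 1, a) (D0 P)))" "z \<in> carrier (shift (d + a + 1) (D1 P))"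
    and dx: "dM x = 0_(tot (\<Psi> \<epsilon>) (shift (d + 1, a) (D0 P)))" and ex: "eta a P x = dN z"
   then have x: "x \<in> carrier (H0 P)" and z: "z \<in> carrier (H1 P)" by simp_all
   obtain w where w: "w \<in> carrier (H0 T)" "eta a T w = ?r1 z" using eta_surj[OF T b ahom_closed[OF r1h z]] by blast
   have "eta a T (dT w) = eta a T (?r x)"
    by (simp add: ed[OF w(1)] w(2) eta_precomp[OF P T r x] ex rc1[OF z])
   then have e: "dT w = ?r x" by (rule inj[OF ahom_closed[OF dTh w(1)] ahom_closed[OF rh x]])
   obtain y where y: "y \<in> carrier (H0 P)" "precomp P id x = precomp P (r o i) x +_(H0 P) dd (D0 P) y"
    using B0.precomp_homotopic[OF P P dg_hom_id rid h x k0[OF x]] dx by auto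
   have "precomp P (r o i) x = ?i (?r x)" by (auto simp: precomp_def fun_eq_iff dg_homD(2)[OF i])
   also have "\<dots> = dM (?i w)" by (simp add: e[symmetric] ic[OF w(1)])
   finally have "x = dM (?i w) +_(H0 P) dM (koszul (H0 P) (d + 1) y)"
    using y b0[OF y(1)] precomp_id[OF B0.H_ext[OF x]] by simp
   then have "x = dM (?i w +_(H0 P) koszul (H0 P) (d + 1) y)"
    using ahom_add[OF dMh ahom_closed[OF ih w(1)] koszul_closed[OF HP.abgrp y(1)]] by simp
   moreover have "?i w +_(H0 P) koszul (H0 P) (d + 1) y \<in> carrier (tot (\<Psi> \<epsilon>) (shift (d + 1, a) (D0 P)))"
    using ahom_closed[OF ih w(1)] y(1) by (simp add: HP.abgrp)
   ultimately show "\<exists>w\<in>carrier (tot (\<Psi> \<epsilon>) (shift (d + 1, a) (D0 P))). x = dM w" by blast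
  qed
  show "hsurj (tot (\<Psi> \<epsilon>) (shift (d + 1, a) (D0 P))) (shift (d + a + 1) (D1 P)) (eta a P)"
   unfolding hsurj_def sM sN
  proof (intro ballI impI)
   fix y assume "y \<in> carrier (shift (d + a + 1) (D1 P))" and dy: "dN y = 0_(shift (d + a + 1) (D1 P))"
   then have y: "y \<in> carrier (H1 P)" by simp
   obtain w where w: "w \<in> carrier (H0 T)" "eta a T w = ?r1 y" using eta_surj[OF T b ahom_closed[OF r1h y]] by blast
   have "eta a T (dT w) = eta a T 0_(H0 T)"
    using dy by (simp add: ed[OF w(1)] w(2) rc1[OF y, symmetric] ahom_zero[OF HP1.abgrp HT1.abgrp r1h]
      ahom_zero[OF HT.abgrp HT1.abgrp eh])
   then have dw: "dT w = 0_(H0 T)" by (rule inj[OF ahom_closed[OF dTh w(1)] HT.zero_closed])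
   have 1: "dM (?i w) = 0_(tot (\<Psi> \<epsilon>) (shift (d + 1, a) (D0 P)))"
    by (simp add: ic[OF w(1), symmetric] dw ahom_zero[OF HT.abgrp HP.abgrp ih])
   obtain v where v: "v \<in> carrier (H1 P)"
     "precomp (tot (\<Psi> 0) P) id y = precomp (tot (\<Psi> 0) P) (r o i) y +_(H1 P) dd (D1 P) v"
    using B1.precomp_homotopic[OF tP tP dg_hom_id dg_hom_comp[OF i1d r1d] h' y k1[OF y]] dy by auto
   have "precomp (tot (\<Psi> 0) P) (r o i) y = ?i1 (?r1 y)" by (auto simp: precomp_def fun_eq_iff dg_homD(2)[OF i])
   also have "\<dots> = eta a P (?i w)" by (simp add: w(2)[symmetric] eta_precomp[OF T P i w(1)])
   finally have 2: "y = eta a P (?i w) +_(shift (d + a + 1) (D1 P)) dN (koszul (H1 P) (d + a + 1) v)"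
    using v b1[OF v(1)] precomp_id[OF B1.H_ext[OF y]] by simp
   have 3: "koszul (H1 P) (d + a + 1) v \<in> carrier (shift (d + a + 1) (D1 P))" using v(1) by (simp add: HP1.abgrp)
   have 4: "?i w \<in> carrier (tot (\<Psi> \<epsilon>) (shift (d + 1, a) (D0 P)))" using ahom_closed[OF ih w(1)] by simp
   show "\<exists>x\<in>carrier (tot (\<Psi> \<epsilon>) (shift (d + 1, a) (D0 P))). dM x = 0_(tot (\<Psi> \<epsilon>) (shift (d + 1, a) (D0 P))) \<and>
     (\<exists>z\<in>carrier (shift (d + a + 1) (D1 P)). y = eta a P x +_(shift (d + a + 1) (D1 P)) dN z)"
    by (rule bexI[OF _ 4]) (intro conjI 1 bexI[of _ "koszul (H1 P) (d + a + 1) v"] 2 3)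
  qed
 qed
qed

end

lemma diag_inv: "dg_inv E1 (tot (\<Psi> 0) (diag A0)) (diag A1) id id"
 unfolding diag_def[of A1] by (rule tot_diag_inv[OF B1.twist_id]) (simp add: koszul_even)

text \<open>
Let \<open>T\<close> be a finite cell module quasi-isomorphic to \<open>X \<oplus> X'\<close> with \<open>X\<close> derived isomorphic to the diagonal. Its
totalization splits accordingly, which gives smoothness. Lifting the resolution \<open>P\<close> into \<open>T\<close> and the projection of \<open>T\<close>
back to \<open>P\<close> along the quasi-isomorphisms gives maps whose composite lies over the identity of the diagonal, hence is
homotopic to the identity.
\<close>

lemma smooth_retract:
 fixes P :: "('a, 'u) bicomplex"
 assumes inf: "infinite (UNIV :: 'u set)" and e: "\<exists>\<iota> :: 'a => 'u. inj_on \<iota> (carrier R)"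
  and s: "graded_homologically_smooth TYPE('u) K R"
 shows "homologically_smooth TYPE('u) K A1"
  and "K_projective TYPE('u) E0 P ==> quasi_iso E0 P (diag A0) p ==>
   \<exists>(T :: ('a, 'u) bicomplex) i r. fcell TYPE('u) E0 T \<and>
    i \<in> dg_hom E0 P T \<and> r \<in> dg_hom E0 T P \<and> homotopic E0 P P (r o i) id"
proof -
 interpret z: zhang E0 E1 "\<Psi> 0" "\<Omega> 0" by (rule zhang)
 interpret T0: twist_aut K A0 id by (rule B0.twist_id)
 interpret T1: twist_aut K A1 id by (rule B1.twist_id)
 note D0 = T0.D_dgm[folded diag_def] and D1 = T1.D_dgm[folded diag_def]
 have e0: "\<exists>\<iota> :: 'a => 'u. inj_on \<iota> (carrier A0)" using e by simp
 have eE: "emb TYPE('u) (regular E0)" by (rule B0.emb_E[OF inf e0]) simp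
 have eD: "emb TYPE('u) (diag A0)" using e by (simp add: emb_def diag_def)
 obtain X where X: "thick TYPE('u) E0 (fg_graded_projective TYPE('u) E0) X" and XD: "derived_iso TYPE('u) E0 X (diag A0)"
  using s by (auto simp: graded_homologically_smooth_def in_thick_def)
 note Xm = B0.thick_dgm[OF X]
 have "cell_summand TYPE('u) E0 X"
  by (rule B0.thick_cell_summand[OF inf _ X]) (rule z.E0.fg_graded_projective_cell_summand[OF inf eE])
 then obtain X' T :: "('a, 'u) bicomplex" and t
  where X': "dg_module E0 X'" and T: "fcell TYPE('u) E0 T" and t: "quasi_iso E0 T (dsum X X') t"
  unfolding cell_summand_def by metis
 note Tm = fcell_dgm[OF T]
 note XX = B0.dsum_dgm[OF Xm X']
 note tX = z.tot_dgm[OF Xm] and tX' = z.tot_dgm[OF X'] and tT = z.tot_dgm[OF Tm] and tXX = z.tot_dgm[OF XX]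
 note tD = z.tot_dgm[OF D0]
 note sum = B1.dsum_dgm[OF tX tX']
 have "quasi_iso E1 (tot (\<Psi> 0) T) (dsum (tot (\<Psi> 0) X) (tot (\<Psi> 0) X')) (id o t)"
  by (rule quasi_iso_comp[OF z.tot_quasi_iso[OF Tm XX t]
     dg_inv_quasi_iso[OF z.tot_dsum_inv[OF Xm X'] dgm_cx[OF tXX] dgm_cx[OF sum]] tT tXX dgm_cx[OF sum]])
 then have "derived_iso TYPE('u) E1 (tot (\<Psi> 0) T) (dsum (tot (\<Psi> 0) X) (tot (\<Psi> 0) X'))"
  by (rule derived_iso_spanI[OF tT tT sum dg_inv_quasi_iso[OF dg_inv_refl dgm_cx[OF tT] dgm_cx[OF tT]]])
 from thick_summand[OF fcell_thick[OF B1.zalg_E z.fcell_tot[OF T]] tX tX' this]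
 have th: "thick TYPE('u) E1 (\<lambda>P. derived_iso TYPE('u) E1 P (regular E1)) (tot (\<Psi> 0) X)" .
 have "derived_iso TYPE('u) E1 (tot (\<Psi> 0) X) (diag A1)"
  by (rule derived_iso_quasi_iso_right[OF z.tot_derived_iso[OF Xm D0 XD] dg_inv_quasi_iso[OF diag_inv dgm_cx[OF tD] dgm_cx[OF D1]] tX tD D1])
 with th show "homologically_smooth TYPE('u) K A1"
  unfolding homologically_smooth_def perfect_def in_thick_def by blast
 assume P: "K_projective TYPE('u) E0 P" and p: "quasi_iso E0 P (diag A0) p"
 note Pm = K_dgm[OF P]
 have pd: "p \<in> dg_hom E0 P (diag A0)" by (rule quasi_isoD(1)[OF p Pm dgm_cx[OF D0]])
 obtain Z :: "('a, 'u) bicomplex" and s f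
  where Z: "dg_module E0 Z" and s: "quasi_iso E0 Z X s" and f: "quasi_iso E0 Z (diag A0) f"
  using XD Xm D0 by (rule derived_iso_spanD)
 have sd: "s \<in> dg_hom E0 Z X" by (rule quasi_isoD(1)[OF s Z dgm_cx[OF Xm]])
 have fd: "f \<in> dg_hom E0 Z (diag A0)" by (rule quasi_isoD(1)[OF f Z dgm_cx[OF D0]])
 have td: "t \<in> dg_hom E0 T (dsum X X')" by (rule quasi_isoD(1)[OF t Tm dgm_cx[OF XX]])
 interpret mX': dgmod E0 X' using X' by blast
 have fst: "fst \<in> dg_hom E0 (dsum X X') X" by (rule dg_homI) (auto simp: dsum_proj)
 have incl: "(\<lambda>x. (x, 0_X')) \<in> dg_hom E0 X (dsum X X')"
  by (rule dg_homI) (auto simp: gr_zero[OF mX'.gg] ahom_zero[OF mX'.abgrp mX'.abgrp mX'.d_hom])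
 \<comment> \<open>\<open>p1\<close> lifts the resolution to the roof \<open>Z\<close>, \<open>i\<close> lifts it further to \<open>T\<close>, and \<open>r\<close> returns by way of \<open>r1\<close>.\<close>
 obtain p1 where p1: "p1 \<in> dg_hom E0 P Z" "homotopic E0 P (diag A0) (f o p1) p"
  by (rule B0.K_lift[OF inf emb_self eD P Z D0 f pd])
 note sp = dg_hom_comp[OF p1(1) sd]
 note g = dg_hom_comp[OF sp incl]
 obtain i where i: "i \<in> dg_hom E0 P T" "homotopic E0 P (dsum X X') (t o i) ((\<lambda>x. (x, 0_X')) o (s o p1))"
  by (rule B0.K_lift[OF inf emb_self emb_dsum[OF inf emb_self emb_self] P Tm XX t g])
 note tfst = dg_hom_comp[OF td fst]
 note TK = B0.fcell_K[OF T]
 obtain r1 where r1: "r1 \<in> dg_hom E0 T Z" "homotopic E0 T X (s o r1) (fst o t)"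
  by (rule B0.K_lift[OF inf emb_self emb_self TK Z Xm s tfst])
 note fr1 = dg_hom_comp[OF r1(1) fd]
 obtain r where r: "r \<in> dg_hom E0 T P" "homotopic E0 T (diag A0) (p o r) (f o r1)"
  by (rule B0.K_lift[OF inf emb_self eD TK Pm D0 p fr1])
 note r1i = dg_hom_comp[OF i(1) r1(1)] and ti = dg_hom_comp[OF i(1) td]
 have 1: "homotopic E0 P X (s o (r1 o i)) (fst o (t o i))"
  using homotopic_comp_right[OF r1(2) Pm Tm Xm dg_hom_comp[OF r1(1) sd] tfst i(1)] by (simp add: comp_assoc)
 have 2: "homotopic E0 P X (fst o (t o i)) (s o p1)"
  using homotopic_comp_left[OF i(2) Pm XX Xm ti g fst] by (simp add: comp_def)
 have 3: "homotopic E0 P Z (r1 o i) p1"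
  by (rule B0.K_unique[OF inf emb_self emb_self P Z Xm s r1i p1(1)
     homotopic_trans[OF 1 2 Pm Xm dg_hom_comp[OF r1i sd] dg_hom_comp[OF ti fst] sp]])
 have 4: "homotopic E0 P (diag A0) (p o (r o i)) (f o (r1 o i))"
  using homotopic_comp_right[OF r(2) Pm Tm D0 dg_hom_comp[OF r(1) pd] fr1 i(1)] by (simp add: comp_assoc)
 have 5: "homotopic E0 P (diag A0) (f o (r1 o i)) (f o p1)"
  by (rule homotopic_comp_left[OF 3 Pm Z D0 r1i p1(1) fd])
 note ri = dg_hom_comp[OF i(1) r(1)]
 note c = dg_hom_comp[OF ri pd] dg_hom_comp[OF r1i fd] dg_hom_comp[OF p1(1) fd]
 have 6: "homotopic E0 P (diag A0) (p o (r o i)) (p o id)"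
  using homotopic_trans[OF homotopic_trans[OF 4 5 Pm D0 c] p1(2) Pm D0 c(1,3) pd] by simp
 have "homotopic E0 P P (r o i) id"
  by (rule B0.K_unique[OF inf emb_self eD P Pm D0 p ri dg_hom_id 6])
 with T i(1) r(1) show "\<exists>(T :: ('a, 'u) bicomplex) i r. fcell TYPE('u) E0 T \<and>
   i \<in> dg_hom E0 P T \<and> r \<in> dg_hom E0 T P \<and> homotopic E0 P P (r o i) id" by metis
qed

text \<open>
The resolution is totalized without right twist and its dual with the twist \<open>\<epsilon>\<close>; the comparison of the two duals
and \<open>tot_diag_inv\<close> are quasi-isomorphisms at the two ends of the totalized hypothesis.
\<close>

lemma RHom_tot:
 assumes inf: "infinite (UNIV :: 'u set)" and e: "\<exists>\<iota> :: 'a => 'u. inj_on \<iota> (carrier R)"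
  and CY: "graded_bimodule_CY TYPE('u) K R (d + 1) a" and \<epsilon>: "even (\<epsilon> + a + 1)"
  and \<sigma>: "twist_aut K A1 \<sigma>" and v: "\<And>y n. y \<in> gr R n ==> \<sigma> y = koszul A1 (\<epsilon> * n) y"
 shows "RHom_shift_iso TYPE('u) K A1 (d + a + 1) (twisted_diag A1 \<sigma>)"
proof -
 interpret z: zhang E0 E1 "\<Psi> 0" "\<Omega> 0" by (rule zhang)
 interpret ze: zhang E0 E1 "\<Psi> \<epsilon>" "\<Omega> \<epsilon>" by (rule zhang)
 interpret T0: twist_aut K A0 id by (rule B0.twist_id)
 interpret T1: twist_aut K A1 id by (rule B1.twist_id)
 interpret Ts: twist_aut K A1 \<sigma> by (rule \<sigma>)
 note D0 = T0.D_dgm[folded diag_def] and D1 = T1.D_dgm[folded diag_def]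
 obtain P :: "('a, 'u) bicomplex" and p where P: "K_projective TYPE('u) E0 P"
  and p: "quasi_iso E0 P (diag A0) p" and dual: "derived_iso TYPE('u) E0 (shift (d + 1, a) (D0 P)) (diag A0)"
  using CY by (auto simp: graded_bimodule_CY_def RHom_shift_iso_def)
 have s: "graded_homologically_smooth TYPE('u) K R" using CY by (simp add: graded_bimodule_CY_def)
 note Pm = K_dgm[OF P]
 obtain T :: "('a, 'u) bicomplex" and i r
  where T: "fcell TYPE('u) E0 T" and i: "i \<in> dg_hom E0 P T" and r: "r \<in> dg_hom E0 T P" and ri: "homotopic E0 P P (r o i) id"
  using smooth_retract(2)[OF inf e s P p] by metis
 note Tm = fcell_dgm[OF T] and tP = z.tot_dgm[OF Pm] and tD = z.tot_dgm[OF D0]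
 have K: "K_projective TYPE('u) E1 (tot (\<Psi> 0) P)"
  by (rule B1.K_retract[OF B1.fcell_K[OF z.fcell_tot[OF T]] tP z.tot_dg_hom[OF Pm Tm i] z.tot_dg_hom[OF Tm Pm r]
     z.tot_homotopic[OF Pm Pm dg_hom_comp[OF i r] dg_hom_id ri]])
 have q: "quasi_iso E1 (tot (\<Psi> 0) P) (diag A1) (id o p)"
  by (rule quasi_iso_comp[OF z.tot_quasi_iso[OF Pm D0 p] dg_inv_quasi_iso[OF diag_inv dgm_cx[OF tD] dgm_cx[OF D1]] tP tD dgm_cx[OF D1]])
 note S = B0.shift_dgm[OF B0.dual_dgm[OF Pm], of "(d + 1, a)"]
 note tS = ze.tot_dgm[OF S] and teD = ze.tot_dgm[OF D0] and N = B1.shift_dgm[OF B1.dual_dgm[OF tP], of "d + a + 1"]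
 have "derived_iso TYPE('u) E1 (tot (\<Psi> \<epsilon>) (shift (d + 1, a) (D0 P))) (twisted_diag A1 \<sigma>)"
  by (rule derived_iso_quasi_iso_right[OF ze.tot_derived_iso[OF S D0 dual]
     dg_inv_quasi_iso[OF tot_diag_inv[OF \<sigma> v] dgm_cx[OF teD] dgm_cx[OF Ts.D_dgm]] tS teD Ts.D_dgm])
 from derived_iso_quasi_iso_left[OF this eta_quasi_iso[OF Pm Tm z.E0.fcell_bounded[OF T] i r ri \<epsilon>] tS N Ts.D_dgm]
 show ?thesis unfolding RHom_shift_iso_def using K q by blast
qed

end

theorem proposition1p1:
  fixes K :: "('k, 'z) ring_scheme"
    and R :: "('k, int, 'a) graded"
    and d a :: int
  assumes "graded_algebra K R"
    and "infinite (UNIV :: 'u set)"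
    and "\<exists>\<iota> :: 'a => 'u. inj_on \<iota> (carrier R)"
    and "graded_bimodule_CY TYPE('u) K R (d + 1) a"
  shows "(odd a --> bimodule_CY TYPE('u) K (dg_of_graded R) (d + a + 1)) \<and>
    (even a --> homologically_smooth TYPE('u) K (dg_of_graded R) \<and>
      RHom_shift_iso TYPE('u) K (dg_of_graded R) (d + a + 1)
        (twisted_diag (dg_of_graded R) (sign_aut (dg_of_graded R))))"
proof -
  interpret ralg K R by (rule ralg.intro[OF assms(1)])
  have s: "homologically_smooth TYPE('u) K A1"
    by (rule smooth_retract(1)[OF assms(2,3)]) (use assms(4) in "simp add: graded_bimodule_CY_def")
  have "RHom_shift_iso TYPE('u) K A1 (d + a + 1) (diag A1)" if "odd a"
    unfolding diag_def by (rule RHom_tot[OF assms(2-4), of 0]) (use that B1.twist_id in "simp_all add: koszul_even")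
  moreover have "RHom_shift_iso TYPE('u) K A1 (d + a + 1) (twisted_diag A1 (sign_aut A1))" if "even a"
    by (rule RHom_tot[OF assms(2-4), of 1]) (use that B1.twist_sign B1.sign_aut_gr in "simp_all add: cdeg_int_def")
  ultimately show ?thesis using s by (simp add: bimodule_CY_def)
qed

end
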